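(* Let $N\ge2$ and let $\mu^1,\dots,\mu^N$ be partitions. Let $a_1,\dots,a_N$ be parameters, $a_{kl}=a_k-a_l$, $Q_k=e^{-2\beta a_{k,k+1}}$ for $1\le k\le N-1$, and $q=e^{-\beta\hbar}$. Then $$\frac{\tilde K_{\mu^1\cdots\mu^N}(Q_1,\dots,Q_{N-1})^2}{\prod_{1\le k<l\le N}K_{(0)(0)}(Q_k\cdots Q_{l-1})^2}=2^{-2N\sum_{i=1}^N|\mu^i|}\prod_{k=1}^{N-1}Q_k^{-[(N-k)(|\mu^1|+\cdots+|\mu^k|)+k(|\mu^{k+1}|+\cdots+|\mu^N|)]}$$ $$\cdot\; q^{-\frac12\sum_{k=1}^N(N-2k)\kappa_{\mu^k}}\prod_{1\le k,l\le N}\prod_{i,j\ge1}\frac{\sinh\frac\beta2(2a_{kl}+\hbar(\mu^k_i-\mu^l_j+j-i))}{\sinh\frac\beta2(2a_{kl}+\hbar(j-i))}.$$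
   Context: A partition $\mu$ is a nonincreasing sequence $\mu_1\ge\mu_2\ge\cdots$ of nonnegative integers with finitely many nonzero terms; $l(\mu)$ is the number of nonzero terms, $|\mu|=\sum_i\mu_i$, $\mu^t$ the transposed partition, $(0)=\emptyset$ the empty partition, $\kappa_\mu=\sum_{i=1}^{l(\mu)}\mu_i(\mu_i-2i+1)$. Let $[m]=q^{m/2}-q^{-m/2}$. For a symmetric function $F$, $F(q^{\mu+\rho})$ denotes its evaluation at $x_i=q^{\mu_i-i+1/2}$, $i\ge1$, regarded as a rational function of $q^{1/2}$ (series converge for $|q|>1$; the power sums become $p_n=\sum_{i=1}^{l(\mu)}(q^{n(\mu_i-i+1/2)}-q^{n(-i+1/2)})+\frac{1}{q^{n/2}-q^{-n/2}}$). $s_\nu$ is the Schur function and $c^\mu_{\nu\rho}$ are the Littlewood–Richardson coefficients, $s_\nu s_\rho=\sum_\mu c^\mu_{\nu\rho}s_\mu$. Define $$\mathcal{W}_\mu=q^{\kappa_\mu/4}\prod_{1\le i<j\le l(\mu)}\frac{[\mu_i-\mu_j+j-i]}{[j-i]}\prod_{i=1}^{l(\mu)}\prod_{v=1}^{\mu_i}\frac{1}{[v-i+l(\mu)]},\qquad \mathcal{W}_{\mu\nu}=\mathcal{W}_\mu\, s_\nu(q^{\mu+\rho}),$$ and the topological vertex $$\mathcal{W}_{\mu^1\mu^2\mu^3}=\sum_{\rho^1,\rho^3}\left(\sum_\eta c^{\mu^1}_{\eta\rho^1}c^{(\mu^3)^t}_{\eta(\rho^3)^t}\right)q^{\kappa_{\mu^2}/2+\kappa_{\mu^3}/2}\frac{\mathcal{W}_{(\mu^2)^t\rho^1}\mathcal{W}_{\mu^2(\rho^3)^t}}{\mathcal{W}_{\mu^2\emptyset}}.$$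 Define the formal power series $$K_{(0)(0)}(Q)=\sum_\nu Q^{|\nu|}\mathcal{W}_{(0)\nu}\mathcal{W}_{\nu(0)},\qquad \tilde K_{\mu^1\cdots\mu^N}(Q_1,\dots,Q_{N-1})=\sum_{\nu^1,\dots,\nu^{N-1}}\prod_{k=1}^N q^{\kappa_{\nu^k}/2}\,\mathcal{W}_{\nu^{k-1}\mu^k(\nu^k)^t}(q)\,Q_k^{|\nu^k|},$$ where $\nu^0=\nu^N=(0)$, $Q_N=1$. The parameters $a_k,\beta,\hbar$ are generic; hyperbolic sines are expressed through exponentials (so for $k<l$, $\sinh\frac\beta2(2a_{kl}+\hbar m)=\frac12(P^{-1/2}q^{-m/2}-P^{1/2}q^{m/2})$ with $P=Q_k\cdots Q_{l-1}$), and the identity is understood after expanding the right-hand side as a power series in $Q_1,\dots,Q_{N-1}$. Meaning of the formal infinite products (taken after cancellation of equal factors). For partitions $\lambda,\mu$ and $m\in\mathbb{Z}$ let $e_m(\lambda,\mu)$ be the coefficient of $t^m$ in $\sum_{i,j\ge1}(t^{\lambda_i-\mu_j+j-i}-t^{j-i})$, computed coefficientwise (for each $m$ only finitely many $(i,j)$ contribute); let $e'_m(\mu)$ be the coefficient of $t^m$ in $\sum_{1\le i<j<\infty}(t^{\mu_i-\mu_j+j-i}-t^{j-i})$; both vanish for almost all $m$. For $k<l$ the product over $i,j\ge1$ means $\prod_m(\sinh\frac\beta2(2a_{kl}+\hbar m))^{e_m(\mu^k,\mu^l)}$. Since $\sinh$ is odd, the $(i,j)$ ratio for $(l,k)$ equals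 the $(j,i)$ ratio for $(k,l)$, and the product for $(l,k)$ is by convention equal to that for $(k,l)$. For $k=l$ the factors with $i=j$ are $1$ and the $(i,j)$ and $(j,i)$ ratios are equal, so the product means $\left(\prod_{m\ge1}(\sinh\frac{\beta\hbar m}{2})^{e'_m(\mu^k)}\right)^2$. *)

theory Defs
  imports
    "HOL-Analysis.Analysis"
    "HOL-Library.FuncSet"
    "HOL-Library.Poly_Mapping"
    "HOL-Computational_Algebra.Formal_Power_Series"
begin

section \<open>Formal power series in several variables\<close>

text \<open>
  Coefficients are indexed by exponent vectors \<open>\<alpha> :: nat \<Rightarrow>\<^sub>0 nat\<close>, so that countably many
  variables \<open>X\<^sub>0, X\<^sub>1, \<dots>\<close> are available. The same type serves for the series in
  \<open>Q\<^sub>1, \<dots>, Q\<^bsub>N-1\<^esub>\<close> and for symmetric functions in infinitely many variables.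
\<close>

typedef 'a mfps = "UNIV :: ((nat \<Rightarrow>\<^sub>0 nat) \<Rightarrow> 'a) set"
  morphisms mfps_nth Abs_mfps
  by simp

lemma mfps_nth_Abs [simp]: "mfps_nth (Abs_mfps f) = f"
  by (simp add: Abs_mfps_inverse)

lemma mfps_eqI: "(\<And>\<alpha>. mfps_nth F \<alpha> = mfps_nth G \<alpha>) \<Longrightarrow> F = G"
  by (rule iffD1[OF mfps_nth_inject], rule ext)

definition mdeg :: "(nat \<Rightarrow>\<^sub>0 nat) \<Rightarrow> nat" where
  "mdeg \<alpha> = (\<Sum>i\<in>Poly_Mapping.keys \<alpha>. Poly_Mapping.lookup \<alpha> i)"

definition splits :: "(nat \<Rightarrow>\<^sub>0 nat) \<Rightarrow> ((nat \<Rightarrow>\<^sub>0 nat) \<times> (nat \<Rightarrow>\<^sub>0 nat)) set" where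
  "splits \<alpha> = {(\<gamma>, \<delta>). \<gamma> + \<delta> = \<alpha>}"

lemma finite_splits [simp]: "finite (splits \<alpha>)"
proof -
  let ?M = "Max (Poly_Mapping.lookup \<alpha> ` Poly_Mapping.keys \<alpha>)"
  let ?S = "{f :: nat \<Rightarrow> nat. \<forall>i. (i \<in> Poly_Mapping.keys \<alpha> \<longrightarrow> f i \<in> {..?M}) \<and>
              (i \<notin> Poly_Mapping.keys \<alpha> \<longrightarrow> f i = 0)}"
  have fin: "finite ?S"
    by (rule finite_set_of_finite_funs) auto
  have mem: "Poly_Mapping.lookup \<gamma> \<in> ?S" if le: "\<And>i. Poly_Mapping.lookup \<gamma> i \<le> Poly_Mapping.lookup \<alpha> i" for \<gamma>
  proof -
    have "Poly_Mapping.lookup \<gamma> i \<le> ?M" if "i \<in> Poly_Mapping.keys \<alpha>" for i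
    proof -
      have "Poly_Mapping.lookup \<alpha> i \<le> ?M" using that by (intro Max_ge) auto
      then show ?thesis using le[of i] by linarith
    qed
    moreover have "Poly_Mapping.lookup \<gamma> i = 0" if "i \<notin> Poly_Mapping.keys \<alpha>" for i
      using le[of i] that by (simp add: in_keys_iff)
    ultimately show ?thesis by blast
  qed
  have "inj (Poly_Mapping.lookup :: (nat \<Rightarrow>\<^sub>0 nat) \<Rightarrow> _)"
    by (simp add: inj_def lookup_inject)
  then have fin2: "finite (Poly_Mapping.lookup -` ?S)"
    using fin by (rule finite_vimageI[rotated])
  have "splits \<alpha> \<subseteq> (Poly_Mapping.lookup -` ?S) \<times> (Poly_Mapping.lookup -` ?S)"
  proof (rule subrelI)
    fix \<gamma> \<delta> assume "(\<gamma>, \<delta>) \<in> splits \<alpha>"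
    then have "\<alpha> = \<gamma> + \<delta>" by (simp add: splits_def)
    then have "\<And>i. Poly_Mapping.lookup \<gamma> i \<le> Poly_Mapping.lookup \<alpha> i"
      "\<And>i. Poly_Mapping.lookup \<delta> i \<le> Poly_Mapping.lookup \<alpha> i"
      by (simp_all add: lookup_add)
    then show "(\<gamma>, \<delta>) \<in> (Poly_Mapping.lookup -` ?S) \<times> (Poly_Mapping.lookup -` ?S)"
      using mem by blast
  qed
  then show ?thesis
    by (rule finite_subset) (intro finite_cartesian_product fin2)
qed

lemma splits_0 [simp]: "splits 0 = {(0, 0)}"
proof -
  have "\<gamma> = 0 \<and> \<delta> = 0" if "\<gamma> + \<delta> = 0" for \<gamma> \<delta> :: "nat \<Rightarrow>\<^sub>0 nat"
  proof -
    have "Poly_Mapping.lookup \<gamma> i + Poly_Mapping.lookup \<delta> i = 0" for i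
      using that by (metis lookup_add lookup_zero)
    then show ?thesis by (intro conjI poly_mapping_eqI) simp_all
  qed
  then have "splits 0 \<subseteq> {(0, 0)}" unfolding splits_def by blast
  moreover have "(0, 0) \<in> splits 0" by (simp add: splits_def)
  ultimately show ?thesis by blast
qed

lemma mdeg_0_iff [simp]: "mdeg \<alpha> = 0 \<longleftrightarrow> \<alpha> = 0"
proof -
  have "(\<forall>i\<in>Poly_Mapping.keys \<alpha>. Poly_Mapping.lookup \<alpha> i = 0) \<longleftrightarrow> Poly_Mapping.keys \<alpha> = {}"
    by (simp add: in_keys_iff set_eq_iff Ball_def del: keys_eq_empty)
  then show ?thesis by (simp add: mdeg_def)
qed

lemma mdeg_add: "mdeg (\<gamma> + \<delta>) = mdeg \<gamma> + mdeg \<delta>"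
proof -
  let ?K = "Poly_Mapping.keys \<gamma> \<union> Poly_Mapping.keys \<delta>"
  have *: "mdeg \<epsilon> = (\<Sum>i\<in>?K. Poly_Mapping.lookup \<epsilon> i)" if "Poly_Mapping.keys \<epsilon> \<subseteq> ?K" for \<epsilon>
    unfolding mdeg_def using that
    by (intro sum.mono_neutral_left) (auto simp: in_keys_iff)
  have "Poly_Mapping.keys (\<gamma> + \<delta>) \<subseteq> ?K"
    by (rule Poly_Mapping.keys_add)
  then show ?thesis
    by (simp add: * lookup_add sum.distrib)
qed

instantiation mfps :: (comm_ring_1) comm_ring_1
begin

definition "0 = Abs_mfps (\<lambda>_. 0)"
definition "1 = Abs_mfps (\<lambda>\<alpha>. if \<alpha> = 0 then 1 else 0)"
definition "F + G = Abs_mfps (\<lambda>\<alpha>. mfps_nth F \<alpha> + mfps_nth G \<alpha>)"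
definition "F - G = Abs_mfps (\<lambda>\<alpha>. mfps_nth F \<alpha> - mfps_nth G \<alpha>)"
definition "- F = Abs_mfps (\<lambda>\<alpha>. - mfps_nth F \<alpha>)"
definition "F * G = Abs_mfps (\<lambda>\<alpha>. \<Sum>(\<gamma>, \<delta>)\<in>splits \<alpha>. mfps_nth F \<gamma> * mfps_nth G \<delta>)"

instance
proof
  fix F G H :: "'a mfps"
  show "F * G * H = F * (G * H)"
  proof (rule mfps_eqI)
    fix \<alpha>
    let ?t = "\<lambda>\<gamma> \<delta> \<epsilon>. mfps_nth F \<gamma> * mfps_nth G \<delta> * mfps_nth H \<epsilon>"
    have "mfps_nth (F * G * H) \<alpha> =
        (\<Sum>p\<in>splits \<alpha>. \<Sum>r\<in>splits (fst p). ?t (fst r) (snd r) (snd p))"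
      by (simp add: times_mfps_def sum_distrib_right case_prod_unfold)
    also have "\<dots> = (\<Sum>(p, r)\<in>(SIGMA p:splits \<alpha>. splits (fst p)). ?t (fst r) (snd r) (snd p))"
      by (subst sum.Sigma) auto
    also have "\<dots> = (\<Sum>(p, r)\<in>(SIGMA p:splits \<alpha>. splits (snd p)). ?t (fst p) (fst r) (snd r))"
      by (rule sum.reindex_bij_witness[of _
            "\<lambda>(p, r). ((fst p + fst r, snd r), (fst p, fst r))"
            "\<lambda>(p, r). ((fst r, snd r + snd p), (snd r, snd p))"])
         (auto simp: splits_def add.assoc)
    also have "\<dots> = (\<Sum>p\<in>splits \<alpha>. \<Sum>r\<in>splits (snd p). ?t (fst p) (fst r) (snd r))"
      by (subst sum.Sigma) auto
    also have "\<dots> = mfps_nth (F * (G * H)) \<alpha>"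
      by (simp add: times_mfps_def sum_distrib_left case_prod_unfold mult.assoc)
    finally show "mfps_nth (F * G * H) \<alpha> = mfps_nth (F * (G * H)) \<alpha>" .
  qed
  show "F * G = G * F"
  proof (rule mfps_eqI)
    fix \<alpha>
    show "mfps_nth (F * G) \<alpha> = mfps_nth (G * F) \<alpha>"
      unfolding times_mfps_def mfps_nth_Abs
      by (rule sum.reindex_bij_witness[of _ prod.swap prod.swap])
         (auto simp: splits_def add.commute mult.commute)
  qed
  show "1 * F = F"
  proof (rule mfps_eqI)
    fix \<alpha>
    have "mfps_nth (1 * F) \<alpha> = (\<Sum>(\<gamma>, \<delta>)\<in>splits \<alpha>. (if \<gamma> = 0 then 1 else 0) * mfps_nth F \<delta>)"
      by (simp add: times_mfps_def one_mfps_def)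
    also have "\<dots> = (\<Sum>(\<gamma>, \<delta>)\<in>{(0 :: nat \<Rightarrow>\<^sub>0 nat, \<alpha>)}. (if \<gamma> = 0 then 1 else 0) * mfps_nth F \<delta>)"
      by (rule sum.mono_neutral_right, simp) (auto simp: splits_def split: if_splits)
    finally show "mfps_nth (1 * F) \<alpha> = mfps_nth F \<alpha>" by simp
  qed
  show "(F + G) * H = F * H + G * H"
    by (rule mfps_eqI)
       (simp add: times_mfps_def plus_mfps_def case_prod_unfold distrib_right sum.distrib)
  show "(0 :: 'a mfps) \<noteq> 1"
  proof
    assume "(0 :: 'a mfps) = 1"
    then have "mfps_nth (0 :: 'a mfps) 0 = mfps_nth 1 0" by simp
    then show False by (simp add: zero_mfps_def one_mfps_def)
  qed
qed (rule mfps_eqI, simp add: zero_mfps_def plus_mfps_def minus_mfps_def uminus_mfps_def algebra_simps)+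

end

lemma mfps_nth_0 [simp]: "mfps_nth 0 \<alpha> = 0"
  and mfps_nth_1: "mfps_nth 1 \<alpha> = (if \<alpha> = 0 then 1 else 0)"
  and mfps_nth_add [simp]: "mfps_nth (F + G) \<alpha> = mfps_nth F \<alpha> + mfps_nth G \<alpha>"
  and mfps_nth_diff [simp]: "mfps_nth (F - G) \<alpha> = mfps_nth F \<alpha> - mfps_nth G \<alpha>"
  and mfps_nth_uminus [simp]: "mfps_nth (- F) \<alpha> = - mfps_nth F \<alpha>"
  and mfps_nth_mult: "mfps_nth (F * G) \<alpha> = (\<Sum>(\<gamma>, \<delta>)\<in>splits \<alpha>. mfps_nth F \<gamma> * mfps_nth G \<delta>)"
  by (simp_all add: zero_mfps_def one_mfps_def plus_mfps_def minus_mfps_def uminus_mfps_def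
      times_mfps_def)

definition mfps_const :: "'a \<Rightarrow> 'a :: zero mfps" where
  "mfps_const c = Abs_mfps (\<lambda>\<alpha>. if \<alpha> = 0 then c else 0)"

definition mfps_X :: "nat \<Rightarrow> 'a :: zero_neq_one mfps" where
  "mfps_X i = Abs_mfps (\<lambda>\<alpha>. if \<alpha> = Poly_Mapping.single i 1 then 1 else 0)"

lemma mfps_nth_power_eq_0:
  fixes U :: "'a :: comm_ring_1 mfps"
  assumes "mfps_nth U 0 = 0" and "mdeg \<alpha> < n"
  shows "mfps_nth (U ^ n) \<alpha> = 0"
  using assms(2)
proof (induction n arbitrary: \<alpha>)
  case (Suc n)
  have "mfps_nth U \<gamma> * mfps_nth (U ^ n) \<delta> = 0" if "(\<gamma>, \<delta>) \<in> splits \<alpha>" for \<gamma> \<delta>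
  proof (cases "\<gamma> = 0")
    case False
    then have "mdeg \<gamma> \<noteq> 0" by simp
    moreover have "mdeg \<gamma> + mdeg \<delta> = mdeg \<alpha>"
      using that by (auto simp: splits_def mdeg_add)
    ultimately have "mdeg \<delta> < n" using Suc.prems by linarith
    then show ?thesis using Suc.IH by simp
  qed (simp add: assms)
  then show ?case
    by (auto simp: mfps_nth_mult intro!: sum.neutral)
qed simp

lemma mfps_invertible:
  fixes F :: "'a :: field mfps"
  assumes "mfps_nth F 0 \<noteq> 0"
  shows "\<exists>!G. F * G = 1"
proof (rule ex_ex1I)
  define c where "c = mfps_nth F 0"
  define U where "U = 1 - mfps_const (inverse c) * F"
  have c: "c \<noteq> 0" using assms by (simp add: c_def)
  have U0: "mfps_nth U 0 = 0"
    using c by (simp add: U_def mfps_nth_mult mfps_const_def c_def mfps_nth_1)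
  define G where "G = Abs_mfps (\<lambda>\<alpha>. \<Sum>j\<le>mdeg \<alpha>. mfps_nth (U ^ j) \<alpha>)"
  have nth_sum: "mfps_nth (sum f A) \<alpha> = (\<Sum>x\<in>A. mfps_nth (f x) \<alpha>)"
    if "finite A" for f :: "nat \<Rightarrow> 'a mfps" and A \<alpha>
    using that by (induction A rule: finite_induct) auto
  have G: "mfps_nth G \<alpha> = mfps_nth (\<Sum>j\<le>n. U ^ j) \<alpha>" if "mdeg \<alpha> \<le> n" for \<alpha> n
  proof -
    have "(\<Sum>j\<le>n. mfps_nth (U ^ j) \<alpha>) = (\<Sum>j\<le>mdeg \<alpha>. mfps_nth (U ^ j) \<alpha>)"
      using that by (intro sum.mono_neutral_right) (auto intro!: mfps_nth_power_eq_0[OF U0])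
    then show ?thesis by (simp add: G_def nth_sum)
  qed
  have "(1 - U) * G = 1"
  proof (rule mfps_eqI)
    fix \<alpha>
    have "mfps_nth ((1 - U) * G) \<alpha> = mfps_nth ((1 - U) * (\<Sum>j\<le>mdeg \<alpha>. U ^ j)) \<alpha>"
      unfolding mfps_nth_mult
    proof (rule sum.cong[OF refl], clarify)
      fix \<gamma> \<delta> assume "(\<gamma>, \<delta>) \<in> splits \<alpha>"
      then have "mdeg \<delta> \<le> mdeg \<alpha>" by (auto simp: splits_def mdeg_add)
      then show "mfps_nth (1 - U) \<gamma> * mfps_nth G \<delta> =
          mfps_nth (1 - U) \<gamma> * mfps_nth (\<Sum>j\<le>mdeg \<alpha>. U ^ j) \<delta>"
        using G by metis
    qed
    also have "(1 - U) * (\<Sum>j\<le>mdeg \<alpha>. U ^ j) = 1 - U ^ Suc (mdeg \<alpha>)"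
      by (rule sum_gp_basic)
    also have "mfps_nth (1 - U ^ Suc (mdeg \<alpha>)) \<alpha> = mfps_nth 1 \<alpha>"
      using mfps_nth_power_eq_0[OF U0, of \<alpha> "Suc (mdeg \<alpha>)"] by (simp del: power_Suc)
    finally show "mfps_nth ((1 - U) * G) \<alpha> = mfps_nth 1 \<alpha>" .
  qed
  then have "F * (mfps_const (inverse c) * G) = 1"
    by (simp add: U_def algebra_simps)
  then show "\<exists>G. F * G = 1" by blast
next
  fix G H assume *: "F * G = 1" "F * H = 1"
  have "G = G * (F * H)" using * by simp
  also have "\<dots> = (F * G) * H" by (simp add: ac_simps)
  finally show "G = H" using * by simp
qed

instantiation mfps :: (field) inverse
begin

definition "inverse F = (if mfps_nth F 0 = 0 then 0 else THE G. F * G = 1)"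
definition "F div G = F * inverse G" for F G :: "'a mfps"

instance ..

end

lemma mfps_mult_inverse:
  fixes F :: "'a :: field mfps"
  assumes "mfps_nth F 0 \<noteq> 0"
  shows "F * inverse F = 1"
  using theI'[OF mfps_invertible[OF assms]] assms by (simp add: inverse_mfps_def)

text \<open>
  Substitution of \<open>P\<close> for the variable of \<open>F\<close>; intended for \<open>P\<close> with zero constant term, in
  which case \<open>P ^ j\<close> has no terms of degree less than \<open>j\<close>.
\<close>

definition mfps_subst :: "'a :: comm_ring_1 fps \<Rightarrow> 'a mfps \<Rightarrow> 'a mfps" where
  "mfps_subst F P = Abs_mfps (\<lambda>\<alpha>. \<Sum>j\<le>mdeg \<alpha>. fps_nth F j * mfps_nth (P ^ j) \<alpha>)"

definition mfps_sums :: "complex mfps \<Rightarrow> (nat \<Rightarrow> complex) \<Rightarrow> complex \<Rightarrow> bool" where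
  "mfps_sums F x v \<longleftrightarrow>
     ((\<lambda>\<alpha>. mfps_nth F \<alpha> * (\<Prod>i\<in>Poly_Mapping.keys \<alpha>. x i ^ Poly_Mapping.lookup \<alpha> i)) has_sum v) UNIV"


section \<open>Partitions\<close>

text \<open>A partition is the list of its nonzero parts, so \<open>l(\<mu>)\<close> is \<open>length \<mu>\<close>, \<open>|\<mu>|\<close> is
  \<open>sum_list \<mu>\<close> and the empty partition is \<open>[]\<close>. Parts are numbered from 1.\<close>

definition is_partition :: "nat list \<Rightarrow> bool" where
  "is_partition \<mu> \<longleftrightarrow> sorted_wrt (\<ge>) \<mu> \<and> 0 \<notin> set \<mu>"

definition part :: "nat list \<Rightarrow> nat \<Rightarrow> nat" where
  "part \<mu> i = (if 1 \<le> i \<and> i \<le> length \<mu> then \<mu> ! (i - 1) else 0)"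

definition conj_part :: "nat list \<Rightarrow> nat list" where
  "conj_part \<mu> = map (\<lambda>j. card {i. j \<le> part \<mu> i}) [1..<Suc (part \<mu> 1)]"

definition kappa :: "nat list \<Rightarrow> int" where
  "kappa \<mu> = (\<Sum>i=1..length \<mu>. int (part \<mu> i) * (int (part \<mu> i) - 2 * int i + 1))"

definition cells :: "nat list \<Rightarrow> (nat \<times> nat) set" where
  "cells \<mu> = {(i, j). 1 \<le> i \<and> 1 \<le> j \<and> j \<le> part \<mu> i}"


section \<open>Symmetric functions\<close>

text \<open>Semistandard Young tableaux of shape \<open>\<nu>\<close>; as variables are indexed by all of \<open>nat\<close>,
  so are the entries.\<close>

definition ssyt :: "nat list \<Rightarrow> (nat \<times> nat \<Rightarrow> nat) set" where
  "ssyt \<nu> = {T \<in> extensional (cells \<nu>).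
     (\<forall>i j. (i, j) \<in> cells \<nu> \<and> (i, Suc j) \<in> cells \<nu> \<longrightarrow> T (i, j) \<le> T (i, Suc j)) \<and>
     (\<forall>i j. (i, j) \<in> cells \<nu> \<and> (Suc i, j) \<in> cells \<nu> \<longrightarrow> T (i, j) < T (Suc i, j))}"

definition schur :: "nat list \<Rightarrow> 'a :: comm_ring_1 mfps" where
  "schur \<nu> = Abs_mfps (\<lambda>\<alpha>. of_nat (card
     {T \<in> ssyt \<nu>. \<forall>v. card {x \<in> cells \<nu>. T x = v} = Poly_Mapping.lookup \<alpha> v}))"

definition psum :: "nat \<Rightarrow> 'a :: comm_ring_1 mfps" where
  "psum n = Abs_mfps (\<lambda>\<alpha>. if \<exists>i. \<alpha> = Poly_Mapping.single i n then 1 else 0)"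

text \<open>\<open>lr_coeff \<nu> \<rho> \<mu>\<close> is \<open>c\<^sup>\<mu>\<^bsub>\<nu>\<rho>\<^esub>\<close>.\<close>

definition lr_coeff :: "nat list \<Rightarrow> nat list \<Rightarrow> nat list \<Rightarrow> int" where
  "lr_coeff \<nu> \<rho> = (THE c. finite {\<mu>. c \<mu> \<noteq> 0} \<and> {\<mu>. c \<mu> \<noteq> 0} \<subseteq> Collect is_partition \<and>
     schur \<nu> * schur \<rho> = (\<Sum>\<mu> | c \<mu> \<noteq> 0. mfps_const (c \<mu>) * schur \<mu>))"

text \<open>
  The value of a symmetric function \<open>F\<close> under the algebra homomorphism sending the power sum
  \<open>p\<^sub>n\<close> to \<open>\<pi> n\<close>: write \<open>F\<close> as a linear combination of products \<open>p\<^sub>\<tau>\<close> of power sums and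
  replace each \<open>p\<^sub>n\<close> by \<open>\<pi> n\<close>. In characteristic 0 the \<open>p\<^sub>\<tau>\<close> form a basis of the symmetric
  functions, so the value is unique.
\<close>

definition sym_eval :: "(nat \<Rightarrow> 'a) \<Rightarrow> 'a :: field_char_0 mfps \<Rightarrow> 'a" where
  "sym_eval \<pi> F = (THE v. \<exists>S c. finite S \<and> S \<subseteq> Collect is_partition \<and>
     F = (\<Sum>\<tau>\<in>S. mfps_const (c \<tau>) * prod_list (map psum \<tau>)) \<and>
     v = (\<Sum>\<tau>\<in>S. c \<tau> * prod_list (map \<pi> \<tau>)))"


section \<open>The topological vertex\<close>

text \<open>Throughout, \<open>s\<close> stands for \<open>q\<^bsup>1/2\<^esup>\<close>; a rational function of \<open>q\<^bsup>1/2\<^esup>\<close> is represented by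
  its value at \<open>s\<close>.\<close>

definition qnum :: "'a :: field_char_0 \<Rightarrow> int \<Rightarrow> 'a" where
  "qnum s m = s powi m - s powi (- m)"

text \<open>The regularised value of \<open>p\<^sub>n\<close> at \<open>x\<^sub>i = q\<^bsup>\<mu>\<^sub>i - i + 1/2\<^esup>\<close>, \<open>i \<ge> 1\<close>; for \<open>|q| > 1\<close> it is
  the sum of the series.\<close>

definition psum_at :: "'a :: field_char_0 \<Rightarrow> nat list \<Rightarrow> nat \<Rightarrow> 'a" where
  "psum_at s \<mu> n =
     (\<Sum>i=1..length \<mu>. s powi (int n * (2 * int (part \<mu> i) - 2 * int i + 1))
                     - s powi (int n * (- 2 * int i + 1)))
     + 1 / qnum s (int n)"

definition W1 :: "'a :: field_char_0 \<Rightarrow> nat list \<Rightarrow> 'a" where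
  "W1 s \<mu> = s powi (kappa \<mu> div 2) \<comment> \<open>\<open>kappa \<mu>\<close> is even\<close>
     * (\<Prod>(i, j) | 1 \<le> i \<and> i < j \<and> j \<le> length \<mu>.
          qnum s (int (part \<mu> i) - int (part \<mu> j) + int j - int i) / qnum s (int j - int i))
     * (\<Prod>i=1..length \<mu>. \<Prod>v=1..part \<mu> i. 1 / qnum s (int v - int i + int (length \<mu>)))"

definition W2 :: "'a :: field_char_0 \<Rightarrow> nat list \<Rightarrow> nat list \<Rightarrow> 'a" where
  "W2 s \<mu> \<nu> = W1 s \<mu> * sym_eval (psum_at s \<mu>) (schur \<nu>)"

text \<open>Since \<open>c\<^sup>\<mu>\<^bsub>\<eta>\<rho>\<^esub>\<close> vanishes unless \<open>|\<mu>| = |\<eta>| + |\<rho>|\<close>, the sums over \<open>\<rho>\<^sup>1\<close>, \<open>\<rho>\<^sup>3\<close> and \<open>\<eta>\<close>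
  may be restricted to bounded sizes.\<close>

definition W3 :: "'a :: field_char_0 \<Rightarrow> nat list \<Rightarrow> nat list \<Rightarrow> nat list \<Rightarrow> 'a" where
  "W3 s \<mu>1 \<mu>2 \<mu>3 =
     (\<Sum>\<rho>1 | is_partition \<rho>1 \<and> sum_list \<rho>1 \<le> sum_list \<mu>1.
      \<Sum>\<rho>3 | is_partition \<rho>3 \<and> sum_list \<rho>3 \<le> sum_list \<mu>3.
        of_int (\<Sum>\<eta> | is_partition \<eta> \<and> sum_list \<eta> \<le> sum_list \<mu>1.
                  lr_coeff \<eta> \<rho>1 \<mu>1 * lr_coeff \<eta> (conj_part \<rho>3) (conj_part \<mu>3))
        * s powi (kappa \<mu>2 + kappa \<mu>3)
        * (W2 s (conj_part \<mu>2) \<rho>1 * W2 s \<mu>2 (conj_part \<rho>3) / W2 s \<mu>2 []))"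

definition K00 :: "'a :: field_char_0 \<Rightarrow> 'a fps" where
  "K00 s = Abs_fps (\<lambda>n. \<Sum>\<nu> | is_partition \<nu> \<and> sum_list \<nu> = n. W2 s [] \<nu> * W2 s \<nu> [])"

text \<open>The series \<open>K\<close>-tilde, with \<open>Q\<^sub>k\<close> the formal variable \<open>mfps_X k\<close>. The coefficient at
  \<open>\<alpha>\<close> collects the families with \<open>|\<nu>\<^sup>k| = \<alpha>\<^sub>k\<close>; families are extended by \<open>[]\<close> outside
  \<open>{1..<N}\<close>, so \<open>\<nu>\<^sup>0 = \<nu>\<^sup>N = []\<close>, and there is no such family if \<open>\<alpha>\<close> involves other variables.\<close>

definition Ktilde :: "'a :: field_char_0 \<Rightarrow> nat \<Rightarrow> (nat \<Rightarrow> nat list) \<Rightarrow> 'a mfps" where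
  "Ktilde s N \<mu> = Abs_mfps (\<lambda>\<alpha>.
     \<Sum>\<nu> | (\<forall>k. is_partition (\<nu> k) \<and> sum_list (\<nu> k) = Poly_Mapping.lookup \<alpha> k) \<and>
           (\<forall>k. k \<notin> {1..<N} \<longrightarrow> \<nu> k = []).
       \<Prod>k=1..N. s powi kappa (\<nu> k) * W3 s (\<nu> (k - 1)) (\<mu> k) (conj_part (\<nu> k)))"


section \<open>The products of hyperbolic sines\<close>

text \<open>\<open>e_coeff \<nu> \<mu> m\<close> is the coefficient of \<open>t\<^sup>m\<close> in
  \<open>\<Sum>\<^bsub>i,j\<ge>1\<^esub> (t\<^bsup>\<nu>\<^sub>i-\<mu>\<^sub>j+j-i\<^esup> - t\<^bsup>j-i\<^esup>)\<close>; the sum is over the finitely many pairs that contribute.\<close>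

definition e_coeff :: "nat list \<Rightarrow> nat list \<Rightarrow> int \<Rightarrow> int" where
  "e_coeff \<nu> \<mu> m =
     (let u = (\<lambda>i j. int (part \<nu> i) - int (part \<mu> j) + int j - int i = m);
          w = (\<lambda>i j. int j - int i = m)
      in \<Sum>(i, j) | 1 \<le> i \<and> 1 \<le> j \<and> u i j \<noteq> w i j. of_bool (u i j) - of_bool (w i j))"

definition e_coeff' :: "nat list \<Rightarrow> int \<Rightarrow> int" where
  "e_coeff' \<mu> m =
     (let u = (\<lambda>i j. int (part \<mu> i) - int (part \<mu> j) + int j - int i = m);
          w = (\<lambda>i j. int j - int i = m)
      in \<Sum>(i, j) | 1 \<le> i \<and> i < j \<and> u i j \<noteq> w i j. of_bool (u i j) - of_bool (w i j))"

text \<open>The meaning of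
  \<open>\<Prod>\<^bsub>i,j\<ge>1\<^esub> sinh (\<beta>/2 (2a\<^bsub>kl\<^esub> + \<hbar>(\<mu>\<^sup>k\<^sub>i - \<mu>\<^sup>l\<^sub>j + j - i))) / sinh (\<beta>/2 (2a\<^bsub>kl\<^esub> + \<hbar>(j - i)))\<close>
  after cancellation; for \<open>k > l\<close> it is by convention the product for \<open>(l, k)\<close>.\<close>

definition sinh_prod ::
  "complex \<Rightarrow> complex \<Rightarrow> (nat \<Rightarrow> complex) \<Rightarrow> (nat \<Rightarrow> nat list) \<Rightarrow> nat \<Rightarrow> nat \<Rightarrow> complex" where
  "sinh_prod \<beta> h a \<mu> k l =
     (let P = (\<lambda>k l. \<Prod>m | e_coeff (\<mu> k) (\<mu> l) m \<noteq> 0.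
                 sinh (\<beta> / 2 * (2 * (a k - a l) + h * of_int m)) powi e_coeff (\<mu> k) (\<mu> l) m)
      in if k < l then P k l
         else if l < k then P l k
         else (\<Prod>m | m \<ge> 1 \<and> e_coeff' (\<mu> k) m \<noteq> 0.
                 sinh (\<beta> * h * of_int m / 2) powi e_coeff' (\<mu> k) m)\<^sup>2)"

end

theory Submission
  imports Defs "Jordan_Normal_Form.Determinant"
begin

text \<open>
  Write \<open>x\<^sub>k\<close> and \<open>y\<^sub>k\<close> for the alphabets \<open>q\<^bsup>(\<mu>\<^sup>k)\<^sup>t + \<rho>\<^esup>\<close> and \<open>q\<^bsup>\<mu>\<^sup>k + \<rho>\<^esup>\<close>. The sum over \<open>\<eta>\<close>, \<open>\<rho>\<^sup>1\<close> and
  \<open>\<rho>\<^sup>3\<close> that defines the vertex at \<open>\<sigma>\<close>, \<open>\<mu>\<^sup>k\<close>, \<open>\<tau>\<^sup>t\<close> is a sum of products of two skew Schur functions,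
  \<open>\<Sum>\<^sub>\<eta> s\<^bsub>\<sigma>/\<eta>\<^esub>(x\<^sub>k) s\<^bsub>\<tau>/\<eta>\<^esub>(y\<^sub>k)\<close>, times \<open>W\<close> of \<open>\<mu>\<^sup>k\<close> and a power of \<open>q\<close> that cancels the framing factor
  (\<open>vertex_eq_transfer\<close>). So the strip amplitude is a matrix element of a product of transfer matrices.
  Each of them is a translation of the power sums followed by multiplication with an exponential,
  hence moving one vertex past another produces a scalar, the Cauchy kernel of \<open>y\<^sub>k\<close> and
  \<open>x\<^sub>l\<close> at \<open>Q\<^sub>k \<cdots> Q\<^bsub>l-1\<^esub>\<close> (\<open>transfer_schur_val\<close>, \<open>strip_sum_trunc\<close>). The result is
  \<open>Ktilde_product\<close>: the amplitude is \<open>\<Prod>\<^sub>k W\<^bsub>\<mu>\<^sup>k\<^esub>\<close> times the product of these kernels over all pairs \<open>k < l\<close>.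

  The series \<open>K\<^bsub>(0)(0)\<^esub>\<close> is the same kernel for empty partitions. This is the Cauchy identity together
  with the principal specialisation \<open>W\<^sub>\<mu> = s\<^sub>\<mu>(q\<^sup>\<rho>)\<close> (\<open>W1_eq_schur_val\<close>). The latter holds because
  \<open>q\<^sup>\<rho>\<close> is a geometric progression: splitting off its first variable gives, by the branching rule, a
  recursion whose solution is unique up to a scalar, and the determinant of Jacobi and Trudi, which is a Vandermonde
  determinant here, satisfies it since its rows telescope (\<open>jt_det_branching\<close>).

  The quotient of the two kernels is the exponential of a finite sum of logarithms. Summing geometric progressions
  expresses the power sums of \<open>x\<^sub>l\<close> and \<open>y\<^sub>k\<close> by the contents of the cells, and then the product of two such
  power sums minus its value for empty partitions is \<open>- \<Sum>\<^sub>m e\<^sub>m q\<^bsup>nm\<^esup>\<close>, where \<open>e\<^sub>m\<close> are the very exponents that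
  regularise the infinite products of hyperbolic sines (\<open>psum_at_product\<close>; the double sum over \<open>i, j \<ge> 1\<close>
  is a second difference that can be summed over the cells, \<open>box_sum_contents\<close>). So each pair \<open>k < l\<close>
  contributes \<open>\<Prod>\<^sub>m (1 - q\<^sup>m Q\<^sub>k \<cdots> Q\<^bsub>l-1\<^esub>)\<close> with exponents \<open>e\<^sub>m\<close>, which is the hyperbolic sine product up to
  monomials; their exponents are the total \<open>\<Sum>\<^sub>m e\<^sub>m = - \<bar>\<mu>\<^sup>k\<bar> - \<bar>\<mu>\<^sup>l\<bar>\<close> and the moment
  \<open>2 \<Sum>\<^sub>m m e\<^sub>m = \<kappa>\<^bsub>\<mu>\<^sup>l\<^esub> - \<kappa>\<^bsub>\<mu>\<^sup>k\<^esub>\<close>. The factors \<open>W\<close> account for the diagonal \<open>k = l\<close>. Collecting the monomials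
  gives the prefactors, and the rational function converges to its value once the \<open>Q\<^sub>k\<close> are small.

  The theory of Schur functions that is needed rests on one bijection, \<open>hstrip_reflection\<close>, from which
  the Pieri rule follows; the Kostka numbers are unitriangular, so Schur functions are a basis over any
  ring and have values at any prescribed power sums. Values are taken in an arbitrary commutative ring
  that contains the rationals, because the alphabets scaled by the \<open>Q\<^sub>k\<close> have power sums that are power series.
\<close>

section \<open>Partitions\<close>

lemma part_0 [simp]: "part \<mu> 0 = 0"
  by (simp add: part_def)

lemma part_Nil [simp]: "part [] i = 0"
  by (simp add: part_def)

lemma part_beyond_length: "length \<mu> < i \<Longrightarrow> part \<mu> i = 0"
  by (simp add: part_def)

lemma is_partition_Nil [simp]: "is_partition []"
  by (simp add: is_partition_def)

lemma part_pos:
  assumes "is_partition \<mu>" "1 \<le> i" "i \<le> length \<mu>"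
  shows "part \<mu> i > 0"
proof -
  have "\<mu> ! (i - 1) \<in> set \<mu>"
    using assms by simp
  then have "\<mu> ! (i - 1) \<noteq> 0"
    using assms(1) unfolding is_partition_def by metis
  then show ?thesis
    using assms by (simp add: part_def)
qed

lemma part_antimono:
  assumes "is_partition \<mu>" "1 \<le> i" "i \<le> j"
  shows "part \<mu> j \<le> part \<mu> i"
proof (cases "i = j \<or> length \<mu> < j")
  case False
  then show ?thesis
    using assms sorted_wrt_nth_less[of "(\<ge>)" \<mu> "i - 1" "j - 1"]
    by (auto simp: part_def is_partition_def)
qed (auto simp: part_beyond_length)

lemma length_le_iff_part:
  assumes "is_partition \<mu>"
  shows "length \<mu> \<le> n \<longleftrightarrow> part \<mu> (Suc n) = 0"
  using part_pos[OF assms, of "Suc n"] part_beyond_length[of \<mu> "Suc n"] by force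

lemma partition_eqI:
  assumes "is_partition \<theta>" "is_partition \<mu>" "\<And>i. 1 \<le> i \<Longrightarrow> part \<theta> i = part \<mu> i"
  shows "\<theta> = \<mu>"
proof -
  have "length \<theta> \<le> n \<longleftrightarrow> length \<mu> \<le> n" for n
    using assms by (simp add: length_le_iff_part)
  then have len: "length \<theta> = length \<mu>"
    by (metis le_antisym order_refl)
  show ?thesis
  proof (rule nth_equalityI[OF len])
    fix i assume "i < length \<theta>"
    then show "\<theta> ! i = \<mu> ! i"
      using assms(3)[of "Suc i"] len by (simp add: part_def)
  qed
qed

text \<open>Nonincreasing functions that reach 0 are partitions. The value at 0 is left free, because parts
  are numbered from 1.\<close>

lemma partition_of_parts:
  assumes "\<And>i. 1 \<le> i \<Longrightarrow> f (Suc i) \<le> f i" and "f (Suc N) = 0"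
  shows "\<exists>\<theta>. is_partition \<theta> \<and> (\<forall>i\<ge>1. part \<theta> i = f i)"
proof -
  have mono: "f j \<le> f i" if "1 \<le> i" "i \<le> j" for i j
    using that(2)
  proof (induction rule: dec_induct)
    case (step n)
    then show ?case using assms(1)[of n] that(1) by linarith
  qed simp
  define n where "n = (LEAST n. f (Suc n) = 0)"
  have n0: "f (Suc n) = 0"
    unfolding n_def using assms(2) by (rule LeastI)
  have pos: "f (Suc i) > 0" if "i < n" for i
    using not_less_Least[of i "\<lambda>n. f (Suc n) = 0"] that by (auto simp: n_def)
  define \<theta> where "\<theta> = map (\<lambda>i. f (Suc i)) [0..<n]"
  have "is_partition \<theta>"
    unfolding is_partition_def sorted_wrt_iff_nth_less
  proof (intro conjI allI impI)
    show "\<theta> ! j \<le> \<theta> ! i" if "i < j" "j < length \<theta>" for i j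
      using that mono[of "Suc i" "Suc j"] by (simp add: \<theta>_def)
    show "0 \<notin> set \<theta>" using pos by (force simp: \<theta>_def)
  qed
  moreover have "part \<theta> i = f i" if "i \<ge> 1" for i
    using that mono[of "Suc n" i] n0 by (auto simp: \<theta>_def part_def)
  ultimately show ?thesis by blast
qed

lemma sum_list_eq_sum_part:
  assumes "length \<mu> \<le> M"
  shows "sum_list \<mu> = (\<Sum>i=1..M. part \<mu> i)"
proof -
  have "(\<Sum>i=1..M. part \<mu> i) = (\<Sum>i=1..length \<mu>. part \<mu> i)"
    using assms by (intro sum.mono_neutral_right) (auto simp: part_beyond_length)
  also have "\<dots> = (\<Sum>i<length \<mu>. \<mu> ! i)"
    by (rule sum.reindex_bij_witness[of _ Suc "\<lambda>i. i - 1"]) (auto simp: part_def)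
  also have "\<dots> = sum_list \<mu>"
    by (simp add: sum_list_sum_nth lessThan_atLeast0)
  finally show ?thesis ..
qed

lemma part_le_sum_list: "part \<mu> i \<le> sum_list \<mu>"
  by (cases "1 \<le> i \<and> i \<le> length \<mu>")
     (auto simp: part_def intro: member_le_sum_list)

lemma length_le_sum_list:
  assumes "is_partition \<mu>"
  shows "length \<mu> \<le> sum_list \<mu>"
proof -
  have "(\<Sum>i=1..length \<mu>. 1) \<le> (\<Sum>i=1..length \<mu>. part \<mu> i)"
    using part_pos[OF assms] by (intro sum_mono) (simp add: Suc_leI)
  then show ?thesis
    using sum_list_eq_sum_part[of \<mu> "length \<mu>"] by simp
qed

lemma sum_list_eq_0_partition:
  assumes "is_partition \<mu>"
  shows "sum_list \<mu> = 0 \<longleftrightarrow> \<mu> = []"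
  using length_le_sum_list[OF assms] by (metis le_0_eq length_0_conv sum_list.Nil)

lemma finite_partitions_le: "finite {\<mu>. is_partition \<mu> \<and> sum_list \<mu> \<le> n}"
proof (rule finite_subset)
  show "{\<mu>. is_partition \<mu> \<and> sum_list \<mu> \<le> n} \<subseteq> {xs. set xs \<subseteq> {..n} \<and> length xs \<le> n}"
    using length_le_sum_list member_le_sum_list by fastforce
  show "finite {xs. set xs \<subseteq> {..n} \<and> length xs \<le> n}"
    by (rule finite_lists_length_le) simp
qed

definition partitions_of :: "nat \<Rightarrow> nat list set" where
  "partitions_of n = {\<mu>. is_partition \<mu> \<and> sum_list \<mu> = n}"

lemma finite_partitions_of [simp]: "finite (partitions_of n)"
  by (rule finite_subset[OF _ finite_partitions_le[of n]]) (auto simp: partitions_of_def)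

lemma partitions_of_0 [simp]: "partitions_of 0 = {[]}"
  using sum_list_eq_0_partition by (auto simp: partitions_of_def)

lemma finite_cells [simp]: "finite (cells \<mu>)"
proof (rule finite_subset)
  show "cells \<mu> \<subseteq> {..length \<mu>} \<times> {..sum_list \<mu>}"
  proof (clarsimp simp: cells_def)
    fix i j assume "Suc 0 \<le> i" "Suc 0 \<le> j" "j \<le> part \<mu> i"
    then show "i \<le> length \<mu> \<and> j \<le> sum_list \<mu>"
      using part_le_sum_list[of \<mu> i] part_beyond_length[of \<mu> i] by linarith
  qed
qed simp

lemma cells_eq_Sigma: "cells \<mu> = (SIGMA i:{1..length \<mu>}. {1..part \<mu> i})"
proof -
  have "i \<le> length \<mu>" if "Suc 0 \<le> j" "j \<le> part \<mu> i" for i j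
    using that part_beyond_length[of \<mu> i] by linarith
  then show ?thesis by (auto simp: cells_def)
qed

lemma card_cells: "card (cells \<mu>) = sum_list \<mu>"
  using sum_list_eq_sum_part[of \<mu> "length \<mu>"] by (simp add: cells_eq_Sigma)

lemma partition_eq_cellsI:
  assumes "is_partition \<theta>" "is_partition \<mu>" "cells \<theta> = cells \<mu>"
  shows "\<theta> = \<mu>"
proof (rule partition_eqI[OF assms(1,2)])
  fix i :: nat assume "1 \<le> i"
  then have "{1..part \<theta> i} = {1..part \<mu> i}"
    using assms(3) by (auto simp: cells_def set_eq_iff)
  then show "part \<theta> i = part \<mu> i"
    by (metis card_atLeastAtMost diff_Suc_1)
qed


section \<open>Horizontal strips and Kostka numbers\<close>

definition hstrip :: "nat list \<Rightarrow> nat list \<Rightarrow> bool" where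
  "hstrip \<mu> \<theta> \<longleftrightarrow> (\<forall>i\<ge>1. part \<mu> i \<le> part \<theta> i \<and> part \<theta> (Suc i) \<le> part \<mu> i)"

lemma hstrip_Nil [simp]: "hstrip [] []"
  by (simp add: hstrip_def)

lemma hstrip_length:
  assumes "is_partition \<mu>" "is_partition \<theta>" "hstrip \<mu> \<theta>"
  shows "length \<mu> \<le> length \<theta>" and "length \<theta> \<le> Suc (length \<mu>)"
proof -
  have "part \<mu> (Suc (length \<theta>)) \<le> part \<theta> (Suc (length \<theta>))"
    using assms(3) unfolding hstrip_def by (metis le_add1 plus_1_eq_Suc)
  then show "length \<mu> \<le> length \<theta>"
    using length_le_iff_part[OF assms(1)] part_beyond_length[of \<theta>] by simp
  have "part \<theta> (Suc (Suc (length \<mu>))) \<le> part \<mu> (Suc (length \<mu>))"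
    using assms(3) unfolding hstrip_def by (metis le_add1 plus_1_eq_Suc)
  then show "length \<theta> \<le> Suc (length \<mu>)"
    using length_le_iff_part[OF assms(2)] part_beyond_length[of \<mu>] by simp
qed

lemma hstrip_sum_list_le:
  assumes "is_partition \<mu>" "is_partition \<theta>" "hstrip \<mu> \<theta>"
  shows "sum_list \<mu> \<le> sum_list \<theta>"
proof -
  have "(\<Sum>i=1..length \<theta>. part \<mu> i) \<le> (\<Sum>i=1..length \<theta>. part \<theta> i)"
    using assms(3) by (intro sum_mono) (auto simp: hstrip_def)
  then show ?thesis
    using sum_list_eq_sum_part[OF hstrip_length(1)[OF assms]] sum_list_eq_sum_part[OF order_refl, of \<theta>]
    by simp
qed

lemma finite_hstrip_below:
  assumes "is_partition \<theta>"
  shows "finite {\<mu>. is_partition \<mu> \<and> hstrip \<mu> \<theta> \<and> P \<mu>}"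
  by (rule finite_subset[OF _ finite_partitions_le[of "sum_list \<theta>"]])
     (use hstrip_sum_list_le assms in blast)

lemma finite_hstrip_above: "finite {\<theta>. is_partition \<theta> \<and> hstrip \<mu> \<theta> \<and> sum_list \<theta> = n}"
  by (rule finite_subset[OF _ finite_partitions_of[of n]]) (auto simp: partitions_of_def)

text \<open>
  The number of semistandard tableaux of shape \<open>\<theta>\<close> in which \<open>v\<close> occurs \<open>\<alpha> v\<close> times for \<open>v < n\<close>
  and nothing else occurs: removing the entries equal to the largest letter removes a horizontal
  strip.
\<close>

fun kostka :: "nat \<Rightarrow> (nat \<Rightarrow> nat) \<Rightarrow> nat list \<Rightarrow> nat" where
  "kostka 0 \<alpha> \<theta> = of_bool (\<theta> = [])"
| "kostka (Suc n) \<alpha> \<theta> =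
     (\<Sum>\<mu> | is_partition \<mu> \<and> hstrip \<mu> \<theta> \<and> sum_list \<mu> + \<alpha> n = sum_list \<theta>. kostka n \<alpha> \<mu>)"

lemma kostka_cong: "(\<And>i. i < n \<Longrightarrow> \<alpha> i = \<beta> i) \<Longrightarrow> kostka n \<alpha> \<theta> = kostka n \<beta> \<theta>"
  by (induction n arbitrary: \<theta>) auto

lemma kostka_Suc_obtain:
  assumes "kostka (Suc n) \<alpha> \<theta> \<noteq> 0"
  obtains \<mu> where "is_partition \<mu>" "hstrip \<mu> \<theta>" "sum_list \<mu> + \<alpha> n = sum_list \<theta>" "kostka n \<alpha> \<mu> \<noteq> 0"
proof -
  have "\<exists>\<mu>\<in>{\<mu>. is_partition \<mu> \<and> hstrip \<mu> \<theta> \<and> sum_list \<mu> + \<alpha> n = sum_list \<theta>}. kostka n \<alpha> \<mu> \<noteq> 0"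
    using assms by (metis (no_types, lifting) kostka.simps(2) sum.neutral)
  then show ?thesis using that by blast
qed

lemma kostka_nonzero_size: "kostka n \<alpha> \<theta> \<noteq> 0 \<Longrightarrow> sum_list \<theta> = (\<Sum>i<n. \<alpha> i)"
proof (induction n arbitrary: \<theta>)
  case (Suc n)
  from Suc.prems obtain \<mu> where "sum_list \<mu> + \<alpha> n = sum_list \<theta>" "kostka n \<alpha> \<mu> \<noteq> 0"
    by (rule kostka_Suc_obtain)
  then show ?case using Suc.IH[of \<mu>] by simp
qed (simp split: if_splits)

lemma kostka_nonzero_length: "kostka n \<alpha> \<theta> \<noteq> 0 \<Longrightarrow> is_partition \<theta> \<Longrightarrow> length \<theta> \<le> n"
proof (induction n arbitrary: \<theta>)
  case (Suc n)
  from Suc.prems(1) obtain \<mu> where "is_partition \<mu>" "hstrip \<mu> \<theta>" "kostka n \<alpha> \<mu> \<noteq> 0"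
    by (rule kostka_Suc_obtain)
  then show ?case
    using Suc.IH[of \<mu>] hstrip_length(2)[of \<mu> \<theta>] Suc.prems(2) by linarith
qed (simp split: if_splits)

text \<open>The statistic \<open>\<Sum>\<^sub>i (i - 1) \<theta>\<^sub>i\<close>; it strictly decreases along the dominance order, which
  makes it a convenient measure for unitriangularity arguments.\<close>

definition row_weight :: "nat list \<Rightarrow> nat" where
  "row_weight \<theta> = (\<Sum>i<length \<theta>. i * part \<theta> (Suc i))"

lemma row_weight_eq: "length \<theta> \<le> n \<Longrightarrow> row_weight \<theta> = (\<Sum>i<n. i * part \<theta> (Suc i))"
  unfolding row_weight_def
  by (intro sum.mono_neutral_left) (auto simp: part_beyond_length)

lemma sum_list_eq_sum_part': "length \<mu> \<le> n \<Longrightarrow> sum_list \<mu> = (\<Sum>i<n. part \<mu> (Suc i))"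
  using sum_list_eq_sum_part[of \<mu> n] by (simp add: sum.atLeast1_atMost_eq)

text \<open>A horizontal strip of \<open>\<alpha>\<^sub>n\<close> boxes added in step \<open>n\<close> lies in the rows of index at most \<open>n\<close>,
  so its contribution to the weight is at most \<open>n \<alpha>\<^sub>n\<close>, with equality only if it lies in row \<open>n\<close>.\<close>

lemma kostka_triangular:
  assumes "kostka n \<alpha> \<theta> \<noteq> 0" "is_partition \<theta>"
  shows "row_weight \<theta> < (\<Sum>i<n. i * \<alpha> i) \<or> (\<forall>i<n. part \<theta> (Suc i) = \<alpha> i)"
  using assms
proof (induction n arbitrary: \<theta>)
  case (Suc n)
  from Suc.prems(1) obtain \<mu> where \<mu>: "is_partition \<mu>" "hstrip \<mu> \<theta>"
    "sum_list \<mu> + \<alpha> n = sum_list \<theta>" "kostka n \<alpha> \<mu> \<noteq> 0"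
    by (rule kostka_Suc_obtain)
  have len: "length \<theta> \<le> Suc n" "length \<mu> \<le> n" "length \<mu> \<le> Suc n"
    using kostka_nonzero_length Suc.prems \<mu> le_SucI by blast+
  define d where "d i = part \<theta> (Suc i) - part \<mu> (Suc i)" for i
  have d: "part \<theta> (Suc i) = part \<mu> (Suc i) + d i" for i
    using \<mu>(2) by (simp add: hstrip_def d_def)
  have sum_d: "(\<Sum>i<Suc n. d i) = \<alpha> n"
    using \<mu>(3) unfolding sum_list_eq_sum_part'[OF len(1)] sum_list_eq_sum_part'[OF len(3)] d
      sum.distrib by linarith
  have rw: "row_weight \<theta> = row_weight \<mu> + (\<Sum>i<Suc n. i * d i)"
    unfolding row_weight_eq[OF len(1)] row_weight_eq[OF len(3)] d
    by (simp add: sum.distrib algebra_simps)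
  have le: "(\<Sum>i<Suc n. i * d i) \<le> (\<Sum>i<Suc n. n * d i)"
    by (intro sum_mono) simp
  then have le': "(\<Sum>i<Suc n. i * d i) \<le> n * \<alpha> n"
    by (metis sum_d sum_distrib_left)
  have le_mu: "row_weight \<mu> \<le> (\<Sum>i<n. i * \<alpha> i)"
    using Suc.IH[OF \<mu>(4,1)] row_weight_eq[OF len(2)] by auto
  show ?case
  proof (cases "\<exists>i<n. d i > 0")
    case True
    then obtain i where "i < n" "d i > 0" by blast
    then have "(\<Sum>i<Suc n. i * d i) < (\<Sum>i<Suc n. n * d i)"
      by (intro sum_strict_mono_ex1) auto
    then have "(\<Sum>i<Suc n. i * d i) < n * \<alpha> n"
      by (metis sum_d sum_distrib_left)
    then show ?thesis using rw le_mu by simp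
  next
    case False
    then have "d n = \<alpha> n" using sum_d by simp
    moreover have "part \<mu> (Suc n) = 0"
      using len(2) \<mu>(1) by (simp add: length_le_iff_part)
    ultimately have "part \<theta> (Suc n) = \<alpha> n" by (simp add: d)
    moreover have "part \<theta> (Suc i) = part \<mu> (Suc i)" if "i < n" for i
      using False that d by auto
    moreover have "row_weight \<theta> < (\<Sum>i<Suc n. i * \<alpha> i) \<or> row_weight \<mu> = (\<Sum>i<n. i * \<alpha> i)"
      using rw le' le_mu unfolding sum.lessThan_Suc[of "\<lambda>i. i * \<alpha> i"] by linarith
    ultimately show ?thesis
      using Suc.IH[OF \<mu>(4,1)] by (metis less_SucE nat_neq_iff)
  qed
qed simp

text \<open>The strip added last has to fill the last row, so there is exactly one tableau.\<close>

lemma kostka_diagonal: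
  assumes "\<And>i. i < n \<Longrightarrow> part \<theta> (Suc i) = \<alpha> i" "is_partition \<theta>" "length \<theta> \<le> n"
  shows "kostka n \<alpha> \<theta> = 1"
  using assms
proof (induction n arbitrary: \<theta>)
  case (Suc n)
  let ?A = "{\<mu>. is_partition \<mu> \<and> hstrip \<mu> \<theta> \<and> sum_list \<mu> + \<alpha> n = sum_list \<theta>}"
  define \<theta>' where "\<theta>' = take n \<theta>"
  have p': "is_partition \<theta>'"
    using Suc.prems(2) by (auto simp: is_partition_def \<theta>'_def sorted_wrt_take dest: in_set_takeD)
  have part': "part \<theta>' i = (if i \<le> n then part \<theta> i else 0)" for i
    by (auto simp: part_def \<theta>'_def)
  have len': "length \<theta>' \<le> n" by (simp add: \<theta>'_def)
  have hs: "hstrip \<theta>' \<theta>"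
    unfolding hstrip_def part'
    using part_antimono[OF Suc.prems(2)] part_beyond_length[of \<theta>] Suc.prems(3) by auto
  have size: "sum_list \<theta>' + \<alpha> n = sum_list \<theta>"
    using sum_list_eq_sum_part'[OF len'] sum_list_eq_sum_part'[OF Suc.prems(3)] Suc.prems(1)
    by (simp add: part')
  have zero: "kostka n \<alpha> \<mu> = 0" if "\<mu> \<in> ?A" "\<mu> \<noteq> \<theta>'" for \<mu>
  proof (rule ccontr)
    assume "kostka n \<alpha> \<mu> \<noteq> 0"
    then have len: "length \<mu> \<le> n" using that kostka_nonzero_length by blast
    have "sum_list \<mu> = sum_list \<theta>'" using that size by simp
    then have "(\<Sum>i<n. part \<mu> (Suc i)) = (\<Sum>i<n. part \<theta>' (Suc i))"
      using sum_list_eq_sum_part'[OF len] sum_list_eq_sum_part'[OF len'] by simp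
    moreover have le: "part \<mu> (Suc i) \<le> part \<theta>' (Suc i)" if "i \<in> {..<n}" for i
      using \<open>\<mu> \<in> ?A\<close> that by (auto simp: hstrip_def part')
    ultimately have eq: "part \<mu> (Suc i) = part \<theta>' (Suc i)" if "i \<in> {..<n}" for i
      using sum_mono_inv[of "\<lambda>i. part \<mu> (Suc i)" "{..<n}" "\<lambda>i. part \<theta>' (Suc i)" i] that by auto
    have "part \<mu> i = part \<theta>' i" if "1 \<le> i" for i
      using eq[of "i - 1"] that len len' part_beyond_length[of _ i] by (cases "i \<le> n") auto
    then show False
      using partition_eqI[of \<mu> \<theta>'] that p' by auto
  qed
  have "(\<Sum>\<mu>\<in>?A. kostka n \<alpha> \<mu>) = (\<Sum>\<mu>\<in>{\<theta>'}. kostka n \<alpha> \<mu>)"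
    using p' hs size zero finite_hstrip_below[OF Suc.prems(2)]
    by (intro sum.mono_neutral_right) auto
  moreover have "kostka n \<alpha> \<theta>' = 1"
    using Suc.IH[OF _ p' len'] Suc.prems(1) by (simp add: part')
  ultimately show ?case by simp
qed simp

text \<open>The local form of the Cauchy identity. Given \<open>\<mu>\<close> and \<open>\<kappa>\<close>, each part of a common cover
  \<open>\<theta>\<close> except the first ranges over the interval from \<open>max \<mu>\<^sub>i\<^sub>+\<^sub>1 \<kappa>\<^sub>i\<^sub>+\<^sub>1\<close> to
  \<open>min \<mu>\<^sub>i \<kappa>\<^sub>i\<close>, which is also the range of the parts of a common lower bound; reflecting
  these intervals turns covers into lower bounds.\<close>

lemma hstrip_reflection:
  assumes "is_partition \<mu>" "is_partition \<kappa>"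
  shows "card {\<theta>. is_partition \<theta> \<and> hstrip \<mu> \<theta> \<and> hstrip \<kappa> \<theta> \<and> sum_list \<theta> = m} =
    card {\<nu>. is_partition \<nu> \<and> hstrip \<nu> \<mu> \<and> hstrip \<nu> \<kappa> \<and> sum_list \<mu> + sum_list \<kappa> \<le> sum_list \<nu> + m}"
    (is "card ?A = card ?B")
proof -
  define lo where "lo i = max (part \<mu> i) (part \<kappa> i)" for i
  define hi where "hi i = min (part \<mu> i) (part \<kappa> i)" for i
  define M where "M = Suc (max (length \<mu>) (length \<kappa>))"
  have anti: "lo (Suc i) \<le> lo i" "hi (Suc i) \<le> hi i" "hi i \<le> lo i" if "1 \<le> i" for i
    using part_antimono[OF assms(1) that, of "Suc i"] part_antimono[OF assms(2) that, of "Suc i"]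
    by (auto simp: lo_def hi_def)
  have big: "lo i = 0" "hi i = 0" if "i \<ge> M" for i
    using that by (auto simp: lo_def hi_def M_def part_beyond_length)
  have sum_lohi: "sum_list \<mu> + sum_list \<kappa> = (\<Sum>i=1..M. lo i + hi i)"
  proof -
    have "lo i + hi i = part \<mu> i + part \<kappa> i" for i
      by (auto simp: lo_def hi_def)
    then show ?thesis
      using sum_list_eq_sum_part[of \<mu> M] sum_list_eq_sum_part[of \<kappa> M]
      by (simp add: sum.distrib M_def)
  qed
  have M1: "1 \<le> M" by (simp add: M_def)
  have shift: "(\<Sum>i=1..M. g i) = g 1 + (\<Sum>i=1..M. g (Suc i))" if "g (Suc M) = 0" for g :: "nat \<Rightarrow> nat"
  proof -
    have "(\<Sum>i=1..M. g i) = (\<Sum>i=1..Suc M. g i)" using that by simp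
    also have "\<dots> = g 1 + (\<Sum>i=Suc 1..Suc M. g i)"
      by (subst sum.atLeast_Suc_atMost) simp_all
    finally show ?thesis by (simp only: sum.shift_bounds_cl_Suc_ivl)
  qed
  have inA: "hstrip \<mu> \<theta> \<and> hstrip \<kappa> \<theta> \<longleftrightarrow>
      lo 1 \<le> part \<theta> 1 \<and> (\<forall>i\<ge>1. lo (Suc i) \<le> part \<theta> (Suc i) \<and> part \<theta> (Suc i) \<le> hi i)" (is "?L \<longleftrightarrow> ?R") for \<theta>
  proof
    assume ?L then show ?R by (auto simp: hstrip_def lo_def hi_def)
  next
    assume R: ?R
    have "lo i \<le> part \<theta> i" if "1 \<le> i" for i
      using R that by (cases "i = 1") (auto dest: spec[of _ "i - 1"])
    with R show ?L by (auto simp: hstrip_def lo_def hi_def)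
  qed
  have inB: "hstrip \<nu> \<mu> \<and> hstrip \<nu> \<kappa> \<longleftrightarrow> (\<forall>i\<ge>1. lo (Suc i) \<le> part \<nu> i \<and> part \<nu> i \<le> hi i)" for \<nu>
    unfolding hstrip_def lo_def hi_def by auto
  have szA: "sum_list \<theta> = part \<theta> 1 + (\<Sum>i=1..M. part \<theta> (Suc i))"
    if "is_partition \<theta>" "\<forall>i\<ge>1. part \<theta> (Suc i) \<le> hi i" for \<theta>
  proof -
    have "part \<theta> (Suc M) = 0" using that(2) big M1 by (metis le_0_eq order_refl)
    then have "length \<theta> \<le> M" using that(1) by (simp add: length_le_iff_part)
    then show ?thesis
      using sum_list_eq_sum_part[of \<theta> M] shift[of "part \<theta>"] \<open>part \<theta> (Suc M) = 0\<close> by simp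
  qed
  have szB: "sum_list \<nu> = (\<Sum>i=1..M. part \<nu> i)"
    if "is_partition \<nu>" "\<forall>i\<ge>1. part \<nu> i \<le> hi i" for \<nu>
  proof -
    have "part \<nu> (Suc M) = 0" using that(2) big by (metis le_0_eq le_SucI le_add1 order_refl plus_1_eq_Suc)
    then have "length \<nu> \<le> M" using that(1) by (simp add: length_le_iff_part)
    then show ?thesis by (rule sum_list_eq_sum_part)
  qed
  define flip where "flip \<theta> = (SOME \<nu>. is_partition \<nu> \<and> (\<forall>i\<ge>1. part \<nu> i = lo (Suc i) + hi i - part \<theta> (Suc i)))" for \<theta>
  have flip: "is_partition (flip \<theta>) \<and> (\<forall>i\<ge>1. part (flip \<theta>) i = lo (Suc i) + hi i - part \<theta> (Suc i))"
    if "\<theta> \<in> ?A" for \<theta>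
    unfolding flip_def
  proof (rule someI_ex, rule partition_of_parts)
    from that have A: "\<forall>i\<ge>1. lo (Suc i) \<le> part \<theta> (Suc i) \<and> part \<theta> (Suc i) \<le> hi i"
      using inA by blast
    show "lo (Suc (Suc i)) + hi (Suc i) - part \<theta> (Suc (Suc i)) \<le> lo (Suc i) + hi i - part \<theta> (Suc i)"
      if "1 \<le> i" for i
    proof -
      have "lo (Suc (Suc i)) \<le> part \<theta> (Suc (Suc i))" "part \<theta> (Suc i) \<le> hi i" "hi (Suc i) \<le> lo (Suc i)"
        using A that anti(3)[of "Suc i"] by auto
      then show ?thesis by linarith
    qed
    show "lo (Suc (Suc M)) + hi (Suc M) - part \<theta> (Suc (Suc M)) = 0"
      using big by simp
  qed
  have "bij_betw flip ?A ?B"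
  proof (rule bij_betwI')
    fix \<theta> \<theta>' assume L: "\<theta> \<in> ?A" "\<theta>' \<in> ?A"
    show "flip \<theta> = flip \<theta>' \<longleftrightarrow> \<theta> = \<theta>'"
    proof
      assume eq: "flip \<theta> = flip \<theta>'"
      have A: "\<forall>i\<ge>1. lo (Suc i) \<le> part \<theta> (Suc i) \<and> part \<theta> (Suc i) \<le> hi i"
        "\<forall>i\<ge>1. lo (Suc i) \<le> part \<theta>' (Suc i) \<and> part \<theta>' (Suc i) \<le> hi i"
        using inA L by blast+
      have s: "part \<theta> (Suc i) = part \<theta>' (Suc i)" if "1 \<le> i" for i
      proof -
        have "lo (Suc i) + hi i - part \<theta> (Suc i) = lo (Suc i) + hi i - part \<theta>' (Suc i)"
          using flip[OF L(1), THEN conjunct2, rule_format, OF that]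
            flip[OF L(2), THEN conjunct2, rule_format, OF that] eq by simp
        moreover have "part \<theta> (Suc i) \<le> hi i" "part \<theta>' (Suc i) \<le> hi i"
          using A that by auto
        ultimately show ?thesis by linarith
      qed
      have "part \<theta> 1 + (\<Sum>i=1..M. part \<theta> (Suc i)) = part \<theta>' 1 + (\<Sum>i=1..M. part \<theta>' (Suc i))"
        using szA[of \<theta>] szA[of \<theta>'] A L by auto
      moreover have "(\<Sum>i=1..M. part \<theta> (Suc i)) = (\<Sum>i=1..M. part \<theta>' (Suc i))"
        using s by (intro sum.cong) auto
      ultimately have "part \<theta> 1 = part \<theta>' 1" by linarith
      then have "part \<theta> i = part \<theta>' i" if "1 \<le> i" for i
        using s[of "i - 1"] that by (cases "i = 1") auto
      then show "\<theta> = \<theta>'"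
        using L by (intro partition_eqI) auto
    qed simp
  next
    fix \<theta> assume L: "\<theta> \<in> ?A"
    have A: "\<forall>i\<ge>1. lo (Suc i) \<le> part \<theta> (Suc i) \<and> part \<theta> (Suc i) \<le> hi i" "lo 1 \<le> part \<theta> 1"
      using inA L by blast+
    let ?\<nu> = "flip \<theta>"
    have \<nu>: "is_partition ?\<nu>" "\<And>i. 1 \<le> i \<Longrightarrow> part ?\<nu> i = lo (Suc i) + hi i - part \<theta> (Suc i)"
      using flip[OF L] by blast+
    have B: "\<forall>i\<ge>1. lo (Suc i) \<le> part ?\<nu> i \<and> part ?\<nu> i \<le> hi i"
    proof (intro allI impI)
      fix i :: nat assume "1 \<le> i"
      then have "lo (Suc i) \<le> part \<theta> (Suc i)" "part \<theta> (Suc i) \<le> hi i" using A by auto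
      then show "lo (Suc i) \<le> part ?\<nu> i \<and> part ?\<nu> i \<le> hi i" using \<nu>(2)[OF \<open>1 \<le> i\<close>] by linarith
    qed
    have "sum_list ?\<nu> + (\<Sum>i=1..M. part \<theta> (Suc i)) = (\<Sum>i=1..M. lo (Suc i) + hi i)"
      using A B \<nu> by (subst szB) (auto simp: sum.distrib[symmetric] intro!: sum.cong)
    moreover have "lo 1 + (\<Sum>i=1..M. lo (Suc i) + hi i) = sum_list \<mu> + sum_list \<kappa>"
      using sum_lohi shift[of lo] big[of "Suc M"] by (simp add: sum.distrib)
    moreover have "sum_list \<theta> = part \<theta> 1 + (\<Sum>i=1..M. part \<theta> (Suc i))"
      using L A by (intro szA) blast+
    moreover have "sum_list \<theta> = m"
      using L by blast
    ultimately have "sum_list \<mu> + sum_list \<kappa> \<le> sum_list ?\<nu> + m"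
      using A(2) by linarith
    then show "?\<nu> \<in> ?B" using \<nu>(1) B inB by blast
  next
    fix \<nu> assume N: "\<nu> \<in> ?B"
    then have B: "\<forall>i\<ge>1. lo (Suc i) \<le> part \<nu> i \<and> part \<nu> i \<le> hi i"
      using inB by blast
    define k where "k = sum_list \<nu> + m - (sum_list \<mu> + sum_list \<kappa>)"
    define f where "f i = (if i \<le> 1 then lo 1 + k else lo i + hi (i - 1) - part \<nu> (i - 1))" for i
    have f_Suc: "f (Suc i) = lo (Suc i) + hi i - part \<nu> i" if "1 \<le> i" for i
      using that by (auto simp: f_def)
    have f_bounds: "lo (Suc i) \<le> f (Suc i) \<and> f (Suc i) \<le> hi i" if "1 \<le> i" for i
    proof -
      have "lo (Suc i) \<le> part \<nu> i" "part \<nu> i \<le> hi i" using B that by auto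
      then show ?thesis using f_Suc[OF that] by linarith
    qed
    have "\<exists>\<theta>. is_partition \<theta> \<and> (\<forall>i\<ge>1. part \<theta> i = f i)"
    proof (rule partition_of_parts)
      show "f (Suc i) \<le> f i" if i: "1 \<le> i" for i
      proof (cases "i = 1")
        case True
        then show ?thesis using f_bounds[of 1] anti(3)[of 1] by (simp add: f_def)
      next
        case False
        then obtain j where j: "i = Suc j" "1 \<le> j" using i by (cases i) auto
        show ?thesis using f_bounds[of i] f_bounds[of j] anti(3)[of i] i j by simp
      qed
      show "f (Suc M) = 0" using f_bounds[OF M1] big[of M] by simp
    qed
    then obtain \<theta> where \<theta>: "is_partition \<theta>" "\<And>i. 1 \<le> i \<Longrightarrow> part \<theta> i = f i" by blast
    have R: "lo 1 \<le> part \<theta> 1 \<and> (\<forall>i\<ge>1. lo (Suc i) \<le> part \<theta> (Suc i) \<and> part \<theta> (Suc i) \<le> hi i)"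
    proof (intro conjI allI impI)
      show "lo 1 \<le> part \<theta> 1" using \<theta>(2)[of 1] by (simp add: f_def)
      fix i :: nat assume "1 \<le> i"
      then show "lo (Suc i) \<le> part \<theta> (Suc i)" "part \<theta> (Suc i) \<le> hi i"
        using f_bounds[of i] \<theta>(2)[of "Suc i"] by simp_all
    qed
    have "sum_list \<nu> + (\<Sum>i=1..M. part \<theta> (Suc i)) = (\<Sum>i=1..M. lo (Suc i) + hi i)"
    proof -
      have "part \<nu> i + part \<theta> (Suc i) = lo (Suc i) + hi i" if "i \<in> {1..M}" for i
      proof -
        have "part \<nu> i \<le> hi i" using B that by auto
        then show ?thesis using \<theta>(2)[of "Suc i"] f_Suc[of i] that by simp
      qed
      then have "(\<Sum>i=1..M. part \<nu> i + part \<theta> (Suc i)) = (\<Sum>i=1..M. lo (Suc i) + hi i)"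
        by (intro sum.cong) auto
      moreover have "sum_list \<nu> = (\<Sum>i=1..M. part \<nu> i)"
        using N B by (intro szB) blast+
      ultimately show ?thesis
        by (simp add: sum.distrib)
    qed
    moreover have "lo 1 + (\<Sum>i=1..M. lo (Suc i) + hi i) = sum_list \<mu> + sum_list \<kappa>"
      using sum_lohi shift[of lo] big[of "Suc M"] by (simp add: sum.distrib)
    moreover have "part \<theta> 1 = lo 1 + k"
      using \<theta>(2)[of 1] by (simp add: f_def)
    moreover have "sum_list \<theta> = part \<theta> 1 + (\<Sum>i=1..M. part \<theta> (Suc i))"
      using R by (intro szA[OF \<theta>(1)]) blast
    moreover have "sum_list \<mu> + sum_list \<kappa> \<le> sum_list \<nu> + m"
      using N by blast
    ultimately have "sum_list \<theta> = m"
      unfolding k_def by linarith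
    moreover have "hstrip \<mu> \<theta> \<and> hstrip \<kappa> \<theta>"
      by (rule iffD2[OF inA R])
    ultimately have T: "\<theta> \<in> ?A" using \<theta>(1) by simp
    have "\<nu> = flip \<theta>"
    proof (rule partition_eqI)
      show "is_partition \<nu>" using N by simp
      show "is_partition (flip \<theta>)" using flip[OF T] by (rule conjunct1)
      fix i :: nat assume i: "1 \<le> i"
      have "part \<nu> i \<le> hi i" using B i by simp
      moreover have "part (flip \<theta>) i = lo (Suc i) + hi i - part \<theta> (Suc i)"
        using flip[OF T] i by simp
      moreover have "part \<theta> (Suc i) = lo (Suc i) + hi i - part \<nu> i"
        using \<theta>(2)[of "Suc i"] f_Suc[OF i] by simp
      ultimately show "part \<nu> i = part (flip \<theta>) i"
        by linarith
    qed
    with T show "\<exists>\<theta>\<in>?A. \<nu> = flip \<theta>" by blast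
  qed
  then show ?thesis by (rule bij_betw_same_card)
qed

text \<open>
  The Pieri rule in coefficient form: by induction on the number of variables, with the local
  reflection commuting the added strip past the strip of the last letter.
\<close>

lemma kostka_pieri:
  assumes "is_partition \<mu>"
  shows "(\<Sum>\<theta> | is_partition \<theta> \<and> hstrip \<mu> \<theta> \<and> sum_list \<theta> = (\<Sum>i<n. \<alpha> i). kostka n \<alpha> \<theta>) =
    (\<Sum>\<delta> | (\<forall>i<n. \<delta> i \<le> \<alpha> i) \<and> (\<forall>i\<ge>n. \<delta> i = 0). kostka n \<delta> \<mu>)"
  using assms
proof (induction n arbitrary: \<mu>)
  case 0
  have "{\<theta>. is_partition \<theta> \<and> hstrip \<mu> \<theta> \<and> sum_list \<theta> = 0} = (if \<mu> = [] then {[]} else {})"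
  proof -
    have "is_partition \<theta> \<and> hstrip \<mu> \<theta> \<and> sum_list \<theta> = 0 \<longleftrightarrow> \<theta> = [] \<and> \<mu> = []" for \<theta>
      using hstrip_length(1)[OF 0, of "[]"] sum_list_eq_0_partition[of \<theta>] by auto
    then show ?thesis by (simp del: sum_list_eq_0_iff)
  qed
  moreover have "{\<delta> :: nat \<Rightarrow> nat. \<forall>i. \<delta> i = 0} = {\<lambda>_. 0}" by auto
  ultimately show ?case by (simp del: sum_list_eq_0_iff)
next
  case (Suc n)
  note part_mu = Suc.prems
  define m where "m = (\<Sum>i<Suc n. \<alpha> i)"
  define U where "U = {\<theta>. is_partition \<theta> \<and> hstrip \<mu> \<theta> \<and> sum_list \<theta> = m}"
  define m' where "m' = (\<Sum>i<n. \<alpha> i)"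
  have m: "m = m' + \<alpha> n" by (simp add: m_def m'_def)
  define P where "P = {\<kappa>. is_partition \<kappa> \<and> sum_list \<kappa> = m'}"
  define D where "D = {\<nu>. is_partition \<nu> \<and> hstrip \<nu> \<mu> \<and> sum_list \<mu> \<le> sum_list \<nu> + \<alpha> n}"
  have fin: "finite U" "finite P" "finite D"
    using finite_hstrip_above[of \<mu> m] finite_partitions_of[of m'] finite_hstrip_below[OF part_mu]
    by (simp_all add: U_def P_def D_def partitions_of_def)
  have "(\<Sum>\<theta>\<in>U. kostka (Suc n) \<alpha> \<theta>) = (\<Sum>\<theta>\<in>U. \<Sum>\<kappa>\<in>P. of_bool (hstrip \<kappa> \<theta>) * kostka n \<alpha> \<kappa>)"
  proof (rule sum.cong[OF refl])
    fix \<theta> assume "\<theta> \<in> U"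
    then have "{\<kappa>. is_partition \<kappa> \<and> hstrip \<kappa> \<theta> \<and> sum_list \<kappa> + \<alpha> n = sum_list \<theta>} = P \<inter> {\<kappa>. hstrip \<kappa> \<theta>}"
      by (auto simp: U_def P_def m)
    then show "kostka (Suc n) \<alpha> \<theta> = (\<Sum>\<kappa>\<in>P. of_bool (hstrip \<kappa> \<theta>) * kostka n \<alpha> \<kappa>)"
      using fin by (simp add: sum_of_bool_mult_eq)
  qed
  also have "\<dots> = (\<Sum>\<kappa>\<in>P. (\<Sum>\<theta>\<in>U. of_bool (hstrip \<kappa> \<theta>)) * kostka n \<alpha> \<kappa>)"
    by (subst sum.swap) (simp add: sum_distrib_right)
  also have "\<dots> = (\<Sum>\<kappa>\<in>P. (\<Sum>\<nu>\<in>D. of_bool (hstrip \<nu> \<kappa>)) * kostka n \<alpha> \<kappa>)"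
  proof (rule sum.cong[OF refl])
    fix \<kappa> assume "\<kappa> \<in> P"
    then have K: "is_partition \<kappa>" "sum_list \<kappa> = m'" by (auto simp: P_def)
    have "{\<theta> \<in> U. hstrip \<kappa> \<theta>} = {\<theta>. is_partition \<theta> \<and> hstrip \<mu> \<theta> \<and> hstrip \<kappa> \<theta> \<and> sum_list \<theta> = m}"
      by (auto simp: U_def)
    moreover have "{\<nu> \<in> D. hstrip \<nu> \<kappa>} =
        {\<nu>. is_partition \<nu> \<and> hstrip \<nu> \<mu> \<and> hstrip \<nu> \<kappa> \<and> sum_list \<mu> + sum_list \<kappa> \<le> sum_list \<nu> + m}"
      using K by (auto simp: D_def m)
    ultimately have "card {\<theta> \<in> U. hstrip \<kappa> \<theta>} = card {\<nu> \<in> D. hstrip \<nu> \<kappa>}"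
      using hstrip_reflection[OF part_mu K(1), of m] by simp
    then show "(\<Sum>\<theta>\<in>U. of_bool (hstrip \<kappa> \<theta>)) * kostka n \<alpha> \<kappa> =
        (\<Sum>\<nu>\<in>D. of_bool (hstrip \<nu> \<kappa>)) * kostka n \<alpha> \<kappa>"
      using fin by (simp add: sum.inter_filter[symmetric] of_bool_def)
  qed
  also have "\<dots> = (\<Sum>\<nu>\<in>D. \<Sum>\<kappa>\<in>P. of_bool (hstrip \<nu> \<kappa>) * kostka n \<alpha> \<kappa>)"
    by (subst sum.swap) (simp add: sum_distrib_right)
  also have "\<dots> = (\<Sum>\<nu>\<in>D. \<Sum>\<delta> | (\<forall>i<n. \<delta> i \<le> \<alpha> i) \<and> (\<forall>i\<ge>n. \<delta> i = 0). kostka n \<delta> \<nu>)"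
  proof (rule sum.cong[OF refl])
    fix \<nu> assume "\<nu> \<in> D"
    then have "is_partition \<nu>" by (simp add: D_def)
    note IH = Suc.IH[OF this]
    show "(\<Sum>\<kappa>\<in>P. of_bool (hstrip \<nu> \<kappa>) * kostka n \<alpha> \<kappa>) =
        (\<Sum>\<delta> | (\<forall>i<n. \<delta> i \<le> \<alpha> i) \<and> (\<forall>i\<ge>n. \<delta> i = 0). kostka n \<delta> \<nu>)"
    proof -
      have "P \<inter> {\<kappa>. hstrip \<nu> \<kappa>} = {\<kappa>. is_partition \<kappa> \<and> hstrip \<nu> \<kappa> \<and> sum_list \<kappa> = (\<Sum>i<n. \<alpha> i)}"
        by (auto simp: P_def m'_def)
      then show ?thesis
        using fin(2) IH by (simp add: sum_of_bool_mult_eq)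
    qed
  qed
  also have "\<dots> = (\<Sum>(\<nu>, \<delta>)\<in>D \<times> {\<delta>. (\<forall>i<n. \<delta> i \<le> \<alpha> i) \<and> (\<forall>i\<ge>n. \<delta> i = 0)}. kostka n \<delta> \<nu>)"
    by (simp add: sum.cartesian_product)
  also have "\<dots> = (\<Sum>(\<delta>, \<nu>)\<in>(SIGMA \<delta>:{\<delta>. (\<forall>i<Suc n. \<delta> i \<le> \<alpha> i) \<and> (\<forall>i\<ge>Suc n. \<delta> i = 0)}.
      {\<nu>. is_partition \<nu> \<and> hstrip \<nu> \<mu> \<and> sum_list \<nu> + \<delta> n = sum_list \<mu>}). kostka n \<delta> \<nu>)"
    by (rule sum.reindex_bij_witness[of _
          "\<lambda>(\<delta>, \<nu>). (\<nu>, \<delta>(n := 0))" "\<lambda>(\<nu>, \<delta>). (\<delta>(n := sum_list \<mu> - sum_list \<nu>), \<nu>)"])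
       (auto simp: D_def fun_eq_iff less_Suc_eq intro: kostka_cong dest: hstrip_sum_list_le[OF _ part_mu])
  also have "\<dots> = (\<Sum>\<delta> | (\<forall>i<Suc n. \<delta> i \<le> \<alpha> i) \<and> (\<forall>i\<ge>Suc n. \<delta> i = 0). kostka (Suc n) \<delta> \<mu>)"
  proof -
    have "finite {\<delta>. \<forall>i. (i \<in> {..<Suc n} \<longrightarrow> \<delta> i \<in> {..m}) \<and> (i \<notin> {..<Suc n} \<longrightarrow> \<delta> i = 0)}"
      by (rule finite_set_of_finite_funs) auto
    moreover have "\<alpha> i \<le> m" if "i < Suc n" for i
      unfolding m_def using that by (intro member_le_sum) auto
    ultimately have "finite {\<delta>. (\<forall>i<Suc n. \<delta> i \<le> \<alpha> i) \<and> (\<forall>i\<ge>Suc n. \<delta> i = 0)}"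
      by (elim finite_subset[rotated]) (auto simp: not_less intro: order_trans)
    then show ?thesis
      by (subst sum.Sigma[symmetric]) (auto intro: finite_hstrip_below[OF part_mu])
  qed
  finally show ?case by (simp only: U_def m_def)
qed


section \<open>Counting semistandard tableaux\<close>

definition ssyt_content :: "nat \<Rightarrow> (nat \<Rightarrow> nat) \<Rightarrow> nat list \<Rightarrow> (nat \<times> nat \<Rightarrow> nat) set" where
  "ssyt_content n \<alpha> \<theta> = {T \<in> ssyt \<theta>. (\<forall>x\<in>cells \<theta>. T x < n) \<and>
     (\<forall>v<n. card {x \<in> cells \<theta>. T x = v} = \<alpha> v)}"

lemma finite_ssyt_content: "finite (ssyt_content n \<alpha> \<theta>)"
proof (rule finite_subset)
  show "ssyt_content n \<alpha> \<theta> \<subseteq> PiE (cells \<theta>) (\<lambda>_. {..<n})"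
    by (simp add: subset_iff PiE_iff ssyt_content_def ssyt_def)
  show "finite (PiE (cells \<theta>) (\<lambda>_. {..<n}))"
    by (rule finite_PiE) simp_all
qed

lemma cells_Nil_iff: "is_partition \<theta> \<Longrightarrow> cells \<theta> = {} \<longleftrightarrow> \<theta> = []"
  using card_cells[of \<theta>] sum_list_eq_0_partition[of \<theta>] by (metis card_eq_0_iff finite_cells)

lemma ssyt_row_mono:
  assumes "T \<in> ssyt \<theta>" "(i, j') \<in> cells \<theta>" "1 \<le> j" "j \<le> j'"
  shows "T (i, j) \<le> T (i, j')"
  using assms(4,2)
proof (induction rule: dec_induct)
  case (step k)
  from step.prems step.hyps assms(3) have "(i, k) \<in> cells \<theta>" by (auto simp: cells_def)
  with step assms(1) show ?case by (fastforce simp: ssyt_def)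
qed simp

text \<open>The cells with entries less than \<open>n\<close> form the diagram of a partition, and the remaining
  cells a horizontal strip, because columns increase strictly.\<close>

lemma ssyt_inner_shape:
  assumes part: "is_partition \<theta>" and T: "T \<in> ssyt \<theta>" and bound: "\<forall>x\<in>cells \<theta>. T x < Suc n"
  obtains \<mu> where "is_partition \<mu>" "hstrip \<mu> \<theta>" "cells \<mu> = {x \<in> cells \<theta>. T x < n}"
proof -
  define f where "f i = card {j \<in> {1..part \<theta> i}. T (i, j) < n}" for i
  have f_le: "f i \<le> part \<theta> i" for i
  proof -
    have "f i \<le> card {1..part \<theta> i}" unfolding f_def by (intro card_mono) auto
    then show ?thesis by simp
  qed
  have row: "{j \<in> {1..part \<theta> i}. T (i, j) < n} = {1..f i}" if i: "1 \<le> i" for i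
  proof -
    let ?J = "{j \<in> {1..part \<theta> i}. T (i, j) < n}"
    have down: "j \<in> ?J" if "j' \<in> ?J" "1 \<le> j" "j \<le> j'" for j j'
    proof -
      have "T (i, j) \<le> T (i, j')"
        using that i by (intro ssyt_row_mono[OF T]) (auto simp: cells_def)
      then show ?thesis using that by auto
    qed
    have "?J = {1..Max (insert 0 ?J)}"
    proof (intro equalityI subsetI)
      fix j assume "j \<in> ?J"
      then show "j \<in> {1..Max (insert 0 ?J)}" by (auto intro: Max_ge)
    next
      fix j assume j: "j \<in> {1..Max (insert 0 ?J)}"
      have "Max (insert 0 ?J) \<in> insert 0 ?J" by (rule Max_in) auto
      moreover have "Max (insert 0 ?J) \<noteq> 0" using j by simp
      ultimately have "Max (insert 0 ?J) \<in> ?J" by blast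
      then show "j \<in> ?J" by (rule down) (use j in auto)
    qed
    then obtain k where k: "?J = {1..k}" by blast
    then have "f i = k" by (simp add: f_def)
    with k show ?thesis by simp
  qed
  have strip: "part \<theta> (Suc i) \<le> f i" if i: "1 \<le> i" for i
  proof -
    have "j \<in> {1..f i}" if j: "j \<in> {1..part \<theta> (Suc i)}" for j
    proof -
      have "(Suc i, j) \<in> cells \<theta>" "(i, j) \<in> cells \<theta>"
        using i j part_antimono[OF part i, of "Suc i"] by (auto simp: cells_def)
      then have "T (i, j) < T (Suc i, j)" "T (Suc i, j) < Suc n"
        using T bound by (auto simp: ssyt_def)
      then have "T (i, j) < n" by simp
      then have "j \<in> {j \<in> {1..part \<theta> i}. T (i, j) < n}"
        using \<open>(i, j) \<in> cells \<theta>\<close> by (auto simp: cells_def)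
      then show ?thesis using row[OF i] by blast
    qed
    then have "{1..part \<theta> (Suc i)} \<subseteq> {1..f i}" by blast
    then show ?thesis by (cases "part \<theta> (Suc i)") auto
  qed
  have "\<exists>\<mu>. is_partition \<mu> \<and> (\<forall>i\<ge>1. part \<mu> i = f i)"
  proof (rule partition_of_parts)
    show "f (Suc i) \<le> f i" if "1 \<le> i" for i
      using f_le[of "Suc i"] strip[OF that] by linarith
    show "f (Suc (length \<theta>)) = 0"
      using f_le[of "Suc (length \<theta>)"] by (simp add: part_beyond_length)
  qed
  then obtain \<mu> where \<mu>: "is_partition \<mu>" "\<And>i. 1 \<le> i \<Longrightarrow> part \<mu> i = f i" by blast
  show ?thesis
  proof (rule that[OF \<mu>(1)])
    show "hstrip \<mu> \<theta>" using \<mu>(2) f_le strip by (simp add: hstrip_def)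
    show "cells \<mu> = {x \<in> cells \<theta>. T x < n}"
    proof (rule Set.set_eqI)
      fix x :: "nat \<times> nat"
      obtain i j where x: "x = (i, j)" by force
      show "x \<in> cells \<mu> \<longleftrightarrow> x \<in> {x \<in> cells \<theta>. T x < n}"
      proof (cases "1 \<le> i")
        case True
        have "x \<in> cells \<mu> \<longleftrightarrow> j \<in> {1..f i}" using True \<mu>(2)[OF True] by (simp add: x cells_def)
        also have "\<dots> \<longleftrightarrow> x \<in> {x \<in> cells \<theta>. T x < n}"
          unfolding row[OF True, symmetric] using True by (auto simp: x cells_def)
        finally show ?thesis .
      qed (simp add: x cells_def)
    qed
  qed
qed

lemma cells_hstrip_subset: "hstrip \<mu> \<theta> \<Longrightarrow> cells \<mu> \<subseteq> cells \<theta>"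
  by (auto simp: hstrip_def cells_def intro: order_trans)

lemma ssyt_extend:
  assumes hs: "hstrip \<mu> \<theta>" and part: "is_partition \<mu>" and T: "T \<in> ssyt \<mu>" and bound: "\<forall>x\<in>cells \<mu>. T x < n"
  shows "(\<lambda>x. if x \<in> cells \<mu> then T x else if x \<in> cells \<theta> then n else undefined) \<in> ssyt \<theta>"
    (is "?T \<in> _")
proof -
  have sub: "cells \<mu> \<subseteq> cells \<theta>" by (rule cells_hstrip_subset[OF hs])
  have le: "?T x \<le> n" if "x \<in> cells \<theta>" for x
    using that bound by (auto intro: less_imp_le)
  have "?T (i, j) \<le> ?T (i, Suc j)" if "(i, j) \<in> cells \<theta>" "(i, Suc j) \<in> cells \<theta>" for i j
  proof (cases "(i, Suc j) \<in> cells \<mu>")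
    case True
    then have "(i, j) \<in> cells \<mu>" using that by (auto simp: cells_def)
    with True show ?thesis using T by (auto simp: ssyt_def)
  next
    case False
    then show ?thesis using le[OF that(1)] that by simp
  qed
  moreover have "?T (i, j) < ?T (Suc i, j)" if "(i, j) \<in> cells \<theta>" "(Suc i, j) \<in> cells \<theta>" for i j
  proof -
    have inner: "(i, j) \<in> cells \<mu>"
    proof -
      have "1 \<le> i" "1 \<le> j" "j \<le> part \<theta> (Suc i)" using that by (auto simp: cells_def)
      moreover have "part \<theta> (Suc i) \<le> part \<mu> i" using hs \<open>1 \<le> i\<close> by (simp add: hstrip_def)
      ultimately show ?thesis by (auto simp: cells_def)
    qed
    show ?thesis
    proof (cases "(Suc i, j) \<in> cells \<mu>")
      case True
      with inner show ?thesis using T by (auto simp: ssyt_def)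
    next
      case False
      with inner show ?thesis using bound that by auto
    qed
  qed
  ultimately show ?thesis
    using sub unfolding ssyt_def extensional_def by auto
qed

text \<open>Deleting the cells with the largest entry is a bijection onto the tableaux counted by the
  recursion for the Kostka numbers.\<close>

lemma card_ssyt_content: "is_partition \<theta> \<Longrightarrow> card (ssyt_content n \<alpha> \<theta>) = kostka n \<alpha> \<theta>"
proof (induction n arbitrary: \<theta>)
  case 0
  have "ssyt_content 0 \<alpha> \<theta> = (if \<theta> = [] then {\<lambda>_. undefined} else {})"
  proof -
    have "cells \<theta> = {} \<longleftrightarrow> \<theta> = []" by (rule cells_Nil_iff[OF 0])
    then show ?thesis by (auto simp: ssyt_content_def ssyt_def extensional_def fun_eq_iff)
  qed
  then show ?case by simp
next
  case (Suc n)
  note part = Suc.prems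
  define M where "M = {\<mu>. is_partition \<mu> \<and> hstrip \<mu> \<theta> \<and> sum_list \<mu> + \<alpha> n = sum_list \<theta>}"
  define ext where "ext \<mu> T = (\<lambda>x. if x \<in> cells \<mu> then T x else if x \<in> cells \<theta> then n else undefined)"
    for \<mu> and T :: "nat \<times> nat \<Rightarrow> nat"
  have finM: "finite M" unfolding M_def by (rule finite_hstrip_below[OF part])
  have count: "card (cells \<theta> - cells \<mu>) = \<alpha> n \<longleftrightarrow> sum_list \<mu> + \<alpha> n = sum_list \<theta>" if "hstrip \<mu> \<theta>" for \<mu>
  proof -
    have "card (cells \<theta> - cells \<mu>) + sum_list \<mu> = sum_list \<theta>"
      using cells_hstrip_subset[OF that] card_mono[of "cells \<theta>" "cells \<mu>"]
      by (simp add: card_Diff_subset card_cells)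
    then show ?thesis by linarith
  qed
  have restr: "restrict (ext \<mu> T) (cells \<mu>) = T" if "T \<in> ssyt \<mu>" for \<mu> T
    using that by (auto simp: ext_def ssyt_def extensional_def fun_eq_iff)
  have low: "{x \<in> cells \<theta>. ext \<mu> T x < n} = cells \<mu>"
    if "hstrip \<mu> \<theta>" "\<forall>x\<in>cells \<mu>. T x < n" for \<mu> T
    using that cells_hstrip_subset[OF that(1)] by (auto simp: ext_def)
  have "bij_betw (\<lambda>(\<mu>, T). ext \<mu> T) (SIGMA \<mu>:M. ssyt_content n \<alpha> \<mu>) (ssyt_content (Suc n) \<alpha> \<theta>)"
  proof (rule bij_betwI')
    fix p p' assume p: "p \<in> (SIGMA \<mu>:M. ssyt_content n \<alpha> \<mu>)" "p' \<in> (SIGMA \<mu>:M. ssyt_content n \<alpha> \<mu>)"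
    obtain \<mu> T \<mu>' T' where pp: "p = (\<mu>, T)" "p' = (\<mu>', T')" by force
    have P: "is_partition \<mu>" "hstrip \<mu> \<theta>" "T \<in> ssyt \<mu>" "\<forall>x\<in>cells \<mu>. T x < n"
      "is_partition \<mu>'" "hstrip \<mu>' \<theta>" "T' \<in> ssyt \<mu>'" "\<forall>x\<in>cells \<mu>'. T' x < n"
      using p by (auto simp: pp M_def ssyt_content_def)
    show "(case p of (\<mu>, T) \<Rightarrow> ext \<mu> T) = (case p' of (\<mu>, T) \<Rightarrow> ext \<mu> T) \<longleftrightarrow> p = p'"
    proof
      assume "(case p of (\<mu>, T) \<Rightarrow> ext \<mu> T) = (case p' of (\<mu>, T) \<Rightarrow> ext \<mu> T)"
      then have eq: "ext \<mu> T = ext \<mu>' T'" by (simp add: pp)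
      then have "cells \<mu> = cells \<mu>'" using low[OF P(2,4)] low[OF P(6,8)] by simp
      then have "\<mu> = \<mu>'" by (rule partition_eq_cellsI[OF P(1,5)])
      moreover have "T = T'" using restr[OF P(3)] restr[OF P(7)] eq \<open>\<mu> = \<mu>'\<close> by metis
      ultimately show "p = p'" by (simp add: pp)
    qed simp
  next
    fix p assume p: "p \<in> (SIGMA \<mu>:M. ssyt_content n \<alpha> \<mu>)"
    obtain \<mu> T where pp: "p = (\<mu>, T)" by force
    have P: "is_partition \<mu>" "hstrip \<mu> \<theta>" "sum_list \<mu> + \<alpha> n = sum_list \<theta>" "T \<in> ssyt \<mu>"
      "\<forall>x\<in>cells \<mu>. T x < n" "\<forall>v<n. card {x \<in> cells \<mu>. T x = v} = \<alpha> v"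
      using p by (auto simp: pp M_def ssyt_content_def)
    have sub: "cells \<mu> \<subseteq> cells \<theta>" by (rule cells_hstrip_subset[OF P(2)])
    have "ext \<mu> T \<in> ssyt \<theta>" unfolding ext_def by (rule ssyt_extend[OF P(2,1,4,5)])
    moreover have "\<forall>x\<in>cells \<theta>. ext \<mu> T x < Suc n"
      using P(5) by (auto simp: ext_def intro: less_SucI)
    moreover have "card {x \<in> cells \<theta>. ext \<mu> T x = v} = \<alpha> v" if "v < Suc n" for v
    proof (cases "v = n")
      case True
      have "{x \<in> cells \<theta>. ext \<mu> T x = n} = cells \<theta> - cells \<mu>"
        using P(5) by (auto simp: ext_def)
      then show ?thesis using count[OF P(2)] P(3) True by simp
    next
      case False
      then have "{x \<in> cells \<theta>. ext \<mu> T x = v} = {x \<in> cells \<mu>. T x = v}"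
        using sub that by (auto simp: ext_def)
      then show ?thesis using P(6) that False by simp
    qed
    ultimately show "(case p of (\<mu>, T) \<Rightarrow> ext \<mu> T) \<in> ssyt_content (Suc n) \<alpha> \<theta>"
      by (simp add: pp ssyt_content_def)
  next
    fix T assume "T \<in> ssyt_content (Suc n) \<alpha> \<theta>"
    then have T: "T \<in> ssyt \<theta>" "\<forall>x\<in>cells \<theta>. T x < Suc n"
      "\<And>v. v < Suc n \<Longrightarrow> card {x \<in> cells \<theta>. T x = v} = \<alpha> v"
      by (auto simp: ssyt_content_def)
    obtain \<mu> where \<mu>: "is_partition \<mu>" "hstrip \<mu> \<theta>" "cells \<mu> = {x \<in> cells \<theta>. T x < n}"
      by (rule ssyt_inner_shape[OF part T(1,2)])
    have "cells \<theta> - cells \<mu> = {x \<in> cells \<theta>. T x = n}"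
      using T(2) \<mu>(3) by (auto simp: less_Suc_eq)
    then have "\<mu> \<in> M" using count[OF \<mu>(2)] T(3)[of n] \<mu> by (simp add: M_def)
    moreover have "restrict T (cells \<mu>) \<in> ssyt_content n \<alpha> \<mu>"
    proof -
      have "restrict T (cells \<mu>) \<in> ssyt \<mu>"
        using T(1) cells_hstrip_subset[OF \<mu>(2)] by (fastforce simp: ssyt_def)
      moreover have "{x \<in> cells \<mu>. restrict T (cells \<mu>) x = v} = {x \<in> cells \<theta>. T x = v}" if "v < n" for v
        using that \<mu>(3) by auto
      ultimately show ?thesis using T(3) \<mu>(3) by (simp add: ssyt_content_def)
    qed
    moreover have "T = ext \<mu> (restrict T (cells \<mu>))"
    proof
      fix x
      show "T x = ext \<mu> (restrict T (cells \<mu>)) x"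
        using T(1,2) \<mu>(3) by (cases x) (auto simp: ext_def ssyt_def extensional_def less_Suc_eq)
    qed
    ultimately show "\<exists>p\<in>(SIGMA \<mu>:M. ssyt_content n \<alpha> \<mu>). T = (case p of (\<mu>, T) \<Rightarrow> ext \<mu> T)"
      by (intro bexI[of _ "(\<mu>, restrict T (cells \<mu>))"]) auto
  qed
  then have "card (ssyt_content (Suc n) \<alpha> \<theta>) = card (SIGMA \<mu>:M. ssyt_content n \<alpha> \<mu>)"
    by (metis bij_betw_same_card)
  also have "\<dots> = (\<Sum>\<mu>\<in>M. card (ssyt_content n \<alpha> \<mu>))"
    using finM finite_ssyt_content by (intro card_SigmaI) auto
  also have "\<dots> = (\<Sum>\<mu>\<in>M. kostka n \<alpha> \<mu>)"
    using Suc.IH by (intro sum.cong) (auto simp: M_def)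
  finally show ?case by (simp add: M_def)
qed

section \<open>Schur functions as power series\<close>

lemma mfps_nth_sum [simp]: "mfps_nth (sum f A) \<alpha> = (\<Sum>x\<in>A. mfps_nth (f x) \<alpha>)"
  by (induction A rule: infinite_finite_induct) auto

lemma mfps_nth_const_mult [simp]:
  fixes F :: "'a :: comm_ring_1 mfps"
  shows "mfps_nth (mfps_const c * F) \<alpha> = c * mfps_nth F \<alpha>"
proof -
  have "mfps_nth (mfps_const c * F) \<alpha> =
      (\<Sum>(\<gamma>, \<delta>)\<in>splits \<alpha>. (if \<gamma> = 0 then c else 0) * mfps_nth F \<delta>)"
    by (simp add: mfps_nth_mult mfps_const_def)
  also have "\<dots> = (\<Sum>(\<gamma>, \<delta>)\<in>{(0 :: nat \<Rightarrow>\<^sub>0 nat, \<alpha>)}. (if \<gamma> = 0 then c else 0) * mfps_nth F \<delta>)"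
    by (rule sum.mono_neutral_right, simp) (auto simp: splits_def split: if_splits)
  finally show ?thesis by simp
qed

lemma mfps_nth_const: "mfps_nth (mfps_const c) \<alpha> = (if \<alpha> = 0 then c else 0)"
  by (simp add: mfps_const_def)

lemma mfps_const_0 [simp]: "mfps_const 0 = 0"
  by (rule mfps_eqI) (simp add: mfps_nth_const)

lemma mfps_const_1 [simp]: "mfps_const 1 = 1"
  by (rule mfps_eqI) (simp add: mfps_nth_const mfps_nth_1)

lemma mfps_const_add: "mfps_const (a + b) = mfps_const a + mfps_const (b :: 'a :: comm_ring_1)"
  by (rule mfps_eqI) (simp add: mfps_nth_const)

lemma mfps_const_diff: "mfps_const (a - b) = mfps_const a - mfps_const (b :: 'a :: comm_ring_1)"
  by (rule mfps_eqI) (simp add: mfps_nth_const)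

lemma mfps_const_mult: "mfps_const (a * b) = mfps_const a * mfps_const (b :: 'a :: comm_ring_1)"
  by (rule mfps_eqI) (simp add: mfps_nth_const)

lemma mfps_const_sum: "mfps_const (sum f A) = (\<Sum>x\<in>A. mfps_const (f x :: 'a :: comm_ring_1))"
  by (induction A rule: infinite_finite_induct) (auto simp: mfps_const_add)

lemma mfps_const_of_nat: "mfps_const (of_nat n :: 'a :: comm_ring_1) = of_nat n"
  by (induction n) (auto simp: mfps_const_add)

lemma exists_keys_bound: "\<exists>n. Poly_Mapping.keys (\<alpha> :: nat \<Rightarrow>\<^sub>0 nat) \<subseteq> {..<n}"
  by (metis finite_keys finite_nat_iff_bounded)

lemma mdeg_eq_sum:
  assumes "Poly_Mapping.keys \<alpha> \<subseteq> {..<n}"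
  shows "mdeg \<alpha> = (\<Sum>i<n. Poly_Mapping.lookup \<alpha> i)"
  unfolding mdeg_def using assms
  by (intro sum.mono_neutral_left) (auto simp: in_keys_iff)

lemma keys_subset_iff_beyond:
  "Poly_Mapping.keys (\<alpha> :: nat \<Rightarrow>\<^sub>0 nat) \<subseteq> {..<n} \<longleftrightarrow> (\<forall>i\<ge>n. Poly_Mapping.lookup \<alpha> i = 0)"
  by (auto simp: in_keys_iff not_less[symmetric] subset_iff)

lemma mfps_nth_schur:
  assumes "is_partition \<theta>" "Poly_Mapping.keys \<alpha> \<subseteq> {..<n}"
  shows "mfps_nth (schur \<theta>) \<alpha> = of_nat (kostka n (Poly_Mapping.lookup \<alpha>) \<theta>)"
proof -
  have beyond: "Poly_Mapping.lookup \<alpha> v = 0" if "n \<le> v" for v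
    using assms(2) that by (simp add: keys_subset_iff_beyond)
  have "{T \<in> ssyt \<theta>. \<forall>v. card {x \<in> cells \<theta>. T x = v} = Poly_Mapping.lookup \<alpha> v} =
      ssyt_content n (Poly_Mapping.lookup \<alpha>) \<theta>"
  proof (intro equalityI subsetI)
    fix T assume "T \<in> {T \<in> ssyt \<theta>. \<forall>v. card {x \<in> cells \<theta>. T x = v} = Poly_Mapping.lookup \<alpha> v}"
    then have T: "T \<in> ssyt \<theta>" "\<And>v. card {x \<in> cells \<theta>. T x = v} = Poly_Mapping.lookup \<alpha> v" by auto
    have "T x < n" if "x \<in> cells \<theta>" for x
    proof (rule ccontr)
      assume "\<not> T x < n"
      then have "card {y \<in> cells \<theta>. T y = T x} = 0" using T(2) beyond by simp
      then have "{y \<in> cells \<theta>. T y = T x} = {}" by (simp only: card_eq_0_iff) simp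
      then show False using that by blast
    qed
    then show "T \<in> ssyt_content n (Poly_Mapping.lookup \<alpha>) \<theta>"
      using T by (simp add: ssyt_content_def)
  next
    fix T assume T: "T \<in> ssyt_content n (Poly_Mapping.lookup \<alpha>) \<theta>"
    have "card {x \<in> cells \<theta>. T x = v} = Poly_Mapping.lookup \<alpha> v" for v
    proof (cases "v < n")
      case False
      then have "{x \<in> cells \<theta>. T x = v} = {}" using T by (auto simp: ssyt_content_def)
      then show ?thesis using beyond False by (metis card.empty not_less)
    qed (use T in \<open>simp add: ssyt_content_def\<close>)
    then show "T \<in> {T \<in> ssyt \<theta>. \<forall>v. card {x \<in> cells \<theta>. T x = v} = Poly_Mapping.lookup \<alpha> v}"
      using T by (simp add: ssyt_content_def)
  qed
  then show ?thesis
    by (simp add: schur_def card_ssyt_content[OF assms(1)])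
qed

lemma mfps_nth_schur_eq_0:
  assumes "is_partition \<theta>" "mdeg \<alpha> \<noteq> sum_list \<theta>"
  shows "mfps_nth (schur \<theta>) \<alpha> = 0"
proof -
  obtain n where n: "Poly_Mapping.keys \<alpha> \<subseteq> {..<n}" using exists_keys_bound by blast
  then have "kostka n (Poly_Mapping.lookup \<alpha>) \<theta> = 0"
    using kostka_nonzero_size assms(2) mdeg_eq_sum by metis
  then show ?thesis using mfps_nth_schur[OF assms(1) n] by simp
qed

text \<open>Splittings of a multi-index, rephrased as a box of functions so that they match the index set
  of the Pieri rule.\<close>

lemma sum_splits_box:
  assumes "Poly_Mapping.keys \<alpha> \<subseteq> {..<n}"
  shows "(\<Sum>(\<gamma>, \<delta>)\<in>splits \<alpha>. f (Poly_Mapping.lookup \<gamma>) (Poly_Mapping.lookup \<delta>)) =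
    (\<Sum>\<delta> | (\<forall>i<n. \<delta> i \<le> Poly_Mapping.lookup \<alpha> i) \<and> (\<forall>i\<ge>n. \<delta> i = 0).
       f (\<lambda>i. Poly_Mapping.lookup \<alpha> i - \<delta> i) \<delta>)"
proof (rule sum.reindex_bij_witness[of _
      "\<lambda>\<delta>. (Abs_poly_mapping (\<lambda>i. Poly_Mapping.lookup \<alpha> i - \<delta> i), Abs_poly_mapping \<delta>)"
      "\<lambda>(\<gamma>, \<delta>). Poly_Mapping.lookup \<delta>"])
  have beyond: "Poly_Mapping.lookup \<alpha> i = 0" if "n \<le> i" for i
    using assms that by (simp add: keys_subset_iff_beyond)
  fix p assume "p \<in> splits \<alpha>"
  then obtain \<gamma> \<delta> where p: "p = (\<gamma>, \<delta>)" and \<alpha>: "\<alpha> = \<gamma> + \<delta>" by (auto simp: splits_def)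
  have diff: "(\<lambda>i. Poly_Mapping.lookup \<alpha> i - Poly_Mapping.lookup \<delta> i) = Poly_Mapping.lookup \<gamma>"
    by (rule ext) (simp add: \<alpha> lookup_add)
  show "(Abs_poly_mapping (\<lambda>i. Poly_Mapping.lookup \<alpha> i - (case p of (\<gamma>, \<delta>) \<Rightarrow> Poly_Mapping.lookup \<delta>) i),
      Abs_poly_mapping (case p of (\<gamma>, \<delta>) \<Rightarrow> Poly_Mapping.lookup \<delta>)) = p"
    by (simp add: p diff lookup_inverse)
  show "(case p of (\<gamma>, \<delta>) \<Rightarrow> Poly_Mapping.lookup \<delta>) \<in>
      {\<delta>. (\<forall>i<n. \<delta> i \<le> Poly_Mapping.lookup \<alpha> i) \<and> (\<forall>i\<ge>n. \<delta> i = 0)}"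
    using beyond by (auto simp: p \<alpha> lookup_add)
  show "f (\<lambda>i. Poly_Mapping.lookup \<alpha> i - (case p of (\<gamma>, \<delta>) \<Rightarrow> Poly_Mapping.lookup \<delta>) i)
      (case p of (\<gamma>, \<delta>) \<Rightarrow> Poly_Mapping.lookup \<delta>) =
      (case p of (\<gamma>, \<delta>) \<Rightarrow> f (Poly_Mapping.lookup \<gamma>) (Poly_Mapping.lookup \<delta>))"
    by (simp add: p diff)
next
  have beyond: "Poly_Mapping.lookup \<alpha> i = 0" if "n \<le> i" for i
    using assms that by (simp add: keys_subset_iff_beyond)
  fix \<delta> assume "\<delta> \<in> {\<delta>. (\<forall>i<n. \<delta> i \<le> Poly_Mapping.lookup \<alpha> i) \<and> (\<forall>i\<ge>n. \<delta> i = 0)}"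
  then have \<delta>: "\<And>i. i < n \<Longrightarrow> \<delta> i \<le> Poly_Mapping.lookup \<alpha> i" "\<And>i. n \<le> i \<Longrightarrow> \<delta> i = 0" by auto
  have fin: "finite {i. \<delta> i \<noteq> 0}" "finite {i. Poly_Mapping.lookup \<alpha> i - \<delta> i \<noteq> 0}"
    by (rule finite_subset[of _ "{..<n}"]; use \<delta>(2) beyond in \<open>force simp: not_less[symmetric]\<close>)+
  show "(case (Abs_poly_mapping (\<lambda>i. Poly_Mapping.lookup \<alpha> i - \<delta> i), Abs_poly_mapping \<delta>) of
      (\<gamma>, \<delta>) \<Rightarrow> Poly_Mapping.lookup \<delta>) = \<delta>"
    using fin by simp
  have "Poly_Mapping.lookup \<alpha> i - \<delta> i + \<delta> i = Poly_Mapping.lookup \<alpha> i" for i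
    using \<delta> by (cases "i < n") auto
  then show "(Abs_poly_mapping (\<lambda>i. Poly_Mapping.lookup \<alpha> i - \<delta> i), Abs_poly_mapping \<delta>) \<in> splits \<alpha>"
    using fin by (auto simp: splits_def lookup_add intro!: poly_mapping_eqI)
qed

text \<open>The complete homogeneous symmetric function.\<close>

definition hsym :: "nat \<Rightarrow> 'a :: comm_ring_1 mfps" where
  "hsym n = Abs_mfps (\<lambda>\<alpha>. if mdeg \<alpha> = n then 1 else 0)"

lemma mfps_nth_hsym: "mfps_nth (hsym n) \<alpha> = (if mdeg \<alpha> = n then 1 else 0)"
  by (simp add: hsym_def)

theorem pieri:
  assumes "is_partition \<mu>"
  shows "hsym k * schur \<mu> =
    (\<Sum>\<theta> | is_partition \<theta> \<and> hstrip \<mu> \<theta> \<and> sum_list \<theta> = sum_list \<mu> + k.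
       schur \<theta> :: 'a :: comm_ring_1 mfps)"
proof (rule mfps_eqI)
  fix \<alpha> :: "nat \<Rightarrow>\<^sub>0 nat"
  obtain n where n: "Poly_Mapping.keys \<alpha> \<subseteq> {..<n}" using exists_keys_bound by blast
  let ?U = "{\<theta>. is_partition \<theta> \<and> hstrip \<mu> \<theta> \<and> sum_list \<theta> = sum_list \<mu> + k}"
  have "mfps_nth (hsym k * schur \<mu> :: 'a mfps) \<alpha> =
      (\<Sum>(\<gamma>, \<delta>)\<in>splits \<alpha>. if mdeg \<alpha> = sum_list \<mu> + k then mfps_nth (schur \<mu>) \<delta> else 0)"
    unfolding mfps_nth_mult
  proof (rule sum.cong[OF refl], clarify)
    fix \<gamma> \<delta> assume "(\<gamma>, \<delta>) \<in> splits \<alpha>"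
    then have "mdeg \<alpha> = mdeg \<gamma> + mdeg \<delta>" by (auto simp: splits_def mdeg_add)
    then show "mfps_nth (hsym k) \<gamma> * mfps_nth (schur \<mu>) \<delta> =
        (if mdeg \<alpha> = sum_list \<mu> + k then mfps_nth (schur \<mu>) \<delta> else (0 :: 'a))"
      using mfps_nth_schur_eq_0[OF assms, of \<delta>, where ?'a = 'a]
      by (cases "mdeg \<delta> = sum_list \<mu>") (auto simp: mfps_nth_hsym)
  qed
  also have "\<dots> = (\<Sum>\<theta>\<in>?U. mfps_nth (schur \<theta>) \<alpha>)"
  proof (cases "mdeg \<alpha> = sum_list \<mu> + k")
    case True
    have "(\<Sum>(\<gamma>, \<delta>)\<in>splits \<alpha>. mfps_nth (schur \<mu>) \<delta>) =
        (\<Sum>(\<gamma>, \<delta>)\<in>splits \<alpha>. of_nat (kostka n (Poly_Mapping.lookup \<delta>) \<mu>) :: 'a)"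
    proof (rule sum.cong[OF refl], clarify)
      fix \<gamma> \<delta> assume "(\<gamma>, \<delta>) \<in> splits \<alpha>"
      then have "Poly_Mapping.keys \<delta> \<subseteq> {..<n}"
        using n by (auto simp: splits_def keys_subset_iff_beyond lookup_add)
      then show "mfps_nth (schur \<mu>) \<delta> = (of_nat (kostka n (Poly_Mapping.lookup \<delta>) \<mu>) :: 'a)"
        by (rule mfps_nth_schur[OF assms])
    qed
    also have "\<dots> = of_nat (\<Sum>\<delta> | (\<forall>i<n. \<delta> i \<le> Poly_Mapping.lookup \<alpha> i) \<and> (\<forall>i\<ge>n. \<delta> i = 0). kostka n \<delta> \<mu>)"
      using sum_splits_box[OF n, of "\<lambda>_ \<delta>. of_nat (kostka n \<delta> \<mu>)"] by simp
    also have "\<dots> = of_nat (\<Sum>\<theta>\<in>?U. kostka n (Poly_Mapping.lookup \<alpha>) \<theta>)"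
      using kostka_pieri[OF assms, of n "Poly_Mapping.lookup \<alpha>"] True mdeg_eq_sum[OF n] by simp
    also have "\<dots> = (\<Sum>\<theta>\<in>?U. mfps_nth (schur \<theta>) \<alpha>)"
      by (simp add: mfps_nth_schur[OF _ n])
    finally show ?thesis using True by simp
  qed (simp add: mfps_nth_schur_eq_0)
  finally show "mfps_nth (hsym k * schur \<mu>) \<alpha> = mfps_nth (\<Sum>\<theta>\<in>?U. schur \<theta> :: 'a mfps) \<alpha>"
    by simp
qed

lemma schur_Nil [simp]: "schur [] = 1"
proof (rule mfps_eqI)
  fix \<alpha> :: "nat \<Rightarrow>\<^sub>0 nat"
  have "kostka 0 (Poly_Mapping.lookup 0) [] = 1" by simp
  then show "mfps_nth (schur []) \<alpha> = mfps_nth 1 \<alpha>"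
    using mfps_nth_schur_eq_0[of "[]" \<alpha>] mfps_nth_schur[of "[]" 0 0]
    by (cases "\<alpha> = 0") (auto simp: mfps_nth_1)
qed


section \<open>Linear independence and structure constants\<close>

definition part_content :: "nat list \<Rightarrow> nat \<Rightarrow>\<^sub>0 nat" where
  "part_content \<nu> = Abs_poly_mapping (\<lambda>i. part \<nu> (Suc i))"

lemma lookup_part_content [simp]: "Poly_Mapping.lookup (part_content \<nu>) i = part \<nu> (Suc i)"
proof -
  have "finite {i. part \<nu> (Suc i) \<noteq> 0}"
    by (rule finite_subset[of _ "{..<length \<nu>}"]) (auto simp: part_def)
  then show ?thesis by (simp add: part_content_def)
qed

lemma keys_part_content: "Poly_Mapping.keys (part_content \<nu>) \<subseteq> {..<length \<nu>}"
  by (simp add: keys_subset_iff_beyond part_beyond_length)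

text \<open>Unitriangularity of the Kostka matrix: rows are indexed by \<open>\<theta>\<close>, columns by the exponents of the
  dominant monomials, ordered by the row weight.\<close>

lemma kostka_part_content:
  assumes "is_partition \<nu>" "is_partition \<theta>"
    and "kostka (length \<nu>) (\<lambda>i. part \<nu> (Suc i)) \<theta> \<noteq> 0"
  shows "\<theta> = \<nu> \<or> row_weight \<theta> < row_weight \<nu>"
proof (rule disjCI)
  assume "\<not> row_weight \<theta> < row_weight \<nu>"
  then have eq: "\<forall>i<length \<nu>. part \<theta> (Suc i) = part \<nu> (Suc i)"
    using kostka_triangular[OF assms(3,2)] by (simp add: row_weight_def)
  have len: "length \<theta> \<le> length \<nu>" by (rule kostka_nonzero_length[OF assms(3,2)])
  show "\<theta> = \<nu>"
  proof (rule partition_eqI[OF assms(2,1)])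
    fix i :: nat assume "1 \<le> i"
    then show "part \<theta> i = part \<nu> i"
      using eq[rule_format, of "i - 1"] len part_beyond_length[of _ i]
      by (cases "i \<le> length \<nu>") auto
  qed
qed

text \<open>The coefficients at dominant monomials form a unitriangular system, which is invertible over
  every commutative ring.\<close>

lemma schur_linear_independent:
  assumes "finite S" "S \<subseteq> Collect is_partition"
    and zero: "(\<Sum>\<nu>\<in>S. mfps_const (a \<nu>) * schur \<nu>) = (0 :: 'a :: comm_ring_1 mfps)"
    and "\<nu> \<in> S"
  shows "a \<nu> = 0"
  using assms(4)
proof (induction "row_weight \<nu>" arbitrary: \<nu> rule: less_induct)
  case less
  let ?n = "length \<nu>"
  have part: "is_partition \<nu>" using less.prems assms(2) by auto
  have "a \<theta> * mfps_nth (schur \<theta>) (part_content \<nu>) = 0" if "\<theta> \<in> S - {\<nu>}" for \<theta>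
  proof -
    have "is_partition \<theta>" using that assms(2) by auto
    then have "mfps_nth (schur \<theta>) (part_content \<nu>) = (of_nat (kostka ?n (\<lambda>i. part \<nu> (Suc i)) \<theta>) :: 'a)"
      using mfps_nth_schur[OF _ keys_part_content] by (simp add: fun_eq_iff[symmetric] cong: kostka_cong)
    moreover have "a \<theta> = 0" if "kostka ?n (\<lambda>i. part \<nu> (Suc i)) \<theta> \<noteq> 0"
    proof -
      have "row_weight \<theta> < row_weight \<nu>"
        using kostka_part_content[OF part \<open>is_partition \<theta>\<close> that] \<open>\<theta> \<in> S - {\<nu>}\<close> by simp
      then show ?thesis using less.hyps \<open>\<theta> \<in> S - {\<nu>}\<close> by simp
    qed
    ultimately show ?thesis by (metis mult_zero_left mult_zero_right of_nat_0)
  qed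
  then have "(\<Sum>\<theta>\<in>S. a \<theta> * mfps_nth (schur \<theta>) (part_content \<nu>)) =
      a \<nu> * mfps_nth (schur \<nu>) (part_content \<nu>)"
    using assms(1) less.prems by (simp add: sum.remove[of S \<nu>])
  also have "mfps_nth (schur \<nu>) (part_content \<nu>) = (1 :: 'a)"
    using mfps_nth_schur[OF part keys_part_content, where ?'a = 'a]
      kostka_diagonal[of ?n \<nu> "\<lambda>i. part \<nu> (Suc i)"] part
    by (simp cong: kostka_cong)
  finally show ?case
    using arg_cong[OF zero, of "\<lambda>F. mfps_nth F (part_content \<nu>)"] by simp
qed

lemma schur_expansion_unique:
  assumes "(\<Sum>\<nu>\<in>partitions_of d. mfps_const (a \<nu>) * schur \<nu>) =
      (\<Sum>\<nu>\<in>partitions_of d. mfps_const (b \<nu>) * schur \<nu> :: 'a :: comm_ring_1 mfps)"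
    and "\<nu> \<in> partitions_of d"
  shows "a \<nu> = b \<nu>"
proof -
  have "partitions_of d \<subseteq> Collect is_partition"
    by (auto simp: partitions_of_def)
  moreover have "(\<Sum>\<nu>\<in>partitions_of d. mfps_const (a \<nu> - b \<nu>) * schur \<nu>) = 0"
    using assms(1) by (simp add: mfps_const_diff left_diff_distrib sum_subtractf)
  ultimately have "a \<nu> - b \<nu> = 0"
    using assms(2) schur_linear_independent[of "partitions_of d" "\<lambda>\<nu>. a \<nu> - b \<nu>" \<nu>] by simp
  then show ?thesis by simp
qed

definition schur_span :: "nat \<Rightarrow> 'a :: comm_ring_1 mfps set" where
  "schur_span d = range (\<lambda>c. \<Sum>\<nu>\<in>partitions_of d. mfps_const (c \<nu>) * schur \<nu>)"

lemma schur_spanI: "F = (\<Sum>\<nu>\<in>partitions_of d. mfps_const (c \<nu>) * schur \<nu>) \<Longrightarrow> F \<in> schur_span d"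
  by (auto simp: schur_span_def)

lemma schur_span_add: "F \<in> schur_span d \<Longrightarrow> G \<in> schur_span d \<Longrightarrow> F + G \<in> schur_span d"
proof -
  assume "F \<in> schur_span d" "G \<in> schur_span d"
  then obtain a b where "F = (\<Sum>\<nu>\<in>partitions_of d. mfps_const (a \<nu>) * schur \<nu>)"
    "G = (\<Sum>\<nu>\<in>partitions_of d. mfps_const (b \<nu>) * schur \<nu>)"
    unfolding schur_span_def by blast
  then have "F + G = (\<Sum>\<nu>\<in>partitions_of d. mfps_const (a \<nu> + b \<nu>) * schur \<nu>)"
    by (simp add: mfps_const_add distrib_right sum.distrib)
  then show ?thesis by (rule schur_spanI)
qed

lemma schur_span_const_mult: "F \<in> schur_span d \<Longrightarrow> mfps_const c * F \<in> schur_span d"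
proof -
  assume "F \<in> schur_span d"
  then obtain a where "F = (\<Sum>\<nu>\<in>partitions_of d. mfps_const (a \<nu>) * schur \<nu>)"
    unfolding schur_span_def by blast
  then have "mfps_const c * F = (\<Sum>\<nu>\<in>partitions_of d. mfps_const (c * a \<nu>) * schur \<nu>)"
    by (simp add: mfps_const_mult sum_distrib_left mult.assoc)
  then show ?thesis by (rule schur_spanI)
qed

lemma schur_span_0: "0 \<in> schur_span d"
  by (rule schur_spanI[where c = "\<lambda>_. 0"]) simp

lemma schur_span_sum: "(\<And>x. x \<in> A \<Longrightarrow> f x \<in> schur_span d) \<Longrightarrow> sum f A \<in> schur_span d"
  by (induction A rule: infinite_finite_induct) (auto intro: schur_span_add schur_span_0)

lemma schur_in_span: "\<nu> \<in> partitions_of d \<Longrightarrow> schur \<nu> \<in> schur_span d"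
  by (rule schur_spanI[where c = "\<lambda>\<mu>. of_bool (\<mu> = \<nu>)"])
     (simp add: of_bool_def if_distrib[of mfps_const] if_distrib[of "\<lambda>c. c * _"] cong: if_cong)

lemma hsym_mult_span: "F \<in> schur_span d \<Longrightarrow> hsym k * F \<in> schur_span (d + k)"
proof -
  assume "F \<in> schur_span d"
  then obtain a where F: "F = (\<Sum>\<nu>\<in>partitions_of d. mfps_const (a \<nu>) * schur \<nu>)"
    unfolding schur_span_def by blast
  have "hsym k * F = (\<Sum>\<nu>\<in>partitions_of d. mfps_const (a \<nu>) * (hsym k * schur \<nu>))"
    by (simp add: F sum_distrib_left mult_ac)
  also have "\<dots> \<in> schur_span (d + k)"
    by (intro schur_span_sum schur_span_const_mult)
       (auto simp: pieri partitions_of_def intro!: schur_span_sum schur_in_span)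
  finally show ?thesis .
qed

text \<open>Iterating the Pieri rule reproduces the recursion that defines the Kostka numbers.\<close>

lemma prod_hsym_expansion:
  "(\<Prod>i<n. hsym (\<alpha> i)) =
    (\<Sum>\<nu>\<in>partitions_of (\<Sum>i<n. \<alpha> i). mfps_const (of_nat (kostka n \<alpha> \<nu>)) * schur \<nu> :: 'a :: comm_ring_1 mfps)"
proof (induction n)
  case (Suc n)
  let ?P = "partitions_of (\<Sum>i<n. \<alpha> i)" and ?P' = "partitions_of (\<Sum>i<Suc n. \<alpha> i)"
  have "(\<Prod>i<Suc n. hsym (\<alpha> i) :: 'a mfps) =
      (\<Sum>\<nu>\<in>?P. mfps_const (of_nat (kostka n \<alpha> \<nu>)) * (hsym (\<alpha> n) * schur \<nu>))"
    by (simp add: Suc sum_distrib_left sum_distrib_right mult_ac)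
  also have "\<dots> = (\<Sum>\<nu>\<in>?P. \<Sum>\<theta>\<in>?P'. of_bool (hstrip \<nu> \<theta>) * (mfps_const (of_nat (kostka n \<alpha> \<nu>)) * schur \<theta>))"
  proof (rule sum.cong[OF refl])
    fix \<nu> assume "\<nu> \<in> ?P"
    then have \<nu>: "is_partition \<nu>" "sum_list \<nu> = (\<Sum>i<n. \<alpha> i)" by (auto simp: partitions_of_def)
    have "{\<theta>. is_partition \<theta> \<and> hstrip \<nu> \<theta> \<and> sum_list \<theta> = sum_list \<nu> + \<alpha> n} = ?P' \<inter> {\<theta>. hstrip \<nu> \<theta>}"
      using \<nu>(2) by (auto simp: partitions_of_def)
    then show "mfps_const (of_nat (kostka n \<alpha> \<nu>)) * (hsym (\<alpha> n) * schur \<nu>) =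
        (\<Sum>\<theta>\<in>?P'. of_bool (hstrip \<nu> \<theta>) * (mfps_const (of_nat (kostka n \<alpha> \<nu>)) * schur \<theta> :: 'a mfps))"
      by (simp add: pieri[OF \<nu>(1)] sum_distrib_left sum_of_bool_mult_eq)
  qed
  also have "\<dots> = (\<Sum>\<theta>\<in>?P'. \<Sum>\<nu>\<in>?P. of_bool (hstrip \<nu> \<theta>) * mfps_const (of_nat (kostka n \<alpha> \<nu>)) * schur \<theta>)"
    by (subst sum.swap) (simp add: mult.assoc)
  also have "\<dots> = (\<Sum>\<theta>\<in>?P'. mfps_const (of_nat (kostka (Suc n) \<alpha> \<theta>)) * schur \<theta>)"
  proof (rule sum.cong[OF refl])
    fix \<theta> assume "\<theta> \<in> ?P'"
    then have "{\<mu>. is_partition \<mu> \<and> hstrip \<mu> \<theta> \<and> sum_list \<mu> + \<alpha> n = sum_list \<theta>} = ?P \<inter> {\<nu>. hstrip \<nu> \<theta>}"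
      by (auto simp: partitions_of_def)
    then show "(\<Sum>\<nu>\<in>?P. of_bool (hstrip \<nu> \<theta>) * mfps_const (of_nat (kostka n \<alpha> \<nu>)) * schur \<theta>) =
        mfps_const (of_nat (kostka (Suc n) \<alpha> \<theta>)) * (schur \<theta> :: 'a mfps)"
      by (simp add: sum_distrib_right[symmetric] mfps_const_sum sum_of_bool_mult_eq)
  qed
  finally show ?case .
qed simp

lemma prod_hsym_mult_span:
  "F \<in> schur_span d \<Longrightarrow> (\<Prod>i<(n::nat). hsym (\<alpha> i)) * F \<in> schur_span ((\<Sum>i<n. \<alpha> i) + d)"
proof (induction n)
  case (Suc n)
  have "hsym (\<alpha> n) * ((\<Prod>i<n. hsym (\<alpha> i)) * F) \<in> schur_span ((\<Sum>i<n. \<alpha> i) + d + \<alpha> n)"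
    by (rule hsym_mult_span[OF Suc.IH[OF Suc.prems]])
  then show ?case by (simp add: mult_ac add_ac)
qed simp

text \<open>The unitriangular expansion of products of complete functions solved for the leading Schur
  function. It is the recursion behind all statements that reduce Schur functions to complete ones.\<close>

lemma schur_eq_prod_hsym_diff:
  assumes "is_partition \<nu>"
  shows "schur \<nu> = (\<Prod>i<length \<nu>. hsym (part \<nu> (Suc i))) -
    (\<Sum>\<theta> | \<theta> \<in> partitions_of (sum_list \<nu>) \<and> row_weight \<theta> < row_weight \<nu>.
       mfps_const (of_nat (kostka (length \<nu>) (\<lambda>i. part \<nu> (Suc i)) \<theta>)) * schur \<theta> :: 'a :: comm_ring_1 mfps)"
proof -
  let ?K = "\<lambda>\<theta>. mfps_const (of_nat (kostka (length \<nu>) (\<lambda>i. part \<nu> (Suc i)) \<theta>)) * schur \<theta> :: 'a mfps"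
  let ?P = "partitions_of (sum_list \<nu>)"
  have \<nu>: "\<nu> \<in> ?P" using assms by (simp add: partitions_of_def)
  have "(\<Prod>i<length \<nu>. hsym (part \<nu> (Suc i))) = (\<Sum>\<theta>\<in>?P. ?K \<theta>)"
    by (simp add: prod_hsym_expansion sum_list_eq_sum_part'[OF order_refl])
  also have "\<dots> = ?K \<nu> + (\<Sum>\<theta>\<in>?P - {\<nu>}. ?K \<theta>)"
    using \<nu> by (simp add: sum.remove)
  also have "(\<Sum>\<theta>\<in>?P - {\<nu>}. ?K \<theta>) = (\<Sum>\<theta> | \<theta> \<in> ?P \<and> row_weight \<theta> < row_weight \<nu>. ?K \<theta>)"
  proof (rule sum.mono_neutral_right)
    show "\<forall>\<theta>\<in>?P - {\<nu>} - {\<theta> \<in> ?P. row_weight \<theta> < row_weight \<nu>}. ?K \<theta> = 0"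
      using kostka_part_content[OF assms] by (fastforce simp: partitions_of_def)
  qed auto
  also have "?K \<nu> = schur \<nu>"
    using kostka_diagonal[of "length \<nu>" \<nu> "\<lambda>i. part \<nu> (Suc i)"] assms by simp
  finally show ?thesis by simp
qed

lemma schur_mult_span:
  "is_partition \<nu> \<Longrightarrow> F \<in> schur_span d \<Longrightarrow> schur \<nu> * F \<in> schur_span (sum_list \<nu> + d)"
proof (induction "row_weight \<nu>" arbitrary: \<nu> rule: less_induct)
  case less
  let ?H = "\<Prod>i<length \<nu>. hsym (part \<nu> (Suc i))"
  let ?S = "{\<theta> \<in> partitions_of (sum_list \<nu>). row_weight \<theta> < row_weight \<nu>}"
  let ?k = "\<lambda>\<theta>. of_nat (kostka (length \<nu>) (\<lambda>i. part \<nu> (Suc i)) \<theta>)"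
  have eq: "schur \<nu> * F = ?H * F + (\<Sum>\<theta>\<in>?S. mfps_const (- ?k \<theta>) * (schur \<theta> * F))"
    by (subst schur_eq_prod_hsym_diff[OF less.prems(1)])
       (simp add: left_diff_distrib sum_distrib_right mult.assoc sum_negf mfps_const_diff[of 0, simplified])
  have "?H * F \<in> schur_span (sum_list \<nu> + d)"
    using prod_hsym_mult_span[OF less.prems(2)]
    by (simp add: sum_list_eq_sum_part'[OF order_refl])
  moreover have "(\<Sum>\<theta>\<in>?S. mfps_const (- ?k \<theta>) * (schur \<theta> * F)) \<in> schur_span (sum_list \<nu> + d)"
  proof (intro schur_span_sum schur_span_const_mult)
    fix \<theta> assume "\<theta> \<in> ?S"
    then have "row_weight \<theta> < row_weight \<nu>" "is_partition \<theta>" "sum_list \<theta> = sum_list \<nu>"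
      by (auto simp: partitions_of_def)
    then show "schur \<theta> * F \<in> schur_span (sum_list \<nu> + d)"
      using less.hyps[of \<theta>] less.prems(2) by simp
  qed
  ultimately show ?case unfolding eq by (rule schur_span_add)
qed

text \<open>The structure constants exist because Schur functions generate the same graded pieces as
  products of complete functions, and are unique by linear independence; homogeneity bounds their
  support.\<close>

lemma lr_coeff_exists_unique:
  assumes "is_partition \<nu>" "is_partition \<rho>"
  shows "\<exists>!c. finite {\<mu>. c \<mu> \<noteq> 0} \<and> {\<mu>. c \<mu> \<noteq> 0} \<subseteq> Collect is_partition \<and>
     schur \<nu> * schur \<rho> = (\<Sum>\<mu> | c \<mu> \<noteq> 0. mfps_const (c \<mu> :: int) * schur \<mu>)"
    and "\<And>c. finite {\<mu>. c \<mu> \<noteq> 0} \<Longrightarrow> {\<mu>. c \<mu> \<noteq> 0} \<subseteq> Collect is_partition \<Longrightarrow>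
     schur \<nu> * schur \<rho> = (\<Sum>\<mu> | c \<mu> \<noteq> 0. mfps_const (c \<mu> :: int) * schur \<mu>) \<Longrightarrow>
     {\<mu>. c \<mu> \<noteq> 0} \<subseteq> partitions_of (sum_list \<nu> + sum_list \<rho>)"
proof -
  let ?d = "sum_list \<nu> + sum_list \<rho>"
  have "schur \<rho> \<in> schur_span (sum_list \<rho>)"
    using assms(2) by (intro schur_in_span) (simp add: partitions_of_def)
  then have "schur \<nu> * schur \<rho> \<in> (schur_span ?d :: int mfps set)"
    by (rule schur_mult_span[OF assms(1)])
  then obtain a where a: "schur \<nu> * schur \<rho> = (\<Sum>\<mu>\<in>partitions_of ?d. mfps_const (a \<mu> :: int) * schur \<mu>)"
    unfolding schur_span_def by blast
  define b where "b \<mu> = (if \<mu> \<in> partitions_of ?d then a \<mu> else 0)" for \<mu>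
  let ?ok = "\<lambda>c. finite {\<mu>. c \<mu> \<noteq> 0} \<and> {\<mu>. c \<mu> \<noteq> 0} \<subseteq> Collect is_partition \<and>
     schur \<nu> * schur \<rho> = (\<Sum>\<mu> | c \<mu> \<noteq> 0. mfps_const (c \<mu> :: int) * schur \<mu>)"
  have sup: "{\<mu>. b \<mu> \<noteq> 0} \<subseteq> partitions_of ?d" by (auto simp: b_def)
  have ok: "?ok b"
  proof (intro conjI)
    show "finite {\<mu>. b \<mu> \<noteq> 0}" by (rule finite_subset[OF sup]) simp
    show "{\<mu>. b \<mu> \<noteq> 0} \<subseteq> Collect is_partition" using sup by (auto simp: partitions_of_def)
    have "(\<Sum>\<mu>\<in>partitions_of ?d. mfps_const (a \<mu>) * schur \<mu>) = (\<Sum>\<mu>\<in>partitions_of ?d. mfps_const (b \<mu>) * schur \<mu>)"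
      by (intro sum.cong) (auto simp: b_def)
    also have "\<dots> = (\<Sum>\<mu> | b \<mu> \<noteq> 0. mfps_const (b \<mu>) * schur \<mu>)"
      by (rule sum.mono_neutral_right) (use sup in auto)
    finally show "schur \<nu> * schur \<rho> = (\<Sum>\<mu> | b \<mu> \<noteq> 0. mfps_const (b \<mu>) * schur \<mu>)" using a by simp
  qed
  have uniq: "c = b" if c: "?ok c" for c
  proof
    fix \<mu>
    let ?S = "{\<mu>. c \<mu> \<noteq> 0} \<union> {\<mu>. b \<mu> \<noteq> 0}"
    have fin: "finite ?S" using c ok by blast
    have S: "?S \<subseteq> Collect is_partition" using c ok by blast
    have "(\<Sum>\<mu>\<in>?S. mfps_const (e \<mu>) * schur \<mu>) = schur \<nu> * schur \<rho>"
      if "?ok e" "{\<mu>. e \<mu> \<noteq> 0} \<subseteq> ?S" for e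
      using that fin by (simp add: sum.mono_neutral_left[of ?S "{\<mu>. e \<mu> \<noteq> 0}"])
    then have "(\<Sum>\<mu>\<in>?S. mfps_const (c \<mu>) * schur \<mu>) = (\<Sum>\<mu>\<in>?S. mfps_const (b \<mu>) * schur \<mu>)"
      using c ok by (metis (no_types, lifting) Un_upper1 Un_upper2)
    then have "(\<Sum>\<mu>\<in>?S. mfps_const (c \<mu> - b \<mu>) * schur \<mu>) = 0"
      by (simp add: mfps_const_diff left_diff_distrib sum_subtractf)
    from schur_linear_independent[OF fin S this, of \<mu>]
    show "c \<mu> = b \<mu>" by (cases "\<mu> \<in> ?S") auto
  qed
  show "\<exists>!c. ?ok c" using ok uniq by blast
  show "{\<mu>. c \<mu> \<noteq> 0} \<subseteq> partitions_of ?d" if "finite {\<mu>. c \<mu> \<noteq> 0}" "{\<mu>. c \<mu> \<noteq> 0} \<subseteq> Collect is_partition"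
    "schur \<nu> * schur \<rho> = (\<Sum>\<mu> | c \<mu> \<noteq> 0. mfps_const (c \<mu> :: int) * schur \<mu>)" for c
    using uniq[of c] that sup by blast
qed

lemma lr_coeff_support:
  assumes "is_partition \<nu>" "is_partition \<rho>" "lr_coeff \<nu> \<rho> \<mu> \<noteq> 0"
  shows "\<mu> \<in> partitions_of (sum_list \<nu> + sum_list \<rho>)"
  using theI'[OF lr_coeff_exists_unique(1)[OF assms(1,2)], folded lr_coeff_def]
    lr_coeff_exists_unique(2)[OF assms(1,2), of "lr_coeff \<nu> \<rho>"] assms(3) by blast

lemma mfps_nth_schur_of_int: "mfps_nth (schur \<theta> :: 'a :: comm_ring_1 mfps) \<alpha> = of_int (mfps_nth (schur \<theta>) \<alpha>)"
  by (simp add: schur_def)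

theorem schur_mult:
  assumes "is_partition \<nu>" "is_partition \<rho>"
  shows "schur \<nu> * schur \<rho> = (\<Sum>\<mu>\<in>partitions_of (sum_list \<nu> + sum_list \<rho>).
    mfps_const (of_int (lr_coeff \<nu> \<rho> \<mu>)) * schur \<mu> :: 'a :: comm_ring_1 mfps)"
proof (rule mfps_eqI)
  fix \<alpha> :: "nat \<Rightarrow>\<^sub>0 nat"
  let ?P = "partitions_of (sum_list \<nu> + sum_list \<rho>)"
  have "(schur \<nu> * schur \<rho> :: int mfps) = (\<Sum>\<mu> | lr_coeff \<nu> \<rho> \<mu> \<noteq> 0. mfps_const (lr_coeff \<nu> \<rho> \<mu>) * schur \<mu>)"
    using theI'[OF lr_coeff_exists_unique(1)[OF assms], folded lr_coeff_def] by blast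
  also have "\<dots> = (\<Sum>\<mu>\<in>?P. mfps_const (lr_coeff \<nu> \<rho> \<mu>) * schur \<mu>)"
    by (rule sum.mono_neutral_left) (use lr_coeff_support[OF assms] in auto)
  finally have "mfps_nth (schur \<nu> * schur \<rho> :: int mfps) \<alpha> =
      (\<Sum>\<mu>\<in>?P. lr_coeff \<nu> \<rho> \<mu> * mfps_nth (schur \<mu>) \<alpha>)" by simp
  then have "(of_int (mfps_nth (schur \<nu> * schur \<rho>) \<alpha>) :: 'a) =
      of_int (\<Sum>\<mu>\<in>?P. lr_coeff \<nu> \<rho> \<mu> * mfps_nth (schur \<mu>) \<alpha>)" by simp
  then show "mfps_nth (schur \<nu> * schur \<rho> :: 'a mfps) \<alpha> = mfps_nth (\<Sum>\<mu>\<in>?P.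
      mfps_const (of_int (lr_coeff \<nu> \<rho> \<mu>)) * schur \<mu>) \<alpha>"
    by (simp add: mfps_nth_mult[of "schur \<nu>" "schur \<rho>"] case_prod_unfold
        mfps_nth_schur_of_int[where ?'a = 'a])
qed

section \<open>Power sums and Newton's identities\<close>

text \<open>
  Symmetric functions are evaluated both at numbers and at power series in the \<open>Q\<^sub>k\<close>, so the
  evaluation is developed over any commutative ring containing the rationals.
\<close>

class rat_algebra = comm_ring_1 +
  assumes of_nat_Suc_invertible: "\<exists>r. of_nat (Suc n) * r = 1"

instance complex :: rat_algebra
proof
  show "\<exists>r :: complex. of_nat (Suc n) * r = 1" for n
    by (rule exI[of _ "inverse (of_nat (Suc n))"]) (simp del: of_nat_Suc)
qed

instance mfps :: (rat_algebra) rat_algebra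
proof
  fix n
  obtain r :: 'a where "of_nat (Suc n) * r = 1" using of_nat_Suc_invertible by blast
  then have "of_nat (Suc n) * mfps_const r = 1"
    by (metis mfps_const_1 mfps_const_mult mfps_const_of_nat)
  then show "\<exists>r :: 'a mfps. of_nat (Suc n) * r = 1" by blast
qed

lemma of_nat_mult_cancel:
  fixes x y :: "'a :: rat_algebra"
  assumes "n > 0" "of_nat n * x = of_nat n * y"
  shows "x = y"
proof -
  obtain r :: 'a where r: "of_nat n * r = 1"
    using of_nat_Suc_invertible[of "n - 1"] assms(1) by auto
  have cancel: "r * (of_nat n * z) = z" for z
    using r by (simp add: mult.assoc[symmetric] mult.commute[of r])
  show ?thesis using arg_cong[OF assms(2), of "(*) r"] by (simp add: cancel)
qed

text \<open>\<open>hval \<phi> n\<close> is the value of the complete function \<open>h\<^sub>n\<close> when the power sums take the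
  values \<open>\<phi>\<close>.\<close>

fun hval :: "(nat \<Rightarrow> 'a :: rat_algebra) \<Rightarrow> nat \<Rightarrow> 'a" where
  "hval \<phi> 0 = 1"
| "hval \<phi> (Suc n) = (SOME r. of_nat (Suc n) * r = 1) * (\<Sum>k\<le>n. \<phi> (Suc k) * hval \<phi> (n - k))"

declare hval.simps(2) [simp del]

lemma hval_newton: "of_nat n * hval \<phi> n = (\<Sum>k=1..n. \<phi> k * hval \<phi> (n - k))"
proof (cases n)
  case (Suc m)
  let ?r = "SOME r. of_nat (Suc m) * r = (1 :: 'a)"
  have "of_nat (Suc m) * ?r = 1"
    using of_nat_Suc_invertible by (rule someI_ex)
  then have "of_nat n * hval \<phi> n = (\<Sum>k\<le>m. \<phi> (Suc k) * hval \<phi> (m - k))"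
    by (simp add: Suc hval.simps(2) mult.assoc[symmetric] del: of_nat_Suc)
  also have "\<dots> = (\<Sum>k=1..n. \<phi> k * hval \<phi> (n - k))"
    by (rule sum.reindex_bij_witness[of _ "\<lambda>k. k - 1" Suc]) (auto simp: Suc)
  finally show ?thesis .
qed simp

text \<open>Newton's identities determine the complete functions once \<open>n\<close> is invertible. This is the way
  in which all values of \<open>hval\<close> below are found.\<close>

lemma hval_eqI:
  assumes "h 0 = 1" and newton: "\<And>n. of_nat n * h n = (\<Sum>k=1..n. \<phi> k * h (n - k))"
  shows "h n = hval \<phi> n"
proof (induction n rule: less_induct)
  case (less n)
  show ?case
  proof (cases "n = 0")
    case False
    have "of_nat n * h n = of_nat n * hval \<phi> n"
      unfolding newton hval_newton using less by (intro sum.cong) auto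
    then show ?thesis using False of_nat_mult_cancel[of n] by blast
  qed (simp add: assms(1))
qed

definition hfps :: "(nat \<Rightarrow> 'a :: rat_algebra) \<Rightarrow> 'a fps" where
  "hfps \<phi> = Abs_fps (hval \<phi>)"

lemma fps_nth_hfps [simp]: "fps_nth (hfps \<phi>) n = hval \<phi> n"
  by (simp add: hfps_def)

text \<open>Newton's identities as the differential equation \<open>x H' = p(x) H\<close>, with the constant term of
  \<open>p\<close> set to 0.\<close>

lemma newton_fps_iff:
  fixes H :: "'a :: rat_algebra fps"
  shows "fps_X * fps_deriv H = Abs_fps (\<lambda>n. if n = 0 then 0 else \<phi> n) * H \<longleftrightarrow>
    (\<forall>n. of_nat n * fps_nth H n = (\<Sum>k=1..n. \<phi> k * fps_nth H (n - k)))"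
proof -
  have "fps_nth (fps_X * fps_deriv H) n = of_nat n * fps_nth H n" for n
    by (cases n) auto
  moreover have "fps_nth (Abs_fps (\<lambda>n. if n = 0 then 0 else \<phi> n) * H) n =
      (\<Sum>k=1..n. \<phi> k * fps_nth H (n - k))" for n
    unfolding fps_mult_nth
    by (rule sum.mono_neutral_cong_right) auto
  ultimately show ?thesis by (simp add: fps_eq_iff)
qed

text \<open>The generating function of the \<open>h\<^sub>n\<close> is the exponential of the one of the \<open>\<phi>\<^sub>n / n\<close>; here
  this is expressed by its logarithmic derivative.\<close>

lemma hfps_add: "hfps (\<lambda>n. \<phi> n + \<psi> n) = hfps \<phi> * hfps \<psi>"
proof -
  let ?p = "\<lambda>\<phi>. Abs_fps (\<lambda>n. if n = 0 then 0 else \<phi> n :: 'a)"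
  have p: "fps_X * fps_deriv (hfps \<zeta>) = ?p \<zeta> * hfps \<zeta>" for \<zeta>
    using newton_fps_iff[of "hfps \<zeta>" \<zeta>] by (simp add: hval_newton)
  have "fps_X * fps_deriv (hfps \<phi> * hfps \<psi>) =
      fps_X * fps_deriv (hfps \<phi>) * hfps \<psi> + hfps \<phi> * (fps_X * fps_deriv (hfps \<psi>))"
    by (simp add: algebra_simps)
  also have "\<dots> = (?p \<phi> + ?p \<psi>) * (hfps \<phi> * hfps \<psi>)"
    by (simp add: p algebra_simps)
  also have "?p \<phi> + ?p \<psi> = ?p (\<lambda>n. \<phi> n + \<psi> n)"
    by (simp add: fps_eq_iff)
  finally have "fps_nth (hfps \<phi> * hfps \<psi>) n = hval (\<lambda>n. \<phi> n + \<psi> n) n" for n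
    using newton_fps_iff[of "hfps \<phi> * hfps \<psi>" "\<lambda>n. \<phi> n + \<psi> n"] by (intro hval_eqI) auto
  then show ?thesis by (simp add: fps_eq_iff)
qed

lemma hval_add: "hval (\<lambda>n. \<phi> n + \<psi> n) n = (\<Sum>i\<le>n. hval \<phi> i * hval \<psi> (n - i))"
  using arg_cong[OF hfps_add[of \<phi> \<psi>], of "\<lambda>F. fps_nth F n"]
  by (simp add: fps_mult_nth atMost_atLeast0)

lemma hval_scale: "hval (\<lambda>n. c ^ n * \<phi> n) n = c ^ n * hval \<phi> n"
proof (rule hval_eqI[symmetric])
  fix n
  have "of_nat n * (c ^ n * hval \<phi> n) = c ^ n * (of_nat n * hval \<phi> n)"
    by (simp only: mult_ac)
  also have "\<dots> = (\<Sum>k=1..n. c ^ n * (\<phi> k * hval \<phi> (n - k)))"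
    by (simp only: hval_newton sum_distrib_left)
  also have "\<dots> = (\<Sum>k=1..n. c ^ k * \<phi> k * (c ^ (n - k) * hval \<phi> (n - k)))"
  proof (intro sum.cong refl)
    fix k assume "k \<in> {1..n}"
    then have "c ^ n = c ^ k * c ^ (n - k)" by (simp flip: power_add)
    then show "c ^ n * (\<phi> k * hval \<phi> (n - k)) = c ^ k * \<phi> k * (c ^ (n - k) * hval \<phi> (n - k))"
      by (simp only: mult_ac)
  qed
  finally show "of_nat n * (c ^ n * hval \<phi> n) =
      (\<Sum>k=1..n. c ^ k * \<phi> k * (c ^ (n - k) * hval \<phi> (n - k)))" .
qed simp

lemma hval_geometric: "hval (\<lambda>n. c ^ n) n = c ^ n"
  by (rule hval_eqI[symmetric]) (auto simp: power_add[symmetric])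

lemma hval_zero: "hval (\<lambda>_. 0) n = (if n = 0 then 1 else 0)"
  by (rule hval_eqI[symmetric]) auto

lemma hval_one: "hval (\<lambda>_. 1) n = 1"
  using hval_geometric[of 1 n] by simp

lemma hval_const: "hval (\<lambda>n. mfps_const (\<phi> n)) n = mfps_const (hval \<phi> n)"
proof (rule hval_eqI[symmetric])
  show "of_nat n * mfps_const (hval \<phi> n) = (\<Sum>k=1..n. mfps_const (\<phi> k) * mfps_const (hval \<phi> (n - k)))" for n
    by (simp only: mfps_const_of_nat[symmetric] mfps_const_mult[symmetric] mfps_const_sum[symmetric] hval_newton)
qed simp

text \<open>The component of degree \<open>d\<close> of the product \<open>\<Prod>\<^sub>i (\<Sum>\<^sub>n h\<^sub>n x\<^sub>i\<^sup>n)\<close>.\<close>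

definition hprod :: "(nat \<Rightarrow> 'a :: comm_ring_1) \<Rightarrow> nat \<Rightarrow> 'a mfps" where
  "hprod h d = Abs_mfps (\<lambda>\<alpha>. if mdeg \<alpha> = d then \<Prod>i\<in>Poly_Mapping.keys \<alpha>. h (Poly_Mapping.lookup \<alpha> i) else 0)"

lemma mfps_nth_hprod:
  assumes "h 0 = 1" "Poly_Mapping.keys \<alpha> \<subseteq> {..<n}"
  shows "mfps_nth (hprod h d) \<alpha> = (if mdeg \<alpha> = d then \<Prod>i<n. h (Poly_Mapping.lookup \<alpha> i) else 0)"
proof -
  have "(\<Prod>i\<in>Poly_Mapping.keys \<alpha>. h (Poly_Mapping.lookup \<alpha> i)) = (\<Prod>i<n. h (Poly_Mapping.lookup \<alpha> i))"
    using assms by (intro prod.mono_neutral_left) (auto simp: in_keys_iff)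
  then show ?thesis by (simp add: hprod_def)
qed

lemma mfps_nth_psum_mult:
  assumes "k > 0" "Poly_Mapping.keys \<alpha> \<subseteq> {..<n}"
  shows "mfps_nth (psum k * F) \<alpha> =
    (\<Sum>v | v < n \<and> k \<le> Poly_Mapping.lookup \<alpha> v. mfps_nth F (\<alpha> - Poly_Mapping.single v k) :: 'a :: comm_ring_1)"
proof -
  let ?A = "{p \<in> splits \<alpha>. \<exists>i. fst p = Poly_Mapping.single i k}"
  have "mfps_nth (psum k * F) \<alpha> = (\<Sum>p\<in>splits \<alpha>. if \<exists>i. fst p = Poly_Mapping.single i k then mfps_nth F (snd p) else 0)"
    by (auto simp: mfps_nth_mult psum_def case_prod_unfold intro!: sum.cong)
  also have "\<dots> = (\<Sum>p\<in>?A. mfps_nth F (snd p))"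
    by (simp add: sum.inter_filter)
  also have "\<dots> = (\<Sum>v | v < n \<and> k \<le> Poly_Mapping.lookup \<alpha> v. mfps_nth F (\<alpha> - Poly_Mapping.single v k))"
  proof (rule sum.reindex_bij_witness[symmetric, of _
        "\<lambda>p. THE i. fst p = Poly_Mapping.single i k" "\<lambda>v. (Poly_Mapping.single v k, \<alpha> - Poly_Mapping.single v k)"])
    have inj: "Poly_Mapping.single i k = Poly_Mapping.single j k \<longleftrightarrow> i = j" for i j :: nat
      using assms(1) by (metis lookup_single_eq lookup_single_not_eq not_gr_zero)
    then have the: "(THE i. Poly_Mapping.single v k = Poly_Mapping.single i k) = v" for v :: nat
      by (intro the_equality) (auto simp: inj)
    fix v assume v: "v \<in> {v. v < n \<and> k \<le> Poly_Mapping.lookup \<alpha> v}"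
    show "(THE i. fst (Poly_Mapping.single v k, \<alpha> - Poly_Mapping.single v k) = Poly_Mapping.single i k) = v"
      by (simp add: the)
    have "Poly_Mapping.single v k + (\<alpha> - Poly_Mapping.single v k) = \<alpha>"
      using v by (intro poly_mapping_eqI) (auto simp: lookup_add lookup_minus lookup_single when_def)
    then show "(Poly_Mapping.single v k, \<alpha> - Poly_Mapping.single v k) \<in> ?A"
      by (auto simp: splits_def)
  next
    fix p assume "p \<in> ?A"
    then obtain v \<delta> where p: "p = (Poly_Mapping.single v k, \<delta>)" "\<alpha> = Poly_Mapping.single v k + \<delta>"
      by (cases p) (auto simp: splits_def)
    have "(THE i. Poly_Mapping.single v k = Poly_Mapping.single i k) = v"
      using assms(1) by (intro the_equality) (auto, metis lookup_single_eq lookup_single_not_eq not_gr_zero)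
    then have the: "(THE i. fst p = Poly_Mapping.single i k) = v" by (simp add: p)
    have "v \<in> Poly_Mapping.keys \<alpha>" using assms(1) by (simp add: p(2) in_keys_iff lookup_add)
    then have "v < n" using assms(2) by blast
    then show "(THE i. fst p = Poly_Mapping.single i k) \<in> {v. v < n \<and> k \<le> Poly_Mapping.lookup \<alpha> v}"
      unfolding the by (simp add: p(2) lookup_add)
    show "(Poly_Mapping.single (THE i. fst p = Poly_Mapping.single i k) k,
        \<alpha> - Poly_Mapping.single (THE i. fst p = Poly_Mapping.single i k) k) = p"
      unfolding the by (simp add: p)
  qed auto
  finally show ?thesis .
qed

text \<open>Differentiating the product \<open>\<Prod>\<^sub>i (\<Sum>\<^sub>n h\<^sub>n x\<^sub>i\<^sup>n)\<close> logarithmically.\<close>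

lemma newton_hprod:
  fixes h :: "nat \<Rightarrow> 'a :: comm_ring_1"
  assumes h0: "h 0 = 1" and newton: "\<And>n. of_nat n * h n = (\<Sum>k=1..n. \<phi> k * h (n - k))"
  shows "of_nat d * hprod h d = (\<Sum>k=1..d. mfps_const (\<phi> k) * (psum k * hprod h (d - k)))"
proof (rule mfps_eqI)
  fix \<alpha> :: "nat \<Rightarrow>\<^sub>0 nat"
  obtain n where n: "Poly_Mapping.keys \<alpha> \<subseteq> {..<n}" using exists_keys_bound by blast
  let ?l = "Poly_Mapping.lookup \<alpha>"
  have co: "mfps_nth (hprod h (d - k)) (\<alpha> - Poly_Mapping.single v k) =
      (if mdeg \<alpha> = d then h (?l v - k) * (\<Prod>i\<in>{..<n} - {v}. h (?l i)) else 0)"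
    if v: "v < n" "k \<le> ?l v" "1 \<le> k" "k \<le> d" for v k
  proof -
    let ?\<delta> = "\<alpha> - Poly_Mapping.single v k"
    have l: "Poly_Mapping.lookup ?\<delta> i = (if i = v then ?l v - k else ?l i)" for i
      by (simp add: lookup_minus lookup_single when_def)
    have keys: "Poly_Mapping.keys ?\<delta> \<subseteq> {..<n}"
      using n by (auto simp: keys_subset_iff_beyond l)
    have "\<alpha> = ?\<delta> + Poly_Mapping.single v k"
      using v by (intro poly_mapping_eqI) (auto simp: lookup_add l lookup_single when_def)
    moreover have "mdeg (Poly_Mapping.single v k) = k"
      using v by (simp add: mdeg_def)
    ultimately have "mdeg \<alpha> = mdeg ?\<delta> + k" by (metis mdeg_add)
    moreover have "(\<Prod>i<n. h (Poly_Mapping.lookup ?\<delta> i)) = h (?l v - k) * (\<Prod>i\<in>{..<n} - {v}. h (?l i))"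
      using v by (subst prod.remove[of _ v]) (auto simp: l intro!: prod.cong)
    ultimately show ?thesis
      using mfps_nth_hprod[of h, OF h0 keys, of "d - k"] v by auto
  qed
  have "mfps_nth (\<Sum>k=1..d. mfps_const (\<phi> k) * (psum k * hprod h (d - k))) \<alpha> =
      (\<Sum>k=1..d. \<phi> k * (\<Sum>v | v < n \<and> k \<le> ?l v. mfps_nth (hprod h (d - k)) (\<alpha> - Poly_Mapping.single v k)))"
    using n by (auto simp: mfps_nth_psum_mult intro!: sum.cong)
  also have "\<dots> = (\<Sum>k=1..d. \<Sum>v<n. if k \<le> ?l v \<and> mdeg \<alpha> = d
      then \<phi> k * h (?l v - k) * (\<Prod>i\<in>{..<n} - {v}. h (?l i)) else 0)"
  proof (rule sum.cong[OF refl])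
    fix k assume k: "k \<in> {1..d}"
    have "(\<Sum>v | v < n \<and> k \<le> ?l v. mfps_nth (hprod h (d - k)) (\<alpha> - Poly_Mapping.single v k)) =
        (\<Sum>v\<in>{v \<in> {..<n}. k \<le> ?l v}. if mdeg \<alpha> = d then h (?l v - k) * (\<Prod>i\<in>{..<n} - {v}. h (?l i)) else 0)"
      using k by (intro sum.cong) (auto simp: co)
    then show "\<phi> k * (\<Sum>v | v < n \<and> k \<le> ?l v. mfps_nth (hprod h (d - k)) (\<alpha> - Poly_Mapping.single v k)) =
        (\<Sum>v<n. if k \<le> ?l v \<and> mdeg \<alpha> = d
          then \<phi> k * h (?l v - k) * (\<Prod>i\<in>{..<n} - {v}. h (?l i)) else 0)"
      by (subst (asm) sum.inter_filter) (auto simp: sum_distrib_left mult.assoc intro!: sum.cong)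
  qed
  also have "\<dots> = (\<Sum>v<n. \<Sum>k=1..d. if k \<le> ?l v \<and> mdeg \<alpha> = d
      then \<phi> k * h (?l v - k) * (\<Prod>i\<in>{..<n} - {v}. h (?l i)) else 0)"
    by (rule sum.swap)
  also have "\<dots> = (if mdeg \<alpha> = d then \<Sum>v<n. of_nat (?l v) * (\<Prod>i<n. h (?l i)) else 0)"
  proof (cases "mdeg \<alpha> = d")
    case True
    have "(\<Sum>k=1..d. if k \<le> ?l v then \<phi> k * h (?l v - k) * (\<Prod>i\<in>{..<n} - {v}. h (?l i)) else 0) =
        of_nat (?l v) * (\<Prod>i<n. h (?l i))" if v: "v < n" for v
    proof -
      have "?l v \<le> (\<Sum>i<n. ?l i)" using v by (intro member_le_sum) auto
      then have "?l v \<le> d" using True mdeg_eq_sum[OF n] by simp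
      then have "(\<Sum>k=1..d. if k \<le> ?l v then \<phi> k * h (?l v - k) * (\<Prod>i\<in>{..<n} - {v}. h (?l i)) else 0) =
          (\<Sum>k=1..?l v. \<phi> k * h (?l v - k) * (\<Prod>i\<in>{..<n} - {v}. h (?l i)))"
        by (intro sum.mono_neutral_cong_right) auto
      also have "\<dots> = of_nat (?l v) * h (?l v) * (\<Prod>i\<in>{..<n} - {v}. h (?l i))"
        by (simp add: newton sum_distrib_right)
      also have "\<dots> = of_nat (?l v) * (\<Prod>i<n. h (?l i))"
        using v by (subst prod.remove[of "{..<n}" v]) (auto simp: mult.assoc)
      finally show ?thesis .
    qed
    then show ?thesis using True by simp
  qed simp
  also have "\<dots> = mfps_nth (of_nat d * hprod h d) \<alpha>"
    using mfps_nth_hprod[of h, OF h0 n, of d] mdeg_eq_sum[OF n]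
    by (auto simp: mfps_const_of_nat[symmetric] sum_distrib_right[symmetric] simp flip: of_nat_sum)
  finally show "mfps_nth (of_nat d * hprod h d) \<alpha> =
      mfps_nth (\<Sum>k=1..d. mfps_const (\<phi> k) * (psum k * hprod h (d - k))) \<alpha>" ..
qed

lemma hsym_eq_hprod: "hsym = hprod (\<lambda>_. 1)"
  by (rule ext, rule mfps_eqI) (simp add: hsym_def hprod_def)

lemma hprod_0 [simp]: "hprod h 0 = 1"
  by (rule mfps_eqI) (auto simp: hprod_def mfps_nth_1)

lemma newton_hsym: "of_nat d * hsym d = (\<Sum>k=1..d. psum k * hsym (d - k))"
  using newton_hprod[of "\<lambda>_. 1" "\<lambda>_. 1" d] by (simp add: hsym_eq_hprod)

lemma prod_sum_box:
  fixes f :: "nat \<Rightarrow> nat \<Rightarrow> 'a :: comm_ring_1"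
  shows "(\<Prod>i<n. \<Sum>j\<le>\<alpha> i. f i j) = (\<Sum>\<delta> | (\<forall>i<n. \<delta> i \<le> \<alpha> i) \<and> (\<forall>i\<ge>n. \<delta> i = 0). \<Prod>i<n. f i (\<delta> i))"
proof (induction n)
  case 0
  have "{\<delta> :: nat \<Rightarrow> nat. \<forall>i. \<delta> i = 0} = {\<lambda>_. 0}" by auto
  then show ?case by simp
next
  case (Suc n)
  let ?B = "{\<delta>. (\<forall>i<n. \<delta> i \<le> \<alpha> i) \<and> (\<forall>i\<ge>n. \<delta> i = 0)}"
  have "(\<Prod>i<Suc n. \<Sum>j\<le>\<alpha> i. f i j) = (\<Sum>(\<delta>, j)\<in>?B \<times> {..\<alpha> n}. (\<Prod>i<n. f i (\<delta> i)) * f n j)"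
    by (simp add: Suc sum_product sum.cartesian_product)
  also have "\<dots> = (\<Sum>\<delta> | (\<forall>i<Suc n. \<delta> i \<le> \<alpha> i) \<and> (\<forall>i\<ge>Suc n. \<delta> i = 0). \<Prod>i<Suc n. f i (\<delta> i))"
    by (rule sum.reindex_bij_witness[of _ "\<lambda>\<delta>. (\<delta>(n := 0), \<delta> n)" "\<lambda>(\<delta>, j). \<delta>(n := j)"])
       (auto simp: fun_eq_iff less_Suc_eq)
  finally show ?case .
qed

text \<open>In each variable this is the formula for \<open>h\<^sub>n\<close> of a union of alphabets.\<close>

lemma hprod_add:
  fixes \<phi> \<psi> :: "nat \<Rightarrow> 'a :: rat_algebra"
  shows "hprod (hval (\<lambda>n. \<phi> n + \<psi> n)) d = (\<Sum>a\<le>d. hprod (hval \<phi>) a * hprod (hval \<psi>) (d - a))"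
proof (rule mfps_eqI)
  fix \<alpha> :: "nat \<Rightarrow>\<^sub>0 nat"
  obtain n where n: "Poly_Mapping.keys \<alpha> \<subseteq> {..<n}" using exists_keys_bound by blast
  let ?l = "Poly_Mapping.lookup \<alpha>"
  have summand: "(\<Sum>a\<le>d. mfps_nth (hprod (hval \<phi>) a) \<gamma> * mfps_nth (hprod (hval \<psi>) (d - a)) \<delta>) =
      (if mdeg \<alpha> = d then (\<Prod>i<n. hval \<phi> (Poly_Mapping.lookup \<gamma> i) * hval \<psi> (Poly_Mapping.lookup \<delta> i)) else 0)"
    if "(\<gamma>, \<delta>) \<in> splits \<alpha>" for \<gamma> \<delta>
  proof -
    from that have \<alpha>: "\<alpha> = \<gamma> + \<delta>" by (simp add: splits_def)
    then have keys: "Poly_Mapping.keys \<gamma> \<subseteq> {..<n}" "Poly_Mapping.keys \<delta> \<subseteq> {..<n}"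
      using n by (auto simp: keys_subset_iff_beyond lookup_add)
    have "(\<Sum>a\<le>d. mfps_nth (hprod (hval \<phi>) a) \<gamma> * mfps_nth (hprod (hval \<psi>) (d - a)) \<delta>) =
        (\<Sum>a\<le>d. if a = mdeg \<gamma> then (if mdeg \<alpha> = d then (\<Prod>i<n. hval \<phi> (Poly_Mapping.lookup \<gamma> i)) *
          (\<Prod>i<n. hval \<psi> (Poly_Mapping.lookup \<delta> i)) else 0) else 0)"
      by (rule sum.cong) (auto simp: mfps_nth_hprod[OF _ keys(1)] mfps_nth_hprod[OF _ keys(2)] \<alpha> mdeg_add)
    then show ?thesis by (auto simp: prod.distrib \<alpha> mdeg_add)
  qed
  have "mfps_nth (\<Sum>a\<le>d. hprod (hval \<phi>) a * hprod (hval \<psi>) (d - a)) \<alpha> =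
      (\<Sum>(\<gamma>, \<delta>)\<in>splits \<alpha>. \<Sum>a\<le>d. mfps_nth (hprod (hval \<phi>) a) \<gamma> * mfps_nth (hprod (hval \<psi>) (d - a)) \<delta>)"
    by (simp add: mfps_nth_mult case_prod_unfold, rule sum.swap)
  also have "\<dots> = (\<Sum>(\<gamma>, \<delta>)\<in>splits \<alpha>. if mdeg \<alpha> = d then
      (\<Prod>i<n. hval \<phi> (Poly_Mapping.lookup \<gamma> i) * hval \<psi> (Poly_Mapping.lookup \<delta> i)) else 0)"
    by (rule sum.cong) (auto simp: summand)
  also have "\<dots> = (if mdeg \<alpha> = d then \<Prod>i<n. \<Sum>j\<le>?l i. hval \<phi> (?l i - j) * hval \<psi> j else 0)"
    unfolding prod_sum_box
    using sum_splits_box[OF n, of "\<lambda>\<gamma> \<delta>. \<Prod>i<n. hval \<phi> (\<gamma> i) * hval \<psi> (\<delta> i)"] by simp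
  also have "(\<lambda>i. \<Sum>j\<le>?l i. hval \<phi> (?l i - j) * hval \<psi> j) = (\<lambda>i. hval (\<lambda>n. \<phi> n + \<psi> n) (?l i))"
  proof
    fix i
    show "(\<Sum>j\<le>?l i. hval \<phi> (?l i - j) * hval \<psi> j) = hval (\<lambda>n. \<phi> n + \<psi> n) (?l i)"
      unfolding hval_add by (rule sum.reindex_bij_witness[of _ "\<lambda>j. ?l i - j" "\<lambda>j. ?l i - j"]) auto
  qed
  also have "(if mdeg \<alpha> = d then \<Prod>i<n. hval (\<lambda>n. \<phi> n + \<psi> n) (?l i) else 0) =
      mfps_nth (hprod (hval (\<lambda>n. \<phi> n + \<psi> n)) d) \<alpha>"
    by (simp add: mfps_nth_hprod[OF _ n])
  finally show "mfps_nth (hprod (hval (\<lambda>n. \<phi> n + \<psi> n)) d) \<alpha> =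
      mfps_nth (\<Sum>a\<le>d. hprod (hval \<phi>) a * hprod (hval \<psi>) (d - a)) \<alpha>" ..
qed


section \<open>Evaluation of symmetric functions\<close>

text \<open>Values of polynomials in the power sums; that a symmetric function has only one value is
  the algebraic independence of the power sums.\<close>

inductive sym_value :: "(nat \<Rightarrow> 'a :: comm_ring_1) \<Rightarrow> 'a mfps \<Rightarrow> 'a \<Rightarrow> bool" for \<pi> where
  sym_value_const: "sym_value \<pi> (mfps_const c) c"
| sym_value_psum: "n \<ge> 1 \<Longrightarrow> sym_value \<pi> (psum n) (\<pi> n)"
| sym_value_add: "sym_value \<pi> F v \<Longrightarrow> sym_value \<pi> G w \<Longrightarrow> sym_value \<pi> (F + G) (v + w)"
| sym_value_mult: "sym_value \<pi> F v \<Longrightarrow> sym_value \<pi> G w \<Longrightarrow> sym_value \<pi> (F * G) (v * w)"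

lemma sym_value_cmult: "sym_value \<pi> F v \<Longrightarrow> sym_value \<pi> (mfps_const c * F) (c * v)"
  by (intro sym_value_mult sym_value_const)

lemma sym_value_sum:
  "(\<And>x. x \<in> A \<Longrightarrow> sym_value \<pi> (f x) (g x)) \<Longrightarrow> sym_value \<pi> (sum f A) (sum g A)"
  using sym_value_const[of \<pi> 0]
  by (induction A rule: infinite_finite_induct) (auto intro: sym_value_add)

lemma sym_value_prod:
  "(\<And>x. x \<in> A \<Longrightarrow> sym_value \<pi> (f x) (g x)) \<Longrightarrow> sym_value \<pi> (prod f A) (prod g A)"
  using sym_value_const[of \<pi> 1]
  by (induction A rule: infinite_finite_induct) (auto intro: sym_value_mult)

lemma sym_value_diff: "sym_value \<pi> F v \<Longrightarrow> sym_value \<pi> G w \<Longrightarrow> sym_value \<pi> (F - G) (v - w)"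
  using sym_value_add[OF _ sym_value_cmult[of \<pi> G w "- 1"], of F v]
  by (simp add: mfps_const_diff[of 0, simplified])

lemma sym_value_hsym: "sym_value \<pi> (hsym d) (hval \<pi> d)"
proof (induction d rule: less_induct)
  case (less d)
  show ?case
  proof (cases "d = 0")
    case True
    then show ?thesis using sym_value_const[of \<pi> 1] by (simp add: hsym_eq_hprod)
  next
    case False
    obtain r :: 'a where r: "of_nat d * r = 1"
      using of_nat_Suc_invertible[of "d - 1"] False by auto
    have "hsym d = mfps_const r * (of_nat d * hsym d)"
      using r by (simp add: mfps_const_of_nat[symmetric] mult.assoc[symmetric] mfps_const_mult[symmetric] mult.commute)
    also have "\<dots> = mfps_const r * (\<Sum>k=1..d. psum k * hsym (d - k))"
      by (simp only: newton_hsym)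
    finally have "hsym d = mfps_const r * (\<Sum>k=1..d. psum k * hsym (d - k))" .
    moreover have "hval \<pi> d = r * (of_nat d * hval \<pi> d)"
      using r by (simp add: mult.assoc[symmetric] mult.commute)
    then have "hval \<pi> d = r * (\<Sum>k=1..d. \<pi> k * hval \<pi> (d - k))"
      by (simp only: hval_newton)
    moreover have "sym_value \<pi> (mfps_const r * (\<Sum>k=1..d. psum k * hsym (d - k)))
        (r * (\<Sum>k=1..d. \<pi> k * hval \<pi> (d - k)))"
      using less by (intro sym_value_cmult sym_value_sum sym_value_mult sym_value_psum) auto
    ultimately show ?thesis by simp
  qed
qed

text \<open>By induction along the triangular expansion in products of complete functions, whose values are
  known from Newton's identities.\<close>

lemma sym_value_schur_ex: "is_partition \<nu> \<Longrightarrow> \<exists>v. sym_value (\<pi> :: nat \<Rightarrow> 'a :: rat_algebra) (schur \<nu>) v"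
proof (induction "row_weight \<nu>" arbitrary: \<nu> rule: less_induct)
  case less
  let ?S = "{\<theta> \<in> partitions_of (sum_list \<nu>). row_weight \<theta> < row_weight \<nu>}"
  have "\<exists>v. sym_value \<pi> (schur \<theta>) v" if "\<theta> \<in> ?S" for \<theta>
    using less.hyps[of \<theta>] that by (auto simp: partitions_of_def)
  then obtain f where f: "\<And>\<theta>. \<theta> \<in> ?S \<Longrightarrow> sym_value \<pi> (schur \<theta>) (f \<theta>)" by metis
  show ?case
    unfolding schur_eq_prod_hsym_diff[OF less.prems]
    by (intro exI, rule sym_value_diff, rule sym_value_prod, rule sym_value_hsym,
        rule sym_value_sum, rule sym_value_cmult, erule f)
qed

text \<open>A monomial occurs in \<open>p\<^sub>\<tau>\<close> exactly if it arises by distributing the parts of \<open>\<tau>\<close> over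
  the variables.\<close>

lemma mfps_nth_prod_psum:
  "\<exists>k. mfps_nth (prod_list (map psum \<tau>)) \<alpha> = (of_nat k :: 'a :: comm_ring_1) \<and>
    (k > 0 \<longleftrightarrow> (\<exists>vs. length vs = length \<tau> \<and> \<alpha> = sum_list (map2 Poly_Mapping.single vs \<tau>)))"
proof (induction \<tau> arbitrary: \<alpha>)
  case Nil
  show ?case by (rule exI[of _ "of_bool (\<alpha> = 0)"]) (auto simp: mfps_nth_1)
next
  case (Cons t \<tau>)
  from Cons obtain k where k: "\<And>\<alpha>. mfps_nth (prod_list (map psum \<tau>)) \<alpha> = (of_nat (k \<alpha>) :: 'a)"
    "\<And>\<alpha>. k \<alpha> > 0 \<longleftrightarrow> (\<exists>vs. length vs = length \<tau> \<and> \<alpha> = sum_list (map2 Poly_Mapping.single vs \<tau>))"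
    by metis
  let ?K = "\<Sum>(\<gamma>, \<delta>)\<in>splits \<alpha>. if \<exists>i. \<gamma> = Poly_Mapping.single i t then k \<delta> else 0"
  have val: "mfps_nth (prod_list (map psum (t # \<tau>))) \<alpha> = (of_nat ?K :: 'a)"
    by (auto simp: mfps_nth_mult psum_def k(1) case_prod_unfold intro!: sum.cong)
  have pos: "?K > 0 \<longleftrightarrow> (\<exists>i \<delta>. Poly_Mapping.single i t + \<delta> = \<alpha> \<and> k \<delta> > 0)"
  proof -
    have "?K = 0 \<longleftrightarrow> (\<forall>p\<in>splits \<alpha>. (case p of (\<gamma>, \<delta>) \<Rightarrow>
        if \<exists>i. \<gamma> = Poly_Mapping.single i t then k \<delta> else 0) = 0)"
      by (rule sum_eq_0_iff) (rule finite_splits)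
    then have "?K > 0 \<longleftrightarrow> (\<exists>p\<in>splits \<alpha>. (\<exists>i. fst p = Poly_Mapping.single i t) \<and> k (snd p) > 0)"
      unfolding neq0_conv[symmetric] by (force split: if_splits)
    then show ?thesis by (auto simp: splits_def)
  qed
  have vs: "(\<exists>i \<delta>. Poly_Mapping.single i t + \<delta> = \<alpha> \<and> k \<delta> > 0) \<longleftrightarrow>
      (\<exists>vs. length vs = length (t # \<tau>) \<and> \<alpha> = sum_list (map2 Poly_Mapping.single vs (t # \<tau>)))"
    (is "?L \<longleftrightarrow> ?R")
  proof
    assume ?L
    then obtain i vs where "length vs = length \<tau>" "\<alpha> = Poly_Mapping.single i t + sum_list (map2 Poly_Mapping.single vs \<tau>)"
      by (auto simp: k(2))
    then show ?R by (intro exI[of _ "i # vs"]) simp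
  next
    assume ?R
    then obtain i vs where "length vs = length \<tau>" "\<alpha> = Poly_Mapping.single i t + sum_list (map2 Poly_Mapping.single vs \<tau>)"
      by (auto simp: length_Suc_conv)
    then show ?L by (auto simp: k(2))
  qed
  show ?case
    by (rule exI[of _ ?K], rule conjI[OF val trans[OF pos vs]])
qed

lemma keys_sum_singles:
  fixes vs \<tau> :: "nat list"
  shows "Poly_Mapping.keys (sum_list (map2 Poly_Mapping.single vs \<tau>)) \<subseteq> set vs"
proof (induction vs \<tau> rule: list_induct2')
  case (4 v vs t \<tau>)
  then show ?case
    using Poly_Mapping.keys_add[of "Poly_Mapping.single v t" "sum_list (map2 Poly_Mapping.single vs \<tau>)"]
    by (auto split: if_splits)
qed auto

lemma values_sum_singles:
  fixes vs \<tau> :: "nat list"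
  assumes "length vs = length \<tau>" "distinct vs" "0 \<notin> set \<tau>"
  shows "Poly_Mapping.keys (sum_list (map2 Poly_Mapping.single vs \<tau>)) = set vs \<and>
    image_mset (Poly_Mapping.lookup (sum_list (map2 Poly_Mapping.single vs \<tau>))) (mset_set (set vs)) = mset \<tau>"
  using assms
proof (induction vs \<tau> rule: list_induct2)
  case (Cons v vs t \<tau>)
  let ?\<beta> = "sum_list (map2 Poly_Mapping.single vs \<tau>)"
  have IH: "Poly_Mapping.keys ?\<beta> = set vs" "image_mset (Poly_Mapping.lookup ?\<beta>) (mset_set (set vs)) = mset \<tau>"
    using Cons by auto
  have "v \<notin> set vs" "t \<noteq> 0" using Cons.prems by auto
  then have l: "Poly_Mapping.lookup (Poly_Mapping.single v t + ?\<beta>) i =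
      (if i = v then t else Poly_Mapping.lookup ?\<beta> i)" for i
    using IH(1) by (auto simp: lookup_add lookup_single when_def in_keys_iff)
  have "Poly_Mapping.keys (Poly_Mapping.single v t + ?\<beta>) = insert v (set vs)"
    using IH(1) \<open>t \<noteq> 0\<close> by (auto simp: in_keys_iff l split: if_splits)
  moreover have "image_mset (Poly_Mapping.lookup (Poly_Mapping.single v t + ?\<beta>)) (mset_set (set vs)) =
      image_mset (Poly_Mapping.lookup ?\<beta>) (mset_set (set vs))"
    using \<open>v \<notin> set vs\<close> by (intro image_mset_cong) (auto simp: l)
  moreover have "image_mset f (mset_set (insert v (set vs))) = add_mset (f v) (image_mset f (mset_set (set vs)))"
    for f :: "nat \<Rightarrow> nat"
    using \<open>v \<notin> set vs\<close> by simp
  moreover have "Poly_Mapping.lookup (Poly_Mapping.single v t + ?\<beta>) v = t"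
    using l[of v] by simp
  ultimately show ?case
    using IH(2) by simp
qed simp

lemma partition_eq_of_mset:
  assumes "is_partition \<sigma>" "is_partition \<tau>" "mset \<sigma> = mset \<tau>"
  shows "\<sigma> = \<tau>"
proof -
  have "sorted (rev \<sigma>)" "sorted (rev \<tau>)"
    using assms by (auto simp: is_partition_def sorted_wrt_rev)
  then have "rev \<sigma> = rev \<tau>"
    using assms(3) by (metis mset_rev properties_for_sort)
  then show ?thesis by simp
qed

text \<open>In the monomial \<open>\<Prod>\<^sub>j x\<^sub>j ^ \<tau>\<^sub>j\<close> only those \<open>p\<^sub>\<sigma>\<close> have a nonzero coefficient for which \<open>\<sigma>\<close>
  refines \<open>\<tau>\<close>, so the expansion is triangular for the number of parts.\<close>

lemma psum_linear_independent:
  fixes c :: "nat list \<Rightarrow> 'a :: rat_algebra"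
  assumes "finite S" "S \<subseteq> Collect is_partition"
    and zero: "(\<Sum>\<tau>\<in>S. mfps_const (c \<tau>) * prod_list (map psum \<tau>)) = 0"
    and "\<tau> \<in> S"
  shows "c \<tau> = 0"
  using assms(4)
proof (induction "Max (length ` S) - length \<tau>" arbitrary: \<tau> rule: less_induct)
  case less
  have part: "is_partition \<tau>" using less.prems assms(2) by auto
  let ?\<alpha> = "sum_list (map2 Poly_Mapping.single [0..<length \<tau>] \<tau>)"
  have \<tau>: "Poly_Mapping.keys ?\<alpha> = {..<length \<tau>}"
    "image_mset (Poly_Mapping.lookup ?\<alpha>) (mset_set {..<length \<tau>}) = mset \<tau>"
  proof -
    have "0 \<notin> set \<tau>" using part by (simp add: is_partition_def)
    from values_sum_singles[OF _ _ this, of "[0..<length \<tau>]"]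
    show "Poly_Mapping.keys ?\<alpha> = {..<length \<tau>}"
      "image_mset (Poly_Mapping.lookup ?\<alpha>) (mset_set {..<length \<tau>}) = mset \<tau>"
      by (simp_all add: atLeast0LessThan)
  qed
  have "c \<sigma> * mfps_nth (prod_list (map psum \<sigma>)) ?\<alpha> = 0" if \<sigma>: "\<sigma> \<in> S - {\<tau>}" for \<sigma>
  proof -
    have part': "is_partition \<sigma>" using \<sigma> assms(2) by auto
    obtain k where k: "mfps_nth (prod_list (map psum \<sigma>)) ?\<alpha> = (of_nat k :: 'a)"
      "k > 0 \<longleftrightarrow> (\<exists>vs. length vs = length \<sigma> \<and> ?\<alpha> = sum_list (map2 Poly_Mapping.single vs \<sigma>))"
      using mfps_nth_prod_psum by blast
    show ?thesis
    proof (cases "k > 0")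
      case True
      then obtain vs where vs: "length vs = length \<sigma>" "?\<alpha> = sum_list (map2 Poly_Mapping.single vs \<sigma>)"
        using k(2) by blast
      have sub: "{..<length \<tau>} \<subseteq> set vs"
        using keys_sum_singles[of vs \<sigma>] vs(2) \<tau>(1) by simp
      then have le: "length \<tau> \<le> card (set vs)"
        using card_mono[OF _ sub] by simp
      have "length \<tau> \<noteq> length \<sigma>"
      proof
        assume eq: "length \<tau> = length \<sigma>"
        then have "card (set vs) = length vs" using le vs(1) card_length[of vs] by linarith
        then have dist: "distinct vs" by (rule card_distinct)
        have "set vs = {..<length \<tau>}"
          using sub le eq vs(1) card_length[of vs] by (intro card_subset_eq[symmetric]) auto
        then have "mset \<sigma> = mset \<tau>"
          using values_sum_singles[OF vs(1) dist] part' \<tau>(2) vs(2) by (simp add: is_partition_def)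
        then show False using partition_eq_of_mset[OF part' part] \<sigma> by simp
      qed
      then have "length \<tau> < length \<sigma>" using le vs(1) card_length[of vs] by linarith
      moreover have "length \<sigma> \<le> Max (length ` S)" using \<sigma> assms(1) by simp
      ultimately have "c \<sigma> = 0" using less.hyps[of \<sigma>] \<sigma> by auto
      then show ?thesis by simp
    qed (simp add: k(1))
  qed
  then have "(\<Sum>\<sigma>\<in>S. c \<sigma> * mfps_nth (prod_list (map psum \<sigma>)) ?\<alpha>) =
      c \<tau> * mfps_nth (prod_list (map psum \<tau>)) ?\<alpha>"
    using assms(1) less.prems by (simp add: sum.remove[of S \<tau>])
  moreover have "(\<Sum>\<sigma>\<in>S. c \<sigma> * mfps_nth (prod_list (map psum \<sigma>)) ?\<alpha>) = 0"
    using arg_cong[OF zero, of "\<lambda>F. mfps_nth F ?\<alpha>"] by simp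
  moreover obtain k where "mfps_nth (prod_list (map psum \<tau>)) ?\<alpha> = (of_nat k :: 'a)" "k > 0"
    using mfps_nth_prod_psum[of \<tau> ?\<alpha>, where ?'a = 'a] by (metis diff_zero length_upt)
  ultimately show ?case
    using of_nat_mult_cancel[of k "c \<tau>" 0] by (simp add: mult.commute)
qed

definition psum_expansion :: "(nat \<Rightarrow> 'a) \<Rightarrow> 'a :: comm_ring_1 mfps \<Rightarrow> 'a \<Rightarrow> bool" where
  "psum_expansion \<pi> F v \<longleftrightarrow> (\<exists>S c. finite S \<and> S \<subseteq> Collect is_partition \<and>
     F = (\<Sum>\<tau>\<in>S. mfps_const (c \<tau>) * prod_list (map psum \<tau>)) \<and>
     v = (\<Sum>\<tau>\<in>S. c \<tau> * prod_list (map \<pi> \<tau>)))"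

lemma psum_expansion_unique:
  fixes \<pi> :: "nat \<Rightarrow> 'a :: rat_algebra"
  assumes "psum_expansion \<pi> F v" "psum_expansion \<pi> F w"
  shows "v = w"
proof -
  obtain S c where S: "finite S" "S \<subseteq> Collect is_partition"
    "F = (\<Sum>\<tau>\<in>S. mfps_const (c \<tau>) * prod_list (map psum \<tau>))" "v = (\<Sum>\<tau>\<in>S. c \<tau> * prod_list (map \<pi> \<tau>))"
    using assms(1) unfolding psum_expansion_def by blast
  obtain T d where T: "finite T" "T \<subseteq> Collect is_partition"
    "F = (\<Sum>\<tau>\<in>T. mfps_const (d \<tau>) * prod_list (map psum \<tau>))" "w = (\<Sum>\<tau>\<in>T. d \<tau> * prod_list (map \<pi> \<tau>))"
    using assms(2) unfolding psum_expansion_def by blast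
  define e where "e \<tau> = (if \<tau> \<in> S then c \<tau> else 0) - (if \<tau> \<in> T then d \<tau> else 0)" for \<tau>
  let ?U = "S \<union> T"
  have *: "(\<Sum>\<tau>\<in>?U. (if \<tau> \<in> A then f \<tau> else 0) * g \<tau>) = (\<Sum>\<tau>\<in>A. f \<tau> * g \<tau>)"
    if "A \<subseteq> ?U" for A and f g :: "nat list \<Rightarrow> 'b :: comm_ring_1"
    using that S(1) T(1) by (intro sum.mono_neutral_cong_right) auto
  have "(\<Sum>\<tau>\<in>?U. mfps_const (e \<tau>) * prod_list (map psum \<tau>)) =
      (\<Sum>\<tau>\<in>?U. (if \<tau> \<in> S then mfps_const (c \<tau>) else 0) * prod_list (map psum \<tau>)) -
      (\<Sum>\<tau>\<in>?U. (if \<tau> \<in> T then mfps_const (d \<tau>) else 0) * prod_list (map psum \<tau>))"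
    unfolding sum_subtractf[symmetric]
    by (rule sum.cong) (auto simp: e_def mfps_const_diff left_diff_distrib)
  also have "\<dots> = 0" by (simp add: * S(3)[symmetric] T(3)[symmetric])
  finally have zero: "(\<Sum>\<tau>\<in>?U. mfps_const (e \<tau>) * prod_list (map psum \<tau>)) = 0" .
  have e0: "e \<tau> = 0" if "\<tau> \<in> ?U" for \<tau>
    by (rule psum_linear_independent[OF _ _ zero that]) (use S T in auto)
  have "v - w = (\<Sum>\<tau>\<in>?U. e \<tau> * prod_list (map \<pi> \<tau>))"
    by (simp add: e_def left_diff_distrib sum_subtractf * S(4) T(4))
  also have "\<dots> = 0" using e0 by simp
  finally show ?thesis by simp
qed

lemma sum_list_group:
  fixes P :: "nat list \<Rightarrow> 'b :: comm_ring_1"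
  assumes "finite S" "key ` set L \<subseteq> S"
  shows "(\<Sum>\<sigma>\<in>S. (\<Sum>x\<leftarrow>L. if key x = \<sigma> then f x else 0) * P \<sigma>) = (\<Sum>x\<leftarrow>L. f x * P (key x))"
  using assms
proof (induction L)
  case (Cons x L)
  have "(\<Sum>\<sigma>\<in>S. (if key x = \<sigma> then f x else 0) * P \<sigma>) = (\<Sum>\<sigma>\<in>S. if \<sigma> = key x then f x * P (key x) else 0)"
    by (rule sum.cong) auto
  then show ?case using Cons by (simp add: distrib_right sum.distrib)
qed simp

text \<open>A derivation of a value yields a list of monomials in the power sums; collecting equal monomials
  brings it into the form of an expansion over partitions.\<close>

lemma sym_value_expansion:
  fixes \<pi> :: "nat \<Rightarrow> 'a :: rat_algebra"
  assumes "sym_value \<pi> F v"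
  shows "psum_expansion \<pi> F v"
proof -
  have "\<exists>L. (\<forall>x\<in>set L. 0 \<notin> set (snd x)) \<and>
      F = (\<Sum>x\<leftarrow>L. mfps_const (fst x) * prod_list (map psum (snd x))) \<and>
      v = (\<Sum>x\<leftarrow>L. fst x * prod_list (map \<pi> (snd x)))"
    using assms
  proof induction
    case (sym_value_const c)
    show ?case by (rule exI[of _ "[(c, [])]"]) simp
  next
    case (sym_value_psum n)
    then show ?case by (intro exI[of _ "[(1, [n])]"]) simp
  next
    case (sym_value_add F v G w)
    then obtain L M where "\<forall>x\<in>set L. 0 \<notin> set (snd x)"
      "F = (\<Sum>x\<leftarrow>L. mfps_const (fst x) * prod_list (map psum (snd x)))"
      "v = (\<Sum>x\<leftarrow>L. fst x * prod_list (map \<pi> (snd x)))" "\<forall>x\<in>set M. 0 \<notin> set (snd x)"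
      "G = (\<Sum>x\<leftarrow>M. mfps_const (fst x) * prod_list (map psum (snd x)))"
      "w = (\<Sum>x\<leftarrow>M. fst x * prod_list (map \<pi> (snd x)))" by blast
    then show ?case by (intro exI[of _ "L @ M"]) auto
  next
    case (sym_value_mult F v G w)
    then obtain L M where LM: "\<forall>x\<in>set L. 0 \<notin> set (snd x)"
      "F = (\<Sum>x\<leftarrow>L. mfps_const (fst x) * prod_list (map psum (snd x)))"
      "v = (\<Sum>x\<leftarrow>L. fst x * prod_list (map \<pi> (snd x)))" "\<forall>x\<in>set M. 0 \<notin> set (snd x)"
      "G = (\<Sum>x\<leftarrow>M. mfps_const (fst x) * prod_list (map psum (snd x)))"
      "w = (\<Sum>x\<leftarrow>M. fst x * prod_list (map \<pi> (snd x)))" by blast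
    let ?N = "concat (map (\<lambda>x. map (\<lambda>y. (fst x * fst y, snd x @ snd y)) M) L)"
    have *: "(\<Sum>x\<leftarrow>?N. e (fst x) * prod_list (map g (snd x))) =
        (\<Sum>x\<leftarrow>L. e (fst x) * prod_list (map g (snd x))) * (\<Sum>y\<leftarrow>M. e (fst y) * prod_list (map g (snd y)))"
      if "\<And>a b. e (a * b) = e a * e b" for e :: "'a \<Rightarrow> 'b :: comm_ring_1" and g
    proof (induction L)
      case (Cons x L)
      have "(\<Sum>y\<leftarrow>M. e (fst x * fst y) * prod_list (map g (snd x @ snd y))) =
          e (fst x) * prod_list (map g (snd x)) * (\<Sum>y\<leftarrow>M. e (fst y) * prod_list (map g (snd y)))"
        by (induction M) (auto simp: that algebra_simps)
      then show ?case using Cons by (simp add: algebra_simps o_def)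
    qed simp
    show ?case
    proof (intro exI[of _ ?N] conjI)
      show "\<forall>x\<in>set ?N. 0 \<notin> set (snd x)" using LM(1,4) by auto
      show "F * G = (\<Sum>x\<leftarrow>?N. mfps_const (fst x) * prod_list (map psum (snd x)))"
        unfolding LM(2,5) by (rule *[symmetric]) (rule mfps_const_mult)
      show "v * w = (\<Sum>x\<leftarrow>?N. fst x * prod_list (map \<pi> (snd x)))"
        unfolding LM(3,6) using *[of "\<lambda>x. x" \<pi>] by simp
    qed
  qed
  then obtain L where L: "\<forall>x\<in>set L. 0 \<notin> set (snd x)"
    "F = (\<Sum>x\<leftarrow>L. mfps_const (fst x) * prod_list (map psum (snd x)))"
    "v = (\<Sum>x\<leftarrow>L. fst x * prod_list (map \<pi> (snd x)))" by blast
  define key :: "'a \<times> nat list \<Rightarrow> nat list" where "key x = rev (sort (snd x))" for x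
  have prod_key: "prod_list (map g (key x)) = prod_list (map g (snd x))" for g :: "nat \<Rightarrow> 'b :: comm_ring_1" and x
    by (simp add: key_def prod_mset_prod_list[symmetric])
  define S where "S = key ` set L"
  define c where "c \<sigma> = (\<Sum>x\<leftarrow>L. if key x = \<sigma> then fst x else 0)" for \<sigma>
  have const_c: "mfps_const (c \<sigma>) = (\<Sum>x\<leftarrow>L. if key x = \<sigma> then mfps_const (fst x) else 0)" for \<sigma>
    unfolding c_def by (induction L) (auto simp: mfps_const_add)
  have "S \<subseteq> Collect is_partition"
    using L(1) by (auto simp: S_def key_def is_partition_def sorted_wrt_rev)
  moreover have "F = (\<Sum>\<tau>\<in>S. mfps_const (c \<tau>) * prod_list (map psum \<tau>))"
    unfolding const_c L(2) by (subst sum_list_group) (auto simp: S_def prod_key)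
  moreover have "v = (\<Sum>\<tau>\<in>S. c \<tau> * prod_list (map \<pi> \<tau>))"
    unfolding c_def L(3) by (subst sum_list_group) (auto simp: S_def prod_key)
  ultimately show ?thesis unfolding psum_expansion_def S_def by blast
qed

lemma sym_value_unique:
  fixes \<pi> :: "nat \<Rightarrow> 'a :: rat_algebra"
  shows "sym_value \<pi> F v \<Longrightarrow> sym_value \<pi> F w \<Longrightarrow> v = w"
  using sym_value_expansion psum_expansion_unique by blast

lemma sym_eval_eq:
  fixes \<pi> :: "nat \<Rightarrow> complex"
  assumes "sym_value \<pi> F v"
  shows "sym_eval \<pi> F = v"
  unfolding sym_eval_def psum_expansion_def[symmetric]
  using sym_value_expansion[OF assms] psum_expansion_unique by blast

text \<open>The argument \<open>\<phi>\<close> prescribes the power sums and not the variables: then \<open>\<phi> + \<psi>\<close> is the union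
  of two alphabets, \<open>\<phi> \<psi>\<close> their product, and no question of convergence arises.\<close>

definition schur_val :: "(nat \<Rightarrow> 'a :: rat_algebra) \<Rightarrow> nat list \<Rightarrow> 'a" where
  "schur_val \<phi> \<nu> = (THE v. sym_value \<phi> (schur \<nu>) v)"

lemma sym_value_schur:
  assumes "is_partition \<nu>"
  shows "sym_value \<phi> (schur \<nu>) (schur_val \<phi> \<nu>)"
proof -
  obtain v where "sym_value \<phi> (schur \<nu>) v" using sym_value_schur_ex[OF assms] by blast
  then show ?thesis unfolding schur_val_def by (rule theI) (rule sym_value_unique[OF _ \<open>sym_value \<phi> (schur \<nu>) v\<close>])
qed

lemma sym_eval_schur:
  fixes \<phi> :: "nat \<Rightarrow> complex"
  shows "is_partition \<nu> \<Longrightarrow> sym_eval \<phi> (schur \<nu>) = schur_val \<phi> \<nu>"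
  by (rule sym_eval_eq) (rule sym_value_schur)

lemma schur_val_Nil [simp]: "schur_val \<phi> [] = 1"
  by (rule sym_value_unique[OF sym_value_schur[of "[]" \<phi>]]) (use sym_value_const[of \<phi> 1] in auto)

text \<open>The Cauchy identity with one of the two alphabets specialised. Coefficientwise it is the
  expansion of \<open>\<Prod>\<^sub>i h\<^bsub>\<alpha> i\<^esub>\<close> in Schur functions, evaluated at \<open>\<phi>\<close>: the Kostka numbers are also
  the coefficients of the Schur functions.\<close>

lemma schur_val_generating:
  "(\<Sum>\<nu>\<in>partitions_of d. mfps_const (schur_val \<phi> \<nu>) * schur \<nu>) = hprod (hval \<phi>) d"
proof (rule mfps_eqI)
  fix \<alpha> :: "nat \<Rightarrow>\<^sub>0 nat"
  obtain n where n: "Poly_Mapping.keys \<alpha> \<subseteq> {..<n}" using exists_keys_bound by blast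
  let ?l = "Poly_Mapping.lookup \<alpha>"
  have part: "is_partition \<nu>" if "\<nu> \<in> partitions_of d" for \<nu> using that by (simp add: partitions_of_def)
  show "mfps_nth (\<Sum>\<nu>\<in>partitions_of d. mfps_const (schur_val \<phi> \<nu>) * schur \<nu>) \<alpha> = mfps_nth (hprod (hval \<phi>) d) \<alpha>"
  proof (cases "mdeg \<alpha> = d")
    case False
    then have "mfps_nth (schur \<nu> :: 'a mfps) \<alpha> = 0" if "\<nu> \<in> partitions_of d" for \<nu>
      using that by (intro mfps_nth_schur_eq_0) (auto simp: partitions_of_def)
    then show ?thesis using False by (simp add: mfps_nth_hprod[OF _ n])
  next
    case True
    have "sym_value \<phi> (\<Prod>i<n. hsym (?l i)) (\<Prod>i<n. hval \<phi> (?l i))"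
      by (intro sym_value_prod sym_value_hsym)
    moreover have "sym_value \<phi> (\<Sum>\<nu>\<in>partitions_of d. mfps_const (of_nat (kostka n ?l \<nu>)) * schur \<nu>)
        (\<Sum>\<nu>\<in>partitions_of d. of_nat (kostka n ?l \<nu>) * schur_val \<phi> \<nu>)"
      by (intro sym_value_sum sym_value_cmult sym_value_schur part)
    ultimately have "(\<Prod>i<n. hval \<phi> (?l i)) = (\<Sum>\<nu>\<in>partitions_of d. of_nat (kostka n ?l \<nu>) * schur_val \<phi> \<nu>)"
      using prod_hsym_expansion[of ?l n, where ?'a = 'a] True mdeg_eq_sum[OF n]
      by (metis sym_value_unique)
    also have "\<dots> = (\<Sum>\<nu>\<in>partitions_of d. schur_val \<phi> \<nu> * mfps_nth (schur \<nu>) \<alpha>)"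
      by (intro sum.cong) (auto simp: mfps_nth_schur[OF part n] mult.commute)
    finally show ?thesis using True by (simp add: mfps_nth_hprod[OF _ n])
  qed
qed

lemma schur_val_eqI:
  assumes "(\<Sum>\<nu>\<in>partitions_of d. mfps_const (f \<nu>) * schur \<nu>) = hprod (hval \<phi>) d" "\<nu> \<in> partitions_of d"
  shows "schur_val \<phi> \<nu> = f \<nu>"
  by (rule schur_expansion_unique[OF _ assms(2)]) (simp add: assms(1) schur_val_generating)

text \<open>Homogeneity: rescaling all variables by \<open>c\<close> multiplies the \<open>n\<close>-th power sum by \<open>c\<^sup>n\<close>.\<close>

lemma schur_val_scale:
  assumes "is_partition \<nu>"
  shows "schur_val (\<lambda>n. c ^ n * \<phi> n) \<nu> = c ^ sum_list \<nu> * schur_val \<phi> \<nu>"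
proof (rule schur_val_eqI)
  let ?d = "sum_list \<nu>"
  have "(\<Sum>\<nu>\<in>partitions_of ?d. mfps_const (c ^ sum_list \<nu> * schur_val \<phi> \<nu>) * schur \<nu>) =
      mfps_const (c ^ ?d) * (\<Sum>\<nu>\<in>partitions_of ?d. mfps_const (schur_val \<phi> \<nu>) * schur \<nu>)"
    unfolding sum_distrib_left
    by (rule sum.cong) (auto simp: partitions_of_def mfps_const_mult mult.assoc)
  also have "\<dots> = mfps_const (c ^ ?d) * hprod (hval \<phi>) ?d"
    by (simp only: schur_val_generating)
  also have "\<dots> = hprod (hval (\<lambda>n. c ^ n * \<phi> n)) ?d"
  proof (rule mfps_eqI)
    fix \<alpha> :: "nat \<Rightarrow>\<^sub>0 nat"
    obtain n where n: "Poly_Mapping.keys \<alpha> \<subseteq> {..<n}" using exists_keys_bound by blast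
    show "mfps_nth (mfps_const (c ^ ?d) * hprod (hval \<phi>) ?d) \<alpha> = mfps_nth (hprod (hval (\<lambda>n. c ^ n * \<phi> n)) ?d) \<alpha>"
      by (auto simp: mfps_nth_hprod[OF _ n] hval_scale prod.distrib mdeg_eq_sum[OF n] simp flip: power_sum)
  qed
  finally show "(\<Sum>\<nu>\<in>partitions_of ?d. mfps_const (c ^ sum_list \<nu> * schur_val \<phi> \<nu>) * schur \<nu>) =
      hprod (hval (\<lambda>n. c ^ n * \<phi> n)) ?d" .
qed (simp add: partitions_of_def assms)

lemma schur_val_const:
  assumes "is_partition \<nu>"
  shows "schur_val (\<lambda>n. mfps_const (\<phi> n)) \<nu> = mfps_const (schur_val \<phi> \<nu>)"
proof (rule schur_val_eqI)
  let ?d = "sum_list \<nu>"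
  show "(\<Sum>\<nu>\<in>partitions_of ?d. mfps_const (mfps_const (schur_val \<phi> \<nu>)) * schur \<nu>) =
      hprod (hval (\<lambda>n. mfps_const (\<phi> n))) ?d"
  proof (rule mfps_eqI)
    fix \<alpha> :: "nat \<Rightarrow>\<^sub>0 nat"
    obtain n where n: "Poly_Mapping.keys \<alpha> \<subseteq> {..<n}" using exists_keys_bound by blast
    have const: "mfps_nth (schur \<nu> :: 'a mfps mfps) \<alpha> = mfps_const (mfps_nth (schur \<nu>) \<alpha>)" for \<nu>
      by (simp add: schur_def mfps_const_of_nat)
    have "mfps_nth (\<Sum>\<nu>\<in>partitions_of ?d. mfps_const (mfps_const (schur_val \<phi> \<nu>)) * schur \<nu>) \<alpha> =
        mfps_const (mfps_nth (\<Sum>\<nu>\<in>partitions_of ?d. mfps_const (schur_val \<phi> \<nu>) * schur \<nu>) \<alpha>)"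
      by (simp add: const mfps_const_sum mfps_const_mult)
    also have "\<dots> = mfps_const (mfps_nth (hprod (hval \<phi>) ?d) \<alpha>)"
      by (simp only: schur_val_generating)
    also have "\<dots> = mfps_nth (hprod (hval (\<lambda>n. mfps_const (\<phi> n))) ?d) \<alpha>"
    proof -
      have "mfps_const (\<Prod>i\<in>A. g i) = (\<Prod>i\<in>A. mfps_const (g i :: 'a))" for A and g :: "nat \<Rightarrow> 'a"
        by (induction A rule: infinite_finite_induct) (auto simp: mfps_const_mult)
      then show ?thesis by (simp add: mfps_nth_hprod[OF _ n] hval_const)
    qed
    finally show "mfps_nth (\<Sum>\<nu>\<in>partitions_of ?d. mfps_const (mfps_const (schur_val \<phi> \<nu>)) * schur \<nu>) \<alpha> =
        mfps_nth (hprod (hval (\<lambda>n. mfps_const (\<phi> n))) ?d) \<alpha>" .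
  qed
qed (simp add: partitions_of_def assms)

text \<open>The structure constants also describe the coproduct: compare coefficients of Schur functions
  in the product of two generating functions.\<close>

lemma schur_val_add:
  assumes "\<nu> \<in> partitions_of d"
  shows "schur_val (\<lambda>n. \<phi> n + \<psi> n) \<nu> =
    (\<Sum>a\<le>d. \<Sum>\<eta>\<in>partitions_of a. \<Sum>\<rho>\<in>partitions_of (d - a).
       of_int (lr_coeff \<eta> \<rho> \<nu>) * schur_val \<phi> \<eta> * schur_val \<psi> \<rho>)" (is "_ = ?f \<nu>")
proof (rule schur_val_eqI[OF _ assms])
  let ?P = partitions_of
  have "hprod (hval \<phi>) a * hprod (hval \<psi>) (d - a) =
      (\<Sum>\<nu>\<in>?P d. mfps_const (\<Sum>\<eta>\<in>?P a. \<Sum>\<rho>\<in>?P (d - a).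
         of_int (lr_coeff \<eta> \<rho> \<nu>) * schur_val \<phi> \<eta> * schur_val \<psi> \<rho>) * schur \<nu>)" if a: "a \<le> d" for a
  proof -
    have "hprod (hval \<phi>) a * hprod (hval \<psi>) (d - a) =
        (\<Sum>\<eta>\<in>?P a. \<Sum>\<rho>\<in>?P (d - a). mfps_const (schur_val \<phi> \<eta> * schur_val \<psi> \<rho>) * (schur \<eta> * schur \<rho>))"
      unfolding schur_val_generating[symmetric] sum_product by (simp add: mfps_const_mult mult_ac)
    also have "\<dots> = (\<Sum>\<eta>\<in>?P a. \<Sum>\<rho>\<in>?P (d - a). \<Sum>\<nu>\<in>?P d.
        mfps_const (of_int (lr_coeff \<eta> \<rho> \<nu>) * schur_val \<phi> \<eta> * schur_val \<psi> \<rho>) * schur \<nu>)"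
    proof (intro sum.cong refl)
      fix \<eta> \<rho> assume "\<eta> \<in> ?P a" "\<rho> \<in> ?P (d - a)"
      then have "is_partition \<eta>" "is_partition \<rho>" "sum_list \<eta> + sum_list \<rho> = d"
        using a by (auto simp: partitions_of_def)
      then show "mfps_const (schur_val \<phi> \<eta> * schur_val \<psi> \<rho>) * (schur \<eta> * schur \<rho>) =
          (\<Sum>\<nu>\<in>?P d. mfps_const (of_int (lr_coeff \<eta> \<rho> \<nu>) * schur_val \<phi> \<eta> * schur_val \<psi> \<rho>) * schur \<nu>)"
        by (simp add: schur_mult mfps_const_mult sum_distrib_left mult_ac)
    qed
    also have "\<dots> = (\<Sum>\<eta>\<in>?P a. \<Sum>\<nu>\<in>?P d. \<Sum>\<rho>\<in>?P (d - a).
        mfps_const (of_int (lr_coeff \<eta> \<rho> \<nu>) * schur_val \<phi> \<eta> * schur_val \<psi> \<rho>) * schur \<nu>)"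
      by (rule sum.cong[OF refl], rule sum.swap)
    also have "\<dots> = (\<Sum>\<nu>\<in>?P d. \<Sum>\<eta>\<in>?P a. \<Sum>\<rho>\<in>?P (d - a).
        mfps_const (of_int (lr_coeff \<eta> \<rho> \<nu>) * schur_val \<phi> \<eta> * schur_val \<psi> \<rho>) * schur \<nu>)"
      by (rule sum.swap)
    finally show ?thesis by (simp only: mfps_const_sum sum_distrib_right)
  qed
  then have "hprod (hval (\<lambda>n. \<phi> n + \<psi> n)) d = (\<Sum>a\<le>d. \<Sum>\<nu>\<in>?P d. mfps_const (\<Sum>\<eta>\<in>?P a. \<Sum>\<rho>\<in>?P (d - a).
         of_int (lr_coeff \<eta> \<rho> \<nu>) * schur_val \<phi> \<eta> * schur_val \<psi> \<rho>) * schur \<nu>)"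
    by (simp add: hprod_add)
  also have "\<dots> = (\<Sum>\<nu>\<in>?P d. mfps_const (?f \<nu>) * schur \<nu>)"
    by (subst sum.swap) (simp add: mfps_const_sum sum_distrib_right)
  finally show "(\<Sum>\<nu>\<in>?P d. mfps_const (?f \<nu>) * schur \<nu>) = hprod (hval (\<lambda>n. \<phi> n + \<psi> n)) d" ..
qed

lemma schur_val_mult:
  assumes "is_partition \<eta>" "is_partition \<rho>"
  shows "schur_val \<phi> \<eta> * schur_val \<phi> \<rho> =
    (\<Sum>\<nu>\<in>partitions_of (sum_list \<eta> + sum_list \<rho>). of_int (lr_coeff \<eta> \<rho> \<nu>) * schur_val \<phi> \<nu>)"
proof (rule sym_value_unique)
  show "sym_value \<phi> (schur \<eta> * schur \<rho>) (schur_val \<phi> \<eta> * schur_val \<phi> \<rho>)"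
    by (intro sym_value_mult sym_value_schur assms)
  show "sym_value \<phi> (schur \<eta> * schur \<rho>)
      (\<Sum>\<nu>\<in>partitions_of (sum_list \<eta> + sum_list \<rho>). of_int (lr_coeff \<eta> \<rho> \<nu>) * schur_val \<phi> \<nu>)"
    unfolding schur_mult[OF assms]
    by (intro sym_value_sum sym_value_cmult sym_value_schur) (simp add: partitions_of_def)
qed

text \<open>Both sides satisfy Newton's identities for the power sums \<open>\<phi> \<psi>\<close>: on the left this is the
  logarithmic derivative of the generating function, evaluated at \<open>\<psi>\<close>.\<close>

theorem cauchy_identity:
  "(\<Sum>\<nu>\<in>partitions_of d. schur_val \<phi> \<nu> * schur_val \<psi> \<nu>) = hval (\<lambda>n. \<phi> n * \<psi> n) d"
proof (rule hval_eqI)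
  let ?C = "\<lambda>d. \<Sum>\<nu>\<in>partitions_of d. schur_val \<phi> \<nu> * schur_val \<psi> \<nu>"
  have C: "sym_value \<psi> (hprod (hval \<phi>) d) (?C d)" for d
    unfolding schur_val_generating[symmetric]
    by (intro sym_value_sum sym_value_cmult sym_value_schur) (simp add: partitions_of_def)
  fix d
  have "sym_value \<psi> (\<Sum>k=1..d. mfps_const (\<phi> k) * (psum k * hprod (hval \<phi>) (d - k)))
      (\<Sum>k=1..d. \<phi> k * (\<psi> k * ?C (d - k)))"
    by (intro sym_value_sum sym_value_cmult sym_value_mult sym_value_psum C) simp
  moreover have "(\<Sum>k=1..d. mfps_const (\<phi> k) * (psum k * hprod (hval \<phi>) (d - k))) = mfps_const (of_nat d) * hprod (hval \<phi>) d"
    unfolding mfps_const_of_nat by (rule newton_hprod[symmetric]) (simp_all add: hval_newton)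
  moreover have "sym_value \<psi> (mfps_const (of_nat d) * hprod (hval \<phi>) d) (of_nat d * ?C d)"
    by (intro sym_value_cmult C)
  ultimately show "of_nat d * ?C d = (\<Sum>k=1..d. \<phi> k * \<psi> k * ?C (d - k))"
    by (metis (no_types, lifting) mult.assoc sum.cong sym_value_unique)
qed simp

text \<open>The branching rule: adding one variable with value 1 multiplies the generating function by
  the sum of all complete functions, so the Pieri rule applies.\<close>

lemma schur_val_branching:
  assumes "is_partition \<theta>"
  shows "schur_val (\<lambda>n. 1 + \<psi> n) \<theta> = (\<Sum>\<mu> | is_partition \<mu> \<and> hstrip \<mu> \<theta>. schur_val \<psi> \<mu>)"
proof (rule schur_val_eqI)
  let ?P = partitions_of and ?d = "sum_list \<theta>"
  have one: "hprod (hval (\<lambda>_. 1)) a = (hsym a :: 'a mfps)" for a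
    by (simp add: hsym_eq_hprod hval_one[abs_def])
  have "hprod (hval (\<lambda>n. 1 + \<psi> n)) ?d = (\<Sum>a\<le>?d. hsym a * hprod (hval \<psi>) (?d - a))"
    by (simp add: hprod_add one)
  also have "\<dots> = (\<Sum>b\<le>?d. hsym (?d - b) * hprod (hval \<psi>) b)"
    by (rule sum.reindex_bij_witness[of _ "\<lambda>a. ?d - a" "\<lambda>a. ?d - a"]) auto
  also have "\<dots> = (\<Sum>b\<le>?d. \<Sum>\<mu>\<in>?P b. mfps_const (schur_val \<psi> \<mu>) * (hsym (?d - b) * schur \<mu>))"
    by (simp add: schur_val_generating[symmetric] sum_distrib_left mult_ac)
  also have "\<dots> = (\<Sum>b\<le>?d. \<Sum>\<mu>\<in>?P b. \<Sum>\<nu>\<in>?P ?d. of_bool (hstrip \<mu> \<nu>) * (mfps_const (schur_val \<psi> \<mu>) * schur \<nu>))"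
  proof (intro sum.cong refl)
    fix b \<mu> assume "b \<in> {..?d}" "\<mu> \<in> ?P b"
    then have \<mu>: "is_partition \<mu>" "sum_list \<mu> + (?d - b) = ?d" by (auto simp: partitions_of_def)
    have "{\<nu>. is_partition \<nu> \<and> hstrip \<mu> \<nu> \<and> sum_list \<nu> = sum_list \<mu> + (?d - b)} = ?P ?d \<inter> {\<nu>. hstrip \<mu> \<nu>}"
      using \<mu>(2) by (auto simp: partitions_of_def)
    then show "mfps_const (schur_val \<psi> \<mu>) * (hsym (?d - b) * schur \<mu>) =
        (\<Sum>\<nu>\<in>?P ?d. of_bool (hstrip \<mu> \<nu>) * (mfps_const (schur_val \<psi> \<mu>) * schur \<nu>))"
      by (simp add: pieri[OF \<mu>(1)] sum_distrib_left sum_of_bool_mult_eq)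
  qed
  also have "\<dots> = (\<Sum>\<mu> | is_partition \<mu> \<and> sum_list \<mu> \<le> ?d. \<Sum>\<nu>\<in>?P ?d. of_bool (hstrip \<mu> \<nu>) * (mfps_const (schur_val \<psi> \<mu>) * schur \<nu>))"
  proof -
    have "{\<mu>. is_partition \<mu> \<and> sum_list \<mu> \<le> ?d} = (\<Union>b\<le>?d. ?P b)" by (auto simp: partitions_of_def)
    then show ?thesis
      by (simp only:) (rule sum.UNION_disjoint[symmetric], simp, simp, auto simp: partitions_of_def)
  qed
  also have "\<dots> = (\<Sum>\<nu>\<in>?P ?d. \<Sum>\<mu> | is_partition \<mu> \<and> sum_list \<mu> \<le> ?d. of_bool (hstrip \<mu> \<nu>) * (mfps_const (schur_val \<psi> \<mu>) * schur \<nu>))"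
    by (rule sum.swap)
  also have "\<dots> = (\<Sum>\<nu>\<in>?P ?d. mfps_const (\<Sum>\<mu> | is_partition \<mu> \<and> hstrip \<mu> \<nu>. schur_val \<psi> \<mu>) * schur \<nu>)"
  proof (rule sum.cong[OF refl])
    fix \<nu> assume "\<nu> \<in> ?P ?d"
    then have "is_partition \<nu>" "sum_list \<nu> = ?d" by (auto simp: partitions_of_def)
    then have "{\<mu>. is_partition \<mu> \<and> sum_list \<mu> \<le> ?d} \<inter> {\<mu>. hstrip \<mu> \<nu>} = {\<mu>. is_partition \<mu> \<and> hstrip \<mu> \<nu>}"
      using hstrip_sum_list_le[of _ \<nu>] by auto
    then show "(\<Sum>\<mu> | is_partition \<mu> \<and> sum_list \<mu> \<le> ?d. of_bool (hstrip \<mu> \<nu>) * (mfps_const (schur_val \<psi> \<mu>) * schur \<nu>)) =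
        mfps_const (\<Sum>\<mu> | is_partition \<mu> \<and> hstrip \<mu> \<nu>. schur_val \<psi> \<mu>) * schur \<nu>"
      by (simp add: sum_of_bool_mult_eq[OF finite_partitions_le] mfps_const_sum sum_distrib_right)
  qed
  finally show "(\<Sum>\<nu>\<in>?P ?d. mfps_const (\<Sum>\<mu> | is_partition \<mu> \<and> hstrip \<mu> \<nu>. schur_val \<psi> \<mu>) * schur \<nu>) =
      hprod (hval (\<lambda>n. 1 + \<psi> n)) ?d" ..
qed (simp add: partitions_of_def assms)

section \<open>The principal specialisation\<close>

lemma sym_value_cong:
  "sym_value \<phi> F v \<Longrightarrow> (\<And>n. n \<ge> 1 \<Longrightarrow> \<phi> n = \<psi> n) \<Longrightarrow> sym_value \<psi> F v"
proof (induction rule: sym_value.induct)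
  case (sym_value_psum n)
  then show ?case using sym_value.sym_value_psum[of n \<psi>] by simp
qed (auto intro: sym_value.intros)

lemma schur_val_cong:
  assumes "\<And>n. n \<ge> 1 \<Longrightarrow> \<phi> n = \<psi> n" "is_partition \<nu>"
  shows "schur_val \<phi> \<nu> = schur_val \<psi> \<nu>"
proof (rule sym_value_unique)
  show "sym_value \<psi> (schur \<nu>) (schur_val \<phi> \<nu>)"
    by (rule sym_value_cong[OF sym_value_schur[OF assms(2)]]) (rule assms(1))
  show "sym_value \<psi> (schur \<nu>) (schur_val \<psi> \<nu>)"
    by (rule sym_value_schur[OF assms(2)])
qed

text \<open>The recursion determines its solution up to the value at the empty partition: the term
  \<open>\<mu> = \<theta>\<close> on the right carries the coefficient \<open>z ^ \<bar>\<theta>\<bar> \<noteq> 1\<close>, so the equation can be solved for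
  the value at \<open>\<theta>\<close>. The cross-multiplied conclusion avoids dividing by the values at the empty partition.\<close>

lemma branching_unique:
  fixes z :: complex
  assumes z: "\<And>n. n \<ge> 1 \<Longrightarrow> z ^ n \<noteq> 1"
    and X: "\<And>\<theta>. is_partition \<theta> \<Longrightarrow> length \<theta> \<le> L \<Longrightarrow>
      X \<theta> = (\<Sum>\<mu> | is_partition \<mu> \<and> hstrip \<mu> \<theta>. z ^ sum_list \<mu> * X \<mu>)"
    and Y: "\<And>\<theta>. is_partition \<theta> \<Longrightarrow> length \<theta> \<le> L \<Longrightarrow>
      Y \<theta> = (\<Sum>\<mu> | is_partition \<mu> \<and> hstrip \<mu> \<theta>. z ^ sum_list \<mu> * Y \<mu>)"
    and "is_partition \<theta>" "length \<theta> \<le> L"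
  shows "X \<theta> * Y [] = Y \<theta> * X []"
  using assms(4,5)
proof (induction "sum_list \<theta>" arbitrary: \<theta> rule: less_induct)
  case less
  let ?A = "{\<mu>. is_partition \<mu> \<and> hstrip \<mu> \<theta>}"
  have fin: "finite ?A" using finite_hstrip_below[OF less.prems(1), of "\<lambda>_. True"] by simp
  have mem: "\<theta> \<in> ?A"
    using less.prems part_antimono[of \<theta>] by (simp add: hstrip_def)
  have smaller: "sum_list \<mu> < sum_list \<theta>" "length \<mu> \<le> L" if "\<mu> \<in> ?A - {\<theta>}" for \<mu>
  proof -
    from that have \<mu>: "is_partition \<mu>" "hstrip \<mu> \<theta>" "\<mu> \<noteq> \<theta>" by auto
    have len: "length \<mu> \<le> length \<theta>" by (rule hstrip_length(1)[OF \<mu>(1) less.prems(1) \<mu>(2)])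
    then show "length \<mu> \<le> L" using less.prems(2) by simp
    have "\<exists>i. part \<mu> (Suc i) \<noteq> part \<theta> (Suc i)"
      using partition_eqI[OF \<mu>(1) less.prems(1)] \<mu>(3) by (metis Suc_le_D One_nat_def)
    then obtain i where i: "part \<mu> (Suc i) \<noteq> part \<theta> (Suc i)" by blast
    have le: "part \<mu> (Suc j) \<le> part \<theta> (Suc j)" for j using \<mu>(2) by (simp add: hstrip_def)
    have "i < length \<theta>" using i le[of i] part_beyond_length[of \<theta> "Suc i"] by fastforce
    then have "(\<Sum>j<length \<theta>. part \<mu> (Suc j)) < (\<Sum>j<length \<theta>. part \<theta> (Suc j))"
      using i le by (intro sum_strict_mono_ex1) (auto simp: nat_less_le)
    then show "sum_list \<mu> < sum_list \<theta>"
      using sum_list_eq_sum_part'[OF len] sum_list_eq_sum_part'[OF order_refl, of \<theta>] by simp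
  qed
  have split: "(1 - z ^ sum_list \<theta>) * U \<theta> = (\<Sum>\<mu>\<in>?A - {\<theta>}. z ^ sum_list \<mu> * U \<mu>)"
    if "U \<theta> = (\<Sum>\<mu>\<in>?A. z ^ sum_list \<mu> * U \<mu>)" for U
    using that sum.remove[OF fin mem, of "\<lambda>\<mu>. z ^ sum_list \<mu> * U \<mu>"] by (simp add: algebra_simps)
  show ?case
  proof (cases "\<theta> = []")
    case False
    then have "sum_list \<theta> \<noteq> 0"
      using sum_list_eq_0_partition[OF less.prems(1)] by blast
    then have "1 - z ^ sum_list \<theta> \<noteq> 0"
      using z[of "sum_list \<theta>"] by (simp del: sum_list_eq_0_iff)
    moreover have "(1 - z ^ sum_list \<theta>) * (X \<theta> * Y []) = (1 - z ^ sum_list \<theta>) * (Y \<theta> * X [])"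
    proof -
      have "(1 - z ^ sum_list \<theta>) * X \<theta> * Y [] = (\<Sum>\<mu>\<in>?A - {\<theta>}. z ^ sum_list \<mu> * (X \<mu> * Y []))"
        by (simp only: split[OF X[OF less.prems]] sum_distrib_right mult.assoc)
      also have "\<dots> = (\<Sum>\<mu>\<in>?A - {\<theta>}. z ^ sum_list \<mu> * (Y \<mu> * X []))"
        using less.hyps smaller by (intro sum.cong refl) auto
      also have "\<dots> = (1 - z ^ sum_list \<theta>) * Y \<theta> * X []"
        by (simp only: split[OF Y[OF less.prems]] sum_distrib_right mult.assoc)
      finally show ?thesis by (simp only: mult.assoc)
    qed
    ultimately show ?thesis by simp
  qed simp
qed

definition qpoch :: "complex \<Rightarrow> nat \<Rightarrow> complex" where
  "qpoch z n = (\<Prod>i=1..n. 1 - z ^ i)"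

lemma qpoch_0 [simp]: "qpoch z 0 = 1"
  by (simp add: qpoch_def)

lemma qpoch_Suc: "qpoch z (Suc n) = qpoch z n * (1 - z ^ Suc n)"
  by (simp add: qpoch_def)

text \<open>
  The entry of the Jacobi--Trudi matrix: for \<open>k > 0\<close> this is \<open>1 / (z; z)\<^bsub>k-1-j\<^esub>\<close>, which is 0
  for \<open>j \<ge> k\<close>, written so that the Vandermonde structure is visible. The shift of \<open>k\<close> by one
  leaves room for the row that the telescoping sum below subtracts last.
\<close>

definition jt_entry :: "complex \<Rightarrow> nat \<Rightarrow> nat \<Rightarrow> complex" where
  "jt_entry z j k = (if k = 0 then 0 else (\<Prod>r<j. 1 - z powi (int (k - 1) - int r)) / qpoch z (k - 1))"

text \<open>The \<open>q\<close>-difference equation \<open>z\<^sup>m z\<^bsup>-j\<^esup> f(m+1) = f(m+1) - f(m)\<close>, which makes the row sums telescope.\<close>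

lemma jt_entry_step:
  assumes "z \<noteq> 0" "\<And>n. n \<ge> 1 \<Longrightarrow> z ^ n \<noteq> 1"
  shows "z ^ m * z powi (- int j) * jt_entry z j (Suc m) = jt_entry z j (Suc m) - jt_entry z j m"
proof (cases m)
  case 0
  have "(\<Prod>r<Suc i. 1 - z powi (0 - int r)) = 0" for i
    by (rule prod_zero) (auto intro!: bexI[of _ 0])
  with 0 show ?thesis by (cases j) (auto simp: jt_entry_def simp del: prod.lessThan_Suc)
next
  case (Suc n)
  have nz: "qpoch z k \<noteq> 0" for k
    using assms(2) by (auto simp: qpoch_def)
  have "(\<Prod>r<j. 1 - z powi (int n - int r)) * (1 - z powi int m) = (\<Prod>r<Suc j. 1 - z powi (int m - int r))"
    unfolding prod.lessThan_Suc_shift by (simp add: Suc mult.commute)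
  also have "\<dots> = (\<Prod>r<j. 1 - z powi (int m - int r)) * (1 - z ^ m * z powi (- int j))"
    using assms(1) by (simp add: power_int_diff power_int_minus divide_simps)
  finally have "(\<Prod>r<j. 1 - z powi (int n - int r)) * (1 - z powi int m) =
      (\<Prod>r<j. 1 - z powi (int m - int r)) * (1 - z ^ m * z powi (- int j))" .
  then have key: "(\<Prod>r<j. 1 - z powi (int n - int r)) * (1 - z ^ m) =
      (\<Prod>r<j. 1 - z powi (int m - int r)) * (1 - z ^ m * z powi (- int j))"
    unfolding power_int_of_nat .
  have "jt_entry z j m = (\<Prod>r<j. 1 - z powi (int n - int r)) / qpoch z n"
    by (simp add: jt_entry_def Suc)
  also have "\<dots> = (\<Prod>r<j. 1 - z powi (int n - int r)) * (1 - z ^ m) / qpoch z m"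
    using assms(2)[of m] nz by (simp add: Suc qpoch_Suc)
  also have "\<dots> = jt_entry z j (Suc m) * (1 - z ^ m * z powi (- int j))"
    unfolding key by (simp add: jt_entry_def)
  finally show ?thesis by (simp add: algebra_simps)
qed

lemma jt_entry_telescope:
  assumes "z \<noteq> 0" "\<And>n. n \<ge> 1 \<Longrightarrow> z ^ n \<noteq> 1" "a \<le> b"
  shows "(\<Sum>k\<in>{a<..b}. z ^ (k - 1) * z powi (- int j) * jt_entry z j k) = jt_entry z j b - jt_entry z j a"
  using assms(3)
proof (induction rule: dec_induct)
  case (step b)
  have "{a<..Suc b} = insert (Suc b) {a<..b}" using step.hyps by auto
  then show ?case
    using step.IH jt_entry_step[OF assms(1,2), of b j] by simp
qed simp

definition jt_row :: "nat \<Rightarrow> nat list \<Rightarrow> nat \<Rightarrow> nat" where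
  "jt_row L \<theta> i = part \<theta> (Suc i) + (L - i)"

definition jt_det :: "complex \<Rightarrow> nat \<Rightarrow> nat list \<Rightarrow> complex" where
  "jt_det z L \<theta> = Determinant.det (Matrix.mat L L (\<lambda>(i, j). jt_entry z j (jt_row L \<theta> i)))"

text \<open>In terms of the shifted parts, interlacing means that each part ranges over an interval of its
  own.\<close>

lemma bij_betw_jt_row:
  assumes "is_partition \<theta>" "length \<theta> \<le> L"
  shows "bij_betw (\<lambda>\<mu>. restrict (jt_row L \<mu>) {0..<L}) {\<mu>. is_partition \<mu> \<and> hstrip \<mu> \<theta>}
    (PiE {0..<L} (\<lambda>i. {jt_row L \<theta> (Suc i)<..jt_row L \<theta> i}))"
proof (rule bij_betwI')
  have beyond: "part \<mu> i = 0" if "hstrip \<mu> \<theta>" "L < i" for \<mu> i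
  proof -
    have "part \<mu> i \<le> part \<theta> i" using that by (simp add: hstrip_def)
    then show ?thesis using assms(2) that(2) by (simp add: part_beyond_length)
  qed
  fix \<mu> \<nu> assume \<mu>\<nu>: "\<mu> \<in> {\<mu>. is_partition \<mu> \<and> hstrip \<mu> \<theta>}" "\<nu> \<in> {\<mu>. is_partition \<mu> \<and> hstrip \<mu> \<theta>}"
  show "restrict (jt_row L \<mu>) {0..<L} = restrict (jt_row L \<nu>) {0..<L} \<longleftrightarrow> \<mu> = \<nu>"
  proof
    assume eq: "restrict (jt_row L \<mu>) {0..<L} = restrict (jt_row L \<nu>) {0..<L}"
    show "\<mu> = \<nu>"
    proof (rule partition_eqI)
      fix i :: nat assume "1 \<le> i"
      show "part \<mu> i = part \<nu> i"
      proof (cases "i \<le> L")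
        case True
        with \<open>1 \<le> i\<close> obtain j where "i = Suc j" "j < L" by (cases i) auto
        then show ?thesis
          using fun_cong[OF eq, of j] by (simp add: jt_row_def)
      next
        case False
        then have "part \<mu> i = 0" "part \<nu> i = 0" using beyond \<mu>\<nu> by auto
        then show ?thesis by simp
      qed
    qed (use \<mu>\<nu> in auto)
  qed simp
next
  fix \<mu> assume "\<mu> \<in> {\<mu>. is_partition \<mu> \<and> hstrip \<mu> \<theta>}"
  then have \<mu>: "is_partition \<mu>" "hstrip \<mu> \<theta>" by auto
  have "part \<mu> (Suc i) \<le> part \<theta> (Suc i)" "part \<theta> (Suc (Suc i)) \<le> part \<mu> (Suc i)" for i
    using \<mu>(2) by (auto simp: hstrip_def)
  then have "jt_row L \<mu> i \<in> {jt_row L \<theta> (Suc i)<..jt_row L \<theta> i}" if "i < L" for i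
  proof -
    have "L - i = Suc (L - Suc i)" using that by simp
    then show ?thesis
      using \<open>\<And>i. part \<mu> (Suc i) \<le> part \<theta> (Suc i)\<close>[of i] \<open>\<And>i. part \<theta> (Suc (Suc i)) \<le> part \<mu> (Suc i)\<close>[of i]
      unfolding jt_row_def greaterThanAtMost_iff by linarith
  qed
  then show "restrict (jt_row L \<mu>) {0..<L} \<in> PiE {0..<L} (\<lambda>i. {jt_row L \<theta> (Suc i)<..jt_row L \<theta> i})"
    by auto
next
  fix g assume g: "g \<in> PiE {0..<L} (\<lambda>i. {jt_row L \<theta> (Suc i)<..jt_row L \<theta> i})"
  define f where "f i = (if 1 \<le> i \<and> i \<le> L then g (i - 1) - (L - (i - 1)) else 0)" for i
  have bounds: "part \<theta> (Suc i) \<le> f i \<and> f i \<le> part \<theta> i" if "1 \<le> i" for i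
  proof (cases "i \<le> L")
    case True
    have "i - 1 < L" using True that by linarith
    then have "g (i - 1) \<in> {jt_row L \<theta> (Suc (i - 1))<..jt_row L \<theta> (i - 1)}"
      using g by (auto simp: PiE_iff)
    then show ?thesis using True that by (auto simp: f_def jt_row_def)
  next
    case False
    then show ?thesis using assms(2) by (auto simp: f_def part_beyond_length)
  qed
  have "\<exists>\<mu>. is_partition \<mu> \<and> (\<forall>i\<ge>1. part \<mu> i = f i)"
  proof (rule partition_of_parts)
    show "f (Suc i) \<le> f i" if "1 \<le> i" for i
      using bounds[OF that] bounds[of "Suc i"] that by linarith
    show "f (Suc L) = 0" by (simp add: f_def)
  qed
  then obtain \<mu> where \<mu>: "is_partition \<mu>" "\<And>i. 1 \<le> i \<Longrightarrow> part \<mu> i = f i" by blast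
  have "hstrip \<mu> \<theta>" using bounds \<mu>(2) by (simp add: hstrip_def)
  moreover have "g = restrict (jt_row L \<mu>) {0..<L}"
  proof (rule extensionalityI)
    show "g \<in> extensional {0..<L}" using g by (simp add: PiE_iff)
    show "restrict (jt_row L \<mu>) {0..<L} \<in> extensional {0..<L}" by simp
    fix i assume i: "i \<in> {0..<L}"
    then have "g i \<in> {jt_row L \<theta> (Suc i)<..jt_row L \<theta> i}" using g by (auto simp: PiE_iff)
    then show "g i = restrict (jt_row L \<mu>) {0..<L} i"
      using i \<mu>(2)[of "Suc i"] by (auto simp: jt_row_def f_def)
  qed
  ultimately show "\<exists>\<mu>\<in>{\<mu>. is_partition \<mu> \<and> hstrip \<mu> \<theta>}. g = restrict (jt_row L \<mu>) {0..<L}"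
    using \<mu>(1) by blast
qed

text \<open>
  The sum over the partitions interlacing \<open>\<theta>\<close> lets the rows of the Jacobi--Trudi matrix vary
  independently; each row sum telescopes to the difference of two consecutive rows, and the matrix
  of these differences has the original determinant.
\<close>

lemma jt_det_branching:
  assumes z: "z \<noteq> 0" "\<And>n. n \<ge> 1 \<Longrightarrow> z ^ n \<noteq> 1" and \<theta>: "is_partition \<theta>" "length \<theta> \<le> L"
  shows "jt_det z L \<theta> = (\<Sum>\<mu> | is_partition \<mu> \<and> hstrip \<mu> \<theta>. z ^ sum_list \<mu> * jt_det z L \<mu>)"
proof -
  let ?A = "{\<mu>. is_partition \<mu> \<and> hstrip \<mu> \<theta>}" and ?I = "{0..<L}"
  let ?R = "\<lambda>i. {jt_row L \<theta> (Suc i)<..jt_row L \<theta> i}"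
  let ?g = "\<lambda>j k. z ^ (k - 1) * z powi (- int j) * jt_entry z j k"
  let ?M = "Matrix.mat L L (\<lambda>(i, j). jt_entry z j (jt_row L \<theta> i))"
  let ?D = "Matrix.mat L L (\<lambda>(i, j). jt_entry z j (jt_row L \<theta> i) - jt_entry z j (jt_row L \<theta> (Suc i)))"
  let ?U = "Matrix.mat L L (\<lambda>(i, j). if i = j then 1 else if j = Suc i then - 1 else 0 :: complex)"
  have mono: "jt_row L \<theta> (Suc i) \<le> jt_row L \<theta> i" for i
    using part_antimono[OF \<theta>(1), of "Suc i" "Suc (Suc i)"] by (simp add: jt_row_def add_le_mono)
  have weight: "z ^ sum_list \<mu> = (\<Prod>i\<in>?I. z ^ (jt_row L \<mu> i - 1) * z powi (- int (p i)))"
    if \<mu>: "\<mu> \<in> ?A" and p: "p permutes ?I" for \<mu> p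
  proof -
    have len: "length \<mu> \<le> L" using hstrip_length(1)[of \<mu> \<theta>] \<mu> \<theta> by auto
    have "(\<Prod>i\<in>?I. z ^ (jt_row L \<mu> i - 1)) = (\<Prod>i\<in>?I. z ^ part \<mu> (Suc i) * z ^ (L - Suc i))"
      by (intro prod.cong refl) (auto simp: jt_row_def power_add[symmetric])
    also have "\<dots> = z ^ sum_list \<mu> * (\<Prod>i\<in>?I. z ^ (L - Suc i))"
      by (simp add: prod.distrib power_sum[symmetric] sum_list_eq_sum_part'[OF len] atLeast0LessThan)
    also have "(\<Prod>i\<in>?I. z ^ (L - Suc i)) = (\<Prod>i\<in>?I. z ^ i)"
      using prod.nat_diff_reindex[of "\<lambda>i. z ^ i" L] by (simp add: atLeast0LessThan)
    finally have 1: "(\<Prod>i\<in>?I. z ^ (jt_row L \<mu> i - 1)) = z ^ sum_list \<mu> * (\<Prod>i\<in>?I. z ^ i)" .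
    have "(\<Prod>i\<in>?I. z powi (- int (p i))) = (\<Prod>i\<in>?I. z powi (- int i))"
      using prod.permute[OF p, of "\<lambda>i. z powi (- int i)"] by (simp add: o_def)
    then have "(\<Prod>i\<in>?I. z ^ i) * (\<Prod>i\<in>?I. z powi (- int (p i))) = 1"
      using z(1) by (simp add: prod.distrib[symmetric] power_int_minus)
    then show ?thesis unfolding prod.distrib 1 mult.assoc by simp
  qed
  have "(\<Sum>\<mu>\<in>?A. z ^ sum_list \<mu> * jt_det z L \<mu>) =
      (\<Sum>\<mu>\<in>?A. \<Sum>p | p permutes ?I. signof p * (\<Prod>i\<in>?I. ?g (p i) (jt_row L \<mu> i)))"
  proof (rule sum.cong[OF refl])
    fix \<mu> assume \<mu>: "\<mu> \<in> ?A"
    have "jt_det z L \<mu> = (\<Sum>p | p permutes ?I. signof p * (\<Prod>i\<in>?I. jt_entry z (p i) (jt_row L \<mu> i)))"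
      unfolding jt_det_def by (subst det_def'[of _ L]) (auto intro!: sum.cong prod.cong)
    then have "z ^ sum_list \<mu> * jt_det z L \<mu> =
        (\<Sum>p | p permutes ?I. signof p * (z ^ sum_list \<mu> * (\<Prod>i\<in>?I. jt_entry z (p i) (jt_row L \<mu> i))))"
      by (simp add: sum_distrib_left mult_ac)
    also have "\<dots> = (\<Sum>p | p permutes ?I. signof p * (\<Prod>i\<in>?I. ?g (p i) (jt_row L \<mu> i)))"
      by (intro sum.cong refl) (simp add: weight[OF \<mu>] prod.distrib)
    finally show "z ^ sum_list \<mu> * jt_det z L \<mu> =
        (\<Sum>p | p permutes ?I. signof p * (\<Prod>i\<in>?I. ?g (p i) (jt_row L \<mu> i)))" .
  qed
  also have "\<dots> = (\<Sum>p | p permutes ?I. signof p * (\<Sum>\<mu>\<in>?A. \<Prod>i\<in>?I. ?g (p i) (jt_row L \<mu> i)))"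
    by (subst sum.swap) (simp add: sum_distrib_left)
  also have "\<dots> = (\<Sum>p | p permutes ?I. signof p * (\<Prod>i\<in>?I. jt_entry z (p i) (jt_row L \<theta> i) - jt_entry z (p i) (jt_row L \<theta> (Suc i))))"
  proof (intro sum.cong refl arg_cong2[of _ _ _ _ "(*)"])
    fix p
    have "(\<Sum>\<mu>\<in>?A. \<Prod>i\<in>?I. ?g (p i) (jt_row L \<mu> i)) =
        (\<Sum>\<mu>\<in>?A. \<Prod>i\<in>?I. ?g (p i) (restrict (jt_row L \<mu>) ?I i))"
      by (intro sum.cong prod.cong refl) simp
    also have "\<dots> = (\<Sum>f\<in>PiE ?I ?R. \<Prod>i\<in>?I. ?g (p i) (f i))"
      by (rule sum.reindex_bij_betw[OF bij_betw_jt_row[OF \<theta>]])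
    also have "\<dots> = (\<Prod>i\<in>?I. \<Sum>k\<in>?R i. ?g (p i) k)"
      by (rule prod_sum_PiE[symmetric]) auto
    also have "\<dots> = (\<Prod>i\<in>?I. jt_entry z (p i) (jt_row L \<theta> i) - jt_entry z (p i) (jt_row L \<theta> (Suc i)))"
      by (intro prod.cong refl jt_entry_telescope[OF z mono])
    finally show "(\<Sum>\<mu>\<in>?A. \<Prod>i\<in>?I. ?g (p i) (jt_row L \<mu> i)) =
        (\<Prod>i\<in>?I. jt_entry z (p i) (jt_row L \<theta> i) - jt_entry z (p i) (jt_row L \<theta> (Suc i)))" .
  qed
  also have "\<dots> = Determinant.det ?D"
    by (subst det_def'[of _ L]) (auto intro!: sum.cong prod.cong)
  also have "?D = ?U * ?M"
  proof (rule eq_matI)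
    fix i j assume "i < dim_row (?U * ?M)" "j < dim_col (?U * ?M)"
    then have ij: "i < L" "j < L" by auto
    have "(?U * ?M) $$ (i, j) = (\<Sum>k\<in>?I. (if i = k then 1 else if k = Suc i then - 1 else 0) * jt_entry z j (jt_row L \<theta> k))"
      using ij by (simp add: scalar_prod_def)
    also have "\<dots> = (\<Sum>k\<in>?I. (if k = i then jt_entry z j (jt_row L \<theta> k) else 0) -
        (if k = Suc i then jt_entry z j (jt_row L \<theta> k) else 0))"
      by (intro sum.cong) auto
    also have "\<dots> = jt_entry z j (jt_row L \<theta> i) - (if Suc i < L then jt_entry z j (jt_row L \<theta> (Suc i)) else 0)"
      using ij by (simp add: sum_subtractf)
    also have "(if Suc i < L then jt_entry z j (jt_row L \<theta> (Suc i)) else 0) = jt_entry z j (jt_row L \<theta> (Suc i))"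
    proof (cases "Suc i < L")
      case False
      then have "jt_row L \<theta> (Suc i) = 0"
        using ij \<theta>(2) by (simp add: jt_row_def part_beyond_length)
      then show ?thesis using False by (simp add: jt_entry_def)
    qed simp
    finally show "?D $$ (i, j) = (?U * ?M) $$ (i, j)" using ij by simp
  qed auto
  also have "Determinant.det (?U * ?M) = Determinant.det ?U * Determinant.det ?M"
    by (rule det_mult) auto
  also have "Determinant.det ?U = prod_list (diag_mat ?U)"
    by (rule det_upper_triangular) (auto simp: upper_triangular_def)
  also have "diag_mat ?U = map (\<lambda>_. 1) [0..<L]"
    by (auto simp: diag_mat_def)
  finally show ?thesis by (simp add: jt_det_def map_replicate_const)
qed

text \<open>As a function of the last node the determinant is a polynomial of degree at most \<open>n\<close> that vanishes
  at the other nodes, hence a multiple of \<open>\<Prod>\<^sub>i (x - y\<^sub>i)\<close>; the factor is read off from the cofactor of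
  the last entry.\<close>

lemma det_polynomial_basis:
  fixes P :: "nat \<Rightarrow> complex poly"
  assumes deg: "\<And>j. degree (P j) \<le> j" and "inj_on y {..<n}"
  shows "Determinant.det (Matrix.mat n n (\<lambda>(i, j). poly (P j) (y i))) =
    (\<Prod>j<n. coeff (P j) j) * (\<Prod>j<n. \<Prod>i<j. y j - y i)"
  using assms(2)
proof (induction n)
  case 0
  have "Matrix.mat 0 0 (\<lambda>(i, j). poly (P j) (y i)) = 1\<^sub>m 0" by (rule eq_matI) auto
  then show ?case by simp
next
  case (Suc n)
  define A where "A x = Matrix.mat (Suc n) (Suc n) (\<lambda>(i, j). poly (P j) (if i = n then x else y i))" for x
  define D where "D = (\<Sum>j<Suc n. Polynomial.smult (cofactor (A 0) n j) (P j))"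
  have carrier: "A x \<in> carrier_mat (Suc n) (Suc n)" for x by (simp add: A_def)
  have cof: "cofactor (A x) n j = cofactor (A 0) n j" for x j
  proof -
    have "mat_delete (A x) n j = mat_delete (A 0) n j"
      by (rule eq_matI) (auto simp: A_def mat_delete_def)
    then show ?thesis unfolding cofactor_def by (rule arg_cong)
  qed
  have det_A: "Determinant.det (A x) = poly D x" for x
  proof -
    have "Determinant.det (A x) = (\<Sum>j<Suc n. A x $$ (n, j) * cofactor (A x) n j)"
      by (rule laplace_expansion_row[OF carrier]) simp
    also have "\<dots> = (\<Sum>j<Suc n. A x $$ (n, j) * cofactor (A 0) n j)"
      by (intro sum.cong refl arg_cong2[of _ _ _ _ "(*)"] cof)
    also have "\<dots> = (\<Sum>j<Suc n. cofactor (A 0) n j * poly (P j) x)"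
      by (intro sum.cong refl) (auto simp: A_def)
    finally show ?thesis by (simp add: D_def poly_sum)
  qed
  have roots: "poly D (y i) = 0" if "i < n" for i
    unfolding det_A[symmetric]
    by (rule det_identical_rows[OF carrier, of n i]) (use that in \<open>auto simp: A_def intro!: eq_vecI\<close>)
  define c where "c = coeff (P n) n * (\<Prod>j<n. coeff (P j) j) * (\<Prod>j<n. \<Prod>i<j. y j - y i)"
  define E where "E = D - Polynomial.smult c (\<Prod>i<n. [:- y i, 1:])"
  have deg_prod: "degree (\<Prod>i<n. [:- y i, 1:]) = n"
    by (subst degree_prod_sum_eq) auto
  have lead: "coeff (\<Prod>i<n. [:- y i, 1:]) n = 1"
    using lead_coeff_prod[of "\<lambda>i. [:- y i, 1:]" "{..<n}"] deg_prod by simp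
  have "mat_delete (A 0) n n = Matrix.mat n n (\<lambda>(i, j). poly (P j) (y i))"
    by (rule eq_matI) (auto simp: A_def mat_delete_def)
  then have "cofactor (A 0) n n = (\<Prod>j<n. coeff (P j) j) * (\<Prod>j<n. \<Prod>i<j. y j - y i)"
    using Suc by (simp add: cofactor_def inj_on_def power_add[symmetric] mult_2[symmetric])
  moreover have "coeff D n = cofactor (A 0) n n * coeff (P n) n"
  proof -
    have "coeff (P j) n = 0" if "j < n" for j
      using deg[of j] that by (intro coeff_eq_0) simp
    then show ?thesis by (simp add: D_def coeff_sum)
  qed
  ultimately have coeff_E: "coeff E n = 0"
    by (simp add: E_def lead c_def)
  have "degree D \<le> n"
    unfolding D_def
  proof (rule degree_sum_le)
    fix j assume "j \<in> {..<Suc n}"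
    then show "degree (Polynomial.smult (cofactor (A 0) n j) (P j)) \<le> n"
      using degree_smult_le[of "cofactor (A 0) n j" "P j"] deg[of j] by simp
  qed simp
  then have "degree E \<le> n"
    unfolding E_def using degree_smult_le[of c "\<Prod>i<n. [:- y i, 1:]"] deg_prod
    by (intro degree_diff_le) auto
  have "E = 0"
  proof (rule ccontr)
    assume "E \<noteq> 0"
    have "degree E < n"
      using \<open>degree E \<le> n\<close> coeff_E \<open>E \<noteq> 0\<close> by (metis leading_coeff_0_iff nat_less_le)
    moreover have "y ` {..<n} \<subseteq> {x. poly E x = 0}"
      using roots by (auto simp: E_def poly_prod intro!: prod_zero)
    then have "card (y ` {..<n}) \<le> card {x. poly E x = 0}"
      by (intro card_mono poly_roots_finite[OF \<open>E \<noteq> 0\<close>])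
    moreover have "card (y ` {..<n}) = n"
      using Suc.prems by (simp add: card_image inj_on_def)
    ultimately show False using card_poly_roots_bound[OF \<open>E \<noteq> 0\<close>] by linarith
  qed
  then have "poly D (y n) = c * (\<Prod>i<n. y n - y i)"
    by (simp add: E_def poly_prod)
  moreover have "A (y n) = Matrix.mat (Suc n) (Suc n) (\<lambda>(i, j). poly (P j) (y i))"
    by (rule eq_matI) (auto simp: A_def)
  ultimately show ?case
    using det_A[of "y n"] by (simp add: c_def mult_ac)
qed

text \<open>The sum of the contents \<open>j - i\<close> is the form of \<open>\<kappa>\<close> for which transposition is a change of sign.\<close>

lemma kappa_eq_contents: "kappa \<mu> = 2 * (\<Sum>(i, j)\<in>cells \<mu>. int j - int i)"
proof -
  have row: "2 * (\<Sum>j=1..p. int j - int i) = int p * (int p - 2 * int i + 1)" for p i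
    by (induction p) (auto simp: algebra_simps)
  have "(\<Sum>(i, j)\<in>cells \<mu>. int j - int i) = (\<Sum>i=1..length \<mu>. \<Sum>j=1..part \<mu> i. int j - int i)"
    unfolding cells_eq_Sigma by (subst sum.Sigma) auto
  then show ?thesis by (simp add: kappa_def row[symmetric] sum_distrib_left)
qed

lemma prod_powi: "s \<noteq> 0 \<Longrightarrow> (\<Prod>x\<in>A. s powi f x) = s powi (\<Sum>x\<in>A. f x)" for s :: "'a :: field"
  by (induction A rule: infinite_finite_induct) (auto simp: power_int_add)

text \<open>Indices starting from 0 agree with those of matrices and lists.\<close>

lemma W1_zero_based:
  "W1 s \<mu> = s powi (kappa \<mu> div 2)
     * (\<Prod>j<length \<mu>. \<Prod>i<j. qnum s (int (part \<mu> (Suc i)) - int (part \<mu> (Suc j)) + int j - int i) / qnum s (int j - int i))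
     * (\<Prod>i<length \<mu>. \<Prod>v=1..part \<mu> (Suc i). 1 / qnum s (int (length \<mu> - Suc i) + int v))"
proof -
  have "(\<Prod>(i, j) | 1 \<le> i \<and> i < j \<and> j \<le> length \<mu>.
      qnum s (int (part \<mu> i) - int (part \<mu> j) + int j - int i) / qnum s (int j - int i)) =
    (\<Prod>(j, i)\<in>(SIGMA j:{..<length \<mu>}. {..<j}).
      qnum s (int (part \<mu> (Suc i)) - int (part \<mu> (Suc j)) + int j - int i) / qnum s (int j - int i))"
    by (rule prod.reindex_bij_witness[of _ "\<lambda>(j, i). (Suc i, Suc j)" "\<lambda>(i, j). (j - 1, i - 1)"])
       (auto simp: Suc_le_eq gr0_conv_Suc algebra_simps dest!: less_imp_Suc_add)
  moreover have "(\<Prod>i=1..length \<mu>. \<Prod>v=1..part \<mu> i. 1 / qnum s (int v - int i + int (length \<mu>))) =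
      (\<Prod>i<length \<mu>. \<Prod>v=1..part \<mu> (Suc i). 1 / qnum s (int (length \<mu> - Suc i) + int v))"
    unfolding One_nat_def prod.atLeast1_atMost_eq
    by (intro prod.cong refl) (auto simp: of_nat_diff algebra_simps)
  ultimately show ?thesis
    unfolding W1_def by (simp add: prod.Sigma)
qed

lemma qnum_diff:
  assumes "s \<noteq> 0"
  shows "qnum s (a - b) = s powi (a + b) * (inverse (s^2) powi b - inverse (s^2) powi a)"
proof -
  have "inverse (s^2) powi c = s powi (- 2 * c)" for c
    using assms by (simp add: power_int_mult power_int_minus power_int_inverse)
  then show ?thesis
    using assms by (simp add: qnum_def right_diff_distrib power_int_add[symmetric])
qed

lemma qnum_eq:
  assumes "s \<noteq> 0"
  shows "qnum s a = s powi a * (1 - inverse (s^2) powi a)"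
  using qnum_diff[OF assms, of a 0] by simp

text \<open>Up to a factor depending on the row only, the entry in column \<open>j\<close> is a polynomial of degree \<open>j\<close>
  in \<open>z ^ (k - 1)\<close>, where \<open>k\<close> is the row label; so the determinant is a Vandermonde determinant.\<close>

lemma jt_det_vandermonde:
  assumes z: "z \<noteq> 0" "\<And>n. n \<ge> 1 \<Longrightarrow> z ^ n \<noteq> 1"
  obtains c where "c \<noteq> 0"
    "\<And>\<theta>. is_partition \<theta> \<Longrightarrow> jt_det z L \<theta> = c * (\<Prod>i<L. 1 / qpoch z (jt_row L \<theta> i - 1)) *
      (\<Prod>j<L. \<Prod>i<j. z ^ (jt_row L \<theta> j - 1) - z ^ (jt_row L \<theta> i - 1))"
proof -
  define P where "P j = (\<Prod>r<j. [:1, - (z powi (- int r)):])" for j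
  have deg: "degree (P j) \<le> j" for j
  proof -
    have "degree (P j) \<le> (\<Sum>r<j. degree [:1, - (z powi (- int r)):])"
      unfolding P_def by (rule order_trans[OF degree_prod_sum_le]) auto
    also have "\<dots> \<le> (\<Sum>r<j. 1)" by (intro sum_mono) auto
    finally show ?thesis by simp
  qed
  have lead: "coeff (P j) j \<noteq> 0" for j
  proof -
    have "degree (P j) = (\<Sum>r<j. degree [:1, - (z powi (- int r)):])"
      unfolding P_def using z(1) by (intro degree_prod_sum_eq) auto
    also have "\<dots> = j" using z(1) by simp
    finally have "degree (P j) = j" .
    moreover have "P j \<noteq> 0" unfolding P_def by (auto simp: prod_zero_iff)
    ultimately show ?thesis by (metis leading_coeff_0_iff)
  qed
  have inj: "z ^ a = z ^ b \<longleftrightarrow> a = b" for a b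
  proof -
    have "z ^ a \<noteq> z ^ b" if "a < b" for a b
    proof -
      have "z ^ b = z ^ a * z ^ (b - a)" using that by (simp add: power_add[symmetric])
      moreover have "z ^ (b - a) \<noteq> 1" using z(2) that by simp
      ultimately show ?thesis using z(1) by simp
    qed
    then show ?thesis by (metis nat_neq_iff)
  qed
  show ?thesis
  proof (rule that[of "\<Prod>j<L. coeff (P j) j"])
    show "(\<Prod>j<L. coeff (P j) j) \<noteq> 0" using lead by simp
    fix \<theta> assume part: "is_partition \<theta>"
    let ?l = "\<lambda>i. jt_row L \<theta> i - 1"
    have entry: "jt_entry z j (jt_row L \<theta> i) = 1 / qpoch z (?l i) * poly (P j) (z ^ ?l i)" if "i < L" for i j
    proof -
      have "jt_row L \<theta> i \<noteq> 0" using that by (simp add: jt_row_def)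
      moreover have "poly (P j) (z ^ ?l i) = (\<Prod>r<j. 1 - z powi (int (?l i) - int r))"
        unfolding P_def poly_prod using z(1)
        by (intro prod.cong) (auto simp: power_int_diff power_int_minus field_simps)
      ultimately show ?thesis by (simp add: jt_entry_def)
    qed
    have "?l j < ?l i" if "i < j" "j < L" for i j
      using part_antimono[OF part, of "Suc i" "Suc j"] that by (simp add: jt_row_def)
    then have "inj_on ?l {..<L}"
      by (metis (mono_tags, lifting) inj_onI lessThan_iff nat_neq_iff)
    then have "inj_on (\<lambda>i. z ^ ?l i) {..<L}"
      by (auto simp: inj_on_def inj)
    note vdm = det_polynomial_basis[of P, OF deg this]
    have "jt_det z L \<theta> = (\<Sum>p | p permutes {0..<L}. signof p * (\<Prod>i = 0..<L. 1 / qpoch z (?l i) * poly (P (p i)) (z ^ ?l i)))"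
      unfolding jt_det_def by (subst det_def'[of _ L]) (auto simp: entry intro!: sum.cong prod.cong)
    also have "\<dots> = (\<Prod>i<L. 1 / qpoch z (?l i)) *
        (\<Sum>p | p permutes {0..<L}. signof p * (\<Prod>i = 0..<L. poly (P (p i)) (z ^ ?l i)))"
      by (simp only: sum_distrib_left prod.distrib atLeast0LessThan mult_ac)
    also have "(\<Sum>p | p permutes {0..<L}. signof p * (\<Prod>i = 0..<L. poly (P (p i)) (z ^ ?l i))) =
        Determinant.det (Matrix.mat L L (\<lambda>(i, j). poly (P j) (z ^ ?l i)))"
      by (subst det_def'[of _ L]) (auto intro!: sum.cong prod.cong)
    finally show "jt_det z L \<theta> = (\<Prod>j<L. coeff (P j) j) * (\<Prod>i<L. 1 / qpoch z (?l i)) *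
        (\<Prod>j<L. \<Prod>i<j. z ^ ?l j - z ^ ?l i)"
      by (simp only: vdm mult_ac)
  qed
qed

text \<open>Both determinants are Vandermonde products; their ratio is the product formula for the quantum
  dimension up to a power of \<open>q\<close>, whose exponent is found by summing contents.\<close>

lemma W1_eq_jt_det:
  fixes s :: complex
  assumes s: "s \<noteq> 0" "\<And>n. n \<ge> 1 \<Longrightarrow> inverse (s^2) ^ n \<noteq> 1" and part: "is_partition \<theta>"
  shows "W1 s \<theta> * jt_det (inverse (s^2)) (length \<theta>) [] =
      s powi (- int (sum_list \<theta>)) * jt_det (inverse (s^2)) (length \<theta>) \<theta>"
    and "jt_det (inverse (s^2)) (length \<theta>) [] \<noteq> 0"
proof -
  define z where "z = inverse (s^2)"
  define L where "L = length \<theta>"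
  have z: "z \<noteq> 0" "\<And>n. n \<ge> 1 \<Longrightarrow> z ^ n \<noteq> 1" using s by (auto simp: z_def)
  obtain c where c: "c \<noteq> 0" "\<And>\<theta>. is_partition \<theta> \<Longrightarrow> jt_det z L \<theta> = c * (\<Prod>i<L. 1 / qpoch z (jt_row L \<theta> i - 1)) *
      (\<Prod>j<L. \<Prod>i<j. z ^ (jt_row L \<theta> j - 1) - z ^ (jt_row L \<theta> i - 1))"
    using jt_det_vandermonde[OF z, of L] by blast
  define p where "p i = part \<theta> (Suc i)" for i
  define m where "m i = L - Suc i" for i
  have l: "jt_row L \<theta> i - 1 = m i + p i" "jt_row L [] i - 1 = m i" if "i < L" for i
    using that by (auto simp: jt_row_def m_def p_def)
  have qp: "qpoch z k \<noteq> 0" for k using z by (auto simp: qpoch_def)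
  have diff: "z ^ m j - z ^ m i \<noteq> 0" if "i < j" "j < L" for i j
  proof -
    have "z ^ m i = z ^ m j * z ^ (j - i)" using that by (simp add: m_def power_add[symmetric])
    moreover have "z ^ (j - i) \<noteq> 1" using that z by simp
    ultimately show ?thesis using z(1) by simp
  qed
  have cong2: "(\<Prod>j<L. \<Prod>i<j. f i j) = (\<Prod>j<L. \<Prod>i<j. g i j)"
    if "\<And>i j. i < j \<Longrightarrow> j < L \<Longrightarrow> f i j = g i j" for f g :: "nat \<Rightarrow> nat \<Rightarrow> complex"
    using that by (intro prod.cong refl) auto
  define V where "V = (\<Prod>j<L. \<Prod>i<j. z ^ (m j + p j) - z ^ (m i + p i))"
  define V0 where "V0 = (\<Prod>j<L. \<Prod>i<j. z ^ m j - z ^ m i)"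
  define G where "G = (\<Prod>i<L. qpoch z (m i + p i))"
  define G0 where "G0 = (\<Prod>i<L. qpoch z (m i))"
  have nz: "V0 \<noteq> 0" "G \<noteq> 0" "G0 \<noteq> 0"
    using diff qp by (auto simp: V0_def G_def G0_def)
  have jt: "jt_det z L \<theta> = c * (1 / G) * V"
  proof -
    have "(\<Prod>i<L. 1 / qpoch z (jt_row L \<theta> i - 1)) = (\<Prod>i<L. 1 / qpoch z (m i + p i))"
      by (intro prod.cong refl) (simp only: l lessThan_iff)
    moreover have "(\<Prod>j<L. \<Prod>i<j. z ^ (jt_row L \<theta> j - 1) - z ^ (jt_row L \<theta> i - 1)) = V"
      unfolding V_def by (rule cong2) (simp only: l less_trans)
    ultimately show ?thesis by (simp only: c(2)[OF part] G_def prod_dividef prod.neutral_const)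
  qed
  have jt0: "jt_det z L [] = c * (1 / G0) * V0"
  proof -
    have "(\<Prod>i<L. 1 / qpoch z (jt_row L [] i - 1)) = (\<Prod>i<L. 1 / qpoch z (m i))"
      by (intro prod.cong refl) (simp only: l lessThan_iff)
    moreover have "(\<Prod>j<L. \<Prod>i<j. z ^ (jt_row L [] j - 1) - z ^ (jt_row L [] i - 1)) = V0"
      unfolding V0_def by (rule cong2) (simp only: l less_trans)
    ultimately show ?thesis by (simp only: c(2)[OF is_partition_Nil] G0_def prod_dividef prod.neutral_const)
  qed
  show "jt_det (inverse (s^2)) (length \<theta>) [] \<noteq> 0"
    using nz c(1) jt0 by (simp add: z_def L_def)
  have pair: "qnum s (int (p i) - int (p j) + int j - int i) / qnum s (int j - int i) =
      s powi (int (p i) + int (p j)) * ((z ^ (m j + p j) - z ^ (m i + p i)) / (z ^ m j - z ^ m i))"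
    if "i < j" "j < L" for i j
  proof -
    have e: "int (p i) - int (p j) + int j - int i = int (m i + p i) - int (m j + p j)"
      "int j - int i = int (m i) - int (m j)" using that by (auto simp: m_def)
    show ?thesis
      unfolding e qnum_diff[OF s(1)] z_def[symmetric] power_int_of_nat
      using s(1) by (simp add: power_int_add)
  qed
  have row: "(\<Prod>v=1..n. 1 / qnum s (int k + int v)) = s powi (- (\<Sum>v=1..n. int k + int v)) * (qpoch z k / qpoch z (k + n))" for k n
  proof (induction n)
    case (Suc n)
    have "z powi (int k + int (Suc n)) = z ^ (k + Suc n)" by (metis of_nat_add power_int_of_nat)
    moreover have inv: "1 / (x * y) = inverse x * (1 / y)" for x y :: complex
      by (simp add: divide_inverse mult.commute)
    ultimately have step: "1 / qnum s (int k + int (Suc n)) =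
        s powi (- (int k + int (Suc n))) * (1 / (1 - z ^ (k + Suc n)))"
      by (simp only: qnum_eq[OF s(1)] z_def[symmetric] power_int_minus inv)
    have add: "s powi (- a) * s powi (- b) = s powi (- (a + b))" for a b
      using s(1) by (simp add: power_int_add[symmetric])
    have "(\<Prod>v=1..Suc n. 1 / qnum s (int k + int v)) =
        (s powi (- (\<Sum>v=1..n. int k + int v)) * s powi (- (int k + int (Suc n)))) *
        (qpoch z k / qpoch z (k + n) * (1 / (1 - z ^ (k + Suc n))))"
      using Suc step by (simp add: mult_ac)
    also have "qpoch z k / qpoch z (k + n) * (1 / (1 - z ^ (k + Suc n))) = qpoch z k / qpoch z (k + Suc n)"
      by (simp add: qpoch_Suc)
    finally have "(\<Prod>v=1..Suc n. 1 / qnum s (int k + int v)) =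
        s powi (- ((\<Sum>v=1..n. int k + int v) + (int k + int (Suc n)))) * (qpoch z k / qpoch z (k + Suc n))"
      unfolding add .
    moreover have "(\<Sum>v=1..Suc n. int k + int v) = (\<Sum>v=1..n. int k + int v) + (int k + int (Suc n))"
      by simp
    ultimately show ?case by (simp only:)
  qed (use qp in simp)
  define e where "e = kappa \<theta> div 2 + (\<Sum>j<L. \<Sum>i<j. int (p i) + int (p j)) - (\<Sum>i<L. \<Sum>v=1..p i. int (m i) + int v)"
  have "W1 s \<theta> = s powi (kappa \<theta> div 2)
      * (\<Prod>j<L. \<Prod>i<j. s powi (int (p i) + int (p j)) * ((z ^ (m j + p j) - z ^ (m i + p i)) / (z ^ m j - z ^ m i)))
      * (\<Prod>i<L. s powi (- (\<Sum>v=1..p i. int (m i) + int v)) * (qpoch z (m i) / qpoch z (m i + p i)))"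
  proof -
    have "(\<Prod>j<L. \<Prod>i<j. qnum s (int (p i) - int (p j) + int j - int i) / qnum s (int j - int i)) =
        (\<Prod>j<L. \<Prod>i<j. s powi (int (p i) + int (p j)) * ((z ^ (m j + p j) - z ^ (m i + p i)) / (z ^ m j - z ^ m i)))"
      by (rule cong2) (rule pair)
    then show ?thesis
      unfolding W1_zero_based L_def[symmetric] p_def[symmetric] m_def[symmetric] row by simp
  qed
  also have "\<dots> = s powi e * (V / V0) * (G0 / G)"
  proof -
    have "(\<Prod>j<L. \<Prod>i<j. s powi (int (p i) + int (p j)) * ((z ^ (m j + p j) - z ^ (m i + p i)) / (z ^ m j - z ^ m i))) =
        s powi (\<Sum>j<L. \<Sum>i<j. int (p i) + int (p j)) * (V / V0)"
      by (simp only: prod.distrib prod_dividef prod_powi[OF s(1)] V_def V0_def)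
    moreover have "(\<Prod>i<L. s powi (- (\<Sum>v=1..p i. int (m i) + int v)) * (qpoch z (m i) / qpoch z (m i + p i))) =
        s powi (- (\<Sum>i<L. \<Sum>v=1..p i. int (m i) + int v)) * (G0 / G)"
      by (simp only: prod.distrib prod_dividef prod_powi[OF s(1)] G_def G0_def sum_negf)
    ultimately show ?thesis
      unfolding e_def diff_conv_add_uminus by (simp only: power_int_add[OF disjI1[OF s(1)]] mult_ac)
  qed
  also have "e = - int (sum_list \<theta>)"
  proof -
    have pairs: "(\<Sum>j<n. \<Sum>i<j. int (p i) + int (p j)) = (int n - 1) * (\<Sum>i<n. int (p i))" for n
      by (induction n) (auto simp: sum.distrib algebra_simps)
    have rows: "2 * (\<Sum>v=1..n. int k + int v) = int n * (2 * int k + int n + 1)" for n k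
      by (induction n) (auto simp: algebra_simps)
    have kap: "2 * (kappa \<theta> div 2) = (\<Sum>i<L. int (p i) * (int (p i) - 2 * int i - 1))"
    proof -
      have "kappa \<theta> = (\<Sum>i<L. int (p i) * (int (p i) - 2 * int i - 1))"
        unfolding kappa_def L_def[symmetric] One_nat_def sum.atLeast1_atMost_eq p_def
        by (intro sum.cong) (auto simp: algebra_simps)
      moreover have "even (kappa \<theta>)" by (simp add: kappa_eq_contents)
      ultimately show ?thesis by simp
    qed
    have "2 * (\<Sum>i<L. \<Sum>v=1..p i. int (m i) + int v) = (\<Sum>i<L. int (p i) * (2 * int (m i) + int (p i) + 1))"
      by (subst sum_distrib_left) (simp only: rows)
    also have "\<dots> = (\<Sum>i<L. int (p i) * (2 * (int L - int i - 1) + int (p i) + 1))"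
      by (intro sum.cong refl) (auto simp: m_def of_nat_diff)
    finally have "2 * e = (\<Sum>i<L. int (p i) * (int (p i) - 2 * int i - 1)) + 2 * (int L - 1) * (\<Sum>i<L. int (p i))
        - (\<Sum>i<L. int (p i) * (2 * (int L - int i - 1) + int (p i) + 1))"
      using kap pairs[of L] by (simp add: e_def algebra_simps)
    also have "\<dots> = (\<Sum>i<L. - 2 * int (p i))"
      unfolding sum_distrib_left sum_subtractf[symmetric] sum.distrib[symmetric]
      by (intro sum.cong refl) (simp add: algebra_simps)
    also have "\<dots> = - 2 * int (sum_list \<theta>)"
      using sum_list_eq_sum_part'[of \<theta> L] by (simp add: L_def p_def sum_distrib_left[symmetric] sum_negf)
    finally show ?thesis by simp
  qed
  finally have "W1 s \<theta> = s powi (- int (sum_list \<theta>)) * (V / V0) * (G0 / G)" .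
  then show "W1 s \<theta> * jt_det (inverse (s^2)) (length \<theta>) [] =
      s powi (- int (sum_list \<theta>)) * jt_det (inverse (s^2)) (length \<theta>) \<theta>"
    unfolding z_def[symmetric] L_def[symmetric] jt jt0 using nz by (simp add: divide_simps)
qed

text \<open>The quantum dimension \<open>W\<^sub>\<mu>\<close> is the value of the Schur function at \<open>q\<^sup>\<rho>\<close>: both satisfy the
  recursion given by removing the first variable of a geometric progression.\<close>

theorem W1_eq_schur_val:
  fixes s :: complex
  assumes s: "s \<noteq> 0" "\<And>n. n \<ge> 1 \<Longrightarrow> (s^2) ^ n \<noteq> 1" and part: "is_partition \<theta>"
  shows "W1 s \<theta> = schur_val (psum_at s []) \<theta>"
proof -
  define z where "z = inverse (s^2)"
  define L where "L = length \<theta>"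
  have z: "z \<noteq> 0" "\<And>n. n \<ge> 1 \<Longrightarrow> z ^ n \<noteq> 1"
    using s by (auto simp: z_def power_inverse)
  define \<phi> where "\<phi> n = 1 / (1 - z ^ n)" for n
  have Y: "schur_val \<phi> \<theta> = (\<Sum>\<mu> | is_partition \<mu> \<and> hstrip \<mu> \<theta>. z ^ sum_list \<mu> * schur_val \<phi> \<mu>)"
    if "is_partition \<theta>" for \<theta>
  proof -
    have "schur_val \<phi> \<theta> = schur_val (\<lambda>n. 1 + z ^ n * \<phi> n) \<theta>"
      using z(2) by (intro schur_val_cong that) (auto simp: \<phi>_def divide_simps)
    then show ?thesis by (simp add: schur_val_branching[OF that] schur_val_scale)
  qed
  have "jt_det z L \<theta> * schur_val \<phi> [] = schur_val \<phi> \<theta> * jt_det z L []"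
  proof (rule branching_unique[of z L])
    show "length \<theta> \<le> L" by (simp add: L_def)
  qed (use z jt_det_branching[OF z] Y part in auto)
  then have eq: "jt_det z L \<theta> = schur_val \<phi> \<theta> * jt_det z L []" by simp
  have W: "W1 s \<theta> * jt_det z L [] = s powi (- int (sum_list \<theta>)) * jt_det z L \<theta>" "jt_det z L [] \<noteq> 0"
    using W1_eq_jt_det[OF s(1) _ part] z(2) by (auto simp: z_def L_def)
  have "schur_val (psum_at s []) \<theta> = schur_val (\<lambda>n. inverse s ^ n * \<phi> n) \<theta>"
  proof (rule schur_val_cong[OF _ part])
    fix n :: nat assume "n \<ge> 1"
    have "psum_at s [] n = 1 / (s ^ n * (1 - z ^ n))"
      by (simp add: psum_at_def qnum_eq[OF s(1)] z_def)
    then show "psum_at s [] n = inverse s ^ n * \<phi> n"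
      by (simp add: \<phi>_def divide_simps power_inverse)
  qed
  also have "\<dots> = inverse s ^ sum_list \<theta> * schur_val \<phi> \<theta>"
    by (rule schur_val_scale[OF part])
  finally show ?thesis
    using W eq by (simp add: power_int_minus power_inverse)
qed

section \<open>Contents and transposition\<close>

lemma part_conj:
  assumes "is_partition \<mu>" "1 \<le> j"
  shows "part (conj_part \<mu>) j = card {i. j \<le> part \<mu> i}"
proof (cases "j \<le> part \<mu> 1")
  case True
  have "length (conj_part \<mu>) = part \<mu> 1" by (simp add: conj_part_def del: upt_Suc)
  then have "part (conj_part \<mu>) j = conj_part \<mu> ! (j - 1)"
    using True assms(2) by (simp add: part_def[of "conj_part \<mu>"])
  also have "\<dots> = card {i. j \<le> part \<mu> i}"
    unfolding conj_part_def using True assms(2) by (subst nth_map) (auto simp del: upt_Suc)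
  finally show ?thesis .
next
  case False
  have "\<not> j \<le> part \<mu> i" for i
    using part_antimono[OF assms(1), of 1 i] False assms(2) by (cases "i = 0") auto
  then show ?thesis using False by (simp add: conj_part_def part_def del: upt_Suc)
qed

text \<open>The columns of a diagram are intervals, so a column is known by its length.\<close>

lemma column_eq_interval:
  assumes "is_partition \<mu>" "1 \<le> j"
  shows "{i. j \<le> part \<mu> i} = {1..card {i. j \<le> part \<mu> i}}"
proof -
  let ?C = "{i. j \<le> part \<mu> i}"
  have pos: "1 \<le> i" "i \<le> length \<mu>" if "i \<in> ?C" for i
    using that assms(2) part_beyond_length[of \<mu> i] by (cases i; force)+
  have fin: "finite ?C"
    by (rule finite_subset[of _ "{..length \<mu>}"]) (use pos in auto)
  have down: "k \<in> ?C" if "i \<in> ?C" "1 \<le> k" "k \<le> i" for i k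
    using part_antimono[OF assms(1) that(2,3)] that(1) by simp
  have "?C = {1..Max (insert 0 ?C)}"
  proof (intro equalityI subsetI)
    fix i assume "i \<in> ?C"
    then show "i \<in> {1..Max (insert 0 ?C)}" using pos fin by (auto intro: Max_ge)
  next
    fix i assume i: "i \<in> {1..Max (insert 0 ?C)}"
    have "Max (insert 0 ?C) \<in> insert 0 ?C" using fin by (intro Max_in) auto
    moreover have "Max (insert 0 ?C) \<noteq> 0" using i by simp
    ultimately have "Max (insert 0 ?C) \<in> ?C" by blast
    then show "i \<in> ?C" by (rule down) (use i in auto)
  qed
  then obtain k where k: "?C = {1..k}" by blast
  then have "card ?C = k" by simp
  with k show ?thesis by simp
qed

lemma le_part_conj_iff:
  assumes "is_partition \<mu>" "1 \<le> i" "1 \<le> j"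
  shows "i \<le> part (conj_part \<mu>) j \<longleftrightarrow> j \<le> part \<mu> i"
proof -
  have "j \<le> part \<mu> i \<longleftrightarrow> i \<in> {i. j \<le> part \<mu> i}" by simp
  also have "\<dots> \<longleftrightarrow> i \<in> {1..card {i. j \<le> part \<mu> i}}"
    using column_eq_interval[OF assms(1,3)] by blast
  finally show ?thesis using assms by (simp add: part_conj)
qed

lemma is_partition_conj [simp]:
  assumes "is_partition \<mu>"
  shows "is_partition (conj_part \<mu>)"
proof -
  have len: "length (conj_part \<mu>) = part \<mu> 1" by (simp add: conj_part_def del: upt_Suc)
  have nth: "conj_part \<mu> ! i = part (conj_part \<mu>) (Suc i)" if "i < part \<mu> 1" for i
    using that len by (simp add: part_def)
  have "conj_part \<mu> ! j \<le> conj_part \<mu> ! i" if "i < j" "j < part \<mu> 1" for i j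
  proof -
    have "Suc i \<le> part \<mu> k" if "k \<ge> 1" "Suc j \<le> part \<mu> k" for k
      using that \<open>i < j\<close> by simp
    then have "k \<le> part (conj_part \<mu>) (Suc i)" if "1 \<le> k" "k \<le> part (conj_part \<mu>) (Suc j)" for k
      using that assms by (simp add: le_part_conj_iff)
    then show ?thesis using that by (cases "part (conj_part \<mu>) (Suc j)") (auto simp: nth)
  qed
  moreover have "conj_part \<mu> ! i \<noteq> 0" if "i < part \<mu> 1" for i
    using that le_part_conj_iff[OF assms, of 1 "Suc i"] by (simp add: nth)
  ultimately show ?thesis
    unfolding is_partition_def sorted_wrt_iff_nth_less in_set_conv_nth len by auto
qed

lemma cells_conj: "is_partition \<mu> \<Longrightarrow> cells (conj_part \<mu>) = prod.swap ` cells \<mu>"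
  by (auto simp: cells_def le_part_conj_iff image_iff)

lemma sum_cells_conj:
  assumes "is_partition \<mu>"
  shows "(\<Sum>(i, j)\<in>cells (conj_part \<mu>). f i j) = (\<Sum>(i, j)\<in>cells \<mu>. f j i)"
  unfolding cells_conj[OF assms] by (subst sum.reindex) (auto simp: case_prod_unfold intro!: sum.cong)

lemma conj_conj [simp]:
  assumes "is_partition \<mu>"
  shows "conj_part (conj_part \<mu>) = \<mu>"
  using assms by (intro partition_eq_cellsI) (auto simp: cells_conj image_image)

lemma sum_list_conj [simp]: "is_partition \<mu> \<Longrightarrow> sum_list (conj_part \<mu>) = sum_list \<mu>"
  unfolding card_cells[symmetric] by (simp add: cells_conj card_image)

lemma kappa_conj: "is_partition \<mu> \<Longrightarrow> kappa (conj_part \<mu>) = - kappa \<mu>"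
  using sum_cells_conj[of \<mu> "\<lambda>i j. int j - int i"]
  by (simp add: kappa_eq_contents case_prod_unfold sum_negf[symmetric])

lemma sum_cells_rows:
  assumes "length \<mu> \<le> K"
  shows "(\<Sum>(i, j)\<in>cells \<mu>. f i j) = (\<Sum>i=1..K. \<Sum>j=1..part \<mu> i. f i j)"
proof -
  have "(\<Sum>(i, j)\<in>cells \<mu>. f i j) = (\<Sum>i=1..length \<mu>. \<Sum>j=1..part \<mu> i. f i j)"
    unfolding cells_eq_Sigma by (subst sum.Sigma) auto
  also have "\<dots> = (\<Sum>i=1..K. \<Sum>j=1..part \<mu> i. f i j)"
    using assms by (intro sum.mono_neutral_left) (auto simp: part_beyond_length)
  finally show ?thesis .
qed

lemma telescope_up:
  fixes f :: "int \<Rightarrow> 'a :: ab_group_add"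
  shows "(\<Sum>j=1..n. f (a + int j) - f (a + int j - 1)) = f (a + int n) - f a"
  by (induction n) (auto simp: algebra_simps)

lemma telescope_down:
  fixes f :: "int \<Rightarrow> 'a :: ab_group_add"
  shows "(\<Sum>j=1..n. f (a - int j + 1) - f (a - int j)) = f a - f (a - int n)"
  by (induction n) (auto simp: algebra_simps)

lemma qnum_mult_powi:
  assumes "s \<noteq> 0"
  shows "qnum s a * s powi b = s powi (b + a) - s powi (b - a)"
  using assms by (simp add: qnum_def left_diff_distrib power_int_add[symmetric] add.commute)

lemma qnum_square:
  assumes "s \<noteq> 0"
  shows "(qnum s a)^2 = s powi (2 * a) + s powi (- (2 * a)) - 2"
proof -
  have "s powi a * s powi a = s powi (2 * a)" "s powi (- a) * s powi (- a) = s powi (- (2 * a))"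
    "s powi a * s powi (- a) = 1"
    using assms by (simp_all add: power_int_add[symmetric])
  then show ?thesis by (simp add: qnum_def power2_eq_square algebra_simps)
qed

text \<open>Summing the row \<open>q\<^bsup>\<mu>\<^sub>i - i + 1/2\<^esup> - q\<^bsup>- i + 1/2\<^esup>\<close> as a geometric progression turns the
  power sums into content sums, for which transposition is a change of sign.\<close>

lemma psum_at_contents:
  assumes "s \<noteq> 0"
  shows "psum_at s \<mu> n = qnum s (int n) * (\<Sum>(i, j)\<in>cells \<mu>. s powi (2 * int n * (int j - int i))) + 1 / qnum s (int n)"
proof -
  let ?f = "\<lambda>m. s powi (int n * (2 * m + 1))"
  have step: "?f m - ?f (m - 1) = qnum s (int n) * s powi (2 * int n * m)" for m
    unfolding qnum_mult_powi[OF assms] by (simp add: algebra_simps)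
  have "s powi (int n * (2 * int (part \<mu> i) - 2 * int i + 1)) - s powi (int n * (- 2 * int i + 1)) =
      (\<Sum>j=1..part \<mu> i. qnum s (int n) * s powi (2 * int n * (int j - int i)))" for i
    using telescope_up[of ?f "- int i" "part \<mu> i"]
    unfolding step by (simp add: algebra_simps)
  then show ?thesis
    unfolding psum_at_def sum_cells_rows[OF order_refl] by (simp add: sum_distrib_left)
qed


section \<open>The exponents of the infinite products\<close>

definition cell_content :: "nat \<times> nat \<Rightarrow> int" where
  "cell_content x = int (snd x) - int (fst x)"

text \<open>The formal double sum over all \<open>i, j \<ge> 1\<close> in closed form: minus the value of this functional
  at \<open>f m = t ^ m\<close> is \<open>\<Sum>\<^bsub>i,j\<^esub> (t\<^bsup>\<nu>\<^sub>i - \<mu>\<^sub>j + j - i\<^esup> - t\<^bsup>j - i\<^esup>)\<close>.\<close>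

definition content_sum :: "nat list \<Rightarrow> nat list \<Rightarrow> (int \<Rightarrow> 'a :: comm_ring_1) \<Rightarrow> 'a" where
  "content_sum \<nu> \<mu> f = (\<Sum>x\<in>cells \<nu>. f (cell_content x)) + (\<Sum>y\<in>cells \<mu>. f (- cell_content y)) +
     (\<Sum>x\<in>cells \<nu>. \<Sum>y\<in>cells \<mu>. f (cell_content x - cell_content y + 1) + f (cell_content x - cell_content y - 1)
        - 2 * f (cell_content x - cell_content y))"

text \<open>The double sum restricted to a square. The corrections at the far end of the square vanish
  coefficientwise once the square is large.\<close>

lemma box_sum_contents:
  fixes f :: "int \<Rightarrow> 'a :: comm_ring_1"
  assumes "length \<nu> \<le> K" "length \<mu> \<le> K"
  shows "(\<Sum>i=1..K. \<Sum>j=1..K. f (int (part \<nu> i) - int (part \<mu> j) + int j - int i) - f (int j - int i)) =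
    (\<Sum>x\<in>cells \<nu>. f (cell_content x + int K)) + (\<Sum>y\<in>cells \<mu>. f (- cell_content y - int K)) - content_sum \<nu> \<mu> f"
proof -
  let ?n = "\<lambda>i. int (part \<nu> i)" and ?m = "\<lambda>j. int (part \<mu> j)"
  let ?h = "\<lambda>i p \<beta>. f (int p - int i + \<beta>) - f (int p - int i + \<beta> - 1)"
  have row: "f (?n i - int i + \<beta>) - f (- int i + \<beta>) = (\<Sum>p=1..part \<nu> i. ?h i p \<beta>)" for i \<beta>
    using telescope_up[of "\<lambda>x. f (x + \<beta>)" "- int i" "part \<nu> i"] by (simp add: algebra_simps)
  have col: "h (int j - ?m j) - h (int j) = - (\<Sum>r=1..part \<mu> j. h (int j - int r + 1) - h (int j - int r))"
    for h :: "int \<Rightarrow> 'a" and j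
    using telescope_down[of h "int j" "part \<mu> j"] by simp
  have A: "(\<Sum>i=1..K. \<Sum>j=1..K. f (?n i - int i + int j) - f (- int i + int j)) =
      (\<Sum>(i, p)\<in>cells \<nu>. f (int p - int i + int K) - f (int p - int i))"
  proof -
    have "(\<Sum>j=1..K. \<Sum>p=1..part \<nu> i. ?h i p (int j)) = (\<Sum>p=1..part \<nu> i. f (int p - int i + int K) - f (int p - int i))" for i
      by (subst sum.swap, rule sum.cong[OF refl], rule telescope_up)
    then show ?thesis unfolding row sum_cells_rows[OF assms(1)] by simp
  qed
  have B: "(\<Sum>i=1..K. \<Sum>j=1..K. f (- int i + (int j - ?m j)) - f (- int i + int j)) =
      - (\<Sum>(j, r)\<in>cells \<mu>. f (int j - int r) - f (int j - int r - int K))"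
  proof -
    have "(\<Sum>i=1..K. \<Sum>r=1..part \<mu> j. f (- int i + (int j - int r + 1)) - f (- int i + (int j - int r))) =
        (\<Sum>r=1..part \<mu> j. f (int j - int r) - f (int j - int r - int K))" for j
    proof (subst sum.swap, rule sum.cong[OF refl])
      fix r
      show "(\<Sum>i=1..K. f (- int i + (int j - int r + 1)) - f (- int i + (int j - int r))) =
          f (int j - int r) - f (int j - int r - int K)"
        using telescope_down[of f "int j - int r" K] by (simp add: algebra_simps)
    qed
    then show ?thesis
      unfolding col[of "\<lambda>\<beta>. f (- int _ + \<beta>)"] sum_cells_rows[OF assms(2)]
      by (subst sum.swap) (simp add: sum_negf)
  qed
  have C: "(\<Sum>i=1..K. \<Sum>j=1..K. (f (?n i - int i + (int j - ?m j)) - f (- int i + (int j - ?m j))) -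
        (f (?n i - int i + int j) - f (- int i + int j))) =
      - (\<Sum>(i, p)\<in>cells \<nu>. \<Sum>(j, r)\<in>cells \<mu>. f (int p - int i - (int r - int j) + 1)
          + f (int p - int i - (int r - int j) - 1) - 2 * f (int p - int i - (int r - int j)))"
  proof -
    have "(f (?n i - int i + (int j - ?m j)) - f (- int i + (int j - ?m j))) - (f (?n i - int i + int j) - f (- int i + int j)) =
        - (\<Sum>p=1..part \<nu> i. \<Sum>r=1..part \<mu> j. f (int p - int i - (int r - int j) + 1)
          + f (int p - int i - (int r - int j) - 1) - 2 * f (int p - int i - (int r - int j)))" for i j
      unfolding row sum_subtractf[symmetric] col[of "?h i _"] sum_negf
      by (simp add: algebra_simps)
    then show ?thesis
      unfolding sum_cells_rows[OF assms(1)] sum_cells_rows[OF assms(2)]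
      by (simp add: sum_negf) (rule sum.cong[OF refl], rule sum.swap)
  qed
  have "(\<Sum>i=1..K. \<Sum>j=1..K. f (?n i - ?m j + int j - int i) - f (int j - int i)) =
      (\<Sum>i=1..K. \<Sum>j=1..K. f (?n i - int i + int j) - f (- int i + int j)) +
      (\<Sum>i=1..K. \<Sum>j=1..K. f (- int i + (int j - ?m j)) - f (- int i + int j)) +
      (\<Sum>i=1..K. \<Sum>j=1..K. (f (?n i - int i + (int j - ?m j)) - f (- int i + (int j - ?m j))) -
        (f (?n i - int i + int j) - f (- int i + int j)))"
    unfolding sum.distrib[symmetric] by (intro sum.cong refl) (simp add: algebra_simps)
  then show ?thesis
    unfolding A B C content_sum_def cell_content_def by (simp add: case_prod_unfold sum_subtractf)
qed

lemma content_bounds: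
  assumes "x \<in> cells \<mu>"
  shows "- int (length \<mu>) \<le> cell_content x" "cell_content x \<le> int (sum_list \<mu>)"
  using assms part_le_sum_list[of \<mu> "fst x"] by (auto simp: cells_eq_Sigma cell_content_def)

lemma e_coeff_eq_box:
  assumes "nat \<bar>m\<bar> + sum_list \<nu> + sum_list \<mu> + length \<nu> + length \<mu> \<le> K"
  shows "e_coeff \<nu> \<mu> m = (\<Sum>i=1..K. \<Sum>j=1..K.
    of_bool (int (part \<nu> i) - int (part \<mu> j) + int j - int i = m) - of_bool (int j - int i = m))"
    and "finite {(i, j). 1 \<le> i \<and> 1 \<le> j \<and>
      (int (part \<nu> i) - int (part \<mu> j) + int j - int i = m) \<noteq> (int j - int i = m)}"
proof -
  let ?u = "\<lambda>i j. int (part \<nu> i) - int (part \<mu> j) + int j - int i = m" and ?w = "\<lambda>i j. int j - int i = m"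
  let ?A = "{(i, j). 1 \<le> i \<and> 1 \<le> j \<and> ?u i j \<noteq> ?w i j}"
  have sub: "?A \<subseteq> {1..K} \<times> {1..K}"
  proof (rule subrelI)
    fix i j assume "(i, j) \<in> ?A"
    then have ij: "1 \<le> i" "1 \<le> j" "?u i j \<noteq> ?w i j" by auto
    have pi: "part \<nu> i \<le> sum_list \<nu>" "part \<mu> j \<le> sum_list \<mu>" by (rule part_le_sum_list)+
    have "i \<le> length \<nu> \<or> j \<le> length \<mu>"
      using ij(3) part_beyond_length[of \<nu> i] part_beyond_length[of \<mu> j] by fastforce
    then have "i \<le> K \<and> j \<le> K"
      using ij(3) pi assms by (auto split: if_splits)
    then show "(i, j) \<in> {1..K} \<times> {1..K}" using ij by simp
  qed
  show "finite ?A" by (rule finite_subset[OF sub]) simp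
  have "e_coeff \<nu> \<mu> m = (\<Sum>(i, j)\<in>?A. of_bool (?u i j) - of_bool (?w i j))"
    by (simp add: e_coeff_def Let_def)
  also have "\<dots> = (\<Sum>(i, j)\<in>{1..K} \<times> {1..K}. of_bool (?u i j) - of_bool (?w i j))"
    by (rule sum.mono_neutral_left[OF _ sub]) auto
  finally show "e_coeff \<nu> \<mu> m = (\<Sum>i=1..K. \<Sum>j=1..K. of_bool (?u i j) - of_bool (?w i j))"
    by (simp add: sum.cartesian_product)
qed

lemma e_coeff_eq_content_sum: "e_coeff \<nu> \<mu> m = - content_sum \<nu> \<mu> (\<lambda>k. of_bool (k = m))"
proof -
  define K where "K = Suc (nat \<bar>m\<bar> + sum_list \<nu> + sum_list \<mu> + length \<nu> + length \<mu>)"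
  have "(\<Sum>x\<in>cells \<nu>. of_bool (cell_content x + int K = m)) = (0 :: int)"
    using content_bounds(1)[of _ \<nu>] by (intro sum.neutral) (fastforce simp: K_def)
  moreover have "(\<Sum>y\<in>cells \<mu>. of_bool (- cell_content y - int K = m)) = (0 :: int)"
    using content_bounds(1)[of _ \<mu>] by (intro sum.neutral) (fastforce simp: K_def)
  ultimately show ?thesis
    using box_sum_contents[of \<nu> K \<mu> "\<lambda>k. of_bool (k = m) :: int"] e_coeff_eq_box(1)[of m \<nu> \<mu> K]
    by (simp add: K_def)
qed

text \<open>A finite set that contains all exponents, which allows sums over the support of the
  exponents to be rearranged.\<close>

definition content_range :: "nat list \<Rightarrow> nat list \<Rightarrow> int set" where
  "content_range \<nu> \<mu> = cell_content ` cells \<nu> \<union> (\<lambda>y. - cell_content y) ` cells \<mu> \<union>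
     (\<lambda>(x, y). cell_content x - cell_content y) ` (cells \<nu> \<times> cells \<mu>) \<union>
     (\<lambda>(x, y). cell_content x - cell_content y + 1) ` (cells \<nu> \<times> cells \<mu>) \<union>
     (\<lambda>(x, y). cell_content x - cell_content y - 1) ` (cells \<nu> \<times> cells \<mu>)"

lemma finite_content_range [simp]: "finite (content_range \<nu> \<mu>)"
  by (simp add: content_range_def)

lemma content_sum_cong:
  assumes "\<And>m. m \<in> content_range \<nu> \<mu> \<Longrightarrow> f m = g m"
  shows "content_sum \<nu> \<mu> f = content_sum \<nu> \<mu> g"
  unfolding content_sum_def
  by (intro arg_cong2[of _ _ _ _ "(+)"] arg_cong2[of _ _ _ _ "(-)"] arg_cong2[of _ _ _ _ "(*)"] sum.cong refl assms)
     (auto simp: content_range_def)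

lemma content_sum_add: "content_sum \<nu> \<mu> (\<lambda>k. f k + g k) = content_sum \<nu> \<mu> f + content_sum \<nu> \<mu> g"
  unfolding content_sum_def by (simp add: sum.distrib sum_subtractf sum_distrib_left[symmetric] distrib_left)

lemma content_sum_zero: "content_sum \<nu> \<mu> (\<lambda>_. 0) = 0"
  by (simp add: content_sum_def)

lemma e_coeff_outside: "m \<notin> content_range \<nu> \<mu> \<Longrightarrow> e_coeff \<nu> \<mu> m = 0"
  unfolding e_coeff_eq_content_sum
  by (subst content_sum_cong[of _ _ _ "\<lambda>_. 0"]) (auto simp: content_sum_zero)

lemma finite_e_coeff: "finite {m. e_coeff \<nu> \<mu> m \<noteq> 0}"
  by (rule finite_subset[OF _ finite_content_range[of \<nu> \<mu>]]) (use e_coeff_outside in blast)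

text \<open>The closed form is linear in \<open>f\<close> and is known on indicator functions.\<close>

lemma sum_e_coeff:
  fixes f :: "int \<Rightarrow> 'a :: comm_ring_1"
  shows "(\<Sum>m | e_coeff \<nu> \<mu> m \<noteq> 0. of_int (e_coeff \<nu> \<mu> m) * f m) = - content_sum \<nu> \<mu> f"
proof -
  let ?R = "content_range \<nu> \<mu>"
  have sum_delta: "(\<Sum>m\<in>?R. of_bool (k = m) * f m) = f k" if "k \<in> ?R" for k
    using that by (simp add: of_bool_def if_distrib[of "\<lambda>c. c * _"] cong: if_cong)
  have "(\<Sum>m | e_coeff \<nu> \<mu> m \<noteq> 0. of_int (e_coeff \<nu> \<mu> m) * f m) = (\<Sum>m\<in>?R. of_int (e_coeff \<nu> \<mu> m) * f m)"
    by (rule sum.mono_neutral_left) (use e_coeff_outside in auto)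
  also have "\<dots> = (\<Sum>m\<in>?R. - (content_sum \<nu> \<mu> (\<lambda>k. of_bool (k = m) * f m)))"
  proof (rule sum.cong[OF refl])
    fix m
    have "(of_int (content_sum \<nu> \<mu> (\<lambda>k. of_bool (k = m))) :: 'a) = content_sum \<nu> \<mu> (\<lambda>k. of_bool (k = m))"
      by (simp add: content_sum_def)
    then show "of_int (e_coeff \<nu> \<mu> m) * f m = - content_sum \<nu> \<mu> (\<lambda>k. of_bool (k = m) * f m)"
      by (simp add: e_coeff_eq_content_sum) (simp add: content_sum_def algebra_simps sum_distrib_left)
  qed
  also have "\<dots> = - content_sum \<nu> \<mu> (\<lambda>k. \<Sum>m\<in>?R. of_bool (k = m) * f m)"
  proof -
    have "(\<Sum>m\<in>A. content_sum \<nu> \<mu> (g m)) = content_sum \<nu> \<mu> (\<lambda>k. \<Sum>m\<in>A. g m k)" if "finite A"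
      for A :: "int set" and g :: "int \<Rightarrow> int \<Rightarrow> 'a"
      using that
      by (induction A rule: finite_induct) (simp_all add: content_sum_add content_sum_zero)
    then show ?thesis by (simp add: sum_negf)
  qed
  also have "content_sum \<nu> \<mu> (\<lambda>k. \<Sum>m\<in>?R. of_bool (k = m) * f m) = content_sum \<nu> \<mu> f"
    by (rule content_sum_cong) (rule sum_delta)
  finally show ?thesis .
qed

text \<open>The interaction term is a second difference, which vanishes on constants, and also on linear
  functions in the next lemma.\<close>

lemma sum_e_coeff_total: "(\<Sum>m | e_coeff \<nu> \<mu> m \<noteq> 0. e_coeff \<nu> \<mu> m) = - int (sum_list \<nu> + sum_list \<mu>)"
  using sum_e_coeff[of \<nu> \<mu> "\<lambda>_. 1 :: int"] by (simp add: content_sum_def card_cells)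

lemma sum_e_coeff_moment:
  "2 * (\<Sum>m | e_coeff \<nu> \<mu> m \<noteq> 0. e_coeff \<nu> \<mu> m * m) = kappa \<mu> - kappa \<nu>"
  using sum_e_coeff[of \<nu> \<mu> "\<lambda>m. m :: int"]
  by (simp add: content_sum_def kappa_eq_contents cell_content_def case_prod_unfold sum_subtractf)

text \<open>The product of the power sums at \<open>q\<^bsup>\<nu> + \<rho>\<^esup>\<close> and \<open>q\<^bsup>\<mu>\<^sup>t + \<rho>\<^esup>\<close> differs from its value for empty
  partitions by a Laurent polynomial in \<open>q\<^sup>n\<close>, whose exponents are those of the products of
  hyperbolic sines: the cross term carries the factor \<open>q\<^sup>n - 2 + q\<^sup>-\<^sup>n\<close>, which is the second difference
  in the closed form of the exponents.\<close>

lemma psum_at_product: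
  fixes s :: complex
  assumes s: "s \<noteq> 0" "qnum s (int n) \<noteq> 0" and \<mu>: "is_partition \<mu>"
  shows "psum_at s \<nu> n * psum_at s (conj_part \<mu>) n = (psum_at s [] n)^2 -
    (\<Sum>m | e_coeff \<nu> \<mu> m \<noteq> 0. of_int (e_coeff \<nu> \<mu> m) * (s powi (2 * m)) ^ n)"
proof -
  let ?f = "\<lambda>m. s powi (2 * int n * m)"
  define A where "A = (\<Sum>x\<in>cells \<nu>. ?f (cell_content x))"
  define B where "B = (\<Sum>y\<in>cells \<mu>. ?f (- cell_content y))"
  have sq: "(qnum s (int n))^2 = ?f 1 + ?f (- 1) - 2"
    using qnum_square[OF s(1), of "int n"] by (simp add: algebra_simps)
  have "(\<Sum>x\<in>cells \<nu>. \<Sum>y\<in>cells \<mu>. ?f (cell_content x - cell_content y + 1) + ?f (cell_content x - cell_content y - 1)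
        - 2 * ?f (cell_content x - cell_content y)) = (\<Sum>x\<in>cells \<nu>. \<Sum>y\<in>cells \<mu>. (?f (cell_content x) * ?f (- cell_content y)) * (qnum s (int n))^2)"
  proof (intro sum.cong refl)
    fix x y :: "nat \<times> nat"
    have add: "?f (a + b) = ?f a * ?f b" for a b
      using s(1) by (simp add: power_int_add[symmetric] algebra_simps)
    have "?f (cell_content x - cell_content y + 1) = ?f (cell_content x) * ?f (- cell_content y) * ?f 1"
      "?f (cell_content x - cell_content y - 1) = ?f (cell_content x) * ?f (- cell_content y) * ?f (- 1)"
      "?f (cell_content x - cell_content y) = ?f (cell_content x) * ?f (- cell_content y)"
      using add[of "cell_content x + - cell_content y" 1] add[of "cell_content x + - cell_content y" "- 1"] add[of "cell_content x" "- cell_content y"]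
      by simp_all
    then show "?f (cell_content x - cell_content y + 1) + ?f (cell_content x - cell_content y - 1) - 2 * ?f (cell_content x - cell_content y) =
        (?f (cell_content x) * ?f (- cell_content y)) * (qnum s (int n))^2"
      unfolding sq by (simp only: distrib_left right_diff_distrib mult_ac)
  qed
  also have "\<dots> = A * B * (qnum s (int n))^2"
    unfolding A_def B_def sum_product by (simp only: sum_distrib_right)
  finally have cs: "content_sum \<nu> \<mu> ?f = A + B + A * B * (qnum s (int n))^2"
    by (simp only: content_sum_def A_def[symmetric] B_def[symmetric])
  have f: "?f m = (s powi (2 * m)) ^ n" for m
    by (simp add: power_int_mult[symmetric] mult_ac flip: power_int_of_nat)
  have "psum_at s \<nu> n * psum_at s (conj_part \<mu>) n = (qnum s (int n) * A + 1 / qnum s (int n)) * (qnum s (int n) * B + 1 / qnum s (int n))"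
    unfolding psum_at_contents[OF s(1)] sum_cells_conj[OF \<mu>] A_def B_def cell_content_def
    by (simp add: case_prod_unfold)
  also have "\<dots> = (1 / qnum s (int n))^2 + content_sum \<nu> \<mu> ?f"
    unfolding cs using s(2) by (simp add: field_simps power2_eq_square)
  also have "content_sum \<nu> \<mu> ?f = - (\<Sum>m | e_coeff \<nu> \<mu> m \<noteq> 0. of_int (e_coeff \<nu> \<mu> m) * ?f m)"
    by (simp add: sum_e_coeff)
  finally show ?thesis by (simp add: f psum_at_def)
qed

text \<open>For \<open>m > 0\<close> a pair \<open>i \<ge> j\<close> contributes to neither of the two monomials.\<close>

lemma e_coeff'_eq: "m \<ge> 1 \<Longrightarrow> is_partition \<mu> \<Longrightarrow> e_coeff' \<mu> m = e_coeff \<mu> \<mu> m"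
proof -
  assume m: "m \<ge> 1" and \<mu>: "is_partition \<mu>"
  let ?u = "\<lambda>i j. int (part \<mu> i) - int (part \<mu> j) + int j - int i = m" and ?w = "\<lambda>i j. int j - int i = m"
  have "{(i, j). 1 \<le> i \<and> i < j \<and> ?u i j \<noteq> ?w i j} = {(i, j). 1 \<le> i \<and> 1 \<le> j \<and> ?u i j \<noteq> ?w i j}"
  proof (intro equalityI subrelI)
    fix i j assume "(i, j) \<in> {(i, j). 1 \<le> i \<and> 1 \<le> j \<and> ?u i j \<noteq> ?w i j}"
    then have ij: "1 \<le> i" "1 \<le> j" "?u i j \<noteq> ?w i j" by auto
    have "i < j"
    proof (rule ccontr)
      assume "\<not> i < j"
      then have "part \<mu> i \<le> part \<mu> j" using part_antimono[OF \<mu> ij(2)] by simp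
      then show False using ij(3) m \<open>\<not> i < j\<close> by auto
    qed
    then show "(i, j) \<in> {(i, j). 1 \<le> i \<and> i < j \<and> ?u i j \<noteq> ?w i j}" using ij by auto
  qed auto
  then show ?thesis by (simp add: e_coeff_def e_coeff'_def Let_def)
qed

text \<open>Transposition exchanges the contents of the two diagrams and changes their sign; in closed form
  this is an evident symmetry when both partitions are the same.\<close>

lemma e_coeff'_conj:
  assumes "m \<ge> 1" "is_partition \<mu>"
  shows "e_coeff' (conj_part \<mu>) m = e_coeff' \<mu> m"
proof -
  let ?f = "\<lambda>k. of_bool (k = m) :: int"
  have swap: "(\<Sum>x\<in>cells (conj_part \<mu>). g (cell_content x)) = (\<Sum>x\<in>cells \<mu>. g (- cell_content x))" for g :: "int \<Rightarrow> int"
    using sum_cells_conj[OF assms(2), of "\<lambda>i j. g (int j - int i)"]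
    by (simp add: cell_content_def case_prod_unfold)
  have swap': "(\<Sum>x\<in>cells (conj_part \<mu>). g (- cell_content x)) = (\<Sum>x\<in>cells \<mu>. g (cell_content x))" for g :: "int \<Rightarrow> int"
    using swap[of "\<lambda>k. g (- k)"] by simp
  let ?g = "\<lambda>d. ?f (d + 1) + ?f (d - 1) - 2 * ?f d"
  have "(\<Sum>x\<in>cells (conj_part \<mu>). \<Sum>y\<in>cells (conj_part \<mu>). ?g (cell_content x - cell_content y)) =
      (\<Sum>x\<in>cells \<mu>. \<Sum>y\<in>cells \<mu>. ?g (- cell_content x - - cell_content y))"
    by (subst swap[of "\<lambda>c. \<Sum>y\<in>cells (conj_part \<mu>). ?g (c - cell_content y)"],
        subst swap[of "\<lambda>c. ?g (- cell_content _ - c)"], rule refl)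
  also have "\<dots> = (\<Sum>x\<in>cells \<mu>. \<Sum>y\<in>cells \<mu>. ?g (cell_content y - cell_content x))"
    by simp
  also have "\<dots> = (\<Sum>x\<in>cells \<mu>. \<Sum>y\<in>cells \<mu>. ?g (cell_content x - cell_content y))"
    by (rule sum.swap)
  finally have "content_sum (conj_part \<mu>) (conj_part \<mu>) ?f = content_sum \<mu> \<mu> ?f"
    unfolding content_sum_def swap[of ?f] swap'[of ?f] by (simp only: add_ac)
  then show ?thesis
    using assms by (simp add: e_coeff'_eq e_coeff_eq_content_sum)
qed

text \<open>In the product over \<open>i < j\<close> the pairs with \<open>j\<close> beyond the length of \<open>\<mu>\<close> telescope; what
  remains is the product formula for the quantum dimension.\<close>

lemma e_coeff'_finite_form:
  assumes "m \<ge> 1" "is_partition \<mu>"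
  shows "e_coeff' \<mu> m = (\<Sum>j<length \<mu>. \<Sum>i<j.
      of_bool (int (part \<mu> (Suc i)) - int (part \<mu> (Suc j)) + int j - int i = m) - of_bool (int j - int i = m))
    - (\<Sum>i<length \<mu>. \<Sum>v=1..part \<mu> (Suc i). of_bool (int (length \<mu> - Suc i) + int v = m))"
proof -
  let ?L = "length \<mu>"
  define K where "K = Suc (nat \<bar>m\<bar> + sum_list \<mu> + sum_list \<mu> + length \<mu> + length \<mu>)"
  let ?f = "\<lambda>k. of_bool (k = m) :: int"
  let ?t = "\<lambda>i j. ?f (int (part \<mu> (Suc i)) - int (part \<mu> (Suc j)) + int j - int i) - ?f (int j - int i)"
  have LK: "?L \<le> K" by (simp add: K_def)
  have "e_coeff' \<mu> m = (\<Sum>i=1..K. \<Sum>j=1..K. ?f (int (part \<mu> i) - int (part \<mu> j) + int j - int i) - ?f (int j - int i))"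
    unfolding e_coeff'_eq[OF assms] by (rule e_coeff_eq_box(1)) (simp add: K_def)
  also have "\<dots> = (\<Sum>i<K. \<Sum>j<K. ?t i j)"
    unfolding One_nat_def sum.atLeast1_atMost_eq by (simp add: algebra_simps)
  also have "\<dots> = (\<Sum>j<K. \<Sum>i<K. ?t i j)"
    by (rule sum.swap)
  also have "\<dots> = (\<Sum>j<K. \<Sum>i<j. ?t i j)"
  proof (rule sum.cong[OF refl], rule sum.mono_neutral_right)
    fix j assume "j \<in> {..<K}"
    show "\<forall>i\<in>{..<K} - {..<j}. ?t i j = 0"
    proof
      fix i assume "i \<in> {..<K} - {..<j}"
      then have "j \<le> i" by simp
      then have "part \<mu> (Suc i) \<le> part \<mu> (Suc j)" using part_antimono[OF assms(2)] by simp
      then show "?t i j = 0" using assms(1) \<open>j \<le> i\<close> by auto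
    qed
  qed auto
  also have "\<dots> = (\<Sum>j<?L. \<Sum>i<j. ?t i j) + (\<Sum>j\<in>{?L..<K}. \<Sum>i<j. ?t i j)"
    using LK by (simp add: sum.atLeastLessThan_concat[of 0 ?L K, symmetric] lessThan_atLeast0)
  also have "(\<Sum>j\<in>{?L..<K}. \<Sum>i<j. ?t i j) = (\<Sum>j\<in>{?L..<K}. \<Sum>i<?L. ?f (int (part \<mu> (Suc i)) + int j - int i) - ?f (int j - int i))"
  proof (rule sum.cong[OF refl])
    fix j assume "j \<in> {?L..<K}"
    then have "(\<Sum>i<j. ?t i j) = (\<Sum>i<?L. ?t i j)"
      by (intro sum.mono_neutral_right) (auto simp: part_beyond_length)
    also have "\<dots> = (\<Sum>i<?L. ?f (int (part \<mu> (Suc i)) + int j - int i) - ?f (int j - int i))"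
      using \<open>j \<in> {?L..<K}\<close> by (intro sum.cong refl) (simp add: part_beyond_length)
    finally show "(\<Sum>i<j. ?t i j) = (\<Sum>i<?L. ?f (int (part \<mu> (Suc i)) + int j - int i) - ?f (int j - int i))" .
  qed
  also have "\<dots> = (\<Sum>i<?L. \<Sum>j\<in>{?L..<K}. ?f (int (part \<mu> (Suc i)) + int j - int i) - ?f (int j - int i))"
    by (rule sum.swap)
  also have "\<dots> = (\<Sum>i<?L. - (\<Sum>v=1..part \<mu> (Suc i). ?f (int (?L - Suc i) + int v)))"
  proof (rule sum.cong[OF refl])
    fix i assume i: "i \<in> {..<?L}"
    have "(\<Sum>j\<in>{?L..<K}. ?f (int (part \<mu> (Suc i)) + int j - int i) - ?f (int j - int i)) =
        (\<Sum>j\<in>{?L..<K}. \<Sum>v=1..part \<mu> (Suc i). ?f (int j - int i + int v) - ?f (int j - int i + int v - 1))"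
    proof (rule sum.cong[OF refl])
      fix j
      show "?f (int (part \<mu> (Suc i)) + int j - int i) - ?f (int j - int i) =
          (\<Sum>v=1..part \<mu> (Suc i). ?f (int j - int i + int v) - ?f (int j - int i + int v - 1))"
        unfolding telescope_up[of ?f] by (simp add: algebra_simps)
    qed
    also have "\<dots> = (\<Sum>v=1..part \<mu> (Suc i). \<Sum>j\<in>{?L..<K}. ?f (int j - int i + int v) - ?f (int j - int i + int v - 1))"
      by (rule sum.swap)
    also have "\<dots> = (\<Sum>v=1..part \<mu> (Suc i). - ?f (int (?L - Suc i) + int v))"
    proof (rule sum.cong[OF refl])
      fix v assume v: "v \<in> {1..part \<mu> (Suc i)}"
      have "(\<Sum>j\<in>{?L..<K}. ?f (int j - int i + int v) - ?f (int j - int i + int v - 1)) =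
          (\<Sum>j\<in>{?L..<K}. (\<lambda>j. ?f (int j - int i + int v - 1)) (Suc j) - (\<lambda>j. ?f (int j - int i + int v - 1)) j)"
        by (intro sum.cong refl) (simp add: algebra_simps)
      also have "\<dots> = ?f (int K - int i + int v - 1) - ?f (int ?L - int i + int v - 1)"
        by (rule sum_Suc_diff'[OF LK])
      also have "?f (int K - int i + int v - 1) = 0"
        using i by (auto simp: K_def)
      also have "int ?L - int i + int v - 1 = int (?L - Suc i) + int v"
        using i by (simp add: of_nat_diff)
      finally show "(\<Sum>j\<in>{?L..<K}. ?f (int j - int i + int v) - ?f (int j - int i + int v - 1)) = - ?f (int (?L - Suc i) + int v)"
        by simp
    qed
    finally show "(\<Sum>j\<in>{?L..<K}. ?f (int (part \<mu> (Suc i)) + int j - int i) - ?f (int j - int i)) =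
        - (\<Sum>v=1..part \<mu> (Suc i). ?f (int (?L - Suc i) + int v))" by (simp add: sum_negf)
  qed
  finally show ?thesis by (simp add: sum_negf)
qed

lemma prod_powi_delta:
  fixes g :: "int \<Rightarrow> 'a :: field"
  assumes "finite M" "k \<in> M"
  shows "(\<Prod>m\<in>M. g m powi of_bool (k = m)) = g k"
proof -
  have "(\<Prod>m\<in>M. g m powi of_bool (k = m)) = (\<Prod>m\<in>M. if k = m then g m else 1)"
    by (intro prod.cong) auto
  then show ?thesis using assms by simp
qed

lemma prod_e_coeff':
  fixes g :: "int \<Rightarrow> complex"
  assumes \<mu>: "is_partition \<mu>" and g: "\<And>m. m \<ge> 1 \<Longrightarrow> g m \<noteq> 0"
  shows "(\<Prod>m | m \<ge> 1 \<and> e_coeff' \<mu> m \<noteq> 0. g m powi e_coeff' \<mu> m) =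
    (\<Prod>j<length \<mu>. \<Prod>i<j. g (int (part \<mu> (Suc i)) - int (part \<mu> (Suc j)) + int j - int i) / g (int j - int i))
    * (\<Prod>i<length \<mu>. \<Prod>v=1..part \<mu> (Suc i). 1 / g (int (length \<mu> - Suc i) + int v))"
proof -
  let ?L = "length \<mu>"
  let ?a = "\<lambda>i j. int (part \<mu> (Suc i)) - int (part \<mu> (Suc j)) + int j - int i"
  let ?b = "\<lambda>i v. int (?L - Suc i) + int v"
  define M where "M = {1..int (sum_list \<mu> + ?L)} \<union> {m. m \<ge> 1 \<and> e_coeff' \<mu> m \<noteq> 0}"
  have "finite {m. m \<ge> 1 \<and> e_coeff' \<mu> m \<noteq> 0}"
    by (rule finite_subset[OF _ finite_e_coeff[of \<mu> \<mu>]]) (use \<mu> in \<open>auto simp: e_coeff'_eq\<close>)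
  then have fin: "finite M" by (simp add: M_def)
  have M1: "m \<ge> 1" if "m \<in> M" for m using that by (auto simp: M_def)
  have part_le: "part \<mu> i \<le> sum_list \<mu>" for i by (rule part_le_sum_list)
  have in_M: "?a i j \<in> M" "int j - int i \<in> M" if "i < j" "j < ?L" for i j
    using that part_antimono[OF \<mu>, of "Suc i" "Suc j"] part_le[of "Suc i"] by (auto simp: M_def)
  have in_M': "?b i v \<in> M" if "i < ?L" "v \<in> {1..part \<mu> (Suc i)}" for i v
    using that part_le[of "Suc i"] by (auto simp: M_def)
  have add: "(\<Prod>m\<in>M. g m powi (x m - y m)) = (\<Prod>m\<in>M. g m powi x m) / (\<Prod>m\<in>M. g m powi y m)" for x y
    unfolding prod_dividef[symmetric] using g M1 by (intro prod.cong refl) (simp add: power_int_diff)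
  have sum: "(\<Prod>m\<in>M. g m powi (\<Sum>i\<in>A. x i m)) = (\<Prod>i\<in>A. \<Prod>m\<in>M. g m powi x i m)" for A :: "nat set" and x
  proof -
    have "(\<Prod>m\<in>M. g m powi (\<Sum>i\<in>A. x i m)) = (\<Prod>m\<in>M. \<Prod>i\<in>A. g m powi x i m)"
      using g M1 by (intro prod.cong refl) (simp add: prod_powi)
    then show ?thesis by (simp add: prod.swap[of _ M])
  qed
  have "(\<Prod>m | m \<ge> 1 \<and> e_coeff' \<mu> m \<noteq> 0. g m powi e_coeff' \<mu> m) = (\<Prod>m\<in>M. g m powi e_coeff' \<mu> m)"
  proof (rule prod.mono_neutral_left[OF fin])
    show "{m. m \<ge> 1 \<and> e_coeff' \<mu> m \<noteq> 0} \<subseteq> M" by (simp add: M_def)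
    show "\<forall>m\<in>M - {m. m \<ge> 1 \<and> e_coeff' \<mu> m \<noteq> 0}. g m powi e_coeff' \<mu> m = 1"
      using M1 by simp
  qed
  also have "\<dots> = (\<Prod>m\<in>M. g m powi ((\<Sum>j<?L. \<Sum>i<j. of_bool (?a i j = m) - of_bool (int j - int i = m))
      - (\<Sum>i<?L. \<Sum>v=1..part \<mu> (Suc i). of_bool (?b i v = m))))"
    using M1 by (intro prod.cong refl) (simp add: e_coeff'_finite_form[OF _ \<mu>])
  also have "\<dots> = (\<Prod>j<?L. \<Prod>i<j. g (?a i j) / g (int j - int i)) / (\<Prod>i<?L. \<Prod>v=1..part \<mu> (Suc i). g (?b i v))"
    unfolding add sum using in_M in_M'
    by (intro arg_cong2[of _ _ _ _ "(/)"] prod.cong refl) (simp_all add: prod_powi_delta[OF fin])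
  finally show ?thesis by (simp add: prod_dividef)
qed

lemma W1_eq_prod_e_coeff':
  fixes s :: complex
  assumes "is_partition \<mu>" "\<And>m. m \<ge> 1 \<Longrightarrow> qnum s m \<noteq> 0"
  shows "W1 s \<mu> = s powi (kappa \<mu> div 2) * (\<Prod>m | m \<ge> 1 \<and> e_coeff' \<mu> m \<noteq> 0. qnum s m powi e_coeff' \<mu> m)"
proof -
  note prod_e_coeff'[of \<mu> "qnum s", OF assms]
  then show ?thesis unfolding W1_zero_based by (simp only: mult.assoc)
qed

text \<open>The product over the exponents is invariant under transposition, so only the prefactor
  \<open>q\<^bsup>\<kappa>/4\<^esup>\<close> changes.\<close>

lemma W1_conj:
  fixes s :: complex
  assumes "is_partition \<mu>" "s \<noteq> 0" "\<And>m. m \<ge> 1 \<Longrightarrow> qnum s m \<noteq> 0"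
  shows "s powi kappa \<mu> * W1 s (conj_part \<mu>) = W1 s \<mu>"
proof -
  have "{m. m \<ge> 1 \<and> e_coeff' (conj_part \<mu>) m \<noteq> 0} = {m. m \<ge> 1 \<and> e_coeff' \<mu> m \<noteq> 0}"
    using e_coeff'_conj[OF _ assms(1)] by auto
  then have "(\<Prod>m | m \<ge> 1 \<and> e_coeff' (conj_part \<mu>) m \<noteq> 0. qnum s m powi e_coeff' (conj_part \<mu>) m) =
      (\<Prod>m | m \<ge> 1 \<and> e_coeff' \<mu> m \<noteq> 0. qnum s m powi e_coeff' \<mu> m)"
    using e_coeff'_conj[OF _ assms(1)] by (intro prod.cong) auto
  moreover have "s powi kappa \<mu> * s powi (kappa (conj_part \<mu>) div 2) = s powi (kappa \<mu> div 2)"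
  proof -
    obtain c where "kappa \<mu> = 2 * c" using kappa_eq_contents by blast
    moreover have "(- (2 * c)) div 2 = - c" by presburger
    ultimately show ?thesis using assms(1,2) by (simp add: kappa_conj power_int_add[symmetric])
  qed
  ultimately show ?thesis
    using assms by (simp add: W1_eq_prod_e_coeff' mult.assoc[symmetric])
qed

section \<open>Truncation of power series\<close>

text \<open>Infinite sums over partitions are handled through truncations: equality of power series is
  equality of the coefficients up to every degree \<open>M\<close>, and for fixed \<open>M\<close> all sums are finite.\<close>

definition trunc_eq :: "nat \<Rightarrow> 'a mfps \<Rightarrow> 'a mfps \<Rightarrow> bool" where
  "trunc_eq M F G \<longleftrightarrow> (\<forall>\<alpha>. mdeg \<alpha> \<le> M \<longrightarrow> mfps_nth F \<alpha> = mfps_nth G \<alpha>)"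

definition mfps_order :: "nat \<Rightarrow> 'a :: zero mfps \<Rightarrow> bool" where
  "mfps_order n F \<longleftrightarrow> (\<forall>\<alpha>. mdeg \<alpha> < n \<longrightarrow> mfps_nth F \<alpha> = 0)"

lemma trunc_eq_refl [simp]: "trunc_eq M F F"
  by (simp add: trunc_eq_def)

lemma trunc_eq_trans [trans]: "trunc_eq M F G \<Longrightarrow> trunc_eq M G H \<Longrightarrow> trunc_eq M F H"
  by (simp add: trunc_eq_def)

lemma trunc_eq_sym: "trunc_eq M F G \<Longrightarrow> trunc_eq M G F"
  by (simp add: trunc_eq_def)

lemma trunc_eqD: "(\<And>M. trunc_eq M F G) \<Longrightarrow> F = G"
  by (rule mfps_eqI) (auto simp: trunc_eq_def)

lemma trunc_eq_mult:
  fixes F :: "'a :: comm_ring_1 mfps"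
  assumes "trunc_eq M F F'" "trunc_eq M G G'"
  shows "trunc_eq M (F * G) (F' * G')"
  unfolding trunc_eq_def mfps_nth_mult
proof (intro allI impI sum.cong refl, clarify)
  fix \<alpha> \<gamma> \<delta> assume "mdeg \<alpha> \<le> M" "(\<gamma>, \<delta>) \<in> splits \<alpha>"
  then have "mdeg \<gamma> \<le> M" "mdeg \<delta> \<le> M" by (auto simp: splits_def mdeg_add)
  then show "mfps_nth F \<gamma> * mfps_nth G \<delta> = mfps_nth F' \<gamma> * mfps_nth G' \<delta>"
    using assms by (simp add: trunc_eq_def)
qed

lemma trunc_eq_sum:
  "(\<And>x. x \<in> A \<Longrightarrow> trunc_eq M (f x) (g x)) \<Longrightarrow> trunc_eq M (sum f A) (sum g A :: 'a :: comm_ring_1 mfps)"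
  by (simp add: trunc_eq_def)

lemma trunc_eq_prod:
  "(\<And>x. x \<in> A \<Longrightarrow> trunc_eq M (f x) (g x)) \<Longrightarrow> trunc_eq M (prod f A) (prod g A :: 'a :: comm_ring_1 mfps)"
  by (induction A rule: infinite_finite_induct) (auto intro: trunc_eq_mult)

lemma trunc_eq_0: "mfps_order n F \<Longrightarrow> M < n \<Longrightarrow> trunc_eq M F 0"
  by (simp add: trunc_eq_def mfps_order_def)

lemma mfps_order_mult:
  fixes F :: "'a :: comm_ring_1 mfps"
  assumes "mfps_order m F" "mfps_order n G"
  shows "mfps_order (m + n) (F * G)"
  unfolding mfps_order_def mfps_nth_mult
proof (intro allI impI sum.neutral ballI)
  fix \<alpha> p assume "mdeg \<alpha> < m + n" "p \<in> splits \<alpha>"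
  then obtain \<gamma> \<delta> where p: "p = (\<gamma>, \<delta>)" "mdeg \<gamma> + mdeg \<delta> < m + n" by (auto simp: splits_def mdeg_add)
  then have "mdeg \<gamma> < m \<or> mdeg \<delta> < n" by linarith
  then show "(case p of (\<gamma>, \<delta>) \<Rightarrow> mfps_nth F \<gamma> * mfps_nth G \<delta>) = 0"
    using assms by (auto simp: p mfps_order_def)
qed

lemma mfps_order_power:
  fixes F :: "'a :: comm_ring_1 mfps"
  assumes "mfps_nth F 0 = 0"
  shows "mfps_order n (F ^ n)"
  using mfps_nth_power_eq_0[OF assms] by (simp add: mfps_order_def)

lemma mfps_order_0: "mfps_order 0 F"
  by (simp add: mfps_order_def)

lemma mfps_order_sum: "(\<And>x. x \<in> A \<Longrightarrow> mfps_order n (f x)) \<Longrightarrow> mfps_order n (sum f A :: 'a :: comm_ring_1 mfps)"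
  by (simp add: mfps_order_def)

lemma mfps_order_scaled:
  fixes F :: "'a :: comm_ring_1 mfps"
  assumes "mfps_nth P 0 = 0"
  shows "mfps_order n (P ^ n * F)"
  using mfps_order_mult[OF mfps_order_power[OF assms, of n] mfps_order_0[of F]] by simp

lemma mfps_order_hval:
  fixes \<phi> :: "nat \<Rightarrow> complex mfps"
  assumes "\<And>n. n \<ge> 1 \<Longrightarrow> mfps_order n (\<phi> n)"
  shows "mfps_order n (hval \<phi> n)"
proof (induction n rule: less_induct)
  case (less n)
  show ?case
  proof (cases "n = 0")
    case False
    have "mfps_order n (\<phi> k * hval \<phi> (n - k))" if "k \<in> {1..n}" for k
      using mfps_order_mult[OF assms[of k] less[of "n - k"]] that by simp
    then have "mfps_order n (\<Sum>k=1..n. \<phi> k * hval \<phi> (n - k))" by (rule mfps_order_sum)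
    then have "mfps_order n (mfps_const (of_nat n) * hval \<phi> n)"
      unfolding mfps_const_of_nat hval_newton .
    then show ?thesis using False by (simp add: mfps_order_def)
  qed (simp add: mfps_order_def)
qed

text \<open>The triangle \<open>i + j \<le> M\<close> and the square \<open>i, j \<le> M\<close> differ in terms of degree greater than \<open>M\<close>.\<close>

lemma sum_triangle_trunc:
  fixes f g :: "nat \<Rightarrow> 'a :: comm_ring_1 mfps"
  assumes "\<And>n. mfps_order n (f n)" "\<And>n. mfps_order n (g n)"
  shows "trunc_eq M (\<Sum>d\<le>M. \<Sum>i\<le>d. f i * g (d - i)) ((\<Sum>i\<le>M. f i) * (\<Sum>j\<le>M. g j))"
proof -
  have "(\<Sum>d\<le>M. \<Sum>i\<le>d. f i * g (d - i)) = (\<Sum>i\<le>M. \<Sum>j\<le>M. if i + j \<le> M then f i * g j else 0)"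
  proof -
    have "(\<Sum>d\<le>M. \<Sum>i\<le>d. f i * g (d - i)) = (\<Sum>(d, i)\<in>(SIGMA d:{..M}. {..d}). f i * g (d - i))"
      by (subst sum.Sigma) auto
    also have "\<dots> = (\<Sum>(i, j)\<in>{p \<in> {..M} \<times> {..M}. fst p + snd p \<le> M}. f i * g j)"
      by (rule sum.reindex_bij_witness[of _ "\<lambda>(i, j). (i + j, i)" "\<lambda>(d, i). (i, d - i)"]) auto
    also have "\<dots> = (\<Sum>p\<in>{..M} \<times> {..M}. if fst p + snd p \<le> M then f (fst p) * g (snd p) else 0)"
      by (subst sum.inter_filter) (auto intro!: sum.cong)
    finally show ?thesis by (simp add: sum.cartesian_product case_prod_unfold)
  qed
  moreover have "trunc_eq M (if i + j \<le> M then f i * g j else 0) (f i * g j)" for i j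
  proof (cases "i + j \<le> M")
    case False
    then have "trunc_eq M (f i * g j) 0"
      by (intro trunc_eq_0[OF mfps_order_mult[OF assms(1)[of i] assms(2)[of j]]]) simp
    then show ?thesis using False by (simp add: trunc_eq_sym)
  qed simp
  ultimately show ?thesis
    unfolding sum_product by (simp only:) (intro trunc_eq_sum)
qed

lemma hval_add_trunc:
  fixes \<phi> \<psi> :: "nat \<Rightarrow> complex mfps"
  assumes "\<And>n. n \<ge> 1 \<Longrightarrow> mfps_order n (\<phi> n)" "\<And>n. n \<ge> 1 \<Longrightarrow> mfps_order n (\<psi> n)"
  shows "trunc_eq M (\<Sum>d\<le>M. hval (\<lambda>n. \<phi> n + \<psi> n) d) ((\<Sum>d\<le>M. hval \<phi> d) * (\<Sum>d\<le>M. hval \<psi> d))"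
  unfolding hval_add by (intro sum_triangle_trunc mfps_order_hval assms)

lemma hval_sum_trunc:
  fixes \<phi> :: "'b \<Rightarrow> nat \<Rightarrow> complex mfps"
  assumes "finite J" "\<And>j n. j \<in> J \<Longrightarrow> n \<ge> 1 \<Longrightarrow> mfps_order n (\<phi> j n)"
  shows "trunc_eq M (\<Sum>d\<le>M. hval (\<lambda>n. \<Sum>j\<in>J. \<phi> j n) d) (\<Prod>j\<in>J. \<Sum>d\<le>M. hval (\<phi> j) d)"
  using assms
proof (induction J rule: finite_induct)
  case empty
  show ?case by (simp add: hval_zero)
next
  case (insert j J)
  have "trunc_eq M (\<Sum>d\<le>M. hval (\<lambda>n. \<phi> j n + (\<Sum>j\<in>J. \<phi> j n)) d)
      ((\<Sum>d\<le>M. hval (\<phi> j) d) * (\<Sum>d\<le>M. hval (\<lambda>n. \<Sum>j\<in>J. \<phi> j n) d))"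
    using insert.prems by (intro hval_add_trunc mfps_order_sum) auto
  also have "trunc_eq M \<dots> ((\<Sum>d\<le>M. hval (\<phi> j) d) * (\<Prod>j\<in>J. \<Sum>d\<le>M. hval (\<phi> j) d))"
    using insert by (intro trunc_eq_mult) auto
  finally show ?case using insert.hyps by simp
qed

lemma mfps_subst_trunc:
  fixes F :: "'a :: comm_ring_1 fps"
  assumes "mfps_nth P 0 = 0"
  shows "trunc_eq M (mfps_subst F P) (\<Sum>j\<le>M. mfps_const (fps_nth F j) * P ^ j)"
proof (unfold trunc_eq_def, intro allI impI)
  fix \<alpha> :: "nat \<Rightarrow>\<^sub>0 nat" assume "mdeg \<alpha> \<le> M"
  then have "(\<Sum>j\<le>mdeg \<alpha>. fps_nth F j * mfps_nth (P ^ j) \<alpha>) = (\<Sum>j\<le>M. fps_nth F j * mfps_nth (P ^ j) \<alpha>)"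
    using mfps_nth_power_eq_0[OF assms, of \<alpha>] by (intro sum.mono_neutral_left) auto
  then show "mfps_nth (mfps_subst F P) \<alpha> = mfps_nth (\<Sum>j\<le>M. mfps_const (fps_nth F j) * P ^ j) \<alpha>"
    by (simp add: mfps_subst_def)
qed

text \<open>By homogeneity, substituting \<open>P\<close> for the grading variable is the same as scaling the alphabet by
  \<open>P\<close>.\<close>

lemma mfps_subst_hfps_trunc:
  fixes \<psi> :: "nat \<Rightarrow> complex"
  assumes "mfps_nth P 0 = 0"
  shows "trunc_eq M (mfps_subst (hfps \<psi>) P) (\<Sum>d\<le>M. hval (\<lambda>n. P ^ n * mfps_const (\<psi> n)) d)"
  using mfps_subst_trunc[OF assms, of M "hfps \<psi>"]
  unfolding hval_scale hval_const fps_nth_hfps by (simp only: mult.commute)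

text \<open>A union of alphabets multiplies the generating functions.\<close>

lemma mfps_subst_hfps_sum:
  fixes \<psi> :: "'b \<Rightarrow> nat \<Rightarrow> complex"
  assumes "mfps_nth P 0 = 0" "finite J"
  shows "mfps_subst (hfps (\<lambda>n. \<Sum>j\<in>J. \<psi> j n)) P = (\<Prod>j\<in>J. mfps_subst (hfps (\<psi> j)) P)"
proof (rule trunc_eqD)
  fix M
  have "trunc_eq M (mfps_subst (hfps (\<lambda>n. \<Sum>j\<in>J. \<psi> j n)) P)
      (\<Sum>d\<le>M. hval (\<lambda>n. \<Sum>j\<in>J. P ^ n * mfps_const (\<psi> j n)) d)"
    using mfps_subst_hfps_trunc[OF assms(1), of M "\<lambda>n. \<Sum>j\<in>J. \<psi> j n"]
    by (simp add: mfps_const_sum sum_distrib_left)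
  also have "trunc_eq M \<dots> (\<Prod>j\<in>J. \<Sum>d\<le>M. hval (\<lambda>n. P ^ n * mfps_const (\<psi> j n)) d)"
    using assms by (intro hval_sum_trunc mfps_order_scaled) auto
  also have "trunc_eq M \<dots> (\<Prod>j\<in>J. mfps_subst (hfps (\<psi> j)) P)"
    by (intro trunc_eq_prod trunc_eq_sym[OF mfps_subst_hfps_trunc[OF assms(1)]])
  finally show "trunc_eq M (mfps_subst (hfps (\<lambda>n. \<Sum>j\<in>J. \<psi> j n)) P) (\<Prod>j\<in>J. mfps_subst (hfps (\<psi> j)) P)" .
qed


section \<open>Gluing vertices\<close>

definition parts_le :: "nat \<Rightarrow> nat list set" where
  "parts_le M = {\<mu>. is_partition \<mu> \<and> sum_list \<mu> \<le> M}"

lemma finite_parts_le [simp]: "finite (parts_le M)"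
  unfolding parts_le_def by (rule finite_partitions_le)

lemma parts_le_Union: "parts_le M = (\<Union>d\<le>M. partitions_of d)"
  by (auto simp: parts_le_def partitions_of_def)

lemma sum_parts_le: "(\<Sum>\<nu>\<in>parts_le M. f \<nu>) = (\<Sum>d\<le>M. \<Sum>\<nu>\<in>partitions_of d. f \<nu>)"
  unfolding parts_le_Union by (rule sum.UNION_disjoint) (auto, auto simp: partitions_of_def)

lemma lr_coeff_eq_0:
  "is_partition \<eta> \<Longrightarrow> is_partition \<rho> \<Longrightarrow> sum_list \<nu> \<noteq> sum_list \<eta> + sum_list \<rho> \<Longrightarrow> lr_coeff \<eta> \<rho> \<nu> = 0"
  using lr_coeff_support[of \<eta> \<rho> \<nu>] by (auto simp: partitions_of_def)

lemma schur_val_add_le: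
  assumes "\<nu> \<in> parts_le M"
  shows "(\<Sum>\<eta>\<in>parts_le M. \<Sum>\<rho>\<in>parts_le M. of_int (lr_coeff \<eta> \<rho> \<nu>) * schur_val \<phi> \<eta> * schur_val \<psi> \<rho>) =
    schur_val (\<lambda>n. \<phi> n + \<psi> n) \<nu>"
proof -
  define d where "d = sum_list \<nu>"
  have \<nu>: "\<nu> \<in> partitions_of d" and d: "d \<le> M" using assms by (auto simp: d_def parts_le_def partitions_of_def)
  let ?t = "\<lambda>\<eta> \<rho>. of_int (lr_coeff \<eta> \<rho> \<nu>) * schur_val \<phi> \<eta> * schur_val \<psi> \<rho>"
  have t0: "?t \<eta> \<rho> = 0" if "\<eta> \<in> partitions_of a" "\<rho> \<in> partitions_of b" "a + b \<noteq> d" for \<eta> \<rho> a b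
    using that lr_coeff_eq_0[of \<eta> \<rho> \<nu>] by (auto simp: partitions_of_def d_def)
  have "(\<Sum>b\<le>M. \<Sum>\<eta>\<in>partitions_of a. \<Sum>\<rho>\<in>partitions_of b. ?t \<eta> \<rho>) =
      (if a \<le> d then \<Sum>\<eta>\<in>partitions_of a. \<Sum>\<rho>\<in>partitions_of (d - a). ?t \<eta> \<rho> else 0)" for a
  proof (cases "a \<le> d")
    case True
    have "(\<Sum>b\<le>M. \<Sum>\<eta>\<in>partitions_of a. \<Sum>\<rho>\<in>partitions_of b. ?t \<eta> \<rho>) =
        (\<Sum>b\<in>{d - a}. \<Sum>\<eta>\<in>partitions_of a. \<Sum>\<rho>\<in>partitions_of b. ?t \<eta> \<rho>)"
      using d True by (intro sum.mono_neutral_right) (auto intro!: sum.neutral t0)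
    then show ?thesis using True by simp
  next
    case False
    then show ?thesis by (auto intro!: sum.neutral t0)
  qed
  then have "(\<Sum>a\<le>M. \<Sum>b\<le>M. \<Sum>\<eta>\<in>partitions_of a. \<Sum>\<rho>\<in>partitions_of b. ?t \<eta> \<rho>) =
      (\<Sum>a\<le>d. \<Sum>\<eta>\<in>partitions_of a. \<Sum>\<rho>\<in>partitions_of (d - a). ?t \<eta> \<rho>)"
    using d by (simp only:) (intro sum.mono_neutral_cong_right; auto)
  also have "\<dots> = schur_val (\<lambda>n. \<phi> n + \<psi> n) \<nu>"
    by (rule schur_val_add[OF \<nu>, symmetric])
  also have "(\<Sum>a\<le>M. \<Sum>b\<le>M. \<Sum>\<eta>\<in>partitions_of a. \<Sum>\<rho>\<in>partitions_of b. ?t \<eta> \<rho>) =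
      (\<Sum>a\<le>M. \<Sum>\<eta>\<in>partitions_of a. \<Sum>b\<le>M. \<Sum>\<rho>\<in>partitions_of b. ?t \<eta> \<rho>)"
    by (rule sum.cong[OF refl], rule sum.swap)
  finally show ?thesis by (simp only: sum_parts_le)
qed

lemma schur_val_mult_le:
  assumes "\<eta> \<in> parts_le M" "\<rho> \<in> parts_le M"
  shows "(\<Sum>\<nu>\<in>parts_le M. of_int (lr_coeff \<eta> \<rho> \<nu>) * schur_val \<phi> \<nu>) =
    (if sum_list \<eta> + sum_list \<rho> \<le> M then schur_val \<phi> \<eta> * schur_val \<phi> \<rho> else 0)"
proof -
  let ?d = "sum_list \<eta> + sum_list \<rho>"
  have part: "is_partition \<eta>" "is_partition \<rho>" using assms by (auto simp: parts_le_def)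
  have lr0: "of_int (lr_coeff \<eta> \<rho> \<nu>) * schur_val \<phi> \<nu> = 0" if "\<nu> \<in> partitions_of d" "d \<noteq> ?d" for \<nu> d
    using that lr_coeff_eq_0[OF part, of \<nu>] by (auto simp: partitions_of_def)
  show ?thesis
  proof (cases "?d \<le> M")
    case True
    then have "(\<Sum>\<nu>\<in>parts_le M. of_int (lr_coeff \<eta> \<rho> \<nu>) * schur_val \<phi> \<nu>) =
        (\<Sum>\<nu>\<in>partitions_of ?d. of_int (lr_coeff \<eta> \<rho> \<nu>) * schur_val \<phi> \<nu>)"
    proof (intro sum.mono_neutral_right finite_parts_le ballI)
      show "partitions_of ?d \<subseteq> parts_le M" using True by (auto simp: parts_le_def partitions_of_def)
      fix \<nu> assume "\<nu> \<in> parts_le M - partitions_of ?d"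
      then show "of_int (lr_coeff \<eta> \<rho> \<nu>) * schur_val \<phi> \<nu> = 0"
        by (intro lr0[of _ "sum_list \<nu>"]) (auto simp: parts_le_def partitions_of_def)
    qed
    then show ?thesis using True schur_val_mult[OF part, of \<phi>] by simp
  next
    case False
    have "of_int (lr_coeff \<eta> \<rho> \<nu>) * schur_val \<phi> \<nu> = 0" if "\<nu> \<in> parts_le M" for \<nu>
      using lr0[of \<nu> "sum_list \<nu>"] that False by (auto simp: parts_le_def partitions_of_def)
    then show ?thesis using False by simp
  qed
qed

text \<open>The sum over \<open>\<eta>\<close> of products of skew Schur functions
  \<open>s\<^bsub>\<sigma>/\<eta>\<^esub>(x) s\<^bsub>\<tau>/\<eta>\<^esub>(y)\<close>.\<close>

definition transfer :: "(nat \<Rightarrow> complex) \<Rightarrow> (nat \<Rightarrow> complex) \<Rightarrow> nat list \<Rightarrow> nat list \<Rightarrow> complex" where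
  "transfer x y \<sigma> \<tau> = (\<Sum>\<rho>\<in>parts_le (sum_list \<sigma>). \<Sum>\<rho>'\<in>parts_le (sum_list \<tau>). \<Sum>\<eta>\<in>parts_le (sum_list \<sigma>).
     of_int (lr_coeff \<eta> \<rho> \<sigma>) * of_int (lr_coeff \<eta> \<rho>' \<tau>) * schur_val x \<rho> * schur_val y \<rho>')"

text \<open>Enlarging the index sets to a common bound adds only vanishing structure constants.\<close>

lemma transfer_le:
  assumes "\<sigma> \<in> parts_le M" "\<tau> \<in> parts_le M"
  shows "transfer x y \<sigma> \<tau> = (\<Sum>\<rho>\<in>parts_le M. \<Sum>\<rho>'\<in>parts_le M. \<Sum>\<eta>\<in>parts_le M.
     of_int (lr_coeff \<eta> \<rho> \<sigma>) * of_int (lr_coeff \<eta> \<rho>' \<tau>) * schur_val x \<rho> * schur_val y \<rho>')"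
proof -
  have sub: "parts_le (sum_list \<sigma>) \<subseteq> parts_le M" "parts_le (sum_list \<tau>) \<subseteq> parts_le M"
    using assms by (auto simp: parts_le_def)
  have z: "lr_coeff \<eta> \<rho> \<nu> = 0" if "\<eta> \<in> parts_le M" "\<rho> \<in> parts_le M" "\<eta> \<notin> parts_le (sum_list \<nu>) \<or> \<rho> \<notin> parts_le (sum_list \<nu>)"
    for \<eta> \<rho> \<nu>
    using that by (intro lr_coeff_eq_0) (auto simp: parts_le_def)
  have "transfer x y \<sigma> \<tau> = (\<Sum>\<rho>\<in>parts_le (sum_list \<sigma>). \<Sum>\<rho>'\<in>parts_le (sum_list \<tau>). \<Sum>\<eta>\<in>parts_le M.
     of_int (lr_coeff \<eta> \<rho> \<sigma>) * of_int (lr_coeff \<eta> \<rho>' \<tau>) * schur_val x \<rho> * schur_val y \<rho>')"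
    unfolding transfer_def using sub z by (intro sum.cong refl sum.mono_neutral_left) auto
  also have "\<dots> = (\<Sum>\<rho>\<in>parts_le (sum_list \<sigma>). \<Sum>\<rho>'\<in>parts_le M. \<Sum>\<eta>\<in>parts_le M.
     of_int (lr_coeff \<eta> \<rho> \<sigma>) * of_int (lr_coeff \<eta> \<rho>' \<tau>) * schur_val x \<rho> * schur_val y \<rho>')"
    using sub z by (intro sum.cong refl sum.mono_neutral_left) (auto intro!: sum.neutral)
  also have "\<dots> = (\<Sum>\<rho>\<in>parts_le M. \<Sum>\<rho>'\<in>parts_le M. \<Sum>\<eta>\<in>parts_le M.
     of_int (lr_coeff \<eta> \<rho> \<sigma>) * of_int (lr_coeff \<eta> \<rho>' \<tau>) * schur_val x \<rho> * schur_val y \<rho>')"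
    using sub z by (intro sum.mono_neutral_left) (auto intro!: sum.neutral)
  finally show ?thesis .
qed

lemma schur_val_zero: "is_partition \<nu> \<Longrightarrow> schur_val (\<lambda>_. 0) \<nu> = of_bool (\<nu> = [])"
  using schur_val_scale[of \<nu> 0 "\<lambda>_. 0"] sum_list_eq_0_partition[of \<nu>]
  by (cases "\<nu> = []") (simp_all add: zero_power del: sum_list_eq_0_iff)

text \<open>
  In the language of operators on symmetric functions, the transfer matrix is the
  translation \<open>p\<^sub>n \<mapsto> p\<^sub>n + x\<^sub>n\<close> followed by multiplication with \<open>exp (\<Sum>\<^sub>n y\<^sub>n p\<^sub>n / n)\<close>. Applied to
  a family of values \<open>s\<^sub>\<sigma>(\<phi>)\<close> it produces a scalar, the Cauchy kernel of \<open>\<phi>\<close> and \<open>x\<close>, and the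
  family of values at \<open>\<phi> + y\<close>.
\<close>

lemma transfer_schur_val:
  fixes \<phi> :: "nat \<Rightarrow> complex mfps"
  assumes P: "mfps_nth P 0 = 0" and \<tau>: "\<tau> \<in> parts_le M"
  shows "trunc_eq M (\<Sum>\<sigma>\<in>parts_le M. P ^ sum_list \<sigma> * schur_val \<phi> \<sigma> * mfps_const (transfer x y \<sigma> \<tau>))
    ((\<Sum>d\<le>M. hval (\<lambda>n. P ^ n * \<phi> n * mfps_const (x n)) d) * schur_val (\<lambda>n. P ^ n * \<phi> n + mfps_const (y n)) \<tau>)"
proof -
  let ?B = "parts_le M"
  let ?\<phi> = "\<lambda>n. P ^ n * \<phi> n"
  let ?x = "\<lambda>n. mfps_const (x n)" and ?y = "\<lambda>n. mfps_const (y n)"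
  have part: "is_partition \<nu>" if "\<nu> \<in> ?B" for \<nu> using that by (simp add: parts_le_def)
  have order: "mfps_order (sum_list \<nu>) (schur_val ?\<phi> \<nu>)" if "\<nu> \<in> ?B" for \<nu>
    using mfps_order_scaled[OF P, of "sum_list \<nu>"] by (simp add: schur_val_scale[OF part[OF that]])
  have of_int_const: "mfps_const (of_int k :: complex) = of_int k" for k
    by (rule mfps_eqI) (cases k; simp add: mfps_const_of_nat[symmetric] mfps_nth_const mfps_nth_1)
  have const: "mfps_const (transfer x y \<sigma> \<tau>) = (\<Sum>\<rho>\<in>?B. \<Sum>\<rho>'\<in>?B. \<Sum>\<eta>\<in>?B.
      of_int (lr_coeff \<eta> \<rho> \<sigma>) * of_int (lr_coeff \<eta> \<rho>' \<tau>) * schur_val ?x \<rho> * schur_val ?y \<rho>')"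
    if "\<sigma> \<in> ?B" for \<sigma>
    unfolding transfer_le[OF that \<tau>] using part
    by (simp add: mfps_const_sum mfps_const_mult of_int_const schur_val_const)
  have "(\<Sum>\<sigma>\<in>?B. P ^ sum_list \<sigma> * schur_val \<phi> \<sigma> * mfps_const (transfer x y \<sigma> \<tau>)) =
      (\<Sum>\<sigma>\<in>?B. \<Sum>\<rho>\<in>?B. \<Sum>\<rho>'\<in>?B. \<Sum>\<eta>\<in>?B. schur_val ?\<phi> \<sigma> * (of_int (lr_coeff \<eta> \<rho> \<sigma>) *
        of_int (lr_coeff \<eta> \<rho>' \<tau>) * schur_val ?x \<rho> * schur_val ?y \<rho>'))"
    by (intro sum.cong refl) (simp only: const schur_val_scale[OF part, symmetric] sum_distrib_left)
  also have "\<dots> = (\<Sum>\<rho>\<in>?B. \<Sum>\<rho>'\<in>?B. \<Sum>\<eta>\<in>?B. \<Sum>\<sigma>\<in>?B. schur_val ?\<phi> \<sigma> * (of_int (lr_coeff \<eta> \<rho> \<sigma>) *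
        of_int (lr_coeff \<eta> \<rho>' \<tau>) * schur_val ?x \<rho> * schur_val ?y \<rho>'))"
    by (subst sum.swap, rule sum.cong[OF refl], subst sum.swap, rule sum.cong[OF refl], rule sum.swap)
  also have "\<dots> = (\<Sum>\<rho>\<in>?B. \<Sum>\<rho>'\<in>?B. \<Sum>\<eta>\<in>?B. (\<Sum>\<sigma>\<in>?B. of_int (lr_coeff \<eta> \<rho> \<sigma>) * schur_val ?\<phi> \<sigma>) *
        (of_int (lr_coeff \<eta> \<rho>' \<tau>) * schur_val ?x \<rho> * schur_val ?y \<rho>'))"
    by (intro sum.cong refl, unfold sum_distrib_right, simp only: mult_ac)
  also have "trunc_eq M \<dots> (\<Sum>\<rho>\<in>?B. \<Sum>\<rho>'\<in>?B. \<Sum>\<eta>\<in>?B. (schur_val ?\<phi> \<eta> * schur_val ?\<phi> \<rho>) *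
        (of_int (lr_coeff \<eta> \<rho>' \<tau>) * schur_val ?x \<rho> * schur_val ?y \<rho>'))"
  proof (intro trunc_eq_sum trunc_eq_mult trunc_eq_refl)
    fix \<rho> \<eta> assume B: "\<rho> \<in> ?B" "\<eta> \<in> ?B"
    show "trunc_eq M (\<Sum>\<sigma>\<in>?B. of_int (lr_coeff \<eta> \<rho> \<sigma>) * schur_val ?\<phi> \<sigma>) (schur_val ?\<phi> \<eta> * schur_val ?\<phi> \<rho>)"
    proof (cases "sum_list \<eta> + sum_list \<rho> \<le> M")
      case False
      then have "trunc_eq M (schur_val ?\<phi> \<eta> * schur_val ?\<phi> \<rho>) 0"
        by (intro trunc_eq_0[OF mfps_order_mult[OF order order]] B) simp
      then show ?thesis using False by (simp add: schur_val_mult_le[OF B(2,1)] trunc_eq_sym)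
    qed (simp add: schur_val_mult_le[OF B(2,1)])
  qed
  also have "(\<Sum>\<rho>\<in>?B. \<Sum>\<rho>'\<in>?B. \<Sum>\<eta>\<in>?B. (schur_val ?\<phi> \<eta> * schur_val ?\<phi> \<rho>) *
        (of_int (lr_coeff \<eta> \<rho>' \<tau>) * schur_val ?x \<rho> * schur_val ?y \<rho>')) =
      (\<Sum>\<rho>\<in>?B. schur_val ?\<phi> \<rho> * schur_val ?x \<rho>) *
      (\<Sum>\<eta>\<in>?B. \<Sum>\<rho>'\<in>?B. of_int (lr_coeff \<eta> \<rho>' \<tau>) * schur_val ?\<phi> \<eta> * schur_val ?y \<rho>')"
  proof -
    have "(\<Sum>\<rho>'\<in>?B. \<Sum>\<eta>\<in>?B. (schur_val ?\<phi> \<eta> * schur_val ?\<phi> \<rho>) *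
        (of_int (lr_coeff \<eta> \<rho>' \<tau>) * schur_val ?x \<rho> * schur_val ?y \<rho>')) =
      (\<Sum>\<eta>\<in>?B. \<Sum>\<rho>'\<in>?B. (schur_val ?\<phi> \<rho> * schur_val ?x \<rho>) *
        (of_int (lr_coeff \<eta> \<rho>' \<tau>) * schur_val ?\<phi> \<eta> * schur_val ?y \<rho>'))" for \<rho>
      by (subst sum.swap) (simp only: mult_ac)
    then show ?thesis by (subst sum_distrib_right) (simp only: sum_distrib_left)
  qed
  also have "\<dots> = (\<Sum>d\<le>M. hval (\<lambda>n. P ^ n * \<phi> n * mfps_const (x n)) d) * schur_val (\<lambda>n. P ^ n * \<phi> n + mfps_const (y n)) \<tau>"
    unfolding schur_val_add_le[OF \<tau>] unfolding sum_parts_le cauchy_identity ..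
  finally show ?thesis .
qed

text \<open>The truncated sum over all labels of the first \<open>k\<close> edges, with the last one, labelled \<open>\<tau>\<close>,
  left open. Edge 0 is closed off by the initial condition.\<close>

fun strip_sum :: "nat \<Rightarrow> (nat \<Rightarrow> nat \<Rightarrow> complex) \<Rightarrow> (nat \<Rightarrow> nat \<Rightarrow> complex) \<Rightarrow> nat \<Rightarrow> nat list \<Rightarrow> complex mfps" where
  "strip_sum M x y 0 \<tau> = of_bool (\<tau> = [])"
| "strip_sum M x y (Suc k) \<tau> = (\<Sum>\<sigma>\<in>parts_le M. mfps_X k ^ sum_list \<sigma> * strip_sum M x y k \<sigma> *
     mfps_const (transfer (x (Suc k)) (y (Suc k)) \<sigma> \<tau>))"

definition edge_monomial :: "nat \<Rightarrow> nat \<Rightarrow> complex mfps" where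
  "edge_monomial k l = (\<Prod>i=k..<l. mfps_X i)"

lemma mfps_nth_X_0 [simp]: "mfps_nth (mfps_X i :: 'a :: comm_ring_1 mfps) 0 = 0"
proof -
  have "(0 :: nat \<Rightarrow>\<^sub>0 nat) \<noteq> Poly_Mapping.single i 1"
    by (metis lookup_single_eq lookup_zero zero_neq_one)
  then show ?thesis by (simp add: mfps_X_def)
qed

lemma mfps_nth_edge_monomial_0: "k < l \<Longrightarrow> mfps_nth (edge_monomial k l) 0 = 0"
  unfolding edge_monomial_def
  by (subst prod.atLeast_Suc_lessThan) (simp_all add: mfps_nth_mult)

text \<open>Induction on the number of edges. After \<open>k\<close> steps the open edge sees the union of the alphabets
  \<open>y\<^sub>j\<close> of all previous vertices, each scaled by the monomial of the path from vertex \<open>j\<close>; the next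
  vertex pairs each of them with \<open>x\<^bsub>k+1\<^esub>\<close> and adds \<open>y\<^bsub>k+1\<^esub>\<close>.\<close>

lemma strip_sum_trunc:
  assumes "\<tau> \<in> parts_le M"
  shows "trunc_eq M (strip_sum M x y k \<tau>)
    ((\<Prod>l=1..k. \<Prod>j=1..<l. mfps_subst (hfps (\<lambda>n. y j n * x l n)) (edge_monomial j l)) *
      schur_val (\<lambda>n. \<Sum>j=1..k. edge_monomial j k ^ n * mfps_const (y j n)) \<tau>)"
  using assms
proof (induction k arbitrary: \<tau>)
  case 0
  then show ?case using schur_val_zero[of \<tau>, where ?'a = "complex mfps"] by (simp add: parts_le_def)
next
  case (Suc k)
  let ?C = "\<Prod>l=1..k. \<Prod>j=1..<l. mfps_subst (hfps (\<lambda>n. y j n * x l n)) (edge_monomial j l)"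
  let ?\<phi> = "\<lambda>n. \<Sum>j=1..k. edge_monomial j k ^ n * mfps_const (y j n)"
  let ?P = "mfps_X k :: complex mfps"
  have shift: "?P ^ n * ?\<phi> n = (\<Sum>j=1..k. edge_monomial j (Suc k) ^ n * mfps_const (y j n))" for n
  proof -
    have "edge_monomial j (Suc k) = edge_monomial j k * ?P" if "j \<le> k" for j
      using that by (simp add: edge_monomial_def)
    then show ?thesis unfolding sum_distrib_left
      by (intro sum.cong refl) (simp add: power_mult_distrib mult_ac)
  qed
  have "trunc_eq M (strip_sum M x y (Suc k) \<tau>)
      (\<Sum>\<sigma>\<in>parts_le M. ?P ^ sum_list \<sigma> * (?C * schur_val ?\<phi> \<sigma>) * mfps_const (transfer (x (Suc k)) (y (Suc k)) \<sigma> \<tau>))"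
    unfolding strip_sum.simps by (intro trunc_eq_sum trunc_eq_mult trunc_eq_refl Suc.IH)
  also have "(\<Sum>\<sigma>\<in>parts_le M. ?P ^ sum_list \<sigma> * (?C * schur_val ?\<phi> \<sigma>) * mfps_const (transfer (x (Suc k)) (y (Suc k)) \<sigma> \<tau>)) =
      ?C * (\<Sum>\<sigma>\<in>parts_le M. ?P ^ sum_list \<sigma> * schur_val ?\<phi> \<sigma> * mfps_const (transfer (x (Suc k)) (y (Suc k)) \<sigma> \<tau>))"
    by (simp only: sum_distrib_left mult_ac)
  also have "trunc_eq M \<dots> (?C * ((\<Sum>d\<le>M. hval (\<lambda>n. ?P ^ n * ?\<phi> n * mfps_const (x (Suc k) n)) d) *
      schur_val (\<lambda>n. ?P ^ n * ?\<phi> n + mfps_const (y (Suc k) n)) \<tau>))"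
    by (intro trunc_eq_mult trunc_eq_refl transfer_schur_val Suc.prems) simp
  also have "trunc_eq M \<dots> (?C * ((\<Prod>j=1..k. mfps_subst (hfps (\<lambda>n. y j n * x (Suc k) n)) (edge_monomial j (Suc k))) *
      schur_val (\<lambda>n. ?P ^ n * ?\<phi> n + mfps_const (y (Suc k) n)) \<tau>))"
  proof (intro trunc_eq_mult trunc_eq_refl)
    have "(\<lambda>n. ?P ^ n * ?\<phi> n * mfps_const (x (Suc k) n)) =
        (\<lambda>n. \<Sum>j=1..k. edge_monomial j (Suc k) ^ n * mfps_const (y j n * x (Suc k) n))"
      by (rule ext) (simp only: shift sum_distrib_right mfps_const_mult mult.assoc)
    then have "trunc_eq M (\<Sum>d\<le>M. hval (\<lambda>n. ?P ^ n * ?\<phi> n * mfps_const (x (Suc k) n)) d)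
        (\<Prod>j=1..k. \<Sum>d\<le>M. hval (\<lambda>n. edge_monomial j (Suc k) ^ n * mfps_const (y j n * x (Suc k) n)) d)"
      by (simp only:) (intro hval_sum_trunc mfps_order_scaled mfps_nth_edge_monomial_0; simp)
    also have "trunc_eq M \<dots> (\<Prod>j=1..k. mfps_subst (hfps (\<lambda>n. y j n * x (Suc k) n)) (edge_monomial j (Suc k)))"
      by (intro trunc_eq_prod trunc_eq_sym[OF mfps_subst_hfps_trunc] mfps_nth_edge_monomial_0) simp
    finally show "trunc_eq M (\<Sum>d\<le>M. hval (\<lambda>n. ?P ^ n * ?\<phi> n * mfps_const (x (Suc k) n)) d)
        (\<Prod>j=1..k. mfps_subst (hfps (\<lambda>n. y j n * x (Suc k) n)) (edge_monomial j (Suc k)))" .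
  qed
  also have "(\<lambda>n. ?P ^ n * ?\<phi> n + mfps_const (y (Suc k) n)) =
      (\<lambda>n. \<Sum>j=1..Suc k. edge_monomial j (Suc k) ^ n * mfps_const (y j n))"
    unfolding shift by (rule ext) (simp add: edge_monomial_def)
  finally show ?case
    by (simp add: mult.assoc atLeastLessThanSuc_atLeastAtMost)
qed

text \<open>Unfolding the recursion. The label of the open edge enters by a function update, so that the
  induction can replace it; the factor \<open>of_bool\<close> records that edge 0 carries the empty partition.\<close>

lemma strip_sum_families:
  "strip_sum M x y k \<tau> = (\<Sum>\<nu> | (\<forall>i<k. \<nu> i \<in> parts_le M) \<and> (\<forall>i\<ge>k. \<nu> i = []) .
     of_bool ((\<nu>(k := \<tau>)) 0 = []) *
     (\<Prod>i<k. mfps_X i ^ sum_list (\<nu> i) * mfps_const (transfer (x (Suc i)) (y (Suc i)) (\<nu> i) ((\<nu>(k := \<tau>)) (Suc i)))))"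
proof (induction k arbitrary: \<tau>)
  case 0
  have "{\<nu> :: nat \<Rightarrow> nat list. \<forall>i. \<nu> i = []} = {\<lambda>_. []}" by auto
  then show ?case by simp
next
  case (Suc k)
  let ?F = "\<lambda>k. {\<nu>. (\<forall>i<k. \<nu> i \<in> parts_le M) \<and> (\<forall>i\<ge>k. \<nu> i = [])}"
  let ?t = "\<lambda>i \<nu> \<tau>. mfps_X i ^ sum_list \<nu> * mfps_const (transfer (x (Suc i)) (y (Suc i)) \<nu> \<tau>)"
  have "strip_sum M x y (Suc k) \<tau> = (\<Sum>\<sigma>\<in>parts_le M. \<Sum>\<nu>\<in>?F k. of_bool ((\<nu>(k := \<sigma>)) 0 = []) *
      (\<Prod>i<k. ?t i (\<nu> i) ((\<nu>(k := \<sigma>)) (Suc i))) * ?t k \<sigma> \<tau>)"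
    by (simp add: Suc.IH sum_distrib_left sum_distrib_right mult_ac)
  also have "\<dots> = (\<Sum>(\<sigma>, \<nu>)\<in>parts_le M \<times> ?F k. of_bool ((\<nu>(k := \<sigma>)) 0 = []) *
      (\<Prod>i<k. ?t i (\<nu> i) ((\<nu>(k := \<sigma>)) (Suc i))) * ?t k \<sigma> \<tau>)"
    by (simp add: sum.cartesian_product)
  also have "\<dots> = (\<Sum>\<nu>\<in>?F (Suc k). of_bool ((\<nu>(Suc k := \<tau>)) 0 = []) *
      (\<Prod>i<Suc k. ?t i (\<nu> i) ((\<nu>(Suc k := \<tau>)) (Suc i))))"
    by (rule sum.reindex_bij_witness[of _ "\<lambda>\<nu>. (\<nu> k, \<nu>(k := []))" "\<lambda>(\<sigma>, \<nu>). \<nu>(k := \<sigma>)"])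
       (auto simp: fun_eq_iff less_Suc_eq mult.assoc intro!: prod.cong)
  finally show ?case .
qed

lemma lookup_sum_single: "Poly_Mapping.lookup (\<Sum>i<(k::nat). Poly_Mapping.single i (f i :: nat)) j = (if j < k then f j else 0)"
  by (induction k) (auto simp: lookup_add lookup_single when_def)

lemma mfps_nth_X_mult:
  "mfps_nth (mfps_X i * F :: 'a :: comm_ring_1 mfps) (Poly_Mapping.single i 1 + \<alpha>) = mfps_nth F \<alpha>"
  and mfps_nth_X_mult_0: "Poly_Mapping.lookup \<beta> i = 0 \<Longrightarrow> mfps_nth (mfps_X i * F) \<beta> = 0"
proof -
  have nth: "mfps_nth (mfps_X i * F) \<beta> = (\<Sum>p\<in>{p \<in> splits \<beta>. fst p = Poly_Mapping.single i 1}. mfps_nth F (snd p))" for \<beta>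
    unfolding mfps_nth_mult sum.inter_filter[OF finite_splits]
    by (rule sum.cong) (auto simp: mfps_X_def)
  have "{p \<in> splits (Poly_Mapping.single i 1 + \<alpha>). fst p = Poly_Mapping.single i 1} = {(Poly_Mapping.single i 1, \<alpha>)}"
    by (auto simp: splits_def)
  then show "mfps_nth (mfps_X i * F) (Poly_Mapping.single i 1 + \<alpha>) = mfps_nth F \<alpha>"
    by (simp add: nth)
  assume "Poly_Mapping.lookup \<beta> i = 0"
  then have "{p \<in> splits \<beta>. fst p = Poly_Mapping.single i 1} = {}"
    by (auto simp: splits_def lookup_add)
  then show "mfps_nth (mfps_X i * F) \<beta> = 0" by (simp only: nth sum.empty)
qed

lemma X_mult_eq_shift: "mfps_X i * Abs_mfps (\<lambda>\<beta>. of_bool (\<beta> = \<alpha>)) = Abs_mfps (\<lambda>\<beta>. of_bool (\<beta> = Poly_Mapping.single i 1 + \<alpha>) :: 'a :: comm_ring_1)"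
proof (rule mfps_eqI)
  fix \<beta> :: "nat \<Rightarrow>\<^sub>0 nat"
  show "mfps_nth (mfps_X i * Abs_mfps (\<lambda>\<beta>. of_bool (\<beta> = \<alpha>))) \<beta> =
      (mfps_nth (Abs_mfps (\<lambda>\<beta>. of_bool (\<beta> = Poly_Mapping.single i 1 + \<alpha>))) \<beta> :: 'a)"
  proof (cases "Poly_Mapping.lookup \<beta> i = 0")
    case True
    then have "\<beta> \<noteq> Poly_Mapping.single i 1 + \<alpha>" by (auto simp: lookup_add)
    then show ?thesis using True by (simp add: mfps_nth_X_mult_0)
  next
    case False
    then have "\<beta> = Poly_Mapping.single i 1 + (\<beta> - Poly_Mapping.single i 1)"
      by (intro poly_mapping_eqI) (auto simp: lookup_add lookup_minus lookup_single when_def)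
    then obtain \<gamma> where "\<beta> = Poly_Mapping.single i 1 + \<gamma>" by blast
    then show ?thesis by (simp add: mfps_nth_X_mult[unfolded One_nat_def])
  qed
qed

lemma mfps_nth_monomial:
  "mfps_nth (\<Prod>i<k. mfps_X i ^ f i :: 'a :: comm_ring_1 mfps) \<alpha> = of_bool (\<alpha> = (\<Sum>i<k. Poly_Mapping.single i (f i)))"
proof -
  have pow: "mfps_X i ^ n * Abs_mfps (\<lambda>\<beta>. of_bool (\<beta> = \<alpha>)) = Abs_mfps (\<lambda>\<beta>. of_bool (\<beta> = Poly_Mapping.single i n + \<alpha>) :: 'a)" for i n \<alpha>
  proof (induction n)
    case (Suc n)
    have "Poly_Mapping.single i 1 + (Poly_Mapping.single i n + \<alpha>) = Poly_Mapping.single i (Suc n) + \<alpha>"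
      by (simp add: single_add[symmetric] add.assoc[symmetric])
    then show ?case using Suc X_mult_eq_shift[of i "Poly_Mapping.single i n + \<alpha>", where ?'a = 'a]
      by (simp add: mult.assoc)
  qed simp
  have one: "(1 :: 'a mfps) = Abs_mfps (\<lambda>\<beta>. of_bool (\<beta> = 0))"
    by (rule mfps_eqI) (simp add: mfps_nth_1)
  have "(\<Prod>i<k. mfps_X i ^ f i :: 'a mfps) = Abs_mfps (\<lambda>\<beta>. of_bool (\<beta> = (\<Sum>i<k. Poly_Mapping.single i (f i))))"
  proof (induction k)
    case 0
    then show ?case using one by simp
  next
    case (Suc k)
    then show ?case by (simp add: pow mult.commute add.commute)
  qed
  then show ?thesis by simp
qed

lemma strip_sum_coeff:
  assumes "mdeg \<alpha> \<le> M" "1 \<le> N"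
  shows "mfps_nth (strip_sum M x y N []) \<alpha> =
    (\<Sum>\<nu> | (\<forall>k. is_partition (\<nu> k) \<and> sum_list (\<nu> k) = Poly_Mapping.lookup \<alpha> k) \<and> (\<forall>k. k \<notin> {1..<N} \<longrightarrow> \<nu> k = []).
       \<Prod>i<N. transfer (x (Suc i)) (y (Suc i)) (\<nu> i) (\<nu> (Suc i)))"
proof -
  let ?F = "{\<nu>. (\<forall>i<N. \<nu> i \<in> parts_le M) \<and> (\<forall>i\<ge>N. \<nu> i = [])}"
  let ?S = "{\<nu>. (\<forall>k. is_partition (\<nu> k) \<and> sum_list (\<nu> k) = Poly_Mapping.lookup \<alpha> k) \<and> (\<forall>k. k \<notin> {1..<N} \<longrightarrow> \<nu> k = [])}"
  let ?t = "\<lambda>\<nu>. \<Prod>i<N. transfer (x (Suc i)) (y (Suc i)) (\<nu> i) (\<nu> (Suc i))"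
  have "finite {\<nu>. \<forall>i. (i \<in> {..<N} \<longrightarrow> \<nu> i \<in> parts_le M) \<and> (i \<notin> {..<N} \<longrightarrow> \<nu> i = [])}"
    by (rule finite_set_of_finite_funs) auto
  then have fin: "finite ?F"
    by (rule rev_finite_subset) (auto simp: not_less)
  have le: "Poly_Mapping.lookup \<alpha> i \<le> M" for i
  proof -
    obtain n where n: "Poly_Mapping.keys \<alpha> \<subseteq> {..<n}" using exists_keys_bound by blast
    show ?thesis
    proof (cases "i < n")
      case True
      then have "Poly_Mapping.lookup \<alpha> i \<le> (\<Sum>i<n. Poly_Mapping.lookup \<alpha> i)" by (intro member_le_sum) auto
      then show ?thesis using assms(1) mdeg_eq_sum[OF n] by simp
    qed (use n in \<open>simp add: keys_subset_iff_beyond\<close>)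
  qed
  have prod_const: "(\<Prod>i\<in>A. mfps_const (g i)) = mfps_const (\<Prod>i\<in>A. g i :: complex)" for A and g :: "nat \<Rightarrow> complex"
    by (induction A rule: infinite_finite_induct) (auto simp: mfps_const_mult)
  have summand: "mfps_nth (of_bool ((\<nu>(N := [])) 0 = []) * (\<Prod>i<N. mfps_X i ^ sum_list (\<nu> i) *
        mfps_const (transfer (x (Suc i)) (y (Suc i)) (\<nu> i) ((\<nu>(N := [])) (Suc i))))) \<alpha> =
      (if \<nu> \<in> ?S then ?t \<nu> else 0)" if F: "\<nu> \<in> ?F" for \<nu>
  proof -
    have upd: "\<nu>(N := []) = \<nu>" using F by (auto simp: fun_eq_iff)
    have "\<alpha> = (\<Sum>i<N. Poly_Mapping.single i (sum_list (\<nu> i))) \<longleftrightarrow> (\<forall>k. sum_list (\<nu> k) = Poly_Mapping.lookup \<alpha> k)"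
    proof -
      have "Poly_Mapping.lookup (\<Sum>i<N. Poly_Mapping.single i (sum_list (\<nu> i))) k = sum_list (\<nu> k)" for k
        using F by (auto simp: lookup_sum_single not_less)
      then show ?thesis by (auto simp: poly_mapping_eq_iff fun_eq_iff)
    qed
    moreover have "is_partition (\<nu> k)" for k
      using F by (cases "k < N") (auto simp: parts_le_def)
    moreover have "(\<forall>k. k \<notin> {1..<N} \<longrightarrow> \<nu> k = []) \<longleftrightarrow> \<nu> 0 = []"
      using F by (auto simp: not_less Suc_le_eq)
    ultimately have S: "\<nu> \<in> ?S \<longleftrightarrow> \<nu> 0 = [] \<and> \<alpha> = (\<Sum>i<N. Poly_Mapping.single i (sum_list (\<nu> i)))"
      by auto
    have "(\<Prod>i<N. mfps_X i ^ sum_list (\<nu> i) * mfps_const (transfer (x (Suc i)) (y (Suc i)) (\<nu> i) (\<nu> (Suc i)))) =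
        mfps_const (?t \<nu>) * (\<Prod>i<N. mfps_X i ^ sum_list (\<nu> i))"
      by (simp add: prod.distrib prod_const mult.commute)
    then show ?thesis
      unfolding upd S by (simp add: mfps_nth_monomial)
  qed
  have "mfps_nth (strip_sum M x y N []) \<alpha> = (\<Sum>\<nu>\<in>?F. if \<nu> \<in> ?S then ?t \<nu> else 0)"
    unfolding strip_sum_families mfps_nth_sum by (rule sum.cong[OF refl summand])
  also have "\<dots> = (\<Sum>\<nu>\<in>?S. ?t \<nu>)"
  proof (rule sum.mono_neutral_cong_right[OF fin])
    show "?S \<subseteq> ?F" using le by (auto simp: parts_le_def)
  qed auto
  finally show ?thesis .
qed


section \<open>The topological vertex and the strip amplitude\<close>

lemma schur_val_psum_at_Nil: "W2 s \<mu> [] = W1 s \<mu>" for s :: complex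
  using sym_eval_schur[of "[]" "psum_at s \<mu>"] by (simp add: W2_def)

text \<open>With the framing factor of its third leg, the vertex is a transfer matrix: reindexing by
  \<open>\<rho>\<^sup>3 \<mapsto> (\<rho>\<^sup>3)\<^sup>t\<close> removes the transpositions, the powers of \<open>q\<close> that depend on \<open>\<tau>\<close> cancel, and
  what remains turns \<open>W\<close> of \<open>\<mu>\<^sup>t\<close> into \<open>W\<close> of \<open>\<mu>\<close>.\<close>

lemma vertex_eq_transfer:
  fixes s :: complex
  assumes s: "s \<noteq> 0" "\<And>m. m \<ge> 1 \<Longrightarrow> qnum s m \<noteq> 0"
    and part: "is_partition \<sigma>" "is_partition \<mu>" "is_partition \<tau>"
  shows "s powi kappa \<tau> * W3 s \<sigma> \<mu> (conj_part \<tau>) =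
    W1 s \<mu> * transfer (psum_at s (conj_part \<mu>)) (psum_at s \<mu>) \<sigma> \<tau>"
proof -
  let ?x = "psum_at s (conj_part \<mu>)" and ?y = "psum_at s \<mu>"
  have nz: "W1 s \<mu> \<noteq> 0"
  proof -
    have "finite {m. m \<ge> 1 \<and> e_coeff' \<mu> m \<noteq> 0}"
      by (rule finite_subset[OF _ finite_e_coeff[of \<mu> \<mu>]]) (use part(2) in \<open>auto simp: e_coeff'_eq\<close>)
    then have "(\<Prod>m | m \<ge> 1 \<and> e_coeff' \<mu> m \<noteq> 0. qnum s m powi e_coeff' \<mu> m) \<noteq> 0"
      using s(2) by (simp add: prod_zero_iff)
    moreover have "W1 s \<mu> = s powi (kappa \<mu> div 2) * (\<Prod>m | m \<ge> 1 \<and> e_coeff' \<mu> m \<noteq> 0. qnum s m powi e_coeff' \<mu> m)"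
      by (rule W1_eq_prod_e_coeff'[OF part(2) s(2)])
    ultimately show ?thesis using s(1) by simp
  qed
  have W2: "W2 s (conj_part \<mu>) \<rho> * W2 s \<mu> \<rho>' / W2 s \<mu> [] = W1 s (conj_part \<mu>) * (schur_val ?x \<rho> * schur_val ?y \<rho>')"
    if "is_partition \<rho>" "is_partition \<rho>'" for \<rho> \<rho>'
    using nz that unfolding schur_val_psum_at_Nil by (simp add: W2_def sym_eval_schur)
  let ?c = "s powi (kappa \<mu> - kappa \<tau>) * W1 s (conj_part \<mu>)"
  have "W3 s \<sigma> \<mu> (conj_part \<tau>) = (\<Sum>\<rho>\<in>parts_le (sum_list \<sigma>). \<Sum>\<rho>3\<in>parts_le (sum_list \<tau>).
      of_int (\<Sum>\<eta>\<in>parts_le (sum_list \<sigma>). lr_coeff \<eta> \<rho> \<sigma> * lr_coeff \<eta> (conj_part \<rho>3) \<tau>)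
      * (s powi (kappa \<mu> - kappa \<tau>)) * (W2 s (conj_part \<mu>) \<rho> * W2 s \<mu> (conj_part \<rho>3) / W2 s \<mu> []))"
    unfolding W3_def using part by (simp add: parts_le_def[symmetric] kappa_conj)
  also have "\<dots> = (\<Sum>\<rho>\<in>parts_le (sum_list \<sigma>). \<Sum>\<rho>'\<in>parts_le (sum_list \<tau>).
      of_int (\<Sum>\<eta>\<in>parts_le (sum_list \<sigma>). lr_coeff \<eta> \<rho> \<sigma> * lr_coeff \<eta> \<rho>' \<tau>)
      * (s powi (kappa \<mu> - kappa \<tau>)) * (W2 s (conj_part \<mu>) \<rho> * W2 s \<mu> \<rho>' / W2 s \<mu> []))"
    by (intro sum.cong refl sum.reindex_bij_witness[of _ conj_part conj_part]) (auto simp: parts_le_def)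
  also have "\<dots> = ?c * transfer ?x ?y \<sigma> \<tau>"
    unfolding transfer_def sum_distrib_left
  proof (intro sum.cong refl)
    fix \<rho> \<rho>' assume "\<rho> \<in> parts_le (sum_list \<sigma>)" "\<rho>' \<in> parts_le (sum_list \<tau>)"
    then have "is_partition \<rho>" "is_partition \<rho>'" by (auto simp: parts_le_def)
    note W2[OF this]
    then show "of_int (\<Sum>\<eta>\<in>parts_le (sum_list \<sigma>). lr_coeff \<eta> \<rho> \<sigma> * lr_coeff \<eta> \<rho>' \<tau>)
      * (s powi (kappa \<mu> - kappa \<tau>)) * (W2 s (conj_part \<mu>) \<rho> * W2 s \<mu> \<rho>' / W2 s \<mu> []) =
      (\<Sum>\<eta>\<in>parts_le (sum_list \<sigma>). ?c * (of_int (lr_coeff \<eta> \<rho> \<sigma>) * of_int (lr_coeff \<eta> \<rho>' \<tau>) * schur_val ?x \<rho> * schur_val ?y \<rho>'))"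
      by (simp only: of_int_sum of_int_mult sum_distrib_right) (intro sum.cong refl, simp only: mult_ac)
  qed
  finally have "s powi kappa \<tau> * W3 s \<sigma> \<mu> (conj_part \<tau>) =
      (s powi kappa \<tau> * s powi (kappa \<mu> - kappa \<tau>)) * W1 s (conj_part \<mu>) * transfer ?x ?y \<sigma> \<tau>"
    by (simp only: mult.assoc)
  also have "s powi kappa \<tau> * s powi (kappa \<mu> - kappa \<tau>) = s powi kappa \<mu>"
    using s(1) by (simp add: power_int_add[symmetric])
  finally show ?thesis using W1_conj[OF part(2) s] by simp
qed

text \<open>Closing off the last edge with the empty partition leaves only the scalars that the gluing
  steps have produced, a Cauchy kernel for each pair of vertices.\<close>

theorem Ktilde_product:
  fixes s :: complex
  assumes s: "s \<noteq> 0" "\<And>m. m \<ge> 1 \<Longrightarrow> qnum s m \<noteq> 0" and N: "1 \<le> N"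
    and part: "\<And>k. k \<in> {1..N} \<Longrightarrow> is_partition (\<mu> k)"
  shows "Ktilde s N \<mu> = mfps_const (\<Prod>k=1..N. W1 s (\<mu> k)) *
    (\<Prod>l=1..N. \<Prod>j=1..<l. mfps_subst (hfps (\<lambda>n. psum_at s (\<mu> j) n * psum_at s (conj_part (\<mu> l)) n)) (edge_monomial j l))"
proof (rule trunc_eqD)
  fix M
  let ?x = "\<lambda>k. psum_at s (conj_part (\<mu> k))" and ?y = "\<lambda>k. psum_at s (\<mu> k)"
  let ?W = "\<Prod>k=1..N. W1 s (\<mu> k)"
  let ?K = "\<Prod>l=1..N. \<Prod>j=1..<l. mfps_subst (hfps (\<lambda>n. ?y j n * ?x l n)) (edge_monomial j l)"
  have "trunc_eq M (Ktilde s N \<mu>) (mfps_const ?W * strip_sum M ?x ?y N [])"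
    unfolding trunc_eq_def
  proof (intro allI impI)
    fix \<alpha> :: "nat \<Rightarrow>\<^sub>0 nat" assume \<alpha>: "mdeg \<alpha> \<le> M"
    let ?S = "{\<nu>. (\<forall>k. is_partition (\<nu> k) \<and> sum_list (\<nu> k) = Poly_Mapping.lookup \<alpha> k) \<and> (\<forall>k. k \<notin> {1..<N} \<longrightarrow> \<nu> k = [])}"
    have "mfps_nth (Ktilde s N \<mu>) \<alpha> = (\<Sum>\<nu>\<in>?S. \<Prod>k=1..N. s powi kappa (\<nu> k) * W3 s (\<nu> (k - 1)) (\<mu> k) (conj_part (\<nu> k)))"
      by (simp add: Ktilde_def)
    also have "\<dots> = (\<Sum>\<nu>\<in>?S. ?W * (\<Prod>i<N. transfer (?x (Suc i)) (?y (Suc i)) (\<nu> i) (\<nu> (Suc i))))"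
    proof (rule sum.cong[OF refl])
      fix \<nu> assume \<nu>: "\<nu> \<in> ?S"
      have "(\<Prod>k=1..N. s powi kappa (\<nu> k) * W3 s (\<nu> (k - 1)) (\<mu> k) (conj_part (\<nu> k))) =
          (\<Prod>k=1..N. W1 s (\<mu> k) * transfer (?x k) (?y k) (\<nu> (k - 1)) (\<nu> k))"
        using \<nu> part by (intro prod.cong refl vertex_eq_transfer[OF s]) auto
      also have "\<dots> = ?W * (\<Prod>k=1..N. transfer (?x k) (?y k) (\<nu> (k - 1)) (\<nu> k))"
        by (simp only: prod.distrib)
      also have "(\<Prod>k=1..N. transfer (?x k) (?y k) (\<nu> (k - 1)) (\<nu> k)) =
          (\<Prod>i<N. transfer (?x (Suc i)) (?y (Suc i)) (\<nu> i) (\<nu> (Suc i)))"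
        unfolding One_nat_def prod.atLeast1_atMost_eq by simp
      finally show "(\<Prod>k=1..N. s powi kappa (\<nu> k) * W3 s (\<nu> (k - 1)) (\<mu> k) (conj_part (\<nu> k))) =
          ?W * (\<Prod>i<N. transfer (?x (Suc i)) (?y (Suc i)) (\<nu> i) (\<nu> (Suc i)))" .
    qed
    also have "\<dots> = ?W * mfps_nth (strip_sum M ?x ?y N []) \<alpha>"
      unfolding strip_sum_coeff[OF \<alpha> N] sum_distrib_left ..
    finally show "mfps_nth (Ktilde s N \<mu>) \<alpha> = mfps_nth (mfps_const ?W * strip_sum M ?x ?y N []) \<alpha>"
      by simp
  qed
  also have "trunc_eq M \<dots> (mfps_const ?W * (?K * schur_val (\<lambda>n. \<Sum>j=1..N. edge_monomial j N ^ n * mfps_const (?y j n)) []))"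
    by (intro trunc_eq_mult trunc_eq_refl strip_sum_trunc) (simp add: parts_le_def)
  finally show "trunc_eq M (Ktilde s N \<mu>) (mfps_const ?W * ?K)" by simp
qed

lemma W1_Nil [simp]: "W1 s [] = 1"
  by (simp add: W1_zero_based kappa_def)

text \<open>One of the two factors is a Schur function at \<open>q\<^sup>\<rho>\<close> by definition, the other one by the principal
  specialisation; then this is the Cauchy identity.\<close>

lemma K00_eq:
  fixes s :: complex
  assumes s: "s \<noteq> 0" "\<And>n. n \<ge> 1 \<Longrightarrow> (s^2) ^ n \<noteq> 1"
  shows "K00 s = hfps (\<lambda>n. (psum_at s [] n)^2)"
proof (rule fps_ext)
  fix n
  have "fps_nth (K00 s) n = (\<Sum>\<nu>\<in>partitions_of n. schur_val (psum_at s []) \<nu> * schur_val (psum_at s []) \<nu>)"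
    unfolding K00_def partitions_of_def fps_nth_Abs_fps
  proof (rule sum.cong[OF refl])
    fix \<nu> assume "\<nu> \<in> {\<nu>. is_partition \<nu> \<and> sum_list \<nu> = n}"
    then have "is_partition \<nu>" by simp
    then show "W2 s [] \<nu> * W2 s \<nu> [] = schur_val (psum_at s []) \<nu> * schur_val (psum_at s []) \<nu>"
      using W1_eq_schur_val[OF s \<open>is_partition \<nu>\<close>]
      by (simp add: schur_val_psum_at_Nil) (simp add: W2_def sym_eval_schur)
  qed
  then show "fps_nth (K00 s) n = fps_nth (hfps (\<lambda>n. (psum_at s [] n)^2)) n"
    by (simp add: cauchy_identity power2_eq_square)
qed

section \<open>Convergence\<close>

lemma monomial_add:
  fixes x :: "nat \<Rightarrow> 'a :: comm_ring_1"
  shows "(\<Prod>i\<in>Poly_Mapping.keys (\<gamma> + \<delta>). x i ^ Poly_Mapping.lookup (\<gamma> + \<delta>) i) =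
    (\<Prod>i\<in>Poly_Mapping.keys \<gamma>. x i ^ Poly_Mapping.lookup \<gamma> i) * (\<Prod>i\<in>Poly_Mapping.keys \<delta>. x i ^ Poly_Mapping.lookup \<delta> i)"
proof -
  obtain n where n: "Poly_Mapping.keys (\<gamma> + \<delta>) \<subseteq> {..<n}" using exists_keys_bound by blast
  then have n': "Poly_Mapping.keys \<gamma> \<subseteq> {..<n}" "Poly_Mapping.keys \<delta> \<subseteq> {..<n}"
    by (auto simp: keys_subset_iff_beyond lookup_add)
  have "(\<Prod>i\<in>Poly_Mapping.keys \<alpha>. x i ^ Poly_Mapping.lookup \<alpha> i) = (\<Prod>i<n. x i ^ Poly_Mapping.lookup \<alpha> i)"
    if "Poly_Mapping.keys \<alpha> \<subseteq> {..<n}" for \<alpha>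
    using that by (intro prod.mono_neutral_left) (auto simp: in_keys_iff)
  note this[OF n] this[OF n'(1)] this[OF n'(2)]
  then show ?thesis by (simp only: lookup_add power_add prod.distrib)
qed

text \<open>The Cauchy product of absolutely convergent series: regroup the double sum along the splittings
  of the exponent.\<close>

lemma mfps_sums_mult:
  assumes "mfps_sums F x u" "mfps_sums G x v"
  shows "mfps_sums (F * G) x (u * v)"
proof -
  define mon where "mon \<alpha> = (\<Prod>i\<in>Poly_Mapping.keys \<alpha>. x i ^ Poly_Mapping.lookup \<alpha> i)" for \<alpha>
  define f where "f \<alpha> = mfps_nth F \<alpha> * mon \<alpha>" for \<alpha>
  define g where "g \<alpha> = mfps_nth G \<alpha> * mon \<alpha>" for \<alpha>
  have f: "(f has_sum u) UNIV" and g: "(g has_sum v) UNIV"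
    using assms by (simp_all add: mfps_sums_def f_def[abs_def] g_def[abs_def] mon_def)
  have "(\<lambda>\<gamma>. norm (f \<gamma>)) summable_on UNIV" "(\<lambda>\<delta>. norm (g \<delta>)) summable_on UNIV"
    using f g by (auto simp flip: summable_on_iff_abs_summable_on_complex simp: summable_on_def)
  then have "(\<lambda>p. norm (f (fst p) * g (snd p))) summable_on UNIV \<times> UNIV"
    by (intro summable_on_SigmaI[where g = "\<lambda>\<gamma>. norm (f \<gamma>) * (\<Sum>\<^sub>\<infinity>\<delta>. norm (g \<delta>))"])
       (auto simp: norm_mult intro!: has_sum_cmult_right summable_on_cmult_left)
  then have "(\<lambda>p. f (fst p) * g (snd p)) summable_on UNIV \<times> UNIV"
    by (rule abs_summable_summable)
  then have "((\<lambda>p. f (fst p) * g (snd p)) has_sum u * v) (UNIV \<times> UNIV)"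
    by (intro has_sum_SigmaI[where g = "\<lambda>\<gamma>. f \<gamma> * v"])
       (auto intro: has_sum_cmult_right[OF g] has_sum_cmult_left[OF f])
  moreover have "bij_betw snd (SIGMA \<alpha>:UNIV. splits \<alpha>) (UNIV \<times> UNIV)"
    by (rule bij_betwI[where g = "\<lambda>p. (fst p + snd p, p)"]) (auto simp: splits_def)
  ultimately have "((\<lambda>q. f (fst (snd q)) * g (snd (snd q))) has_sum u * v) (SIGMA \<alpha>:UNIV. splits \<alpha>)"
    by (subst has_sum_reindex_bij_betw[where f = "\<lambda>p. f (fst p) * g (snd p)"]) auto
  moreover have "((\<lambda>p. f (fst (snd (\<alpha>, p))) * g (snd (snd (\<alpha>, p)))) has_sum mfps_nth (F * G) \<alpha> * mon \<alpha>) (splits \<alpha>)" for \<alpha>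
  proof -
    have "(\<Sum>p\<in>splits \<alpha>. f (fst p) * g (snd p)) = mfps_nth (F * G) \<alpha> * mon \<alpha>"
      unfolding mfps_nth_mult sum_distrib_right
    proof (rule sum.cong[OF refl])
      fix p assume "p \<in> splits \<alpha>"
      then obtain \<gamma> \<delta> where "p = (\<gamma>, \<delta>)" "\<alpha> = \<gamma> + \<delta>" by (auto simp: splits_def)
      then show "f (fst p) * g (snd p) = (case p of (\<gamma>, \<delta>) \<Rightarrow> mfps_nth F \<gamma> * mfps_nth G \<delta>) * mon \<alpha>"
        by (simp add: f_def g_def mon_def monomial_add mult_ac)
    qed
    then show ?thesis using has_sum_finite[OF finite_splits, of "\<lambda>p. f (fst p) * g (snd p)" \<alpha>] by simp
  qed
  ultimately have "((\<lambda>\<alpha>. mfps_nth (F * G) \<alpha> * mon \<alpha>) has_sum u * v) UNIV"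
    by (rule has_sum_SigmaD)
  then show ?thesis by (simp add: mfps_sums_def mon_def)
qed

lemma mfps_sums_const: "mfps_sums (mfps_const c) x c"
proof -
  have "((\<lambda>\<alpha>. c) has_sum c) {0 :: nat \<Rightarrow>\<^sub>0 nat}"
    using has_sum_finite[of "{0 :: nat \<Rightarrow>\<^sub>0 nat}" "\<lambda>_. c"] by simp
  then show ?thesis
    unfolding mfps_sums_def by (rule iffD1[OF has_sum_cong_neutral, rotated 3]) (auto simp: mfps_nth_const)
qed

lemma mfps_sums_prod:
  "(\<And>i. i \<in> A \<Longrightarrow> mfps_sums (F i) x (v i)) \<Longrightarrow> mfps_sums (prod F A) x (prod v A)"
  using mfps_sums_const[of 1 x]
  by (induction A rule: infinite_finite_induct) (auto intro: mfps_sums_mult)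

lemma mfps_sums_power: "mfps_sums F x v \<Longrightarrow> mfps_sums (F ^ n) x (v ^ n)"
  using mfps_sums_const[of 1 x] by (induction n) (auto intro: mfps_sums_mult)

text \<open>Distinct powers of the monomial are distinct monomials, so the series is a relabelled power
  series in one variable.\<close>

lemma mfps_sums_subst:
  assumes "k < l" and sum: "((\<lambda>j. fps_nth F j * (\<Prod>i=k..<l. x i) ^ j) has_sum v) UNIV"
  shows "mfps_sums (mfps_subst F (edge_monomial k l)) x v"
proof -
  define A where "A j = (\<Sum>i<l. Poly_Mapping.single i (if k \<le> i then j else 0))" for j :: nat
  have lookup: "Poly_Mapping.lookup (A j) i = (if i < l \<and> k \<le> i then j else 0)" for i j
    by (simp add: A_def lookup_sum_single)
  have inj: "inj A"
  proof (rule injI)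
    fix j j' assume "A j = A j'"
    then have "Poly_Mapping.lookup (A j) k = Poly_Mapping.lookup (A j') k" by simp
    then show "j = j'" using assms(1) by (simp add: lookup)
  qed
  have keys: "Poly_Mapping.keys (A j) \<subseteq> {..<l}" for j
    by (auto simp: keys_subset_iff_beyond lookup)
  have deg: "j \<le> mdeg (A j)" for j
  proof -
    have "Poly_Mapping.lookup (A j) k \<le> (\<Sum>i<l. Poly_Mapping.lookup (A j) i)"
      using assms(1) by (intro member_le_sum) auto
    then show ?thesis using assms(1) by (simp add: mdeg_eq_sum[OF keys] lookup)
  qed
  have power: "edge_monomial k l ^ j = (\<Prod>i<l. mfps_X i ^ (if k \<le> i then j else 0))" for j
  proof -
    have "(\<Prod>i<l. mfps_X i ^ (if k \<le> i then j else 0)) = (\<Prod>i=k..<l. mfps_X i ^ j :: complex mfps)"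
      by (intro prod.mono_neutral_cong_right) auto
    then show ?thesis by (simp add: edge_monomial_def prod_power_distrib)
  qed
  have nth: "mfps_nth (mfps_subst F (edge_monomial k l)) \<alpha> = (\<Sum>j\<le>mdeg \<alpha>. fps_nth F j * of_bool (\<alpha> = A j))" for \<alpha>
    by (simp add: mfps_subst_def power mfps_nth_monomial A_def)
  have nth_A: "mfps_nth (mfps_subst F (edge_monomial k l)) (A j) = fps_nth F j" for j
  proof -
    have "mfps_nth (mfps_subst F (edge_monomial k l)) (A j) = (\<Sum>i\<le>mdeg (A j). if i = j then fps_nth F i else 0)"
      unfolding nth by (intro sum.cong refl) (use inj in \<open>auto simp: inj_eq\<close>)
    then show ?thesis using deg[of j] by simp
  qed
  have mon: "(\<Prod>i\<in>Poly_Mapping.keys (A j). x i ^ Poly_Mapping.lookup (A j) i) = (\<Prod>i=k..<l. x i) ^ j" for j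
  proof -
    have "(\<Prod>i\<in>Poly_Mapping.keys (A j). x i ^ Poly_Mapping.lookup (A j) i) = (\<Prod>i=k..<l. x i ^ Poly_Mapping.lookup (A j) i)"
      by (intro prod.mono_neutral_left) (auto simp: in_keys_iff lookup split: if_splits)
    also have "\<dots> = (\<Prod>i=k..<l. x i ^ j)"
      by (intro prod.cong refl) (simp add: lookup)
    finally show ?thesis by (simp add: prod_power_distrib)
  qed
  let ?f = "\<lambda>\<alpha>. mfps_nth (mfps_subst F (edge_monomial k l)) \<alpha> * (\<Prod>i\<in>Poly_Mapping.keys \<alpha>. x i ^ Poly_Mapping.lookup \<alpha> i)"
  have "(?f has_sum v) (range A)"
    using sum by (subst has_sum_reindex[OF inj]) (simp add: o_def nth_A mon)
  then show ?thesis
    unfolding mfps_sums_def by (rule iffD1[OF has_sum_cong_neutral, rotated 3]) (auto simp: nth intro!: sum.neutral)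
qed

lemma hval_neg_geometric: "hval (\<lambda>n. - (c ^ n)) n = (if n = 0 then 1 else if n = 1 then - c else 0)"
proof (rule hval_eqI[symmetric])
  let ?h = "\<lambda>n. if n = 0 then 1 else if n = 1 then - c else 0"
  show "of_nat n * ?h n = (\<Sum>k=1..n. - (c ^ k) * ?h (n - k))" for n
  proof (cases "n \<le> 1")
    case True
    then have "n = 0 \<or> n = 1" by linarith
    then show ?thesis by auto
  next
    case False
    then obtain m where m: "n = Suc (Suc m)" by (metis Suc_le_D not_less_eq_eq One_nat_def)
    have "(\<Sum>k=1..n. - (c ^ k) * ?h (n - k)) = (\<Sum>k\<in>{n - 1, n}. - (c ^ k) * ?h (n - k))"
      using m by (intro sum.mono_neutral_right) auto
    then show ?thesis using m by simp
  qed
qed simp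

text \<open>Each factor of the rational function is either a geometric series or a linear polynomial.\<close>

lemma mfps_sums_geometric_power:
  assumes "k < l" and small: "norm (c * (\<Prod>i=k..<l. x i)) < 1"
  shows "mfps_sums (mfps_subst (hfps (\<lambda>n. of_int e * c ^ n)) (edge_monomial k l)) x
    ((1 - c * (\<Prod>i=k..<l. x i)) powi (- e))"
proof -
  let ?t = "\<Prod>i=k..<l. x i"
  have copies: "mfps_subst (hfps (\<lambda>n. of_nat d * \<phi> n)) (edge_monomial k l) =
      mfps_subst (hfps \<phi>) (edge_monomial k l) ^ d" for d and \<phi> :: "nat \<Rightarrow> complex"
    using mfps_subst_hfps_sum[OF mfps_nth_edge_monomial_0[OF assms(1)], of "{..<d}" "\<lambda>_. \<phi>"] by simp
  have geo: "mfps_sums (mfps_subst (hfps (\<lambda>n. c ^ n)) (edge_monomial k l)) x (1 / (1 - c * ?t))"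
  proof (rule mfps_sums_subst[OF assms(1)])
    have "((\<lambda>j. (c * ?t) ^ j) has_sum 1 / (1 - c * ?t)) UNIV"
      using small by (intro norm_summable_imp_has_sum geometric_sums) (simp_all add: norm_power)
    then show "((\<lambda>j. fps_nth (hfps (\<lambda>n. c ^ n)) j * ?t ^ j) has_sum 1 / (1 - c * ?t)) UNIV"
      by (simp add: hval_geometric power_mult_distrib)
  qed
  have lin: "mfps_sums (mfps_subst (hfps (\<lambda>n. - (c ^ n))) (edge_monomial k l)) x (1 - c * ?t)"
  proof (rule mfps_sums_subst[OF assms(1)])
    have "((\<lambda>j. fps_nth (hfps (\<lambda>n. - (c ^ n))) j * ?t ^ j) has_sum (\<Sum>j\<in>{0, 1}. fps_nth (hfps (\<lambda>n. - (c ^ n))) j * ?t ^ j)) {0, 1}"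
      by (rule has_sum_finite) simp
    also have "(\<Sum>j\<in>{0, 1}. fps_nth (hfps (\<lambda>n. - (c ^ n))) j * ?t ^ j) = 1 - c * ?t"
      using hval_neg_geometric[of c 1] by simp
    finally show "((\<lambda>j. fps_nth (hfps (\<lambda>n. - (c ^ n))) j * ?t ^ j) has_sum 1 - c * ?t) UNIV"
      by (rule iffD1[OF has_sum_cong_neutral, rotated 3]) (auto simp: hval_neg_geometric)
  qed
  show ?thesis
  proof (cases e)
    case (nonneg d)
    have "1 / (1 - c * ?t) = inverse (1 - c * ?t)" by (simp add: inverse_eq_divide)
    then show ?thesis
      using mfps_sums_power[OF geo, of d] nonneg by (simp add: copies power_int_minus power_inverse)
  next
    case (neg d)
    have "(\<lambda>n. of_int e * c ^ n) = (\<lambda>n. of_nat (Suc d) * - (c ^ n))"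
      by (rule ext) (simp add: neg algebra_simps)
    then have "mfps_subst (hfps (\<lambda>n. of_int e * c ^ n)) (edge_monomial k l) =
        mfps_subst (hfps (\<lambda>n. - (c ^ n))) (edge_monomial k l) ^ Suc d"
      by (simp only: copies)
    moreover have "(1 - c * ?t) powi (- e) = (1 - c * ?t) ^ Suc d"
      unfolding neg by (simp only: minus_minus power_int_of_nat)
    ultimately show ?thesis using mfps_sums_power[OF lin, of "Suc d"] by (simp only:)
  qed
qed

text \<open>The value at 0 is not a power sum, and the two sides need not agree there.\<close>

lemma hval_cong:
  assumes "\<And>n. n \<ge> 1 \<Longrightarrow> \<phi> n = \<psi> n"
  shows "hval \<phi> n = hval \<psi> n"
proof (rule sym_value_unique)
  show "sym_value \<psi> (hsym n) (hval \<phi> n)"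
    by (rule sym_value_cong[OF sym_value_hsym]) (rule assms)
  show "sym_value \<psi> (hsym n) (hval \<psi> n)" by (rule sym_value_hsym)
qed

lemma mfps_subst_hfps_add:
  fixes \<phi> \<psi> :: "nat \<Rightarrow> complex"
  assumes "mfps_nth P 0 = 0"
  shows "mfps_subst (hfps (\<lambda>n. \<phi> n + \<psi> n)) P = mfps_subst (hfps \<phi>) P * mfps_subst (hfps \<psi>) P"
  using mfps_subst_hfps_sum[OF assms, of UNIV "\<lambda>b. if b then \<phi> else \<psi>"]
  by (simp add: UNIV_bool add.commute mult.commute)

text \<open>The factor of a pair of vertices as a formal power series. Its exponents carry a sign because
  \<open>hfps (\<lambda>n. c ^ n)\<close> is the geometric series \<open>1 / (1 - c x)\<close>.\<close>

definition edge_ratio :: "complex \<Rightarrow> nat list \<Rightarrow> nat list \<Rightarrow> complex mfps \<Rightarrow> complex mfps" where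
  "edge_ratio s \<nu> \<mu> P = (\<Prod>m | e_coeff \<nu> \<mu> m \<noteq> 0.
     mfps_subst (hfps (\<lambda>n. of_int (- e_coeff \<nu> \<mu> m) * (s powi (2 * m)) ^ n)) P)"

lemma edge_kernel_eq:
  assumes s: "s \<noteq> 0" "\<And>n. n \<ge> 1 \<Longrightarrow> (s^2) ^ n \<noteq> 1" "\<And>m. m \<ge> 1 \<Longrightarrow> qnum s m \<noteq> 0"
    and \<mu>: "is_partition \<mu>" and P: "mfps_nth P 0 = 0"
  shows "mfps_subst (hfps (\<lambda>n. psum_at s \<nu> n * psum_at s (conj_part \<mu>) n)) P = mfps_subst (K00 s) P * edge_ratio s \<nu> \<mu> P"
proof -
  let ?r = "\<lambda>n. \<Sum>m | e_coeff \<nu> \<mu> m \<noteq> 0. of_int (- e_coeff \<nu> \<mu> m) * (s powi (2 * m)) ^ n"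
  have "hfps (\<lambda>n. psum_at s \<nu> n * psum_at s (conj_part \<mu>) n) = hfps (\<lambda>n. (psum_at s [] n)^2 + ?r n)"
    unfolding hfps_def
  proof (rule arg_cong[of _ _ Abs_fps], rule ext, rule hval_cong)
    fix n :: nat assume "n \<ge> 1"
    then show "psum_at s \<nu> n * psum_at s (conj_part \<mu>) n = (psum_at s [] n)^2 + ?r n"
      by (subst psum_at_product[OF s(1) s(3) \<mu>]) (auto simp: sum_negf)
  qed
  moreover have "K00 s = hfps (\<lambda>n. (psum_at s [] n)^2)"
    by (rule K00_eq[OF s(1)]) (rule s(2))
  ultimately show ?thesis
    unfolding edge_ratio_def
    by (simp only: mfps_subst_hfps_add[OF P] mfps_subst_hfps_sum[OF P finite_e_coeff])
qed

lemma mfps_sums_edge_ratio: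
  assumes "k < l" and small: "\<And>m. e_coeff \<nu> \<mu> m \<noteq> 0 \<Longrightarrow> norm (s powi (2 * m) * (\<Prod>i=k..<l. x i)) < 1"
  shows "mfps_sums (edge_ratio s \<nu> \<mu> (edge_monomial k l)) x
    (\<Prod>m | e_coeff \<nu> \<mu> m \<noteq> 0. (1 - s powi (2 * m) * (\<Prod>i=k..<l. x i)) powi e_coeff \<nu> \<mu> m)"
proof -
  have "mfps_sums (mfps_subst (hfps (\<lambda>n. of_int (- e_coeff \<nu> \<mu> m) * (s powi (2 * m)) ^ n)) (edge_monomial k l)) x
      ((1 - s powi (2 * m) * (\<Prod>i=k..<l. x i)) powi e_coeff \<nu> \<mu> m)" if "e_coeff \<nu> \<mu> m \<noteq> 0" for m
    using mfps_sums_geometric_power[OF assms(1) small[OF that], of "- e_coeff \<nu> \<mu> m"] by simp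
  then show ?thesis unfolding edge_ratio_def by (intro mfps_sums_prod) simp
qed

lemma mfps_nth_mult_0: "mfps_nth (F * G) 0 = mfps_nth F 0 * mfps_nth G 0"
  by (simp add: mfps_nth_mult)

lemma mfps_nth_prod_0: "mfps_nth (prod F A) 0 = (\<Prod>i\<in>A. mfps_nth (F i :: 'a :: comm_ring_1 mfps) 0)"
  by (induction A rule: infinite_finite_induct) (auto simp: mfps_nth_mult_0 mfps_nth_1)

text \<open>Each Cauchy kernel is the one of the empty partitions, which is \<open>K\<^bsub>(0)(0)\<^esub>\<close>, times a finite
  product. The division is legitimate because \<open>K\<^bsub>(0)(0)\<^esub>\<close> has constant term 1.\<close>

lemma Ktilde_quotient:
  fixes s :: complex
  assumes s: "s \<noteq> 0" "\<And>n. n \<ge> 1 \<Longrightarrow> (s^2) ^ n \<noteq> 1" "\<And>m. m \<ge> 1 \<Longrightarrow> qnum s m \<noteq> 0" and N: "1 \<le> N"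
    and part: "\<And>k. k \<in> {1..N} \<Longrightarrow> is_partition (\<mu> k)"
  shows "(Ktilde s N \<mu>)^2 / (\<Prod>(k, l) | 1 \<le> k \<and> k < l \<and> l \<le> N. (mfps_subst (K00 s) (\<Prod>i=k..<l. mfps_X i))^2) =
    (mfps_const (\<Prod>k=1..N. W1 s (\<mu> k)) * (\<Prod>l=1..N. \<Prod>k=1..<l. edge_ratio s (\<mu> k) (\<mu> l) (edge_monomial k l)))^2"
proof -
  let ?R = "\<Prod>l=1..N. \<Prod>k=1..<l. edge_ratio s (\<mu> k) (\<mu> l) (edge_monomial k l)"
  let ?K = "\<Prod>l=1..N. \<Prod>k=1..<l. mfps_subst (K00 s) (edge_monomial k l)"
  let ?W = "mfps_const (\<Prod>k=1..N. W1 s (\<mu> k))"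
  have "(\<Prod>l=1..N. \<Prod>j=1..<l. mfps_subst (hfps (\<lambda>n. psum_at s (\<mu> j) n * psum_at s (conj_part (\<mu> l)) n)) (edge_monomial j l)) =
      (\<Prod>l=1..N. \<Prod>j=1..<l. mfps_subst (K00 s) (edge_monomial j l) * edge_ratio s (\<mu> j) (\<mu> l) (edge_monomial j l))"
    using part s by (intro prod.cong refl edge_kernel_eq mfps_nth_edge_monomial_0) auto
  moreover have "Ktilde s N \<mu> = ?W * (\<Prod>l=1..N. \<Prod>j=1..<l.
      mfps_subst (hfps (\<lambda>n. psum_at s (\<mu> j) n * psum_at s (conj_part (\<mu> l)) n)) (edge_monomial j l))"
    by (rule Ktilde_product[OF s(1) _ N]) (use s(3) part in auto)
  ultimately have K: "Ktilde s N \<mu> = ?W * (?K * ?R)"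
    by (simp only: prod.distrib)
  have D: "(\<Prod>(k, l) | 1 \<le> k \<and> k < l \<and> l \<le> N. (mfps_subst (K00 s) (\<Prod>i=k..<l. mfps_X i))^2) = ?K^2"
  proof -
    have "(\<Prod>(k, l) | 1 \<le> k \<and> k < l \<and> l \<le> N. (mfps_subst (K00 s) (\<Prod>i=k..<l. mfps_X i))^2) =
        (\<Prod>(l, k)\<in>(SIGMA l:{1..N}. {1..<l}). (mfps_subst (K00 s) (edge_monomial k l))^2)"
      by (rule prod.reindex_bij_witness[of _ "\<lambda>(l, k). (k, l)" "\<lambda>(k, l). (l, k)"]) (auto simp: edge_monomial_def)
    also have "\<dots> = (\<Prod>l=1..N. \<Prod>k=1..<l. (mfps_subst (K00 s) (edge_monomial k l))^2)"
      by (rule prod.Sigma[symmetric]) auto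
    finally show ?thesis by (simp only: prod_power_distrib)
  qed
  have "mfps_nth (mfps_subst (K00 s) P) 0 = 1" for P
  proof -
    have "K00 s = hfps (\<lambda>n. (psum_at s [] n)^2)"
      by (rule K00_eq[OF s(1)]) (rule s(2))
    then show ?thesis by (simp add: mfps_subst_def mdeg_def mfps_nth_1)
  qed
  then have "mfps_nth (?K^2) 0 \<noteq> 0"
    by (simp add: power2_eq_square mfps_nth_mult_0 mfps_nth_prod_0)
  then have inv: "?K^2 * inverse (?K^2) = 1" by (rule mfps_mult_inverse)
  have "(?W * (?K * ?R))^2 * inverse (?K^2) = (?W * ?R)^2 * (?K^2 * inverse (?K^2))"
    by (simp add: power_mult_distrib mult_ac)
  then show ?thesis unfolding divide_mfps_def D K inv by simp
qed


section \<open>Monomial prefactors\<close>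

lemma sum_pairs_add:
  fixes x :: "nat \<Rightarrow> int"
  shows "(\<Sum>l=1..N. \<Sum>k=1..<l. x k + x l) = (int N - 1) * (\<Sum>k=1..N. x k)"
proof (induction N)
  case (Suc N)
  have "(\<Sum>k=1..<Suc N. x k + x (Suc N)) = (\<Sum>k=1..N. x k) + int N * x (Suc N)"
    by (simp add: sum.distrib atLeastLessThanSuc_atLeastAtMost)
  then show ?case using Suc by (simp add: algebra_simps)
qed simp

lemma sum_pairs_diff:
  fixes x :: "nat \<Rightarrow> int"
  shows "(\<Sum>l=1..N. \<Sum>k=1..<l. x k - x l) = (\<Sum>k=1..N. (int N - 2 * int k + 1) * x k)"
proof (induction N)
  case (Suc N)
  have "(\<Sum>k=1..<Suc N. x k - x (Suc N)) = (\<Sum>k=1..N. x k) - int N * x (Suc N)"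
    by (simp add: sum_subtractf atLeastLessThanSuc_atLeastAtMost)
  moreover have "(\<Sum>k=1..N. (int (Suc N) - 2 * int k + 1) * x k) = (\<Sum>k=1..N. (int N - 2 * int k + 1) * x k) + (\<Sum>k=1..N. x k)"
    by (simp add: sum.distrib[symmetric] algebra_simps)
  ultimately show ?case using Suc by (simp add: algebra_simps)
qed simp

text \<open>Edge \<open>j\<close> lies between the vertices \<open>k\<close> and \<open>l\<close> if \<open>k \<le> j < l\<close>: each \<open>x\<^sub>k\<close> with \<open>k \<le> j\<close> is counted
  \<open>N - j\<close> times and each \<open>x\<^sub>l\<close> with \<open>l > j\<close> is counted \<open>j\<close> times.\<close>

lemma prod_pairs_edges:
  fixes Q :: "nat \<Rightarrow> complex" and x :: "nat \<Rightarrow> int"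
  assumes Q: "\<And>i. Q i \<noteq> 0"
  shows "(\<Prod>l=1..N. \<Prod>k=1..<l. (\<Prod>i=k..<l. Q i) powi (x k + x l)) =
    (\<Prod>j=1..<N. Q j powi (int (N - j) * (\<Sum>i=1..j. x i) + int j * (\<Sum>i=j+1..N. x i)))"
proof (induction N)
  case (Suc N)
  have step: "(\<Prod>k=1..N. (\<Prod>i=k..N. Q i) powi (x k + x (Suc N))) =
      (\<Prod>i=1..N. Q i powi ((\<Sum>k=1..i. x k) + int i * x (Suc N)))"
  proof -
    have "(\<Prod>k=1..N. (\<Prod>i=k..N. Q i) powi (x k + x (Suc N))) = (\<Prod>k=1..N. \<Prod>i=k..N. Q i powi (x k + x (Suc N)))"
    proof (rule prod.cong[OF refl])
      fix k
      show "(\<Prod>i=k..N. Q i) powi w = (\<Prod>i=k..N. Q i powi w)" for w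
        by (induction "{k..N}" rule: infinite_finite_induct)
           (simp_all add: power_int_def prod_power_distrib prod_inversef[symmetric] o_def)
    qed
    also have "\<dots> = (\<Prod>(k, i)\<in>(SIGMA k:{1..N}. {k..N}). Q i powi (x k + x (Suc N)))"
      by (rule prod.Sigma) auto
    also have "\<dots> = (\<Prod>(i, k)\<in>(SIGMA i:{1..N}. {1..i}). Q i powi (x k + x (Suc N)))"
      by (rule prod.reindex_bij_witness[of _ "\<lambda>(i, k). (k, i)" "\<lambda>(k, i). (i, k)"]) auto
    also have "\<dots> = (\<Prod>i=1..N. \<Prod>k=1..i. Q i powi (x k + x (Suc N)))"
      by (rule prod.Sigma[symmetric]) auto
    also have "\<dots> = (\<Prod>i=1..N. Q i powi ((\<Sum>k=1..i. x k) + int i * x (Suc N)))"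
      by (intro prod.cong refl) (simp add: prod_powi[OF Q] sum.distrib)
    finally show ?thesis .
  qed
  have "(\<Prod>j=1..<Suc N. Q j powi (int (Suc N - j) * (\<Sum>i=1..j. x i) + int j * (\<Sum>i=j+1..Suc N. x i))) =
      (\<Prod>j=1..N. Q j powi (int (N - j) * (\<Sum>i=1..j. x i) + int j * (\<Sum>i=j+1..N. x i)) *
        Q j powi ((\<Sum>i=1..j. x i) + int j * x (Suc N)))"
    unfolding atLeastLessThanSuc_atLeastAtMost
  proof (rule prod.cong[OF refl])
    fix j assume j: "j \<in> {1..N}"
    then have "int (Suc N - j) = int (N - j) + 1" by (simp add: Suc_diff_le)
    then show "Q j powi (int (Suc N - j) * (\<Sum>i=1..j. x i) + int j * (\<Sum>i=j+1..Suc N. x i)) =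
        Q j powi (int (N - j) * (\<Sum>i=1..j. x i) + int j * (\<Sum>i=j+1..N. x i)) * Q j powi ((\<Sum>i=1..j. x i) + int j * x (Suc N))"
      using j Q[of j] by (simp add: power_int_add[symmetric] algebra_simps)
  qed
  also have "\<dots> = (\<Prod>j=1..N. Q j powi (int (N - j) * (\<Sum>i=1..j. x i) + int j * (\<Sum>i=j+1..N. x i))) *
      (\<Prod>i=1..N. Q i powi ((\<Sum>k=1..i. x k) + int i * x (Suc N)))"
    by (rule prod.distrib)
  also have "(\<Prod>j=1..N. Q j powi (int (N - j) * (\<Sum>i=1..j. x i) + int j * (\<Sum>i=j+1..N. x i))) =
      (\<Prod>j=1..<N. Q j powi (int (N - j) * (\<Sum>i=1..j. x i) + int j * (\<Sum>i=j+1..N. x i))) *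
      (if N = 0 then 1 else Q N powi 0)"
  proof (cases N)
    case (Suc M)
    then show ?thesis by (simp add: atLeastLessThanSuc_atLeastAtMost)
  qed simp
  finally show ?case
    using Suc step by (simp add: atLeastLessThanSuc_atLeastAtMost)
qed simp

text \<open>Pulling out the growing exponential, so that the last factor tends to 1 when \<open>exp (- 2 \<beta> A)\<close> tends
  to 0.\<close>

lemma sinh_exp_form:
  fixes \<beta> h A :: complex and m :: int
  shows "sinh (\<beta> / 2 * (2 * A + h * of_int m)) =
    (exp (\<beta> * A) / 2 * exp (- \<beta> * h / 2) powi (- m)) * (1 - exp (- \<beta> * h / 2) powi (2 * m) * exp (- 2 * \<beta> * A))"
proof -
  have e: "exp (- \<beta> * h / 2) powi k = exp (- \<beta> * h / 2 * of_int k)" for k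
    by (simp add: exp_power_int mult.commute)
  have "exp (\<beta> * A) * exp (- \<beta> * h / 2) powi (- m) = exp (\<beta> / 2 * (2 * A + h * of_int m))"
    unfolding e by (simp add: exp_add[symmetric] algebra_simps)
  moreover have "exp (\<beta> * A) * exp (- \<beta> * h / 2) powi (- m) * (exp (- \<beta> * h / 2) powi (2 * m) * exp (- 2 * \<beta> * A)) =
      exp (- (\<beta> / 2 * (2 * A + h * of_int m)))"
    unfolding e exp_add[symmetric] by (rule arg_cong[of _ _ exp]) (simp add: algebra_simps)
  ultimately show ?thesis
    by (simp add: sinh_def scaleR_conv_of_real algebra_simps)
qed

text \<open>Extracting a constant and a power of \<open>b\<close> from each factor needs only the total and the first moment
  of the exponents. The square doubles the moment, which turns it into a difference of two \<open>\<kappa>\<close>.\<close>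

lemma prod_powi_sum_e_coeff:
  fixes c b :: complex
  assumes "c \<noteq> 0" "b \<noteq> 0"
  shows "(\<Prod>m | e_coeff \<nu> \<mu> m \<noteq> 0. (c * b powi (- m) * g m) powi e_coeff \<nu> \<mu> m)^2 =
    (c^2) powi (- int (sum_list \<nu> + sum_list \<mu>)) * b powi (kappa \<nu> - kappa \<mu>) *
    (\<Prod>m | e_coeff \<nu> \<mu> m \<noteq> 0. g m powi e_coeff \<nu> \<mu> m)^2"
proof -
  let ?E = "{m. e_coeff \<nu> \<mu> m \<noteq> 0}"
  have "(\<Prod>m\<in>?E. (c * b powi (- m) * g m) powi e_coeff \<nu> \<mu> m) =
      (\<Prod>m\<in>?E. c powi e_coeff \<nu> \<mu> m) * (\<Prod>m\<in>?E. b powi (- (e_coeff \<nu> \<mu> m * m))) * (\<Prod>m\<in>?E. g m powi e_coeff \<nu> \<mu> m)"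
    unfolding prod.distrib[symmetric]
    by (intro prod.cong refl) (simp add: power_int_mult_distrib power_int_mult[symmetric] mult.commute)
  also have "(\<Prod>m\<in>?E. c powi e_coeff \<nu> \<mu> m) = c powi (- int (sum_list \<nu> + sum_list \<mu>))"
    by (simp only: prod_powi[OF assms(1)] sum_e_coeff_total)
  also have "(\<Prod>m\<in>?E. b powi (- (e_coeff \<nu> \<mu> m * m))) = b powi (- (\<Sum>m\<in>?E. e_coeff \<nu> \<mu> m * m))"
    by (simp only: prod_powi[OF assms(2)] sum_negf)
  finally have "(\<Prod>m\<in>?E. (c * b powi (- m) * g m) powi e_coeff \<nu> \<mu> m)^2 =
      (c powi (- int (sum_list \<nu> + sum_list \<mu>)))^2 * (b powi (- (\<Sum>m\<in>?E. e_coeff \<nu> \<mu> m * m)))^2 *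
      (\<Prod>m\<in>?E. g m powi e_coeff \<nu> \<mu> m)^2"
    by (simp only: power_mult_distrib)
  also have "(b powi (- (\<Sum>m\<in>?E. e_coeff \<nu> \<mu> m * m)))^2 = b powi (- (2 * (\<Sum>m\<in>?E. e_coeff \<nu> \<mu> m * m)))"
    using assms(2) by (simp add: power2_eq_square power_int_add[symmetric])
  also have "- (2 * (\<Sum>m\<in>?E. e_coeff \<nu> \<mu> m * m)) = kappa \<nu> - kappa \<mu>"
    by (simp only: sum_e_coeff_moment)
  also have "(c powi (- int (sum_list \<nu> + sum_list \<mu>)))^2 = (c^2) powi (- int (sum_list \<nu> + sum_list \<mu>))"
    by (simp add: power2_eq_square power_int_mult_distrib)
  finally show ?thesis .
qed

text \<open>Each hyperbolic sine is \<open>- 1/2\<close> times a \<open>q\<close>-number; the exponents add up to \<open>- \<bar>\<mu>\<bar>\<close>, and the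
  product of the \<open>q\<close>-numbers is the quantum dimension up to its power of \<open>q\<close>.\<close>

lemma sinh_prod_diagonal:
  fixes \<beta> h s :: complex
  assumes s: "s = exp (- \<beta> * h / 2)" and nz: "\<And>m. m \<ge> 1 \<Longrightarrow> qnum s m \<noteq> 0" and \<mu>: "is_partition (\<mu> k)"
  shows "sinh_prod \<beta> h a \<mu> k k = 2 ^ (2 * sum_list (\<mu> k)) * s powi (- kappa (\<mu> k)) * (W1 s (\<mu> k))^2"
proof -
  have s0: "s \<noteq> 0" by (simp add: s)
  have sinh: "sinh (\<beta> * h * of_int m / 2) = - (1 / 2) * qnum s m" for m
  proof -
    have e: "s powi j = exp (- \<beta> * h / 2 * of_int j)" for j
      by (simp add: s exp_power_int mult.commute)
    show ?thesis
      unfolding qnum_def e by (simp add: sinh_def scaleR_conv_of_real algebra_simps)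
  qed
  let ?g = "\<lambda>m. - (1 / 2) * qnum s m"
  let ?l = "length (\<mu> k)" and ?p = "\<lambda>i. part (\<mu> k) (Suc i)"
  let ?A = "\<Prod>j<?l. \<Prod>i<j. qnum s (int (?p i) - int (?p j) + int j - int i) / qnum s (int j - int i)"
  let ?B = "\<Prod>i<?l. \<Prod>v=1..?p i. 1 / qnum s (int (?l - Suc i) + int v)"
  have "(\<Prod>m | m \<ge> 1 \<and> e_coeff' (\<mu> k) m \<noteq> 0. ?g m powi e_coeff' (\<mu> k) m) =
      (\<Prod>j<?l. \<Prod>i<j. ?g (int (?p i) - int (?p j) + int j - int i) / ?g (int j - int i))
      * (\<Prod>i<?l. \<Prod>v=1..?p i. 1 / ?g (int (?l - Suc i) + int v))"
    by (rule prod_e_coeff'[OF \<mu>]) (use nz in auto)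
  also have "\<dots> = ?A * (\<Prod>i<?l. \<Prod>v=1..?p i. (- 2) * (1 / qnum s (int (?l - Suc i) + int v)))"
    by (intro arg_cong2[of _ _ _ _ "(*)"] prod.cong refl) simp_all
  also have "(\<Prod>i<?l. \<Prod>v=1..?p i. (- 2) * (1 / qnum s (int (?l - Suc i) + int v))) = (\<Prod>i<?l. (- 2) ^ ?p i) * ?B"
    unfolding prod.distrib by simp
  also have "(\<Prod>i<?l. (- 2) ^ ?p i) = (- 2 :: complex) ^ sum_list (\<mu> k)"
    by (simp add: power_sum sum_list_eq_sum_part'[OF order_refl])
  finally have P: "(\<Prod>m | m \<ge> 1 \<and> e_coeff' (\<mu> k) m \<noteq> 0. ?g m powi e_coeff' (\<mu> k) m) = (- 2) ^ sum_list (\<mu> k) * (?A * ?B)"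
    by (simp only: mult_ac)
  have "(s powi (- kappa (\<mu> k))) * (s powi (kappa (\<mu> k) div 2))^2 = 1"
  proof -
    obtain c where "kappa (\<mu> k) = 2 * c" using kappa_eq_contents by blast
    then show ?thesis using s0 by (simp add: power2_eq_square power_int_add[symmetric])
  qed
  then have "(?A * ?B)^2 = s powi (- kappa (\<mu> k)) * (W1 s (\<mu> k))^2"
    unfolding W1_zero_based by (simp add: power_mult_distrib mult.assoc[symmetric])
  then have "((- 2) ^ sum_list (\<mu> k) * (?A * ?B))^2 = 2 ^ (2 * sum_list (\<mu> k)) * (s powi (- kappa (\<mu> k)) * (W1 s (\<mu> k))^2)"
    by (simp add: power_mult_distrib power_mult power_even_eq[symmetric] mult.commute flip: power_mult)
  then show ?thesis
    unfolding sinh_prod_def Let_def sinh P by simp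
qed

lemma prod_square_pairs:
  fixes F :: "nat \<Rightarrow> nat \<Rightarrow> complex"
  assumes sym: "\<And>k l. F k l = F l k"
  shows "(\<Prod>k=1..N. \<Prod>l=1..N. F k l) = (\<Prod>k=1..N. F k k) * (\<Prod>l=1..N. \<Prod>k=1..<l. (F k l)^2)"
proof (induction N)
  case (Suc N)
  have "(\<Prod>k=1..Suc N. \<Prod>l=1..Suc N. F k l) =
      (\<Prod>k=1..N. (\<Prod>l=1..N. F k l) * F k (Suc N)) * ((\<Prod>l=1..N. F (Suc N) l) * F (Suc N) (Suc N))"
    by simp
  also have "\<dots> = (\<Prod>k=1..N. \<Prod>l=1..N. F k l) * (\<Prod>k=1..N. F k (Suc N))^2 * F (Suc N) (Suc N)"
  proof -
    have "(\<Prod>l=1..N. F (Suc N) l) = (\<Prod>k=1..N. F k (Suc N))"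
      by (intro prod.cong refl sym)
    then show ?thesis by (simp only: prod.distrib power2_eq_square mult_ac)
  qed
  also have "\<dots> = (\<Prod>k=1..Suc N. F k k) * (\<Prod>l=1..Suc N. \<Prod>k=1..<l. (F k l)^2)"
    unfolding Suc.IH by (simp add: prod_power_distrib atLeastLessThanSuc_atLeastAtMost mult_ac)
  finally show ?case .
qed simp


section \<open>The strip amplitude as a product of hyperbolic sines\<close>

theorem theorem8p2:
  fixes N :: nat and \<mu> :: "nat \<Rightarrow> nat list" and \<beta> h s :: complex
    and Q :: "(nat \<Rightarrow> complex) \<Rightarrow> nat \<Rightarrow> complex"
  defines "s \<equiv> exp (- \<beta> * h / 2)" \<comment> \<open>the square root of \<open>q = exp (- \<beta> * h)\<close>\<close>
    and "Q \<equiv> \<lambda>a k. exp (- 2 * \<beta> * (a k - a (k + 1)))"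
  assumes "N \<ge> 2"
    and "\<forall>k\<in>{1..N}. is_partition (\<mu> k)"
    and generic: "\<forall>n::nat. n \<ge> 1 \<longrightarrow> exp (- \<beta> * h) ^ n \<noteq> 1"
  shows "\<exists>r>0. \<forall>a :: nat \<Rightarrow> complex. (\<forall>k\<in>{1..<N}. norm (Q a k) < r) \<longrightarrow>
    mfps_sums
      ((Ktilde s N \<mu>)\<^sup>2 /
        (\<Prod>(k, l) | 1 \<le> k \<and> k < l \<and> l \<le> N. (mfps_subst (K00 s) (\<Prod>i=k..<l. mfps_X i))\<^sup>2))
      (Q a)
      (2 powi (- 2 * int N * (\<Sum>i=1..N. int (sum_list (\<mu> i))))
       * (\<Prod>k=1..<N. Q a k powi
           (- (int (N - k) * (\<Sum>i=1..k. int (sum_list (\<mu> i)))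
               + int k * (\<Sum>i=k+1..N. int (sum_list (\<mu> i))))))
       * s powi (- (\<Sum>k=1..N. (int N - 2 * int k) * kappa (\<mu> k)))
       * (\<Prod>k=1..N. \<Prod>l=1..N. sinh_prod \<beta> h a \<mu> k l))"
proof -
  have part: "is_partition (\<mu> k)" if "k \<in> {1..N}" for k
    using assms(4) that by blast
  have N: "1 \<le> N" using assms(3) by simp
  have s0: "s \<noteq> 0" by (simp add: s_def)
  have s2: "s^2 = exp (- \<beta> * h)"
    by (simp add: s_def power2_eq_square exp_add[symmetric])
  have s1: "(s^2) ^ n \<noteq> 1" if "n \<ge> 1" for n
    using generic that by (simp add: s2)
  have nz: "qnum s m \<noteq> 0" if "m \<ge> 1" for m
  proof -
    define n where "n = nat m"
    have n: "m = int n" "n \<ge> 1" using that by (auto simp: n_def)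
    have "inverse (s^2) powi m = inverse ((s^2) ^ n)" by (simp add: n power_inverse)
    then have "1 - inverse (s^2) powi m \<noteq> 0" using s1[OF n(2)] by simp
    then show ?thesis using s0 by (simp add: qnum_eq)
  qed
  \<comment> \<open>\<open>C\<close> contains all exponents. The choice of \<open>r\<close> makes \<open>S * r < 1\<close>, so every geometric series
    converges; \<open>r \<le> 1\<close> bounds \<open>Q\<^sub>k \<cdots> Q\<^bsub>l-1\<^esub>\<close> by its first factor.\<close>
  define C where "C = (\<Union>k\<in>{1..N}. \<Union>l\<in>{1..N}. {m. e_coeff (\<mu> k) (\<mu> l) m \<noteq> 0})"
  have finC: "finite C" by (simp add: C_def finite_e_coeff)
  define S where "S = (\<Sum>m\<in>C. norm (s powi (2 * m)))"
  define r where "r = 1 / (1 + S)"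
  have S0: "S \<ge> 0" by (simp add: S_def sum_nonneg)
  then have r: "r > 0" "r \<le> 1" by (simp_all add: r_def)
  show ?thesis
  proof (intro exI[of _ r] conjI allI impI r(1))
    fix a :: "nat \<Rightarrow> complex"
    assume small: "\<forall>k\<in>{1..<N}. norm (Q a k) < r"
    let ?t = "\<lambda>k l. \<Prod>i=k..<l. Q a i"
    define v where "v k l = (\<Prod>m | e_coeff (\<mu> k) (\<mu> l) m \<noteq> 0. (1 - s powi (2 * m) * ?t k l) powi e_coeff (\<mu> k) (\<mu> l) m)" for k l
    have t_small: "norm (?t k l) < r" if "1 \<le> k" "k < l" "l \<le> N" for k l
    proof -
      have "?t k l = Q a k * ?t (Suc k) l" using that by (simp add: prod.atLeast_Suc_lessThan)
      moreover have "norm (?t (Suc k) l) \<le> 1"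
        unfolding prod_norm[symmetric]
      proof (rule prod_le_1)
        fix i assume "i \<in> {Suc k..<l}"
        then have "i \<in> {1..<N}" using that by auto
        then have "norm (Q a i) < r" using small by blast
        then show "0 \<le> norm (Q a i) \<and> norm (Q a i) \<le> 1" using r(2) by simp
      qed
      moreover have "norm (Q a k) < r" using small that by simp
      ultimately show ?thesis
        using mult_left_le[of "norm (?t (Suc k) l)" "norm (Q a k)"] by (simp add: norm_mult)
    qed
    have edge: "mfps_sums (edge_ratio s (\<mu> k) (\<mu> l) (edge_monomial k l)) (Q a) (v k l)"
      if "1 \<le> k" "k < l" "l \<le> N" for k l
      unfolding v_def
    proof (rule mfps_sums_edge_ratio[OF that(2)])
      fix m assume "e_coeff (\<mu> k) (\<mu> l) m \<noteq> 0"
      then have "m \<in> C" using that unfolding C_def by fastforce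
      then have "norm (s powi (2 * m)) \<le> S" unfolding S_def using finC by (intro member_le_sum) auto
      then have "norm (s powi (2 * m)) * norm (?t k l) \<le> S * r"
        using t_small[OF that] S0 by (intro mult_mono) auto
      also have "\<dots> < 1" using S0 by (simp add: r_def)
      finally show "norm (s powi (2 * m) * ?t k l) < 1" by (simp add: norm_mult)
    qed
    let ?W = "\<Prod>k=1..N. W1 s (\<mu> k)" and ?V = "\<Prod>l=1..N. \<Prod>k=1..<l. v k l"
    have series: "mfps_sums ((Ktilde s N \<mu>)^2 / (\<Prod>(k, l) | 1 \<le> k \<and> k < l \<and> l \<le> N. (mfps_subst (K00 s) (\<Prod>i=k..<l. mfps_X i))^2))
        (Q a) ((?W * ?V)^2)"
    proof -
      have "(Ktilde s N \<mu>)^2 / (\<Prod>(k, l) | 1 \<le> k \<and> k < l \<and> l \<le> N. (mfps_subst (K00 s) (\<Prod>i=k..<l. mfps_X i))^2) =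
          (mfps_const ?W * (\<Prod>l=1..N. \<Prod>k=1..<l. edge_ratio s (\<mu> k) (\<mu> l) (edge_monomial k l)))^2"
        by (rule Ktilde_quotient[OF s0 s1 nz N part])
      then show ?thesis
        by (simp only:) (intro mfps_sums_power mfps_sums_mult mfps_sums_const mfps_sums_prod edge; simp)
    qed
    let ?n = "\<lambda>k. int (sum_list (\<mu> k))"
    define E where "E = (\<lambda>k l. sinh_prod \<beta> h a \<mu> k l)"
    have Q0: "Q a i \<noteq> 0" for i by (simp add: Q_def)
    have t_exp: "?t k l = exp (- 2 * \<beta> * (a k - a l))" if "k \<le> l" for k l
      using that
    proof (induction rule: dec_induct)
      case (step l)
      then show ?case by (simp add: Q_def exp_add[symmetric] algebra_simps)
    qed simp
    have off: "(E k l)^2 = 2 powi (2 * (?n k + ?n l)) * ?t k l powi (?n k + ?n l) * s powi (kappa (\<mu> k) - kappa (\<mu> l)) * (v k l)^2"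
      if "k < l" for k l
    proof -
      let ?c = "exp (\<beta> * (a k - a l)) / 2"
      have "(E k l)^2 = (\<Prod>m | e_coeff (\<mu> k) (\<mu> l) m \<noteq> 0. (?c * s powi (- m) * (1 - s powi (2 * m) * ?t k l)) powi e_coeff (\<mu> k) (\<mu> l) m)^2"
      proof -
        have "sinh (\<beta> / 2 * (2 * (a k - a l) + h * of_int m)) = ?c * s powi (- m) * (1 - s powi (2 * m) * ?t k l)" for m
          by (simp only: sinh_exp_form s_def t_exp[OF less_imp_le[OF that]])
        moreover have "E k l = (\<Prod>m | e_coeff (\<mu> k) (\<mu> l) m \<noteq> 0.
            sinh (\<beta> / 2 * (2 * (a k - a l) + h * of_int m)) powi e_coeff (\<mu> k) (\<mu> l) m)"
          using that by (simp only: E_def sinh_prod_def Let_def if_True)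
        ultimately show ?thesis by (simp only:)
      qed
      also have "\<dots> = (?c^2) powi (- int (sum_list (\<mu> k) + sum_list (\<mu> l))) * s powi (kappa (\<mu> k) - kappa (\<mu> l)) * (v k l)^2"
        unfolding v_def by (rule prod_powi_sum_e_coeff) (simp_all add: s0)
      also have "?c^2 = inverse (2 powi 2 * ?t k l)"
      proof -
        have "?t k l * exp (\<beta> * (a k - a l))^2 = 1"
        proof -
          have "?t k l * exp (\<beta> * (a k - a l))^2 =
              exp (- 2 * \<beta> * (a k - a l) + (\<beta> * (a k - a l) + \<beta> * (a k - a l)))"
            by (simp only: t_exp[OF less_imp_le[OF that]] power2_eq_square exp_add)
          also have "- 2 * \<beta> * (a k - a l) + (\<beta> * (a k - a l) + \<beta> * (a k - a l)) = 0"
            by (simp add: algebra_simps)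
          finally show ?thesis by simp
        qed
        then have "exp (\<beta> * (a k - a l))^2 = inverse (?t k l)"
          by (rule inverse_unique[symmetric])
        moreover have "inverse x / 2^2 = inverse (2 powi 2 * x)" for x :: complex
          by (simp only: divide_inverse inverse_mult_distrib power_int_numeral mult.commute)
        ultimately show ?thesis by (simp only: power_divide)
      qed
      also have "inverse (2 powi 2 * ?t k l) powi (- int (sum_list (\<mu> k) + sum_list (\<mu> l))) =
          2 powi (2 * (?n k + ?n l)) * ?t k l powi (?n k + ?n l)"
        by (simp only: power_int_minus power_int_inverse inverse_inverse_eq power_int_mult_distrib power_int_mult of_nat_add)
      finally show ?thesis .
    qed
    have two: "(2 :: complex) \<noteq> 0" by simp
    have two_powi: "2 ^ (2 * n) = (2 :: complex) powi (2 * int n)" for n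
      by (metis of_nat_mult of_nat_numeral power_int_of_nat)
    have diag: "E k k = 2 powi (2 * ?n k) * s powi (- kappa (\<mu> k)) * (W1 s (\<mu> k))^2" if "k \<in> {1..N}" for k
      unfolding E_def two_powi[symmetric]
    proof (rule sinh_prod_diagonal)
      show "s = exp (- \<beta> * h / 2)" by (simp only: s_def)
    qed (fact nz, fact part[OF that])
    have sym: "E k l = E l k" for k l by (simp add: E_def sinh_prod_def Let_def)
    have "(\<Prod>k=1..N. \<Prod>l=1..N. E k l) = (\<Prod>k=1..N. E k k) * (\<Prod>l=1..N. \<Prod>k=1..<l. (E k l)^2)"
      by (rule prod_square_pairs[OF sym])
    also have "(\<Prod>k=1..N. E k k) = 2 powi (2 * (\<Sum>k=1..N. ?n k)) * s powi (- (\<Sum>k=1..N. kappa (\<mu> k))) * ?W^2"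
    proof -
      have "(\<Prod>k=1..N. E k k) = (\<Prod>k=1..N. 2 powi (2 * ?n k) * s powi (- kappa (\<mu> k)) * (W1 s (\<mu> k))^2)"
        by (rule prod.cong[OF refl diag])
      then show ?thesis
        by (simp only: prod.distrib prod_powi[OF s0] prod_powi[OF two] sum_distrib_left sum_negf prod_power_distrib)
    qed
    also have "(\<Prod>l=1..N. \<Prod>k=1..<l. (E k l)^2) =
        2 powi (2 * ((int N - 1) * (\<Sum>k=1..N. ?n k)))
        * (\<Prod>j=1..<N. Q a j powi (int (N - j) * (\<Sum>i=1..j. ?n i) + int j * (\<Sum>i=j+1..N. ?n i)))
        * s powi (\<Sum>k=1..N. (int N - 2 * int k + 1) * kappa (\<mu> k)) * ?V^2"
    proof -
      have "(\<Prod>l=1..N. \<Prod>k=1..<l. (E k l)^2) = (\<Prod>l=1..N. \<Prod>k=1..<l. 2 powi (2 * (?n k + ?n l)) *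
          ?t k l powi (?n k + ?n l) * s powi (kappa (\<mu> k) - kappa (\<mu> l)) * (v k l)^2)"
        by (intro prod.cong refl off) simp
      also have "\<dots> = 2 powi (\<Sum>l=1..N. \<Sum>k=1..<l. 2 * (?n k + ?n l)) * (\<Prod>l=1..N. \<Prod>k=1..<l. ?t k l powi (?n k + ?n l)) *
          s powi (\<Sum>l=1..N. \<Sum>k=1..<l. kappa (\<mu> k) - kappa (\<mu> l)) * ?V^2"
        by (simp only: prod.distrib prod_powi[OF s0] prod_powi[OF two] prod_power_distrib)
      finally show ?thesis
        by (simp only: sum_distrib_left[symmetric] sum_pairs_add sum_pairs_diff prod_pairs_edges[of "Q a", OF Q0])
    qed
    finally have "(\<Prod>k=1..N. \<Prod>l=1..N. E k l) =
        (2 powi (2 * (\<Sum>k=1..N. ?n k)) * 2 powi (2 * ((int N - 1) * (\<Sum>k=1..N. ?n k)))) *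
        (\<Prod>j=1..<N. Q a j powi (int (N - j) * (\<Sum>i=1..j. ?n i) + int j * (\<Sum>i=j+1..N. ?n i))) *
        (s powi (- (\<Sum>k=1..N. kappa (\<mu> k))) * s powi (\<Sum>k=1..N. (int N - 2 * int k + 1) * kappa (\<mu> k))) * (?W * ?V)^2"
      by (simp only: power_mult_distrib mult_ac)
    also have "2 powi (2 * (\<Sum>k=1..N. ?n k)) * 2 powi (2 * ((int N - 1) * (\<Sum>k=1..N. ?n k))) =
        (2 :: complex) powi (2 * int N * (\<Sum>k=1..N. ?n k))"
      by (simp add: power_int_add[symmetric] algebra_simps)
    also have "s powi (- (\<Sum>k=1..N. kappa (\<mu> k))) * s powi (\<Sum>k=1..N. (int N - 2 * int k + 1) * kappa (\<mu> k)) =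
        s powi (\<Sum>k=1..N. (int N - 2 * int k) * kappa (\<mu> k))"
      using s0 by (simp add: power_int_add[symmetric] distrib_right sum.distrib)
    finally have sinhs: "(\<Prod>k=1..N. \<Prod>l=1..N. E k l) = 2 powi (2 * int N * (\<Sum>k=1..N. ?n k)) *
        (\<Prod>j=1..<N. Q a j powi (int (N - j) * (\<Sum>i=1..j. ?n i) + int j * (\<Sum>i=j+1..N. ?n i))) *
        s powi (\<Sum>k=1..N. (int N - 2 * int k) * kappa (\<mu> k)) * (?W * ?V)^2" .
    have regroup: "(b * c * d) * (b' * c' * d' * e) = (b * b') * (c * c') * (d * d') * e"
      for b c d b' c' d' e :: complex
      by (simp only: mult_ac)
    have inv: "x powi (- e) * x powi e = 1" if "x \<noteq> 0" for x :: complex and e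
      using that by (simp add: power_int_add[symmetric])
    have "2 powi (- 2 * int N * (\<Sum>i=1..N. ?n i))
       * (\<Prod>k=1..<N. Q a k powi (- (int (N - k) * (\<Sum>i=1..k. ?n i) + int k * (\<Sum>i=k+1..N. ?n i))))
       * s powi (- (\<Sum>k=1..N. (int N - 2 * int k) * kappa (\<mu> k))) * (\<Prod>k=1..N. \<Prod>l=1..N. E k l) =
       (2 powi (- (2 * int N * (\<Sum>i=1..N. ?n i))) * 2 powi (2 * int N * (\<Sum>k=1..N. ?n k))) *
       (\<Prod>k=1..<N. Q a k powi (- (int (N - k) * (\<Sum>i=1..k. ?n i) + int k * (\<Sum>i=k+1..N. ?n i))) *
          Q a k powi (int (N - k) * (\<Sum>i=1..k. ?n i) + int k * (\<Sum>i=k+1..N. ?n i))) *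
       (s powi (- (\<Sum>k=1..N. (int N - 2 * int k) * kappa (\<mu> k))) * s powi (\<Sum>k=1..N. (int N - 2 * int k) * kappa (\<mu> k))) *
       (?W * ?V)^2"
      unfolding sinhs prod.distrib mult_minus_left by (rule regroup)
    also have "\<dots> = (?W * ?V)^2"
      by (simp only: inv[OF Q0] inv[OF s0] inv[OF two] prod.neutral_const mult_1_left)
    finally have total: "2 powi (- 2 * int N * (\<Sum>i=1..N. ?n i))
       * (\<Prod>k=1..<N. Q a k powi (- (int (N - k) * (\<Sum>i=1..k. ?n i) + int k * (\<Sum>i=k+1..N. ?n i))))
       * s powi (- (\<Sum>k=1..N. (int N - 2 * int k) * kappa (\<mu> k))) * (\<Prod>k=1..N. \<Prod>l=1..N. E k l) = (?W * ?V)^2" .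
    show "mfps_sums ((Ktilde s N \<mu>)\<^sup>2 /
        (\<Prod>(k, l) | 1 \<le> k \<and> k < l \<and> l \<le> N. (mfps_subst (K00 s) (\<Prod>i=k..<l. mfps_X i))\<^sup>2)) (Q a)
      (2 powi (- 2 * int N * (\<Sum>i=1..N. int (sum_list (\<mu> i))))
       * (\<Prod>k=1..<N. Q a k powi
           (- (int (N - k) * (\<Sum>i=1..k. int (sum_list (\<mu> i)))
               + int k * (\<Sum>i=k+1..N. int (sum_list (\<mu> i))))))
       * s powi (- (\<Sum>k=1..N. (int N - 2 * int k) * kappa (\<mu> k)))
       * (\<Prod>k=1..N. \<Prod>l=1..N. sinh_prod \<beta> h a \<mu> k l))"
      using series total unfolding E_def by simp
  qed
qed

end
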